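(* (i) Let $m\ge 1$ be an integer, let $\alpha=\pi/m$, and let $\mathcal{D}=\langle \pi/m\rangle$. Let $X$ be the normally reflected Brownian motion on $\mathcal{D}$. Then for all $t>0$ and $x,y\in\mathcal{D}$, $$\mathbb{P}^{x}(X_t\in dy)=\frac{1}{2\pi t}\sum_{k=0}^{2m-1}e^{-\frac{|x-T_ky|^2}{2t}}\,dy .$$ (ii) Let $\alpha\in(0,2\pi)$ be arbitrary, let $\mathcal{D}=\langle\alpha\rangle$, let $X$ be the normally reflected Brownian motion on $\mathcal{D}$, and let $x=(r_0\cos\theta_0,r_0\sin\theta_0)\in\mathcal{D}$. Then for every $t>0$ the law of $X_t$ under $\mathbb{P}^x$ is given, for $y=(r\cos\theta,r\sin\theta)\in\mathcal{D}$ (with $r\ge0$, $\theta\in[0,\alpha]$), by $$\mathbb{P}^{x}(X_t\in dy)=\frac{2r}{t\alpha}e^{-\frac{r^2+r_0^2}{2t}}\left(\frac12 I_0\left(\frac{rr_0}{t}\right)+\sum_{n=1}^{\infty}I_{n\pi/\alpha}\left(\frac{rr_0}{t}\right)\cos\left(\frac{n\pi\theta}{\alpha}\right)\cos\left(\frac{n\pi\theta_0}{\alpha}\right)\right)dr\,d\theta .$$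
   Context: For $\alpha\in(0,2\pi)$, $\langle\alpha\rangle=\{(r\cos\theta,r\sin\theta): r\ge0,\ \theta\in[0,\alpha]\}\subset\mathbb{R}^2$ is the wedge of angle $\alpha$; $|\cdot|$ is the Euclidean norm. $W$ is a standard two-dimensional Brownian motion (identity covariance), and $\mathbb{P}^x$ is the probability under which $W_0=x$. The normally reflected Brownian motion on $\mathcal{D}$ is the process $X$ in the unique solution $(X_t,L_t)_{t\ge0}$ of: (1) $X_t=W_t+L_t$ with $L$ adapted; (2) $X_t\in\mathcal{D}$ for all $t\ge0$; (3) $L$ is continuous, of bounded variation, $L_0=0$; (4) $L_t=\int_0^t n(X_s)\mathbf{1}_{X_s\in\partial\mathcal{D}}\,d|L|_s$ for all $t\ge 0$, where $n(x)$ is the inward unit normal at the boundary point $x$ and $|L|$ is the total variation process of $L$. (Existence and uniqueness are known.) For $\alpha=\pi/m$ and $k=0,\dots,2m-1$, the map $T_k$ on $\mathcal{D}$ is $T_k(r\cos\theta,r\sin\theta)=(r\cos\vartheta_k,r\sin\vartheta_k)$, with $\vartheta_k=k\alpha+\theta$ if $k$ is even and $\vartheta_k=(k+1)\alpha-\theta$ if $k$ is odd ($\theta\in[0,\alpha]$). $I_a(x)=\sum_{k=0}^\infty \frac{x^{a+2k}}{2^{a+2k}k!\,\Gamma(k+a+1)}$ is the modified Bessel function of the first kind ($a\ge0$, $x\ge0$). *)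

theory Defs
  imports "HOL-Probability.Probability"
begin

definition polar :: "real \<Rightarrow> real \<Rightarrow> real^2" where
  "polar r \<theta> = vector [r * cos \<theta>, r * sin \<theta>]"

definition wedge :: "real \<Rightarrow> (real^2) set" where
  "wedge \<alpha> = {polar r \<theta> | r \<theta>. 0 \<le> r \<and> 0 \<le> \<theta> \<and> \<theta> \<le> \<alpha>}"

text \<open>
  The maps \<open>T\<^sub>k\<close>. On \<open>wedge \<alpha>\<close> with \<open>0 < \<alpha> < 2\<pi>\<close> the described point is unique: the polar
  coordinates of \<open>y \<noteq> 0\<close> are determined, and \<open>y = 0\<close> is sent to \<open>0\<close> for every choice of \<open>\<theta>\<close>.
\<close>

definition wedge_copy :: "real \<Rightarrow> nat \<Rightarrow> real^2 \<Rightarrow> real^2" where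
  "wedge_copy \<alpha> k y = (THE z. \<exists>r \<theta>. 0 \<le> r \<and> 0 \<le> \<theta> \<and> \<theta> \<le> \<alpha> \<and> y = polar r \<theta> \<and>
     z = polar r (if even k then real k * \<alpha> + \<theta> else (real k + 1) * \<alpha> - \<theta>))"

text \<open>
  The exponent is \<open>0\<close> only for \<open>a = 0\<close>, \<open>k = 0\<close>. That case is separated because \<open>0 powr 0 = 0\<close>,
  whereas the series requires \<open>0\<^sup>0 = 1\<close>, so that \<open>I\<^sub>0(0) = 1\<close>.
\<close>

definition bessel_I :: "real \<Rightarrow> real \<Rightarrow> real" where
  "bessel_I a x = (\<Sum>k. (if a + 2 * real k = 0 then 1 else x powr (a + 2 * real k)) /
     (2 powr (a + 2 * real k) * fact k * Gamma (real k + a + 1)))"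

text \<open>
  A filtration indexed by \<open>[0, \<infinity>)\<close> is regarded as one indexed by all reals, for instance by setting
  \<open>F t = F 0\<close> for \<open>t < 0\<close>; only nonnegative times are used below.
  Working under \<open>P\<^sup>x\<close> is expressed by the starting point \<open>x\<close>.
\<close>

locale standard_brownian_motion = prob_space M + filtration "space M" F
  for M :: "'a measure" and F :: "real \<Rightarrow> 'a measure" +
  fixes W :: "real \<Rightarrow> 'a \<Rightarrow> real^'d" and x :: "real^'d"
  assumes subalgebra_F: "\<And>t. 0 \<le> t \<Longrightarrow> subalgebra M (F t)"
    and adapted_W: "\<And>t. 0 \<le> t \<Longrightarrow> W t \<in> borel_measurable (F t)"
    and start_W: "AE \<omega> in M. W 0 \<omega> = x"
    and continuous_W: "AE \<omega> in M. continuous_on {0..} (\<lambda>t. W t \<omega>)"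
    and indep_increments: "\<And>s t. 0 \<le> s \<Longrightarrow> s < t \<Longrightarrow>
      indep_set (sets (F s)) {(\<lambda>\<omega>. W t \<omega> - W s \<omega>) -` A \<inter> space M | A. A \<in> sets borel}"
    and gaussian_increments: "\<And>s t. 0 \<le> s \<Longrightarrow> s < t \<Longrightarrow>
      distributed M lborel (\<lambda>\<omega>. W t \<omega> - W s \<omega>)
        (\<lambda>z. ennreal (\<Prod>i\<in>UNIV. normal_density 0 (sqrt (t - s)) (z $ i)))"

text \<open>The open half-space at \<open>x\<close> with inner normal \<open>v\<close> points into \<open>D\<close>, the opposite one out of \<open>D\<close>.\<close>

definition inward_unit_normal :: "(real^'d) set \<Rightarrow> real^'d \<Rightarrow> real^'d \<Rightarrow> bool" where
  "inward_unit_normal D x v \<longleftrightarrow> x \<in> frontier D \<and> norm v = 1 \<and>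
     (\<forall>h. v \<bullet> h > 0 \<longrightarrow> (\<forall>\<^sub>F s in at_right 0. x + s *\<^sub>R h \<in> D)) \<and>
     (\<forall>h. v \<bullet> h < 0 \<longrightarrow> (\<forall>\<^sub>F s in at_right 0. x + s *\<^sub>R h \<notin> D))"

definition variation_sums :: "(real \<Rightarrow> 'b::real_normed_vector) \<Rightarrow> real \<Rightarrow> real set" where
  "variation_sums f t = {\<Sum>i<N. norm (f (s (Suc i)) - f (s i)) | (N::nat) s.
     s 0 = 0 \<and> s N = t \<and> (\<forall>i<N. s i \<le> s (Suc i))}"

definition total_variation :: "(real \<Rightarrow> 'b::real_normed_vector) \<Rightarrow> real \<Rightarrow> real" where
  "total_variation f t = Sup (variation_sums f t)"

definition variation_measure :: "(real \<Rightarrow> 'b::real_normed_vector) \<Rightarrow> real measure" where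
  "variation_measure f = interval_measure (\<lambda>t. total_variation f (max 0 t))"

text \<open>
  The field \<open>n\<close> is prescribed wherever \<open>D\<close> has a normal. Its value at a boundary point without a
  normal, such as the vertex of a wedge of angle different from \<open>\<pi>\<close>, is left arbitrary.
\<close>

locale normally_reflected_brownian_motion = standard_brownian_motion M F W x
  for M :: "'a measure" and F :: "real \<Rightarrow> 'a measure"
    and W :: "real \<Rightarrow> 'a \<Rightarrow> real^'d" and x :: "real^'d" +
  fixes D :: "(real^'d) set" and n :: "real^'d \<Rightarrow> real^'d"
    and X L :: "real \<Rightarrow> 'a \<Rightarrow> real^'d"
  assumes normal: "\<And>z v. inward_unit_normal D z v \<Longrightarrow> n z = v"
    and adapted_L: "\<And>t. 0 \<le> t \<Longrightarrow> L t \<in> borel_measurable (F t)"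
    and X_eq: "\<And>t \<omega>. 0 \<le> t \<Longrightarrow> \<omega> \<in> space M \<Longrightarrow> X t \<omega> = W t \<omega> + L t \<omega>"
    and X_in: "AE \<omega> in M. \<forall>t\<ge>0. X t \<omega> \<in> D"
    and continuous_L: "AE \<omega> in M. continuous_on {0..} (\<lambda>t. L t \<omega>)"
    and bounded_variation_L: "AE \<omega> in M. \<forall>t\<ge>0. bdd_above (variation_sums (\<lambda>s. L s \<omega>) t)"
    and start_L: "AE \<omega> in M. L 0 \<omega> = 0"
    and reflection: "AE \<omega> in M. \<forall>t\<ge>0. L t \<omega> =
      (LINT s:{0..t}|variation_measure (\<lambda>s. L s \<omega>). indicator (frontier D) (X s \<omega>) *\<^sub>R n (X s \<omega>))"

end

theory Submission
  imports Defs "HOL-Complex_Analysis.Complex_Analysis" "HOL-Real_Asymp.Real_Asymp"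
begin

text \<open>Write \<nu> = n pi / \<alpha>. The functions P_n = r^\<nu> cos(\<nu> \<theta>) are
  harmonic inside the wedge and have vanishing normal derivative on both sides. With c(t) = 1 / (1 +
  2 l t), the function c(T - s)^(\<nu> + 1) P_n exp(- l c(T - s) r^2) therefore solves the backward
  heat equation with Neumann condition, and along the reflected process it should be a martingale:
  the reflection term pushes only in the normal direction and drops out of Ito's formula. Comparing
  times 0 and T gives the expectation of P_n(X_T) exp(- l |X_T|^2) in closed form
  (\<open>mode_moment\<close>). These moments, for all n and all l > 0, determine a finite measure
  on the wedge (\<open>wedge_measure_eqI\<close>), so a proposed law only has to be shown to have
  the same moments.

  Ito's formula is replaced by a discrete version (\<open>discrete_ito\<close>): on a uniform grid
  each increment splits into a reflection part, a centred martingale part and the deviation of a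
  one-step Gaussian average. The reflection parts add up to something that tends to 0 along every
  path, because the gradient annihilates the normal, and bounded second moments turn this into
  convergence of expectations. The Gaussian average is computed by completing the square and by the
  mean value property of the holomorphic power w^\<nu>; it is inexact only through increments that
  may reach the branch cut, which is exponentially unlikely away from the vertex
  (\<open>gauss_integral_Fw\<close>).

  The second difficulty is the vertex, where P_n need not be twice differentiable.
  \<open>heat_mode\<close> subtracts the same mode with a sharply concentrated factor exp(-
  \<Lambda> r^2), so that the difference vanishes to higher order at the vertex. The price is an
  error supported within distance of order \<Lambda>^(-1/2) from the vertex. The case n = 0, which
  is exact (\<open>radial_moment\<close>), bounds how much time X spends there; the total error is
  of order \<Lambda>^(-\<nu>/2) log \<Lambda> and disappears as \<Lambda> tends to infinity.

  For the series, orthogonality of the cosines leaves one Bessel function, and Weber's integral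
  evaluates its moment (\<open>series_density_moment\<close>). Since positivity of the series is not
  known beforehand, its negative part is first added to the law and then shown to be zero
  (\<open>law_series\<close>). For \<alpha> = pi / m the modes are the polynomials Re w^(n m), which
  are invariant under the reflected copies; the copies tile the plane, so folding a planar Gaussian
  into the wedge produces the right moments (\<open>law_images\<close>).\<close>

lemma norm_real2_sq: "(norm (z::real^2))\<^sup>2 = (z$1)\<^sup>2 + (z$2)\<^sup>2"
  by (simp add: norm_vec_def L2_set_def sum_2 sum_nonneg)

section \<open>Planar Gaussian measures\<close>

definition gauss_density :: "real \<Rightarrow> real^2 \<Rightarrow> real" where
  "gauss_density h z = exp (- (norm z)\<^sup>2 / (2 * h)) / (2 * pi * h)"

definition gauss :: "real \<Rightarrow> (real^2) measure" where
  "gauss h = density lborel (\<lambda>z. ennreal (gauss_density h z))"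

lemma gauss_density_nonneg: "0 < h \<Longrightarrow> 0 \<le> gauss_density h z"
  by (simp add: gauss_density_def)

lemma borel_measurable_gauss_density[measurable]: "gauss_density h \<in> borel_measurable borel"
  unfolding gauss_density_def[abs_def] by measurable

lemma prod_normal_density_eq_gauss_density:
  assumes "0 < h"
  shows "(\<Prod>i\<in>UNIV. normal_density 0 (sqrt h) (z $ i)) = gauss_density h (z::real^2)"
proof -
  have "sqrt (2 * pi * h) * sqrt (2 * pi * h) = 2 * pi * h"
    using assms by simp
  moreover have "exp (- (z$1)\<^sup>2 / (2*h)) * exp (- (z$2)\<^sup>2 / (2*h)) = exp (- (norm z)\<^sup>2 / (2 * h))"
    by (simp add: exp_add[symmetric] norm_real2_sq add_divide_distrib diff_divide_distrib)
  ultimately show ?thesis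
    using assms by (simp add: UNIV_2 normal_density_def gauss_density_def field_simps)
qed

lemma sets_gauss[measurable_cong, simp]: "sets (gauss h) = sets borel"
  by (simp add: gauss_def)

lemma space_gauss[simp]: "space (gauss h) = UNIV"
  by (simp add: gauss_def)

lemma prob_space_gauss:
  assumes "0 < h"
  shows "prob_space (gauss h)"
proof
  have B: "(Basis :: (real^2) set) = range (\<lambda>i. axis i 1)"
    by (auto simp: Basis_vec_def)
  have inj: "inj (\<lambda>i. axis i (1::real) :: real^2)"
    by (auto intro!: injI simp: axis_eq_axis)
  have "emeasure (gauss h) (space (gauss h))
      = (\<integral>\<^sup>+z. ennreal (\<Prod>i\<in>UNIV. normal_density 0 (sqrt h) (z $ i)) \<partial>(lborel :: (real^2) measure))"
    using assms by (simp add: gauss_def emeasure_density prod_normal_density_eq_gauss_density)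
  also have "\<dots> = (\<integral>\<^sup>+z. (\<Prod>b\<in>Basis. ennreal (normal_density 0 (sqrt h) (z \<bullet> b))) \<partial>(lborel :: (real^2) measure))"
    by (simp add: B prod.reindex[OF inj] cart_eq_inner_axis[symmetric] prod_ennreal)
  also have "\<dots> = (\<Prod>b\<in>(Basis::(real^2) set). (\<integral>\<^sup>+x. ennreal (normal_density 0 (sqrt h) x) \<partial>lborel))"
    by (rule nn_integral_lborel_prod) auto
  also have "(\<integral>\<^sup>+x. ennreal (normal_density 0 (sqrt h) x) \<partial>lborel) = 1"
    using assms by (subst nn_integral_eq_integral)
      (auto simp: integral_normal_density integrable_normal_density)
  finally show "emeasure (gauss h) (space (gauss h)) = 1" by simp
qed

lemma integral_gauss:
  fixes f :: "real^2 \<Rightarrow> 'b::{banach, second_countable_topology}"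
  assumes [measurable]: "f \<in> borel_measurable borel" and "0 < h"
  shows "integral\<^sup>L (gauss h) f = (\<integral>z. gauss_density h z *\<^sub>R f z \<partial>lborel)"
  unfolding gauss_def using assms by (subst integral_density) (auto simp: gauss_density_nonneg)

lemma lborel_integral_translate:
  fixes f :: "'a::euclidean_space \<Rightarrow> 'b::{banach, second_countable_topology}"
  assumes [measurable]: "f \<in> borel_measurable borel"
  shows "(\<integral>z. f (a + z) \<partial>lborel) = (\<integral>z. f z \<partial>lborel)"
  by (subst (2) lborel_distr_plus[of a, symmetric]) (simp add: integral_distr)

text \<open>Completing the square.\<close>

lemma gauss_density_mult_exp:
  fixes x y :: "real^2"
  assumes h: "0 < h" and c: "0 < 1 + 2 * l * h"
  defines "c \<equiv> 1 / (1 + 2 * l * h)"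
  shows "gauss_density h (y - x) * exp (- l * (norm y)\<^sup>2)
     = c * exp (- l * c * (norm x)\<^sup>2) * gauss_density (h * c) (y - c *\<^sub>R x)"
proof -
  have cp: "0 < c" using c by (simp add: c_def)
  have "1 / c = 1 + 2 * l * h" by (simp add: c_def)
  then have lc: "l = (1 - c) / (2 * h * c)" using h cp by (simp add: divide_simps) (simp add: algebra_simps)
  have e: "norm (y - x) ^ 2 / (2*h) + l * (norm y)\<^sup>2 = l * c * (norm x)\<^sup>2 + norm (y - c *\<^sub>R x) ^ 2 / (2*(h*c))"
    unfolding lc norm_real2_sq using h cp
    by (simp add: divide_simps power2_eq_square) algebra
  have "gauss_density h (y - x) * exp (- l * (norm y)\<^sup>2)
     = exp (- (norm (y - x) ^ 2 / (2*h) + l * (norm y)\<^sup>2)) / (2*pi*h)"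
    by (simp add: gauss_density_def exp_add[symmetric] exp_diff exp_minus field_simps)
  also have "\<dots> = exp (- l * c * (norm x)\<^sup>2) * exp (- (norm (y - c *\<^sub>R x) ^ 2) / (2*(h*c))) / (2*pi*h)"
    unfolding e by (simp add: exp_add[symmetric])
  finally show ?thesis using cp h by (simp add: gauss_density_def)
qed

lemma gauss_integral_mult_exp:
  fixes H :: "real^2 \<Rightarrow> 'b::{banach, second_countable_topology}"
  assumes [measurable]: "H \<in> borel_measurable borel" and h: "0 < h" and c: "0 < 1 + 2 * l * h"
  defines "c \<equiv> 1 / (1 + 2 * l * h)"
  shows "(\<integral>z. exp (- l * (norm (x + z))\<^sup>2) *\<^sub>R H (x + z) \<partial>gauss h)
     = (c * exp (- l * c * (norm x)\<^sup>2)) *\<^sub>R (\<integral>z. H (c *\<^sub>R x + z) \<partial>gauss (h * c))"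
proof -
  have cp: "0 < c" using c by (simp add: c_def)
  have "(\<integral>z. exp (- l * (norm (x + z))\<^sup>2) *\<^sub>R H (x + z) \<partial>gauss h)
    = (\<integral>z. gauss_density h ((x + z) - x) *\<^sub>R exp (- l * (norm (x + z))\<^sup>2) *\<^sub>R H (x + z) \<partial>lborel)"
    using h by (subst integral_gauss) auto
  also have "\<dots> = (\<integral>y. gauss_density h (y - x) *\<^sub>R exp (- l * (norm y)\<^sup>2) *\<^sub>R H y \<partial>lborel)"
    by (rule lborel_integral_translate) measurable
  also have "\<dots> = (\<integral>y. (c * exp (- l * c * (norm x)\<^sup>2)) *\<^sub>R gauss_density (h * c) (y - c *\<^sub>R x) *\<^sub>R H y \<partial>lborel)"
    unfolding scaleR_scaleR gauss_density_mult_exp[OF h c, folded c_def] by simp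
  also have "\<dots> = (c * exp (- l * c * (norm x)\<^sup>2)) *\<^sub>R (\<integral>y. gauss_density (h * c) (y - c *\<^sub>R x) *\<^sub>R H y \<partial>lborel)"
    by (rule integral_scaleR_right) 
  also have "(\<integral>y. gauss_density (h * c) (y - c *\<^sub>R x) *\<^sub>R H y \<partial>lborel)
     = (\<integral>z. gauss_density (h * c) (c *\<^sub>R x + z - c *\<^sub>R x) *\<^sub>R H (c *\<^sub>R x + z) \<partial>lborel)"
    by (rule lborel_integral_translate[symmetric]) measurable
  also have "\<dots> = (\<integral>z. H (c *\<^sub>R x + z) \<partial>gauss (h * c))"
    using h cp by (subst integral_gauss) auto
  finally show ?thesis .
qed

lemma gauss_integral_exp:
  assumes h: "0 < h" and c: "0 < 1 + 2 * l * h"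
  shows "(\<integral>z. exp (- l * (norm (x + z))\<^sup>2) \<partial>gauss h)
     = 1 / (1 + 2 * l * h) * exp (- l * (1 / (1 + 2 * l * h)) * (norm x)\<^sup>2)"
proof -
  interpret prob_space "gauss (h * (1 / (1 + 2 * l * h)))"
    using h c by (intro prob_space_gauss) simp
  show ?thesis
    using gauss_integral_mult_exp[OF _ h c, of "\<lambda>_. 1::real" x] prob_space by simp
qed

text \<open>A function that is not integrable has Bochner integral 0, whereas the closed form just
  computed is positive.\<close>

lemma gauss_integrable_exp:
  assumes h: "0 < h" and c: "0 < 1 + 2 * l * h"
  shows "integrable (gauss h) (\<lambda>z. exp (- l * (norm (x + z))\<^sup>2))"
proof (rule ccontr)
  assume "\<not> ?thesis"
  then have "(\<integral>z. exp (- l * (norm (x + z))\<^sup>2) \<partial>gauss h) = 0"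
    by (rule not_integrable_integral_eq)
  then show False using gauss_integral_exp[OF h c, of x] c by simp
qed

text \<open>The inequality y \<le> exp y at y = k r / a, raised to the power a. The summand 1 in the
  base covers a = 0, where \<open>0 powr 0 = 0\<close> would spoil the bound.\<close>

lemma powr_le_exp:
  fixes a k r :: real
  assumes "0 \<le> a" "0 < k" "0 \<le> r"
  shows "r powr a \<le> (1 + a / k) powr a * exp (k * r)"
proof (cases "r = 0 \<or> a = 0")
  case False
  have r: "0 < r" using False assms by simp
  have a: "0 < a" using False assms by simp
  have "r * k / a \<le> exp (r * k / a)"
    by (smt (verit) exp_ge_add_one_self)
  then have "r \<le> (a / k) * exp (k * r / a)"
    using r a assms by (simp add: field_simps)
  then have "r powr a \<le> ((a / k) * exp (k * r / a)) powr a"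
    using r a by (intro powr_mono2) auto
  also have "\<dots> = (a/k) powr a * exp (k * r)"
    using r a assms by (subst powr_mult) (simp_all add: exp_powr_real)
  also have "\<dots> \<le> (1 + a / k) powr a * exp (k * r)"
    using a assms by (intro mult_right_mono powr_mono2) auto
  finally show ?thesis .
qed (use assms in \<open>auto simp: powr_def\<close>)

text \<open>Lebesgue measure is characterised by its values on boxes. The preimage of a box under A
  is its image under the inverse isometry, and orthogonal images preserve Lebesgue measure.\<close>

lemma orthogonal_lborel_distr:
  fixes A :: "real^'n::{finite,wellorder} \<Rightarrow> real^'n::_"
  assumes A: "orthogonal_transformation A"
  shows "distr lborel borel A = lborel"
proof (rule lborel_eqI[symmetric])
  have lin: "linear A" using A by (rule orthogonal_transformation_linear)
  have [measurable]: "A \<in> borel_measurable borel"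
    using lin by (intro borel_measurable_continuous_onI linear_continuous_on)
      (simp add: linear_conv_bounded_linear)
  obtain B where B: "orthogonal_transformation B" "\<And>x. A (B x) = x" "\<And>x. B (A x) = x"
    using A by (metis orthogonal_transformation_inv orthogonal_transformation_surj
        orthogonal_transformation_inj surj_f_inv_f inv_f_f)
  show "emeasure (distr lborel borel A) (box l u) = ennreal (prod ((\<bullet>) (u - l)) Basis)"
    if "\<And>b. b \<in> Basis \<Longrightarrow> l \<bullet> b \<le> u \<bullet> b" for l u :: "real^'n::_"
  proof -
    have eq: "A -` box l u = B ` box l u"
      by (auto simp: B(2,3) image_iff intro: bexI[of _ "A _"] B(3)[symmetric])
    have [measurable]: "A -` box l u \<in> sets borel"
      using measurable_sets[OF \<open>A \<in> borel_measurable borel\<close>, of "box l u"] by simp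
    have bm: "B ` box l u \<in> lmeasurable" and m: "measure lebesgue (B ` box l u) = measure lebesgue (box l u)"
      using measurable_orthogonal_image[OF B(1), of "box l u"] measure_orthogonal_image[OF B(1), of "box l u"]
      by auto
    have "emeasure (distr lborel borel A) (box l u) = emeasure lborel (A -` box l u)"
      by (simp add: emeasure_distr)
    also have "\<dots> = emeasure lebesgue (B ` box l u)"
      by (simp add: eq[symmetric])
    also have "\<dots> = ennreal (measure lebesgue (box l u))"
      using bm m by (simp add: emeasure_eq_measure2)
    also have "\<dots> = ennreal (prod ((\<bullet>) (u - l)) Basis)"
      using that by (simp add: measure_lborel_box_eq)
    finally show ?thesis .
  qed
qed simp

lemma orthogonal_gauss_distr:
  assumes A: "orthogonal_transformation A"
  shows "distr (gauss h) borel A = gauss h"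
proof -
  have [measurable]: "A \<in> borel_measurable borel"
    using orthogonal_transformation_linear[OF A] by (intro borel_measurable_continuous_onI linear_continuous_on)
      (simp add: linear_conv_bounded_linear)
  have "gauss h = density (distr lborel borel A) (gauss_density h)"
    by (simp add: orthogonal_lborel_distr[OF A] gauss_def)
  also have "\<dots> = distr (density lborel (\<lambda>z. ennreal (gauss_density h (A z)))) borel A"
    by (subst density_distr) auto
  also have "\<dots> = distr (gauss h) borel A"
    using A by (simp add: gauss_def gauss_density_def orthogonal_transformation_norm)
  finally show ?thesis ..
qed

section \<open>Complex coordinate, rotations and the mean value property\<close>

definition cplx :: "real^2 \<Rightarrow> complex" where
  "cplx z = Complex (z$1) (z$2)"

lemma cplx_simps[simp]:
  "cplx (x + y) = cplx x + cplx y" "cplx (x - y) = cplx x - cplx y" "cplx (- x) = - cplx x"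
  "cplx (c *\<^sub>R x) = of_real c * cplx x" "cplx 0 = 0"
  by (auto simp: cplx_def complex_eq_iff)

lemma norm_cplx[simp]: "norm (cplx z) = norm z"
  by (simp add: cplx_def complex_norm norm_vec_def L2_set_def sum_2)

lemma bounded_linear_cplx: "bounded_linear cplx"
  by (rule bounded_linear_intro[of _ 1]) (auto simp: scaleR_conv_of_real[where 'a=complex])

lemma borel_measurable_cplx[measurable]: "cplx \<in> borel_measurable borel"
  by (intro borel_measurable_continuous_onI linear_continuous_on bounded_linear_cplx)

definition rot :: "real \<Rightarrow> real^2 \<Rightarrow> real^2" where
  "rot t z = vector [cos t * z$1 - sin t * z$2, sin t * z$1 + cos t * z$2]"

lemma cplx_rot: "cplx (rot t z) = cis t * cplx z"
  by (simp add: cplx_def rot_def complex_eq_iff)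

lemma norm_rot[simp]: "norm (rot t z) = norm z"
  by (metis norm_cplx cplx_rot norm_mult norm_cis mult_1)

lemma orthogonal_rot: "orthogonal_transformation (rot t)"
  unfolding orthogonal_transformation
proof
  show "linear (rot t)"
    by (rule linearI) (auto simp: rot_def vec_eq_iff forall_2 algebra_simps)
qed simp

text \<open>Cauchy's integral formula on the circle of radius |z| about a. The argument of z is
  absorbed into the auxiliary function \<open>G\<close>, so that the standard
  \<open>circlepath 0 r\<close> can be used; along it the derivative divided by the point is the
  constant 2 pi i.\<close>

lemma circle_mean_value:
  assumes F: "F holomorphic_on ball a \<rho>" and r: "norm z < \<rho>"
  shows "((\<lambda>t. F (a + cis (2 * pi * t) * z)) has_integral F a) {0..1}"
proof (cases "z = 0")
  case True
  then show ?thesis using has_integral_const_real[of "F a" 0 1] by simp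
next
  case False
  define r where "r = norm z"
  have rp: "0 < r" using False by (simp add: r_def)
  obtain \<phi> where z: "z = of_real r * cis \<phi>"
    by (metis r_def cis_Arg complex_sgn_def False scaleR_conv_of_real mult.commute
        norm_eq_zero right_inverse_eq sgn_eq times_divide_eq_left nonzero_mult_div_cancel_left of_real_eq_0_iff)
  define G where "G w = F (a + cis \<phi> * w)" for w
  have "G holomorphic_on cball 0 r"
    unfolding G_def
    by (rule holomorphic_on_compose_gen[OF _ F, unfolded o_def])
       (use r in \<open>auto intro!: holomorphic_intros simp: dist_norm norm_mult r_def\<close>)
  then have "((\<lambda>u. G u / (u - 0)) has_contour_integral (2 * of_real pi * \<i> * G 0)) (circlepath 0 r)"
    by (rule Cauchy_integral_circlepath_simple) (use rp in simp)
  then have "((\<lambda>t. G (circlepath 0 r t) / circlepath 0 r t * vector_derivative (circlepath 0 r) (at t within {0..1}))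
      has_integral (2 * of_real pi * \<i> * G 0)) {0..1}"
    by (simp add: has_contour_integral_def)
  then have "((\<lambda>t. (2 * of_real pi * \<i>) * G (of_real r * cis (2 * pi * t)))
      has_integral (2 * of_real pi * \<i> * G 0)) {0..1}"
  proof (rule has_integral_eq[rotated])
    fix t :: real assume t: "t \<in> {0..1}"
    show "G (circlepath 0 r t) / circlepath 0 r t * vector_derivative (circlepath 0 r) (at t within {0..1})
       = (2 * of_real pi * \<i>) * G (of_real r * cis (2 * pi * t))"
    proof -
      have "vector_derivative (circlepath 0 r) (at t within {0..1}) = 2 * of_real pi * \<i> * circlepath 0 r t"
        using t by (simp add: vector_derivative_circlepath01) (simp add: circlepath)
      moreover have "circlepath 0 r t = of_real r * cis (2 * pi * t)"
        by (simp add: circlepath cis_conv_exp mult_ac)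
      ultimately show ?thesis using rp by (simp add: cis_neq_zero)
    qed
  qed
  from has_integral_mult_right[OF this, of "1 / (2 * of_real pi * \<i>)"]
  have "((\<lambda>t. G (of_real r * cis (2 * pi * t))) has_integral G 0) {0..1}"
    by (simp add: field_simps)
  then show ?thesis by (simp add: G_def z mult_ac)
qed

text \<open>A centred planar Gaussian is a mixture of uniform laws on circles, so the mean value
  property passes from circles to Gaussian averages. The rotation invariant set \<open>S\<close>
  collects the increments z for which F is holomorphic on a disc about a of radius larger than |z|:
  a disc when there is a branch cut, the whole plane for entire F.\<close>

lemma gauss_mean_value:
  assumes F[measurable]: "F \<in> borel_measurable borel"
    and hol: "\<And>z. z \<in> S \<Longrightarrow> \<exists>\<rho>. norm z < \<rho> \<and> F holomorphic_on ball a \<rho>"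
    and S[measurable]: "S \<in> sets borel" and Srot: "\<And>t z. rot t z \<in> S \<longleftrightarrow> z \<in> S"
    and int: "integrable (gauss h) (\<lambda>z. indicator S z *\<^sub>R F (a + cplx z))" and h: "0 < h"
  shows "(\<integral>z. indicator S z *\<^sub>R F (a + cplx z) \<partial>gauss h) = measure (gauss h) S *\<^sub>R F a"
proof -
  interpret prob_space "gauss h" by (rule prob_space_gauss[OF h])
  define G where "G z = (indicator S z *\<^sub>R F (a + cplx z) :: complex)" for z
  have [measurable]: "G \<in> borel_measurable borel" unfolding G_def by measurable
  have intG: "integrable (gauss h) G" using int unfolding G_def[abs_def] .
  have mrot: "(\<lambda>(t, z). rot (2 * pi * t) z) \<in> borel_measurable (borel \<Otimes>\<^sub>M borel)"
  proof -
    have e: "(\<lambda>(t, z). rot (2 * pi * t) z) = (\<lambda>p. \<chi> i. if i = 1 then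
        cos (2 * pi * fst p) * snd p $ 1 - sin (2 * pi * fst p) * snd p $ 2 else
        sin (2 * pi * fst p) * snd p $ 1 + cos (2 * pi * fst p) * snd p $ 2)"
      by (auto simp: rot_def vec_eq_iff forall_2)
    show ?thesis
      unfolding e borel_prod
    proof (intro borel_measurable_continuous_onI continuous_on_vec_lambda)
      show "continuous_on UNIV (\<lambda>p. if i = 1 then
          cos (2 * pi * fst p) * snd p $ 1 - sin (2 * pi * fst p) * snd p $ 2 else
          sin (2 * pi * fst p) * snd p $ 1 + cos (2 * pi * fst p) * (snd p :: real^2) $ 2)" for i :: 2
        by (cases "i = 1") (auto intro!: continuous_intros)
    qed
  qed
  \<comment> \<open>\<open>Q\<close> is the uniform law of the rotation angle, measured in full
    turns.\<close>
  define Q where "Q = restrict_space lborel {0..1::real}"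
  have Qs[measurable_cong]: "sets Q = sets (restrict_space borel {0..1})"
    unfolding Q_def by (rule sets_restrict_space_cong) simp
  interpret Q: prob_space Q
    by standard (simp add: Q_def emeasure_restrict_space space_restrict_space)
  interpret P: pair_sigma_finite Q "gauss h" ..
  have idQ: "(\<lambda>x. x) \<in> Q \<rightarrow>\<^sub>M borel"
    by (subst measurable_cong_sets[OF Qs refl]) (rule measurable_restrict_space1, simp)
  have mG: "(\<lambda>(t, z). G (rot (2 * pi * t) z)) \<in> borel_measurable (Q \<Otimes>\<^sub>M gauss h)"
  proof -
    have "(\<lambda>p. (fst p, snd p)) \<in> Q \<Otimes>\<^sub>M gauss h \<rightarrow>\<^sub>M borel \<Otimes>\<^sub>M borel"
    proof (rule measurable_Pair)
      show "fst \<in> Q \<Otimes>\<^sub>M gauss h \<rightarrow>\<^sub>M borel"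
        by (rule measurable_compose[OF measurable_fst idQ])
      show "snd \<in> Q \<Otimes>\<^sub>M gauss h \<rightarrow>\<^sub>M borel"
        using measurable_snd[of Q "gauss h"] by simp
    qed
    from measurable_compose[OF measurable_compose[OF this mrot] \<open>G \<in> borel_measurable borel\<close>]
    show ?thesis by (simp add: split_beta)
  qed
  have rotint: "(\<integral>z. f (rot t z) \<partial>gauss h) = (\<integral>z. f z \<partial>gauss h)"
    if [measurable]: "f \<in> borel_measurable borel" for f :: "real^2 \<Rightarrow> 'b::{banach,second_countable_topology}" and t
  proof -
    have [measurable]: "rot t \<in> borel_measurable borel"
      using orthogonal_transformation_linear[OF orthogonal_rot, of t]
      by (intro borel_measurable_continuous_onI linear_continuous_on) (simp add: linear_conv_bounded_linear)
    show ?thesis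
      by (subst (2) orthogonal_gauss_distr[OF orthogonal_rot, of h t, symmetric]) (simp add: integral_distr)
  qed
  have rotintegrable: "integrable (gauss h) (\<lambda>z. G (rot t z))" for t
  proof -
    have [measurable]: "rot t \<in> borel_measurable borel"
      using orthogonal_transformation_linear[OF orthogonal_rot, of t]
      by (intro borel_measurable_continuous_onI linear_continuous_on) (simp add: linear_conv_bounded_linear)
    have "integrable (distr (gauss h) borel (rot t)) G"
      unfolding orthogonal_gauss_distr[OF orthogonal_rot] by (rule intG)
    then show ?thesis by (subst (asm) integrable_distr_eq) auto
  qed
  have intp: "integrable (Q \<Otimes>\<^sub>M gauss h) (\<lambda>(t, z). G (rot (2 * pi * t) z))"
  proof (rule P.Fubini_integrable[OF mG])
    show "integrable Q (\<lambda>t. \<integral>z. norm (case (t, z) of (t, z) \<Rightarrow> G (rot (2 * pi * t) z)) \<partial>gauss h)"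
      using rotint[of "\<lambda>z. norm (G z)"] by simp
  qed (simp add: rotintegrable)
  \<comment> \<open>All rotated integrands have the same Gaussian integral, so the integral equals
    its average over the angle; after Fubini the inner average is, for fixed z, the mean of F over a
    circle.\<close>
  have "(\<integral>z. G z \<partial>gauss h) = (\<integral>t. (\<integral>z. G (rot (2 * pi * t) z) \<partial>gauss h) \<partial>Q)"
    by (simp add: rotint Q.prob_space)
  also have "\<dots> = (\<integral>z. (\<integral>t. G (rot (2 * pi * t) z) \<partial>Q) \<partial>gauss h)"
    using P.Fubini_integral[OF intp] by simp
  also have "\<dots> = (\<integral>z. indicator S z *\<^sub>R F a \<partial>gauss h)"
  proof (rule Bochner_Integration.integral_cong[OF refl])
    fix z :: "real^2"
    show "(\<integral>t. G (rot (2 * pi * t) z) \<partial>Q) = indicator S z *\<^sub>R F a"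
    proof (cases "z \<in> S")
      case True
      obtain \<rho> where \<rho>: "norm z < \<rho>" "F holomorphic_on ball a \<rho>" using hol[OF True] by blast
      define g where "g t = F (a + cis (2 * pi * t) * cplx z)" for t
      have c: "continuous_on {0..1} g"
        unfolding g_def
        by (rule continuous_on_compose2[OF holomorphic_on_imp_continuous_on[OF \<rho>(2)]])
           (use \<rho>(1) in \<open>auto intro!: continuous_intros simp: dist_norm norm_mult\<close>)
      have "(\<integral>t. G (rot (2 * pi * t) z) \<partial>Q) = (\<integral>t. g t \<partial>Q)"
        using True by (simp add: G_def Srot cplx_rot g_def)
      also have "\<dots> = (\<integral>t. indicator {0..1} t *\<^sub>R g t \<partial>lborel)"
        unfolding Q_def by (subst integral_restrict_space) auto
      also have "\<dots> = integral {0..1} g"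
        using set_borel_integral_eq_integral(2)[of "{0..1::real}" g] borel_integrable_compact[OF _ c]
        by (simp add: set_integrable_def set_lebesgue_integral_def)
      also have "\<dots> = F a"
        using circle_mean_value[OF \<rho>(2), of "cplx z"] \<rho>(1) by (simp add: g_def[abs_def] integral_unique)
      finally show ?thesis using True by simp
    qed (simp add: G_def Srot)
  qed
  also have "\<dots> = measure (gauss h) S *\<^sub>R F a"
    by (subst integral_scaleR_left) (auto intro!: integrable_real_indicator simp: emeasure_eq_measure)
  finally show ?thesis by (simp add: G_def)
qed

section \<open>The wedge, its boundary and its inward normals\<close>

lemma cplx_polar: "cplx (polar r t) = of_real r * cis t"
  by (simp add: cplx_def polar_def complex_eq_iff)

lemma cplx_inj: "cplx x = cplx y \<longleftrightarrow> x = y"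
  by (auto simp: cplx_def vec_eq_iff forall_2)

lemma norm_polar: "norm (polar r t) = \<bar>r\<bar>"
  by (metis cplx_polar norm_cplx norm_mult norm_cis norm_of_real mult.right_neutral)

lemma polar_scale: "c *\<^sub>R polar r t = polar (c * r) t"
  by (simp add: polar_def vec_eq_iff forall_2)

lemma inner_real2: "(x::real^2) \<bullet> y = x$1 * y$1 + x$2 * y$2"
  by (simp add: inner_vec_def sum_2)

text \<open>Cosine decreases on [0, pi] and \<alpha> / 2 < pi, so comparing cosines compares angles
  with the bisector \<open>polar 1 (\<alpha> / 2)\<close>, for reflex wedges as well. This form
  makes closedness immediate and exhibits the wedge as a superlevel set of a function with an
  explicit gradient.\<close>

lemma wedge_iff:
  assumes "0 < \<alpha>" "\<alpha> < 2 * pi"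
  shows "z \<in> wedge \<alpha> \<longleftrightarrow> norm z * cos (\<alpha> / 2) \<le> polar 1 (\<alpha> / 2) \<bullet> z"
proof
  assume "z \<in> wedge \<alpha>"
  then obtain r t where z: "z = polar r t" and rt: "0 \<le> r" "0 \<le> t" "t \<le> \<alpha>"
    by (auto simp: wedge_def)
  have "cos (\<alpha> / 2) \<le> cos \<bar>\<alpha> / 2 - t\<bar>"
  proof (rule cos_monotone_0_pi_le)
    show "\<bar>\<alpha> / 2 - t\<bar> \<le> \<alpha> / 2" using rt by (simp add: abs_le_iff field_simps)
  qed (use assms in auto)
  then have "cos (\<alpha> / 2) \<le> cos (\<alpha> / 2 - t)" by simp
  then have "r * cos (\<alpha> / 2) \<le> r * cos (\<alpha> / 2 - t)"
    using rt by (intro mult_left_mono)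
  then show "norm z * cos (\<alpha> / 2) \<le> polar 1 (\<alpha> / 2) \<bullet> z"
    using rt by (simp add: z norm_polar inner_real2 cos_diff) (simp add: polar_def algebra_simps)
next
  assume le: "norm z * cos (\<alpha> / 2) \<le> polar 1 (\<alpha> / 2) \<bullet> z"
  show "z \<in> wedge \<alpha>"
  proof (cases "z = 0")
    case True
    then have "z = polar 0 0" by (simp add: polar_def vec_eq_iff forall_2)
    then show ?thesis using assms unfolding wedge_def by fastforce
  next
    case False
    \<comment> \<open>Rotation by - \<alpha> / 2 carries the bisector to the positive real axis,
      where the principal argument measures the deviation from it.\<close>
    define w where "w = cplx z * cis (- \<alpha> / 2)"
    have nw: "norm w = norm z" by (simp add: w_def norm_mult)
    then have w0: "w \<noteq> 0" using False by auto
    have w: "w = of_real (norm z) * cis (Arg w)"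
      using w0 nw by (metis rcis_cmod_Arg rcis_def)
    have "Re w = polar 1 (\<alpha> / 2) \<bullet> z"
      by (simp add: w_def inner_real2 polar_def cplx_def)
    moreover have "Re w = norm z * cos (Arg w)"
      using arg_cong[OF w, of Re] by simp
    ultimately have "norm z * cos (\<alpha> / 2) \<le> norm z * cos (Arg w)" using le by simp
    then have "cos (\<alpha> / 2) \<le> cos (Arg w)" using False mult_le_cancel_left_pos[of "norm z"] by simp
    then have "cos (\<alpha> / 2) \<le> cos \<bar>Arg w\<bar>" by simp
    then have "\<bar>Arg w\<bar> \<le> \<alpha> / 2"
      using Arg_bounded[of w] assms by (subst (asm) cos_mono_le_eq) auto
    moreover have "z = polar (norm z) (Arg w + \<alpha> / 2)"
    proof -
      have "cplx z = w * cis (\<alpha> / 2)" by (simp add: w_def mult.assoc cis_mult)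
      also have "\<dots> = cplx (polar (norm z) (Arg w + \<alpha> / 2))"
        by (subst w) (simp add: cplx_polar mult.assoc cis_mult)
      finally show ?thesis by (simp add: cplx_inj)
    qed
    ultimately show ?thesis
      unfolding wedge_def
      by (intro CollectI exI[of _ "norm z"] exI[of _ "Arg w + \<alpha> / 2"]) (auto simp: abs_le_iff)
  qed
qed

lemma wedge_eq:
  assumes "0 < \<alpha>" "\<alpha> < 2 * pi"
  shows "wedge \<alpha> = {z. norm z * cos (\<alpha> / 2) \<le> polar 1 (\<alpha> / 2) \<bullet> z}"
  using wedge_iff[OF assms] by blast

lemma closed_wedge:
  assumes "0 < \<alpha>" "\<alpha> < 2 * pi"
  shows "closed (wedge \<alpha>)"
  unfolding wedge_eq[OF assms] by (intro closed_Collect_le continuous_intros)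

lemma scale_wedge: "x \<in> wedge \<alpha> \<Longrightarrow> 0 \<le> c \<Longrightarrow> c *\<^sub>R x \<in> wedge \<alpha>"
  unfolding wedge_def by (force simp: polar_scale)

text \<open>The strict form of the inequality in \<open>wedge_iff\<close> is an open condition, so a
  boundary point satisfies equality; injectivity of cosine on [0, pi] then leaves only the two
  extreme angles.\<close>

lemma frontier_wedge:
  assumes "0 < \<alpha>" "\<alpha> < 2 * pi" "z \<in> frontier (wedge \<alpha>)"
  shows "\<exists>r\<ge>0. z = polar r 0 \<or> z = polar r \<alpha>"
proof -
  let ?I = "{z. norm z * cos (\<alpha> / 2) < polar 1 (\<alpha> / 2) \<bullet> z}"
  have "?I \<subseteq> interior (wedge \<alpha>)"
    unfolding wedge_eq[OF assms(1,2)]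
    by (intro interior_maximal open_Collect_less continuous_intros) auto
  moreover have zD: "z \<in> wedge \<alpha>" "z \<notin> interior (wedge \<alpha>)"
    using assms(3) closed_wedge[OF assms(1,2)] by (auto simp: frontier_def)
  ultimately have eq: "norm z * cos (\<alpha> / 2) = polar 1 (\<alpha> / 2) \<bullet> z"
    using wedge_iff[OF assms(1,2), of z] by (auto simp: subset_iff not_less intro!: antisym)
  obtain r t where z: "z = polar r t" and rt: "0 \<le> r" "0 \<le> t" "t \<le> \<alpha>"
    using zD by (auto simp: wedge_def)
  have "polar 1 (\<alpha> / 2) \<bullet> z = r * cos (\<alpha> / 2 - t)"
    by (simp add: z inner_real2 cos_diff) (simp add: polar_def algebra_simps)
  then have "r * cos (\<alpha> / 2) = r * cos (\<alpha> / 2 - t)"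
    using eq rt by (simp add: z norm_polar)
  then consider "r = 0" | "cos (\<alpha> / 2) = cos \<bar>\<alpha> / 2 - t\<bar>" by auto
  then show ?thesis
  proof cases
    case 1
    then have "z = polar 0 0" by (simp add: z polar_def)
    then show ?thesis by blast
  next
    case 2
    have "\<bar>\<alpha> / 2 - t\<bar> \<le> pi" using rt assms(1,2) by linarith
    with 2 have "\<alpha> / 2 = \<bar>\<alpha> / 2 - t\<bar>"
      using assms(1,2) cos_inj_pi[of "\<alpha> / 2" "\<bar>\<alpha> / 2 - t\<bar>"] by simp
    then have "t = 0 \<or> t = \<alpha>" by linarith
    then show ?thesis using z rt by blast
  qed
qed

text \<open>D is the set where f(z) = e . z - k |z| is nonnegative, and x lies on its zero set. By
  \<open>ev\<close> the gradient of f at x is a positive multiple of v, so the sign of v . h is the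
  sign of the derivative of f in direction h, which decides whether a short step along h enters or
  leaves D.\<close>

lemma inward_unit_normalI:
  fixes e v x :: "real^2"
  assumes D: "D = {z. norm z * k \<le> e \<bullet> z}" and x0: "x \<noteq> 0" and ex: "e \<bullet> x = norm x * k"
    and ev: "e - (k / norm x) *\<^sub>R x = s *\<^sub>R v" and s: "0 < s" and nv: "norm v = 1"
  shows "inward_unit_normal D x v"
proof -
  define \<phi> where "\<phi> h t = e \<bullet> (x + t *\<^sub>R h) - norm (x + t *\<^sub>R h) * k" for h t
  have D': "x + t *\<^sub>R h \<in> D \<longleftrightarrow> 0 \<le> \<phi> h t" for t h by (simp add: D \<phi>_def)
  have \<phi>0: "\<phi> h 0 = 0" for h by (simp add: \<phi>_def ex)
  have der: "(\<phi> h has_real_derivative s * (v \<bullet> h)) (at 0)" for h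
  proof -
    have "(\<phi> h has_derivative (\<lambda>t. e \<bullet> (t *\<^sub>R h) - (sgn x \<bullet> (t *\<^sub>R h)) * k)) (at 0)"
      unfolding \<phi>_def using x0
      by (auto intro!: derivative_eq_intros has_derivative_compose[of "\<lambda>t. x + t *\<^sub>R h" _ _ _ norm, OF _ has_derivative_norm, simplified] simp: inner_commute)
    moreover have "e \<bullet> (t *\<^sub>R h) - (sgn x \<bullet> (t *\<^sub>R h)) * k = s * (v \<bullet> h) * t" for t
    proof -
      have "s * (v \<bullet> h) = (e - (k / norm x) *\<^sub>R x) \<bullet> h" by (simp add: ev)
      also have "\<dots> = e \<bullet> h - (sgn x \<bullet> h) * k"
        by (simp add: inner_diff_left sgn_div_norm field_simps)
      finally have "s * (v \<bullet> h) * t = (e \<bullet> h - (sgn x \<bullet> h) * k) * t" by simp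
      then show ?thesis by (simp add: algebra_simps)
    qed
    ultimately show ?thesis by (simp add: has_field_derivative_def)
  qed
  have pos: "\<forall>\<^sub>F t in at_right 0. 0 < \<phi> h t" if "0 < v \<bullet> h" for h
    using DERIV_pos_inc_right[OF der, of h] that s unfolding \<phi>0 eventually_at_right_field
    by (metis (no_types, lifting) add_0 mult_pos_pos diff_zero)
  have neg: "\<forall>\<^sub>F t in at_right 0. \<phi> h t < 0" if "v \<bullet> h < 0" for h
    using DERIV_neg_dec_right[OF der, of h] that s unfolding \<phi>0 eventually_at_right_field
    by (metis (no_types, lifting) add_0 mult_pos_neg diff_zero)
  have xD: "x \<in> D" using D'[of 0 0] \<phi>0 by simp
  \<comment> \<open>A step in the direction - v leaves D at once, so x is a boundary point.\<close>
  have "x \<notin> interior D"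
  proof
    assume "x \<in> interior D"
    then have "\<forall>\<^sub>F y in nhds x. y \<in> D"
      using eventually_nhds interior_subset open_interior by (metis subsetD)
    moreover have "filterlim (\<lambda>t. x + t *\<^sub>R (- v)) (nhds x) (at_right 0)"
      by (rule tendsto_eq_intros refl | simp)+
    ultimately have "\<forall>\<^sub>F t in at_right 0. x + t *\<^sub>R (- v) \<in> D"
      unfolding filterlim_iff by blast
    moreover have "v \<bullet> (- v) < 0" using nv by (metis inner_minus_right dot_square_norm neg_less_0_iff_less one_power2 zero_less_one)
    ultimately have "\<forall>\<^sub>F t in at_right (0::real). x + t *\<^sub>R (- v) \<in> D \<and> \<phi> (- v) t < 0"
      using neg[of "- v"] by (intro eventually_conj)
    then have "\<forall>\<^sub>F t in at_right (0::real). False"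
      by (rule eventually_mono) (metis D' not_le)
    then show False by simp
  qed
  then have "x \<in> frontier D" using xD closure_subset by (auto simp: frontier_def)
  then show ?thesis
    unfolding inward_unit_normal_def
    using nv by (auto intro: eventually_mono[OF pos] eventually_mono[OF neg] simp: D')
qed

text \<open>On either side the gradient of e . z - |z| cos(\<alpha> / 2), where e is the bisector,
  is sin(\<alpha> / 2) times the stated vector, and sin(\<alpha> / 2) > 0 because \<alpha> / 2 lies
  in (0, pi).\<close>

lemma inward_unit_normal_wedge:
  assumes a: "0 < \<alpha>" "\<alpha> < 2 * pi" and r: "0 < r"
  shows "inward_unit_normal (wedge \<alpha>) (polar r 0) (vector [0, 1])"
    and "inward_unit_normal (wedge \<alpha>) (polar r \<alpha>) (vector [sin \<alpha>, - cos \<alpha>])"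
proof -
  have s: "0 < sin (\<alpha> / 2)" using a by (intro sin_gt_zero) auto
  have nz: "polar r t \<noteq> 0" for t using norm_polar[of r t] r by auto
  show "inward_unit_normal (wedge \<alpha>) (polar r 0) (vector [0, 1])"
    by (rule inward_unit_normalI[OF wedge_eq[OF a] nz _ _ s])
       (use r in \<open>auto simp: norm_polar inner_real2 vec_eq_iff forall_2 polar_def norm_vec_def L2_set_def sum_2\<close>)
  have c: "cos \<alpha> = cos (\<alpha>/2) ^ 2 - sin (\<alpha>/2) ^ 2" "sin \<alpha> = 2 * sin (\<alpha>/2) * cos (\<alpha>/2)"
    using cos_double[of "\<alpha>/2"] sin_double[of "\<alpha>/2"] by auto
  have e1: "sin (\<alpha>/2) ^ 2 = 1 - cos (\<alpha>/2) ^ 2" by (simp add: sin_squared_eq)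
  show "inward_unit_normal (wedge \<alpha>) (polar r \<alpha>) (vector [sin \<alpha>, - cos \<alpha>])"
  proof (rule inward_unit_normalI[OF wedge_eq[OF a] nz _ _ s])
    have "cos (\<alpha>/2) * cos \<alpha> + sin (\<alpha>/2) * sin \<alpha> = cos (\<alpha>/2)"
      using cos_diff[of \<alpha> "\<alpha>/2"] by (simp add: mult.commute)
    then have "r * (cos (\<alpha>/2) * cos \<alpha> + sin (\<alpha>/2) * sin \<alpha>) = r * cos (\<alpha>/2)" by simp
    then show "polar 1 (\<alpha> / 2) \<bullet> polar r \<alpha> = norm (polar r \<alpha>) * cos (\<alpha> / 2)"
      using r by (simp only: inner_real2 norm_polar) (simp add: polar_def algebra_simps)
    have "cos (\<alpha>/2) - cos (\<alpha>/2) * cos \<alpha> = sin (\<alpha>/2) * sin \<alpha>"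
      "sin (\<alpha>/2) - cos (\<alpha>/2) * sin \<alpha> = - (sin (\<alpha>/2) * cos \<alpha>)"
      using cos_diff[of \<alpha> "\<alpha>/2"] sin_diff[of "\<alpha>" "\<alpha>/2"] by (auto simp: mult.commute)
    then show "polar 1 (\<alpha> / 2) - (cos (\<alpha> / 2) / norm (polar r \<alpha>)) *\<^sub>R polar r \<alpha> = sin (\<alpha> / 2) *\<^sub>R vector [sin \<alpha>, - cos \<alpha>]"
      using r by (simp add: norm_polar vec_eq_iff forall_2) (simp add: polar_def field_simps)
    show "norm (vector [sin \<alpha>, - cos \<alpha>] :: real^2) = 1"
      by (simp add: norm_vec_def L2_set_def sum_2)
  qed
qed

section \<open>Neumann modes as real parts of holomorphic powers\<close>

text \<open>The power \<zeta>^\<nu>, \<nu> = n pi / \<alpha>, with its branch cut on the ray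
  opposite to the bisector, so that it is holomorphic near every nonzero point of the closed wedge
  even for reflex angles. Rotating by - \<alpha> / 2 costs a phase of \<nu> \<alpha> / 2 = n pi / 2,
  which \<open>\<i> ^ n\<close> restores. The case n = 0 is separate since the power of 0 with
  exponent 0 is 0.\<close>

definition Fw :: "real \<Rightarrow> nat \<Rightarrow> complex \<Rightarrow> complex" where
  "Fw \<alpha> n \<zeta> = (if n = 0 then 1 else \<i> ^ n * (\<zeta> * cis (- \<alpha> / 2)) powr of_real (real n * pi / \<alpha>))"

definition slit :: "real \<Rightarrow> complex set" where
  "slit \<alpha> = {\<zeta>. \<zeta> * cis (- \<alpha> / 2) \<notin> \<real>\<^sub>\<le>\<^sub>0}"

lemma borel_measurable_Fw[measurable]: "Fw \<alpha> n \<in> borel_measurable borel"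
  unfolding Fw_def[abs_def] by measurable

lemma Fw_polar:
  assumes "0 < \<alpha>" "\<alpha> < 2 * pi" "0 \<le> r" "0 \<le> t" "t \<le> \<alpha>"
  shows "Fw \<alpha> n (cplx (polar r t)) =
    of_real (if n = 0 then 1 else r powr (real n * pi / \<alpha>)) * cis (real n * pi * t / \<alpha>)"
proof (cases "n = 0 \<or> r = 0")
  case True
  then show ?thesis by (auto simp: Fw_def cplx_polar)
next
  case False
  then have n: "n \<noteq> 0" and r: "0 < r" using assms by auto
  let ?\<nu> = "real n * pi / \<alpha>"
  have w: "cplx (polar r t) * cis (- \<alpha> / 2) = of_real r * exp (\<i> * of_real (t - \<alpha> / 2))"
    by (simp only: cis_conv_exp[symmetric]) (simp add: cplx_polar mult.assoc cis_mult)
  have "Ln (exp (of_real (ln r) + \<i> * of_real (t - \<alpha> / 2))) = of_real (ln r) + \<i> * of_real (t - \<alpha> / 2)"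
    using assms by (intro Ln_exp) auto
  then have L: "Ln (cplx (polar r t) * cis (- \<alpha> / 2)) = of_real (ln r) + \<i> * of_real (t - \<alpha> / 2)"
    unfolding w exp_add using r by (simp only: exp_of_real exp_ln)
  have "Fw \<alpha> n (cplx (polar r t)) = \<i> ^ n * exp (of_real ?\<nu> * (of_real (ln r) + \<i> * of_real (t - \<alpha> / 2)))"
    using n r unfolding Fw_def powr_def L by (simp add: cplx_polar cis_neq_zero)
  also have "of_real ?\<nu> * (of_real (ln r) + \<i> * of_real (t - \<alpha> / 2))
      = of_real (?\<nu> * ln r) + \<i> * of_real (?\<nu> * (t - \<alpha> / 2))"
    by (simp only: distrib_left of_real_mult mult_ac)
  also have "exp \<dots> = of_real (r powr ?\<nu>) * cis (?\<nu> * (t - \<alpha> / 2))"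
    unfolding exp_add using r by (simp only: exp_of_real cis_conv_exp[symmetric] powr_def if_False less_irrefl) simp
  also have "\<i> ^ n = cis (real n * (pi / 2))"
    by (metis Complex.DeMoivre cis_pi_half)
  also have "cis (real n * (pi / 2)) * (of_real (r powr ?\<nu>) * cis (?\<nu> * (t - \<alpha> / 2)))
     = of_real (r powr ?\<nu>) * cis (real n * (pi / 2) + ?\<nu> * (t - \<alpha> / 2))"
    by (metis cis_mult mult.left_commute)
  also have "real n * (pi / 2) + ?\<nu> * (t - \<alpha> / 2) = real n * pi * t / \<alpha>"
    using assms by (simp add: field_simps)
  finally show ?thesis using n by simp
qed

lemma norm_Fw: "norm (Fw \<alpha> n \<zeta>) = (if n = 0 then 1 else norm \<zeta> powr (real n * pi / \<alpha>))"
  by (auto simp: Fw_def norm_mult norm_power norm_powr_real_powr')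

lemma Fw_scale:
  assumes "0 < c"
  shows "Fw \<alpha> n (of_real c * \<zeta>) = of_real (c powr (real n * pi / \<alpha>)) * Fw \<alpha> n \<zeta>"
proof (cases "n = 0 \<or> \<zeta> = 0")
  case False
  have "Ln (of_real c * (\<zeta> * cis (- \<alpha> / 2))) = of_real (ln c) + Ln (\<zeta> * cis (- \<alpha> / 2))"
    using False assms Ln_times_of_real[of c "\<zeta> * cis (- \<alpha> / 2)"] by (simp add: cis_neq_zero Ln_of_real)
  then have "(of_real c * (\<zeta> * cis (- \<alpha> / 2))) powr of_real (real n * pi / \<alpha>)
     = exp (of_real (real n * pi / \<alpha> * ln c)) * (\<zeta> * cis (- \<alpha> / 2)) powr of_real (real n * pi / \<alpha>)"
    using False assms
    by (simp only: powr_def of_real_mult distrib_left) (simp add: cis_neq_zero exp_add)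
  also have "exp (of_real (real n * pi / \<alpha> * ln c)) = (of_real (c powr (real n * pi / \<alpha>)) :: complex)"
    using assms by (simp only: exp_of_real powr_def) simp
  finally show ?thesis
    using False by (simp add: Fw_def mult.assoc mult.left_commute)
qed (use assms in \<open>auto simp: Fw_def\<close>)

text \<open>A point x of the wedge makes an angle of at least pi - \<alpha> / 2 with the cut, so its
  distance from the cut is at least |x| sin(\<alpha> / 2). This is the radius on which the mean
  value property is available.\<close>

lemma slit_nbhd:
  assumes "0 < \<alpha>" "\<alpha> < 2 * pi" "x \<in> wedge \<alpha>" "norm (y - cplx x) < sin (\<alpha> / 2) * norm x"
  shows "y \<in> slit \<alpha>"
proof (rule ccontr)
  assume "y \<notin> slit \<alpha>"
  \<comment> \<open>In rotated coordinates the cut is the nonpositive real axis, so y becomes - a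
    with a \<ge> 0.\<close>
  then obtain a where a: "0 \<le> a" "y * cis (- \<alpha> / 2) = of_real (- a)"
    unfolding slit_def nonpos_Reals_def by (auto simp: Reals_def) (metis minus_minus neg_0_le_iff_le of_real_minus)
  define X where "X = cplx x * cis (- \<alpha> / 2)"
  have nX: "norm X = norm x" by (simp add: X_def norm_mult)
  have ReX: "norm x * cos (\<alpha> / 2) \<le> Re X"
    using wedge_iff[OF assms(1,2), of x] assms(3)
    by (simp add: X_def cplx_def inner_real2 polar_def mult.commute)
  have "norm (y - cplx x) = norm (of_real (- a) - X)"
    unfolding X_def a(2)[symmetric] by (simp add: norm_mult flip: left_diff_distrib)
  then have "(norm (y - cplx x))\<^sup>2 = (a + Re X)\<^sup>2 + (Im X)\<^sup>2"
    by (simp only: cmod_power2) (simp add: power2_eq_square algebra_simps)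
  also have "\<dots> = a\<^sup>2 + 2 * a * Re X + (norm X)\<^sup>2"
    by (simp add: cmod_power2) (simp add: power2_eq_square algebra_simps)
  also have "\<dots> \<ge> a\<^sup>2 + 2 * a * (norm x * cos (\<alpha> / 2)) + (norm x)\<^sup>2"
    using a ReX by (simp add: nX mult_left_mono)
  also have "a\<^sup>2 + 2 * a * (norm x * cos (\<alpha> / 2)) + (norm x)\<^sup>2
     = (a + norm x * cos (\<alpha> / 2))\<^sup>2 + (sin (\<alpha> / 2) * norm x)\<^sup>2"
    by (simp add: power_mult_distrib sin_squared_eq) (simp add: power2_eq_square algebra_simps)
  finally have "(sin (\<alpha> / 2) * norm x)\<^sup>2 \<le> (norm (y - cplx x))\<^sup>2"
    by (smt (verit) zero_le_power2)
  moreover have "(norm (y - cplx x))\<^sup>2 < (sin (\<alpha> / 2) * norm x)\<^sup>2"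
    using assms(4) by (intro power_strict_mono) auto
  ultimately show False by simp
qed

lemma Fw_has_field_derivative:
  assumes "\<zeta> \<in> slit \<alpha>"
  shows "(Fw \<alpha> n has_field_derivative of_real (real n * pi / \<alpha>) * Fw \<alpha> n \<zeta> / \<zeta>) (at \<zeta>)"
proof (cases "n = 0")
  case True
  then have "Fw \<alpha> n = (\<lambda>_. 1)" by (auto simp: Fw_def)
  then show ?thesis using True by simp
next
  case False
  have \<zeta>0: "\<zeta> \<noteq> 0" using assms by (auto simp: slit_def)
  have s: "\<zeta> * cis (- \<alpha> / 2) \<notin> \<real>\<^sub>\<le>\<^sub>0" using assms by (simp add: slit_def)
  have F: "Fw \<alpha> n = (\<lambda>\<zeta>. \<i> ^ n * (\<zeta> * cis (- \<alpha> / 2)) powr of_real (real n * pi / \<alpha>))"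
    using False by (auto simp: Fw_def)
  have "(Fw \<alpha> n has_field_derivative \<i> ^ n * (of_real (real n * pi / \<alpha>) *
      (\<zeta> * cis (- \<alpha> / 2)) powr (of_real (real n * pi / \<alpha>) - 1) * cis (- \<alpha> / 2))) (at \<zeta>)"
    unfolding F using s
    by (auto intro!: derivative_eq_intros)
  then show ?thesis
  proof (rule DERIV_cong)
  have "(\<zeta> * cis (- \<alpha> / 2)) powr (of_real (real n * pi / \<alpha>) - 1)
     = (\<zeta> * cis (- \<alpha> / 2)) powr of_real (real n * pi / \<alpha>) / (\<zeta> * cis (- \<alpha> / 2))"
    using \<zeta>0 by (simp add: powr_diff cis_neq_zero)
  then show "\<i> ^ n * (of_real (real n * pi / \<alpha>) *
      (\<zeta> * cis (- \<alpha> / 2)) powr (of_real (real n * pi / \<alpha>) - 1) * cis (- \<alpha> / 2))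
      = of_real (real n * pi / \<alpha>) * Fw \<alpha> n \<zeta> / \<zeta>"
    using \<zeta>0 by (simp add: F cis_neq_zero)
  qed
qed

lemma Fw_holomorphic: "Fw \<alpha> n holomorphic_on slit \<alpha>"
  using Fw_has_field_derivative field_differentiable_at_within
  unfolding holomorphic_on_def field_differentiable_def
  by (meson has_field_derivative_at_within)

text \<open>The growth |x + z|^\<nu> is dominated by exp(|x + z|^2 / (8 h)), whose rate is below the
  critical 1 / (2 h) for variance h.\<close>

lemma integrable_Fw:
  assumes \<alpha>: "0 < \<alpha>" and h: "0 < h"
  shows "integrable (gauss h) (\<lambda>z. Fw \<alpha> n (cplx x + cplx z))"
proof -
  let ?\<nu> = "real n * pi / \<alpha>"
  have \<nu>: "0 \<le> ?\<nu>" using \<alpha> by simp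
  define K where "K = (1 + (?\<nu>/2) / (1 / (8 * h))) powr (?\<nu>/2)"
  have "integrable (gauss h) (\<lambda>z. (1 + K) * exp (- (- 1 / (8 * h)) * (norm (x + z))\<^sup>2))"
    using h by (intro integrable_mult_right gauss_integrable_exp) auto
  then show ?thesis
  proof (rule Bochner_Integration.integrable_bound)
    show "AE z in gauss h. norm (Fw \<alpha> n (cplx x + cplx z)) \<le> norm ((1 + K) * exp (- (- 1 / (8 * h)) * (norm (x + z))\<^sup>2))"
    proof (rule AE_I2)
      fix z
      have K0: "0 \<le> K" by (simp add: K_def)
      have e1: "1 \<le> exp (1 / (8 * h) * (norm (x + z))\<^sup>2)" using h by simp
      have "norm (x + z) powr ?\<nu> = (norm (x + z))\<^sup>2 powr (?\<nu>/2)"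
        by (cases "x + z = 0") (simp_all add: powr_powr flip: powr_numeral)
      also have "\<dots> \<le> K * exp (1 / (8 * h) * (norm (x + z))\<^sup>2)"
        unfolding K_def using \<alpha> h by (intro powr_le_exp) auto
      finally have "norm (Fw \<alpha> n (cplx (x + z))) \<le> (1 + K) * exp (1 / (8 * h) * (norm (x + z))\<^sup>2)"
        using e1 K0 unfolding norm_Fw norm_cplx by (auto simp: distrib_right intro: add_increasing add_increasing2)
      then show "norm (Fw \<alpha> n (cplx x + cplx z)) \<le> norm ((1 + K) * exp (- (- 1 / (8 * h)) * (norm (x + z))\<^sup>2))"
        using K0 by (simp add: abs_mult)
    qed
  qed measurable
qed

text \<open>The mean value property is exact for increments shorter than \<kappa> |x|, \<kappa> =
  sin(\<alpha> / 2), since they do not reach the cut. For longer ones both values of the function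
  are at most a constant times |z|^\<nu>, hence at most a constant times h^(\<nu>/2) exp(|z|^2 / (8
  h)), and \<kappa> |x| \<le> |z| converts half of exp(|z|^2 / (4 h)) into the decay in |x|. The
  error is thus visible only within a distance of order sqrt h of the vertex.\<close>

lemma gauss_integral_Fw:
  assumes \<alpha>: "0 < \<alpha>" "\<alpha> < 2 * pi"
  obtains C where "0 \<le> C" "\<And>x h. x \<in> wedge \<alpha> \<Longrightarrow> 0 < h \<Longrightarrow>
    norm ((\<integral>z. Fw \<alpha> n (cplx x + cplx z) \<partial>gauss h) - Fw \<alpha> n (cplx x))
     \<le> C * h powr (real n * pi / \<alpha> / 2) * exp (- (sin (\<alpha> / 2))\<^sup>2 * (norm x)\<^sup>2 / (8 * h))"
proof -
  define \<nu> where "\<nu> = real n * pi / \<alpha>"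
  define \<kappa> where "\<kappa> = sin (\<alpha> / 2)"
  have \<kappa>: "0 < \<kappa>" using \<alpha> by (simp add: \<kappa>_def sin_gt_zero)
  have \<nu>: "0 \<le> \<nu>" using \<alpha> by (simp add: \<nu>_def)
  define K where "K = (1 + (\<nu>/2) / (1 / 8)) powr (\<nu>/2)"
  have K0: "0 \<le> K" by (simp add: K_def)
  \<comment> \<open>The first factor 2 counts the two values at x + z and at x; the last one is the
    Gaussian integral of exp(|z|^2 / (4 h)).\<close>
  define C where "C = 2 * (1 + (1 + 1 / \<kappa>) powr \<nu>) * (1 + K) * 2"
  have C0: "0 \<le> C" using K0 by (simp add: C_def)
  have main: "norm ((\<integral>z. Fw \<alpha> n (cplx x + cplx z) \<partial>gauss h) - Fw \<alpha> n (cplx x))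
     \<le> C * h powr (\<nu> / 2) * exp (- \<kappa>\<^sup>2 * (norm x)\<^sup>2 / (8 * h))"
    if x: "x \<in> wedge \<alpha>" and h: "0 < h" for x h
  proof -
    interpret prob_space "gauss h" by (rule prob_space_gauss[OF h])
    define S where "S = {z::real^2. norm z < \<kappa> * norm x}"
    have [measurable]: "S \<in> sets borel" unfolding S_def by measurable
    define f where "f z = Fw \<alpha> n (cplx x + cplx z)" for z
    have [measurable]: "f \<in> borel_measurable borel" unfolding f_def by measurable
    have fi: "integrable (gauss h) f" unfolding f_def[abs_def] by (rule integrable_Fw[OF \<alpha>(1) h])
    have fS: "integrable (gauss h) (\<lambda>z. indicator S z *\<^sub>R f z)"
      by (rule integrable_mult_indicator[OF _ fi]) simp
    have "(\<integral>z. indicator S z *\<^sub>R f z \<partial>gauss h) = measure (gauss h) S *\<^sub>R Fw \<alpha> n (cplx x)"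
      unfolding f_def
    proof (rule gauss_mean_value[OF _ _ _ _ _ h])
      show "\<exists>\<rho>. norm z < \<rho> \<and> Fw \<alpha> n holomorphic_on ball (cplx x) \<rho>" if "z \<in> S" for z
        using that slit_nbhd[OF \<alpha> x]
        by (intro exI[of _ "\<kappa> * norm x"] conjI holomorphic_on_subset[OF Fw_holomorphic])
           (auto simp: S_def dist_norm norm_minus_commute \<kappa>_def)
    qed (use fS in \<open>auto simp: S_def f_def\<close>)
    moreover have "measure (gauss h) S *\<^sub>R Fw \<alpha> n (cplx x) = (\<integral>z. indicator S z *\<^sub>R Fw \<alpha> n (cplx x) \<partial>gauss h)"
      by (subst integral_scaleR_left) (auto intro!: integrable_real_indicator simp: emeasure_eq_measure)
    ultimately have eq: "(\<integral>z. indicator S z *\<^sub>R f z \<partial>gauss h) = (\<integral>z. indicator S z *\<^sub>R Fw \<alpha> n (cplx x) \<partial>gauss h)"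
      by (rule trans[OF _ _])
    have iS: "integrable (gauss h) (\<lambda>z. indicator S z *\<^sub>R Fw \<alpha> n (cplx x))"
      by (rule integrable_mult_indicator) auto
    have eqS: "(\<integral>z. indicator S z *\<^sub>R (f z - Fw \<alpha> n (cplx x)) \<partial>gauss h) = 0"
      unfolding scaleR_diff_right Bochner_Integration.integral_diff[OF fS iS] eq by (rule diff_self)
    define g where "g z = indicator (- S) z *\<^sub>R (f z - Fw \<alpha> n (cplx x))" for z
    have "(\<integral>z. f z \<partial>gauss h) - Fw \<alpha> n (cplx x) = (\<integral>z. f z - Fw \<alpha> n (cplx x) \<partial>gauss h)"
      using fi prob_space by (subst Bochner_Integration.integral_diff) auto
    also have "\<dots> = (\<integral>z. indicator S z *\<^sub>R (f z - Fw \<alpha> n (cplx x)) + g z \<partial>gauss h)"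
      unfolding g_def by (intro Bochner_Integration.integral_cong refl) (simp split: split_indicator)
    also have "\<dots> = (\<integral>z. g z \<partial>gauss h)"
    proof (subst Bochner_Integration.integral_add)
      show "integrable (gauss h) (\<lambda>z. indicator S z *\<^sub>R (f z - Fw \<alpha> n (cplx x)))" "integrable (gauss h) g"
        unfolding g_def[abs_def]
        by (rule integrable_mult_indicator Bochner_Integration.integrable_diff fi integrable_const | simp)+
    qed (simp add: eqS)
    finally have "norm ((\<integral>z. f z \<partial>gauss h) - Fw \<alpha> n (cplx x)) = norm (\<integral>z. g z \<partial>gauss h)" by simp
    also have "\<dots> \<le> (\<integral>z. (C / 2 * h powr (\<nu> / 2) * exp (- \<kappa>\<^sup>2 * (norm x)\<^sup>2 / (8 * h))) * exp (- (- 1 / (4 * h)) * (norm (0 + z))\<^sup>2) \<partial>gauss h)"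
    proof (rule order_trans[OF integral_norm_bound integral_mono])
      show "integrable (gauss h) (\<lambda>z. norm (g z))"
        unfolding g_def[abs_def]
        by (rule integrable_norm integrable_mult_indicator Bochner_Integration.integrable_diff fi integrable_const | simp)+
      show "integrable (gauss h) (\<lambda>z. (C / 2 * h powr (\<nu> / 2) * exp (- \<kappa>\<^sup>2 * (norm x)\<^sup>2 / (8 * h))) * exp (- (- 1 / (4 * h)) * (norm (0 + z))\<^sup>2))"
        using h by (intro integrable_mult_right gauss_integrable_exp) auto
      fix z :: "real^2"
      show "norm (g z) \<le> (C / 2 * h powr (\<nu> / 2) * exp (- \<kappa>\<^sup>2 * (norm x)\<^sup>2 / (8 * h))) * exp (- (- 1 / (4 * h)) * (norm (0 + z))\<^sup>2)"
      proof (cases "z \<in> S")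
        case True then show ?thesis using C0 by (simp add: g_def)
      next
        case False
        then have zx: "\<kappa> * norm x \<le> norm z" by (simp add: S_def)
        have nx: "norm x \<le> norm z / \<kappa>" using zx \<kappa> by (simp add: field_simps)
        \<comment> \<open>Both x + z and x have norm at most (1 + 1 / \<kappa>) |z| once \<kappa>
          |x| \<le> |z|.\<close>
        have nF: "norm (Fw \<alpha> n (cplx y)) \<le> (1 + (1 + 1 / \<kappa>) powr \<nu>) * (if n = 0 then 1 else norm z powr \<nu>)"
          if "norm y \<le> (1 + 1/\<kappa>) * norm z" for y
        proof (cases "n = 0")
          case False
          have "norm y powr \<nu> \<le> ((1 + 1/\<kappa>) * norm z) powr \<nu>" using that \<nu> by (intro powr_mono2) auto
          also have "\<dots> = (1 + 1/\<kappa>) powr \<nu> * norm z powr \<nu>" using \<kappa> by (simp add: powr_mult)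
          also have "\<dots> \<le> (1 + (1 + 1 / \<kappa>) powr \<nu>) * norm z powr \<nu>" by (intro mult_right_mono) auto
          finally show ?thesis using False by (simp add: norm_Fw \<nu>_def)
        qed (simp add: norm_Fw)
        define P where "P = (if n = 0 then 1 else norm z powr \<nu>)"
        define B where "B = 1 + (1 + 1 / \<kappa>) powr \<nu>"
        define E where "E = exp (- \<kappa>\<^sup>2 * (norm x)\<^sup>2 / (8 * h)) * exp (- (- 1 / (4 * h)) * (norm (0 + z))\<^sup>2)"
        have B0: "0 \<le> B" by (simp add: B_def)
        have g1: "norm (g z) \<le> norm (f z) + norm (Fw \<alpha> n (cplx x))"
          using False norm_triangle_ineq4 by (simp add: g_def)
        have f1: "norm (f z) \<le> B * P" unfolding B_def P_def
          using nF[of "x + z"] norm_triangle_ineq[of x z] nx by (simp add: f_def algebra_simps)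
        have f2: "norm (Fw \<alpha> n (cplx x)) \<le> B * P" unfolding B_def P_def
          by (rule nF) (use nx norm_ge_zero[of z] in \<open>simp add: algebra_simps add_increasing\<close>)
        have P1: "P \<le> (1 + K) * h powr (\<nu>/2) * exp ((norm z)\<^sup>2 / (8 * h))"
        proof (cases "n = 0")
          case True
          then have "\<nu> = 0" by (simp add: \<nu>_def)
          then show ?thesis using True h K0 mult_mono[of 1 "1 + K" 1 "exp ((norm z)\<^sup>2 / (8 * h))"] by (simp add: P_def)
        next
          case False
          have "norm z powr \<nu> = (norm z)\<^sup>2 powr (\<nu>/2)"
            by (cases "z = 0") (simp_all add: powr_powr flip: powr_numeral)
          also have "\<dots> = h powr (\<nu>/2) * ((norm z)\<^sup>2 / h) powr (\<nu>/2)"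
            using h by (simp add: powr_divide)
          finally have e: "norm z powr \<nu> = h powr (\<nu>/2) * ((norm z)\<^sup>2 / h) powr (\<nu>/2)" .
          have "((norm z)\<^sup>2 / h) powr (\<nu>/2) \<le> K * exp (1 / 8 * ((norm z)\<^sup>2 / h))"
            unfolding K_def using \<nu> h by (intro powr_le_exp) auto
          also have "\<dots> \<le> (1 + K) * exp ((norm z)\<^sup>2 / (8 * h))" by simp
          finally have "h powr (\<nu>/2) * ((norm z)\<^sup>2 / h) powr (\<nu>/2) \<le> h powr (\<nu>/2) * ((1 + K) * exp ((norm z)\<^sup>2 / (8 * h)))"
            by (rule mult_left_mono) simp
          then show ?thesis using False by (simp add: P_def e mult_ac)
        qed
        \<comment> \<open>Here exp(|z|^2 / (8 h)) is written as exp(|z|^2 / (4 h)) exp(- |z|^2 / (8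
          h)), and the second factor is bounded through |z| \<ge> \<kappa> |x|.\<close>
        have E1: "exp ((norm z)\<^sup>2 / (8 * h)) \<le> E"
        proof -
          have "\<kappa>\<^sup>2 * (norm x)\<^sup>2 \<le> (norm z)\<^sup>2"
            using power_mono[OF zx, of 2] \<kappa> by (simp add: power_mult_distrib)
          then show ?thesis using h by (simp add: E_def exp_add[symmetric] field_simps)
        qed
        have "norm (g z) \<le> 2 * B * P" using g1 f1 f2 by simp
        also have "\<dots> \<le> 2 * B * ((1 + K) * h powr (\<nu>/2) * exp ((norm z)\<^sup>2 / (8 * h)))"
          using P1 B0 by (intro mult_left_mono) auto
        also have "\<dots> \<le> 2 * B * ((1 + K) * h powr (\<nu>/2) * E)"
          using E1 B0 K0 by (intro mult_left_mono) auto
        moreover have "C / 2 = 2 * B * (1 + K)" by (simp add: C_def B_def)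
        ultimately show ?thesis by (simp only: E_def mult_ac)
      qed
    qed
    also have "\<dots> = C * h powr (\<nu> / 2) * exp (- \<kappa>\<^sup>2 * (norm x)\<^sup>2 / (8 * h))"
      using h gauss_integral_exp[of h "- 1 / (4 * h)" 0] by simp
    finally show ?thesis by (simp add: f_def)
  qed
  show thesis
    by (rule that[OF C0]) (use main in \<open>simp add: \<nu>_def \<kappa>_def\<close>)
qed

definition P :: "real \<Rightarrow> nat \<Rightarrow> real^2 \<Rightarrow> real" where
  "P \<alpha> n x = Re (Fw \<alpha> n (cplx x))"

lemma borel_measurable_P[measurable]: "P \<alpha> n \<in> borel_measurable borel"
  unfolding P_def[abs_def] by measurable

lemma P_polar:
  assumes "0 < \<alpha>" "\<alpha> < 2 * pi" "0 \<le> r" "0 \<le> t" "t \<le> \<alpha>"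
  shows "P \<alpha> n (polar r t) = (if n = 0 then 1 else r powr (real n * pi / \<alpha>)) * cos (real n * pi * t / \<alpha>)"
  using assms by (simp add: P_def Fw_polar)

lemma abs_P_le: "\<bar>P \<alpha> n x\<bar> \<le> (if n = 0 then 1 else norm x powr (real n * pi / \<alpha>))"
  using abs_Re_le_cmod[of "Fw \<alpha> n (cplx x)"] by (simp add: P_def norm_Fw split: if_splits)

text \<open>Completing the square replaces x by c x and h by h c and produces one factor c;
  homogeneity of degree \<nu> produces c^\<nu> more. What remains is the branch cut error of
  \<open>gauss_integral_Fw\<close> at the contracted point. The constant does not depend on l, so
  the estimate can be used for the mode itself and for its cut-off alike.\<close>

lemma gauss_integral_exp_P:
  assumes \<alpha>: "0 < \<alpha>" "\<alpha> < 2 * pi"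
  obtains C where "0 \<le> C" "\<And>x h l c. x \<in> wedge \<alpha> \<Longrightarrow> 0 < h \<Longrightarrow> 0 \<le> l \<Longrightarrow> c = 1 / (1 + 2 * l * h) \<Longrightarrow>
    \<bar>(\<integral>z. exp (- l * (norm (x + z))\<^sup>2) * P \<alpha> n (x + z) \<partial>gauss h)
       - c powr (real n * pi / \<alpha> + 1) * (exp (- l * c * (norm x)\<^sup>2) * P \<alpha> n x)\<bar>
     \<le> C * h powr (real n * pi / \<alpha> / 2) * exp (- (sin (\<alpha> / 2))\<^sup>2 * c * (norm x)\<^sup>2 / (8 * h))"
proof -
  define \<nu> where "\<nu> = real n * pi / \<alpha>"
  have \<nu>: "0 \<le> \<nu>" using \<alpha> by (simp add: \<nu>_def)
  obtain C where C: "0 \<le> C" "\<And>x h. x \<in> wedge \<alpha> \<Longrightarrow> 0 < h \<Longrightarrow>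
    norm ((\<integral>z. Fw \<alpha> n (cplx x + cplx z) \<partial>gauss h) - Fw \<alpha> n (cplx x))
     \<le> C * h powr (real n * pi / \<alpha> / 2) * exp (- (sin (\<alpha> / 2))\<^sup>2 * (norm x)\<^sup>2 / (8 * h))"
    using gauss_integral_Fw[OF \<alpha>] by blast
  show thesis
  proof (rule that[OF C(1)])
    fix x :: "real^2" and h l c :: real
    assume x: "x \<in> wedge \<alpha>" and h: "0 < h" and l: "0 \<le> l" and c: "c = 1 / (1 + 2 * l * h)"
    have lh: "0 \<le> l * h" using l h by simp
    have c1: "0 < 1 + 2 * l * h" using lh by linarith
    have cp: "0 < c" "c \<le> 1" using lh by (auto simp: c field_simps)
    define I where "I = (\<integral>z. Fw \<alpha> n (cplx (c *\<^sub>R x) + cplx z) \<partial>gauss (h * c))"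
    have int: "integrable (gauss (h * c)) (\<lambda>z. Fw \<alpha> n (cplx (c *\<^sub>R x) + cplx z))"
      using h cp \<alpha> by (intro integrable_Fw) auto
    have "(\<integral>z. exp (- l * (norm (x + z))\<^sup>2) * P \<alpha> n (x + z) \<partial>gauss h)
        = (c * exp (- l * c * (norm x)\<^sup>2)) * (\<integral>z. P \<alpha> n (c *\<^sub>R x + z) \<partial>gauss (h * c))"
      using gauss_integral_mult_exp[OF _ h c1, of "P \<alpha> n" x] by (simp add: c)
    also have "(\<integral>z. P \<alpha> n (c *\<^sub>R x + z) \<partial>gauss (h * c)) = Re I"
      using integral_Re[OF int] by (simp add: I_def P_def)
    finally have e1: "(\<integral>z. exp (- l * (norm (x + z))\<^sup>2) * P \<alpha> n (x + z) \<partial>gauss h) = (c * exp (- l * c * (norm x)\<^sup>2)) * Re I" .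
    have "c powr (\<nu> + 1) = c * c powr \<nu>" using cp by (simp add: powr_add)
    moreover have "Re (Fw \<alpha> n (cplx (c *\<^sub>R x))) = c powr \<nu> * P \<alpha> n x"
      using cp by (simp add: Fw_scale P_def \<nu>_def)
    ultimately have e2: "c powr (\<nu> + 1) * (exp (- l * c * (norm x)\<^sup>2) * P \<alpha> n x)
       = (c * exp (- l * c * (norm x)\<^sup>2)) * Re (Fw \<alpha> n (cplx (c *\<^sub>R x)))" by (simp add: mult_ac)
    have "\<bar>(\<integral>z. exp (- l * (norm (x + z))\<^sup>2) * P \<alpha> n (x + z) \<partial>gauss h) - c powr (\<nu> + 1) * (exp (- l * c * (norm x)\<^sup>2) * P \<alpha> n x)\<bar>
       = (c * exp (- l * c * (norm x)\<^sup>2)) * \<bar>Re (I - Fw \<alpha> n (cplx (c *\<^sub>R x)))\<bar>"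
      unfolding e1 e2 using cp by (simp add: abs_mult flip: right_diff_distrib)
    also have "\<dots> \<le> 1 * (C * (h * c) powr (\<nu> / 2) * exp (- (sin (\<alpha> / 2))\<^sup>2 * (norm (c *\<^sub>R x))\<^sup>2 / (8 * (h * c))))"
    proof (rule mult_mono)
      show "c * exp (- l * c * (norm x)\<^sup>2) \<le> 1"
        using cp l by (intro mult_le_one) auto
      show "\<bar>Re (I - Fw \<alpha> n (cplx (c *\<^sub>R x)))\<bar> \<le> C * (h * c) powr (\<nu> / 2) * exp (- (sin (\<alpha> / 2))\<^sup>2 * (norm (c *\<^sub>R x))\<^sup>2 / (8 * (h * c)))"
        using C(2)[of "c *\<^sub>R x" "h * c"] scale_wedge[OF x, of c] cp h
          abs_Re_le_cmod[of "I - Fw \<alpha> n (cplx (c *\<^sub>R x))"] unfolding I_def \<nu>_def by fastforce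
    qed auto
    also have "\<dots> \<le> C * h powr (\<nu> / 2) * exp (- (sin (\<alpha> / 2))\<^sup>2 * c * (norm x)\<^sup>2 / (8 * h))"
    proof -
      have "(h * c) powr (\<nu> / 2) \<le> h powr (\<nu> / 2)"
        using h cp \<nu> by (intro powr_mono2) (auto simp: mult_left_le)
      moreover have "- (sin (\<alpha> / 2))\<^sup>2 * (norm (c *\<^sub>R x))\<^sup>2 / (8 * (h * c)) = - (sin (\<alpha> / 2))\<^sup>2 * c * (norm x)\<^sup>2 / (8 * h)"
        using cp by (simp add: power_mult_distrib power2_eq_square)
      ultimately show ?thesis using C(1) by (simp add: mult_left_mono mult_right_mono)
    qed
    finally show "\<bar>(\<integral>z. exp (- l * (norm (x + z))\<^sup>2) * P \<alpha> n (x + z) \<partial>gauss h)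
       - c powr (real n * pi / \<alpha> + 1) * (exp (- l * c * (norm x)\<^sup>2) * P \<alpha> n x)\<bar>
     \<le> C * h powr (real n * pi / \<alpha> / 2) * exp (- (sin (\<alpha> / 2))\<^sup>2 * c * (norm x)\<^sup>2 / (8 * h))"
      by (simp add: \<nu>_def)
  qed
qed

text \<open>No regularity of \<open>F\<close> is needed: \<^const>\<open>extend_measure\<close> is the zero measure whenever
  no measure with the prescribed values exists.\<close>

lemma emeasure_interval_measure_finite:
  assumes "a \<le> b"
  shows "emeasure (interval_measure F) {a<..b} < \<infinity>"
proof -
  let ?I = "{(a, b). a \<le> b}" and ?G = "\<lambda>(a, b). {a<..b} :: real set"
    and ?m = "\<lambda>(a, b). ennreal (F b - F a)"
  let ?P = "\<lambda>\<mu>'. (\<forall>i\<in>?I. \<mu>' (?G i) = ?m i) \<and> measure_space UNIV (sigma_sets UNIV (?G ` ?I)) \<mu>'"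
  have mem: "{a<..b} \<in> sigma_sets UNIV (?G ` ?I)" using assms by (intro sigma_sets.Basic) force
  show ?thesis
  proof (cases "(\<exists>\<mu>'. ?P \<mu>') \<and> \<not> (\<forall>i\<in>?I. ?m i = 0)")
    case True
    then have ex: "\<exists>\<mu>'. ?P \<mu>'" by (rule conjunct1)
    have S: "?P (SOME \<mu>'. ?P \<mu>')" by (rule someI_ex[OF ex])
    have im: "interval_measure F = measure_of UNIV (?G ` ?I) (SOME \<mu>'. ?P \<mu>')"
      unfolding interval_measure_def extend_measure_def using True by (rule if_P)
    have "emeasure (interval_measure F) {a<..b} = (SOME \<mu>'. ?P \<mu>') {a<..b}"
    proof (rule emeasure_measure_of[OF im])
      have sets: "sets (interval_measure F) = sigma_sets UNIV (?G ` ?I)"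
        unfolding im by (rule sets_measure_of) simp
      show "positive (sets (interval_measure F)) (SOME \<mu>'. ?P \<mu>')"
        "countably_additive (sets (interval_measure F)) (SOME \<mu>'. ?P \<mu>')"
        unfolding sets
        by (rule conjunct1[OF conjunct2[OF iffD1[OF measure_space_def conjunct2[OF S]]]]
            conjunct2[OF conjunct2[OF iffD1[OF measure_space_def conjunct2[OF S]]]])+
      show "{a<..b} \<in> sets (interval_measure F)" unfolding sets by (rule mem)
    qed simp
    also have "\<dots> = ?m (a, b)"
      using bspec[OF conjunct1[OF S], of "(a, b)"] assms by simp
    finally show ?thesis by simp
  next
    case False
    then have "interval_measure F = measure_of UNIV (?G ` ?I) (\<lambda>_. 0)"
      unfolding interval_measure_def extend_measure_def by (rule if_not_P)
    then show ?thesis by (simp add: emeasure_sigma)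
  qed
qed

section \<open>The reflection term along a single path\<close>

text \<open>The expansions about x and about y are compared at the common point y + v, where v is w
  rescaled to length d = |x - y|. The three remainders cost K d^2, K d^2 and K (2 d)^2, whence the
  factor 6. No segment between x and y has to stay in D, which matters for nonconvex wedges.\<close>

lemma whitney_gradient_lipschitz:
  fixes u :: "'a::real_normed_vector \<Rightarrow> real" and g :: "'a \<Rightarrow> 'a \<Rightarrow> real"
  assumes tay: "\<And>z w. z \<in> D \<Longrightarrow> \<bar>u (z + w) - u z - g z w\<bar> \<le> K * (norm w)\<^sup>2"
    and lin: "\<And>z. z \<in> D \<Longrightarrow> linear (g z)" and x: "x \<in> D" and y: "y \<in> D"
  shows "\<bar>g x w - g y w\<bar> \<le> 6 * K * norm (x - y) * norm w"
proof (cases "x = y \<or> w = 0")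
  case True
  then show ?thesis using linear_0[OF lin[OF x]] linear_0[OF lin[OF y]] by auto
next
  case False
  define d where "d = norm (x - y)"
  define v where "v = (d / norm w) *\<^sub>R w"
  have d: "0 < d" using False by (simp add: d_def)
  have nv: "norm v = d" using False d by (simp add: v_def)
  have K: "0 \<le> K"
    using order_trans[OF abs_ge_zero tay[OF x, of v]] nv d by (simp add: zero_le_mult_iff)
  have nyx: "norm (y - x) = d" by (simp add: d_def norm_minus_commute)
  have "norm (y - x + v) \<le> 2 * d" using norm_triangle_ineq[of "y - x" v] nv nyx by simp
  then have "(norm (y - x + v))\<^sup>2 \<le> (2 * d)\<^sup>2" by (intro power_mono) auto
  then have sq: "K * (norm (y - x + v))\<^sup>2 \<le> K * (2 * d)\<^sup>2" using K by (intro mult_left_mono)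
  have a: "\<bar>u (y + v) - u y - g y v\<bar> \<le> K * d\<^sup>2" using tay[OF y, of v] nv by simp
  have b: "\<bar>u y - u x - g x (y - x)\<bar> \<le> K * d\<^sup>2" using tay[OF x, of "y - x"] nyx by simp
  have c: "\<bar>u (y + v) - u x - g x (y - x) - g x v\<bar> \<le> K * (2 * d)\<^sup>2"
  proof -
    have "x + (y - x + v) = y + v" by simp
    then have "\<bar>u (y + v) - u x - (g x (y - x) + g x v)\<bar> \<le> K * (norm (y - x + v))\<^sup>2"
      using tay[OF x, of "y - x + v"] by (simp only: linear_add[OF lin[OF x]])
    then show ?thesis using sq by linarith
  qed
  have "\<bar>g x v - g y v\<bar> \<le> 6 * K * d\<^sup>2"
    using a b c by (simp add: power2_eq_square)
  also have "g x v - g y v = (d / norm w) * (g x w - g y w)"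
    by (simp add: v_def linear_scale[OF lin[OF x]] linear_scale[OF lin[OF y]] right_diff_distrib)
  finally have "(d / norm w) * \<bar>g x w - g y w\<bar> \<le> (d / norm w) * (6 * K * d * norm w)"
    using d False by (simp add: abs_mult power2_eq_square mult_ac)
  then have "\<bar>g x w - g y w\<bar> \<le> 6 * K * d * norm w"
    using d False by (simp only: mult_le_cancel_left_pos divide_pos_pos zero_less_norm_iff simp_thms de_Morgan_disj)
  then show ?thesis by (simp add: d_def)
qed

text \<open>To first order a summand is the gradient at X_t applied to L_t - L_s, which is the
  integral of q over the interval from s to t. The gradient at X_r annihilates q_r, and by the
  Lipschitz property it changes little between X_r and X_t; the quadratic remainder is at most K
  |L_t - L_s| times B times the mass of the interval. So every summand is bounded by an oscillation
  of the path times the mass of its grid interval, and the oscillations vanish by uniform continuity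
  while the masses add up to that of (0, T].\<close>

lemma pathwise_reflection_sum_tendsto:
  fixes Xp Lp q :: "real \<Rightarrow> real^2" and V :: "real measure"
    and u :: "real \<Rightarrow> real^2 \<Rightarrow> real" and g :: "real \<Rightarrow> real^2 \<Rightarrow> real^2 \<Rightarrow> real"
  assumes T: "0 < T" and K: "0 \<le> K" and B: "0 \<le> B"
    and sV: "sets V = sets borel" and fV: "emeasure V {-1<..T} < \<infinity>"
    and qm: "set_borel_measurable V {0..T} q" and qb: "\<And>s. norm (q s) \<le> B"
    and Lp: "\<And>t. 0 \<le> t \<Longrightarrow> t \<le> T \<Longrightarrow> Lp t = (LINT s:{0..t}|V. q s)"
    and cX: "continuous_on {0..T} Xp" and cL: "continuous_on {0..T} Lp"
    and XD: "\<And>t. 0 \<le> t \<Longrightarrow> t \<le> T \<Longrightarrow> Xp t \<in> D"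
    and lin: "\<And>s z. 0 \<le> s \<Longrightarrow> s \<le> T \<Longrightarrow> z \<in> D \<Longrightarrow> linear (g s z)"
    and tay: "\<And>s z w. 0 \<le> s \<Longrightarrow> s \<le> T \<Longrightarrow> z \<in> D \<Longrightarrow> \<bar>u s (z + w) - u s z - g s z w\<bar> \<le> K * (norm w)\<^sup>2"
    and gq: "\<And>s t. 0 \<le> s \<Longrightarrow> s \<le> T \<Longrightarrow> 0 \<le> t \<Longrightarrow> t \<le> T \<Longrightarrow> g s (Xp t) (q t) = 0"
  shows "(\<lambda>N. \<Sum>i<Suc N. let s = real i * (T / real (Suc N)); t = real (Suc i) * (T / real (Suc N)) in
      u t (Xp t) - u t (Xp t - (Lp t - Lp s))) \<longlonglongrightarrow> 0"
proof -
  have m[measurable]: "{a<..b} \<in> sets V" "{a..b} \<in> sets V" for a b :: real by (simp_all add: sV)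
  define mv where "mv a b = measure V {a<..b}" for a b
  \<comment> \<open>The half-open interval starts at -1 so that it contains 0, because the integrals
    defining \<open>Lp\<close> run over closed intervals from 0.\<close>
  have fin: "emeasure V {a<..b} < \<infinity>" if "-1 \<le> a" "b \<le> T" for a b
  proof -
    have "{a<..b} \<subseteq> {-1<..T}" using that by auto
    from emeasure_mono[OF this, of V] show ?thesis using fV m by (auto simp: le_less_trans)
  qed
  have qi: "set_integrable V {0..t} q" if "t \<le> T" for t
    unfolding set_integrable_def
  proof (rule Bochner_Integration.integrable_bound)
    show "integrable V (\<lambda>s. B * indicator {-1<..T} s)"
      using fin[of "-1" T] by (intro integrable_mult_right) (auto simp: integrable_indicator_iff)
    have "set_borel_measurable V {0..t} q"
      by (rule set_borel_measurable_subset[OF qm]) (use that in auto)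
    then show "(\<lambda>x. indicat_real {0..t} x *\<^sub>R q x) \<in> borel_measurable V"
      by (simp add: set_borel_measurable_def)
    show "AE s in V. norm (indicat_real {0..t} s *\<^sub>R q s) \<le> norm (B * indicator {-1<..T} s)"
      using qb B that by (intro AE_I2) (auto simp: indicator_def)
  qed
  have qi': "set_integrable V {s<..t} q" if "0 \<le> s" "t \<le> T" for s t
    by (rule set_integrable_subset[OF qi[OF that(2)]]) (use that in auto)
  have dL: "Lp t - Lp s = (LINT r:{s<..t}|V. q r)" if "0 \<le> s" "s \<le> t" "t \<le> T" for s t
  proof -
    have e: "{0..t} = {0..s} \<union> {s<..t}" using that by auto
    have "(LINT r:{0..t}|V. q r) = (LINT r:{0..s}|V. q r) + (LINT r:{s<..t}|V. q r)"
      unfolding e using that by (intro set_integral_Un qi qi') auto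
    then show ?thesis using that by (simp add: Lp)
  qed
  have bnd: "norm (LINT r:{s<..t}|V. f r) \<le> b * mv s t"
    if "0 \<le> s" "t \<le> T" and f: "set_integrable V {s<..t} f" and b: "\<And>r. s < r \<Longrightarrow> r \<le> t \<Longrightarrow> norm (f r) \<le> b" and b0: "0 \<le> b"
    for s t b and f :: "real \<Rightarrow> 'b::{banach, second_countable_topology}"
  proof -
    have "norm (LINT r:{s<..t}|V. f r) \<le> (\<integral>r. norm (indicat_real {s<..t} r *\<^sub>R f r) \<partial>V)"
      unfolding set_lebesgue_integral_def by (rule integral_norm_bound)
    also have "\<dots> \<le> (\<integral>r. b * indicat_real {s<..t} r \<partial>V)"
    proof (rule integral_mono)
      show "integrable V (\<lambda>r. norm (indicat_real {s<..t} r *\<^sub>R f r))"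
        using f unfolding set_integrable_def by (rule integrable_norm)
      show "integrable V (\<lambda>r. b * indicat_real {s<..t} r)"
        using fin[of s t] that by (intro integrable_mult_right) (auto simp: integrable_indicator_iff)
    qed (use b b0 in \<open>auto simp: indicator_def\<close>)
    also have "\<dots> = b * mv s t" using fin[of s t] that by (simp add: mv_def)
    finally show ?thesis .
  qed
  have mv_split: "mv s t = mv 0 t - mv 0 s" if "0 \<le> s" "s \<le> t" "t \<le> T" for s t
  proof -
    have "measure V ({0<..s} \<union> {s<..t}) = mv 0 s + mv s t"
      unfolding mv_def using fin[of 0 s] fin[of s t] that by (intro measure_Union) auto
    moreover have "{0<..s} \<union> {s<..t} = {0<..t}" using that by auto
    ultimately show ?thesis by (simp add: mv_def)
  qed
  have step: "\<bar>u t (Xp t) - u t (Xp t - (Lp t - Lp s))\<bar> \<le> (K * B * e + 6 * K * e * B) * mv s t"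
    if st: "0 \<le> s" "s \<le> t" "t \<le> T" and e: "0 \<le> e"
      and oL: "norm (Lp t - Lp s) \<le> e" and oX: "\<And>r. s \<le> r \<Longrightarrow> r \<le> t \<Longrightarrow> norm (Xp t - Xp r) \<le> e"
    for s t e
  proof -
    have t0: "0 \<le> t" using st by simp
    note [simp] = t0
    have lt: "linear (g t (Xp t))" using lin XD st by auto
    then have blt: "bounded_linear (g t (Xp t))" by (simp add: linear_conv_bounded_linear)
    let ?d = "Lp t - Lp s"
    have nd: "norm ?d \<le> B * mv s t"
      unfolding dL[OF st] using st B qb by (intro bnd qi') auto
    have "\<bar>u t (Xp t) - u t (Xp t - ?d) - g t (Xp t) ?d\<bar> \<le> K * (norm ?d)\<^sup>2"
      using tay[of t "Xp t" "- ?d"] XD[of t] st linear_neg[OF lt, of ?d] by (simp add: abs_minus_commute norm_minus_commute algebra_simps)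
    also have "\<dots> \<le> K * (e * (B * mv s t))"
      unfolding power2_eq_square using nd oL e K by (intro mult_left_mono mult_mono) auto
    finally have 1: "\<bar>u t (Xp t) - u t (Xp t - ?d) - g t (Xp t) ?d\<bar> \<le> K * (e * (B * mv s t))" .
    have "g t (Xp t) ?d = (LINT r:{s<..t}|V. g t (Xp t) (q r))"
    proof -
      have "g t (Xp t) ?d = (\<integral>r. g t (Xp t) (indicat_real {s<..t} r *\<^sub>R q r) \<partial>V)"
        unfolding dL[OF st] set_lebesgue_integral_def
        using integral_bounded_linear[OF blt, of V "\<lambda>r. indicat_real {s<..t} r *\<^sub>R q r"] qi'[of s t] st
        by (simp add: set_integrable_def)
      then show ?thesis by (simp add: set_lebesgue_integral_def linear_scale[OF lt])
    qed
    also have "norm \<dots> \<le> (6 * K * e * B) * mv s t"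
    proof (rule bnd)
      show "set_integrable V {s<..t} (\<lambda>r. g t (Xp t) (q r))"
        using integrable_bounded_linear[OF blt, of V "\<lambda>r. indicat_real {s<..t} r *\<^sub>R q r"] qi'[of s t] st
        by (simp add: set_integrable_def linear_scale[OF lt])
      fix r assume r: "s < r" "r \<le> t"
      \<comment> \<open>The subtracted term is 0 by \<open>gq\<close>, so this bounds how far the
        gradient at the later point fails to annihilate the direction of reflection at time
        r.\<close>
      have "\<bar>g t (Xp t) (q r) - g t (Xp r) (q r)\<bar> \<le> 6 * K * norm (Xp t - Xp r) * norm (q r)"
        using st r by (intro whitney_gradient_lipschitz[of D "u t"] tay lin XD) auto
      also have "\<dots> \<le> 6 * K * e * B"
        using oX[of r] r qb[of r] K e by (intro mult_mono) auto
      finally show "norm (g t (Xp t) (q r)) \<le> 6 * K * e * B"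
        using gq[of t r] st r by simp
    qed (use st K B e in auto)
    finally have 2: "\<bar>g t (Xp t) ?d\<bar> \<le> (6 * K * e * B) * mv s t" by simp
    show ?thesis using 1 2 by (simp add: algebra_simps)
  qed
  define Y where "Y N = (\<Sum>i<Suc N. let s = real i * (T / real (Suc N)); t = real (Suc i) * (T / real (Suc N)) in
      u t (Xp t) - u t (Xp t - (Lp t - Lp s)))" for N
  have "Y \<longlonglongrightarrow> 0"
  proof (rule LIMSEQ_I)
    fix r :: real assume r: "0 < r"
    \<comment> \<open>The added 1 only keeps the constant positive when the interval carries no
      mass.\<close>
    define C where "C = (K * B + 6 * K * B) * mv 0 T + 1"
    have C: "0 < C" using K B by (auto simp: C_def mv_def intro!: add_nonneg_pos mult_nonneg_nonneg)
    define e where "e = r / (2 * C)"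
    have e: "0 < e" using r C by (simp add: e_def)
    obtain d1 where d1: "0 < d1" "\<And>s t. s \<in> {0..T} \<Longrightarrow> t \<in> {0..T} \<Longrightarrow> dist t s < d1 \<Longrightarrow> dist (Xp t) (Xp s) < e"
      using compact_uniformly_continuous[OF cX compact_Icc] e unfolding uniformly_continuous_on_def by blast
    obtain d2 where d2: "0 < d2" "\<And>s t. s \<in> {0..T} \<Longrightarrow> t \<in> {0..T} \<Longrightarrow> dist t s < d2 \<Longrightarrow> dist (Lp t) (Lp s) < e"
      using compact_uniformly_continuous[OF cL compact_Icc] e unfolding uniformly_continuous_on_def by blast
    define d where "d = min d1 d2"
    have d: "0 < d" "d \<le> d1" "d \<le> d2" using d1 d2 by (auto simp: d_def)
    have osc: "norm (Xp t - Xp s) \<le> e" "norm (Lp t - Lp s) \<le> e"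
      if "0 \<le> s" "s \<le> t" "t \<le> T" "t - s < d" for s t
      using d1(2)[of s t] d2(2)[of s t] that d by (auto simp: dist_norm)
    obtain N0 :: nat where N0: "T / d < real N0" using reals_Archimedean2 by blast
    show "\<exists>no. \<forall>N\<ge>no. norm (Y N - 0) < r"
    proof (intro exI[of _ N0] allI impI)
      fix N assume N: "N0 \<le> N"
      define h where "h = T / real (Suc N)"
      have h: "0 < h" using T by (simp add: h_def)
      have "T / d < real (Suc N)" using N0 N by simp
      then have hd: "h < d" using d T by (simp add: h_def pos_divide_less_eq mult.commute)
      have hT: "real (Suc N) * h = T" by (simp add: h_def)
      have tT: "real i * h \<le> T" if "i \<le> Suc N" for i
      proof -
        have "real i * h \<le> real (Suc N) * h" using that h by (intro mult_right_mono) auto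
        then show ?thesis by (simp only: hT)
      qed
      have "\<bar>Y N\<bar> \<le> (\<Sum>i<Suc N. (K * B * e + 6 * K * e * B) * mv (real i * h) (real (Suc i) * h))"
        unfolding Y_def Let_def h_def[symmetric]
      proof (rule order_trans[OF sum_abs], rule sum_mono)
        fix i assume i: "i \<in> {..<Suc N}"
        define s where "s = real i * h"
        define t where "t = real (Suc i) * h"
        have "t \<le> T" unfolding t_def using i by (intro tT) simp
        moreover have "t = s + h" by (simp add: t_def s_def algebra_simps)
        moreover have "0 \<le> s" using h by (simp add: s_def)
        ultimately have "\<bar>u t (Xp t) - u t (Xp t - (Lp t - Lp s))\<bar> \<le> (K * B * e + 6 * K * e * B) * mv s t"
          using h hd e by (intro step osc) auto
        then show "\<bar>u (real (Suc i) * h) (Xp (real (Suc i) * h)) - u (real (Suc i) * h)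
            (Xp (real (Suc i) * h) - (Lp (real (Suc i) * h) - Lp (real i * h)))\<bar>
          \<le> (K * B * e + 6 * K * e * B) * mv (real i * h) (real (Suc i) * h)"
          unfolding s_def t_def .
      qed
      also have "\<dots> = (K * B * e + 6 * K * e * B) * (\<Sum>i<Suc N. mv 0 (real (Suc i) * h) - mv 0 (real i * h))"
        unfolding sum_distrib_left
      proof (rule sum.cong[OF refl])
        fix i assume i: "i \<in> {..<Suc N}"
        have "mv (real i * h) (real (Suc i) * h) = mv 0 (real (Suc i) * h) - mv 0 (real i * h)"
        proof (rule mv_split)
          show "real (Suc i) * h \<le> T" using i by (intro tT) simp
        qed (use h in \<open>auto intro!: mult_right_mono\<close>)
        then show "(K * B * e + 6 * K * e * B) * mv (real i * h) (real (Suc i) * h)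
          = (K * B * e + 6 * K * e * B) * (mv 0 (real (Suc i) * h) - mv 0 (real i * h))" by (rule arg_cong)
      qed
      also have "(\<Sum>i<Suc N. mv 0 (real (Suc i) * h) - mv 0 (real i * h)) = mv 0 T - mv 0 0"
        using sum_lessThan_telescope[of "\<lambda>i. mv 0 (real i * h)" "Suc N"] by (simp only: hT) simp
      also have "mv 0 0 = 0" by (simp add: mv_def)
      also have "(K * B * e + 6 * K * e * B) * (mv 0 T - 0) \<le> e * C"
        using e by (simp add: C_def algebra_simps)
      also have "\<dots> < r" using r C by (simp add: e_def)
      finally show "norm (Y N - 0) < r" by simp
    qed
  qed
  then show ?thesis by (simp only: Y_def[abs_def])
qed

section \<open>Second moments and Gaussian smoothing\<close>

text \<open>Bounded second moments give uniform integrability: |Y| \<le> min(|Y|, A) + Y^2 / A. The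
  truncated part tends to 0 by dominated convergence, and the tail is at most C / A \<le> r / 2 for
  the chosen level A.\<close>

lemma (in prob_space) expectation_tendsto_0_L2:
  fixes Y :: "nat \<Rightarrow> 'a \<Rightarrow> real"
  assumes int: "\<And>n. integrable M (\<lambda>\<omega>. (Y n \<omega>)\<^sup>2)" and m[measurable]: "\<And>n. Y n \<in> borel_measurable M"
    and C: "\<And>n. expectation (\<lambda>\<omega>. (Y n \<omega>)\<^sup>2) \<le> C"
    and lim: "AE \<omega> in M. (\<lambda>n. Y n \<omega>) \<longlonglongrightarrow> 0"
  shows "(\<lambda>n. expectation (Y n)) \<longlonglongrightarrow> 0"
proof (rule LIMSEQ_I)
  fix r :: real assume r: "0 < r"
  have C0: "0 \<le> C" using order_trans[OF _ C[of 0]] by (simp add: integral_nonneg_AE)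
  define A where "A = 2 * (C + 1) / r"
  have A: "0 < A" using C0 r by (simp add: A_def)
  have intY: "integrable M (Y n)" for n
    by (rule square_integrable_imp_integrable[OF m int])
  have "(\<lambda>n. expectation (\<lambda>\<omega>. min \<bar>Y n \<omega>\<bar> A)) \<longlonglongrightarrow> expectation (\<lambda>\<omega>. 0)"
  proof (rule integral_dominated_convergence)
    show "AE \<omega> in M. (\<lambda>n. min \<bar>Y n \<omega>\<bar> A) \<longlonglongrightarrow> 0"
      using lim
    proof eventually_elim
      case (elim \<omega>)
      have "(\<lambda>n. min \<bar>Y n \<omega>\<bar> A) \<longlonglongrightarrow> min \<bar>0\<bar> A" by (intro tendsto_intros elim)
      then show ?case using A by simp
    qed
    show "integrable M (\<lambda>_. A)" by simp
  qed (use A in auto)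
  then obtain N where N: "\<And>n. n \<ge> N \<Longrightarrow> \<bar>expectation (\<lambda>\<omega>. min \<bar>Y n \<omega>\<bar> A)\<bar> < r / 2"
    using LIMSEQ_D[of _ "0::real" "r/2"] r by auto
  show "\<exists>no. \<forall>n\<ge>no. norm (expectation (Y n) - 0) < r"
  proof (intro exI[of _ N] allI impI)
    fix n assume n: "N \<le> n"
    have im: "integrable M (\<lambda>\<omega>. min \<bar>Y n \<omega>\<bar> A)"
      by (rule Bochner_Integration.integrable_bound[of _ "\<lambda>_. A"]) (use A in auto)
    have "norm (expectation (Y n)) \<le> expectation (\<lambda>\<omega>. norm (Y n \<omega>))" by (rule integral_norm_bound)
    also have "\<dots> \<le> expectation (\<lambda>\<omega>. min \<bar>Y n \<omega>\<bar> A + (Y n \<omega>)\<^sup>2 / A)"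
    proof (rule integral_mono)
      show "norm (Y n \<omega>) \<le> min \<bar>Y n \<omega>\<bar> A + (Y n \<omega>)\<^sup>2 / A" for \<omega>
      proof (cases "\<bar>Y n \<omega>\<bar> \<le> A")
        case False
        then have "A * \<bar>Y n \<omega>\<bar> \<le> (Y n \<omega>)\<^sup>2"
          by (metis abs_ge_zero linear mult_right_mono power2_abs power2_eq_square)
        then have "\<bar>Y n \<omega>\<bar> \<le> (Y n \<omega>)\<^sup>2 / A" using A by (simp add: field_simps)
        then show ?thesis using A by simp
      qed (use A in simp)
    qed (use intY im int in auto)
    also have "\<dots> = expectation (\<lambda>\<omega>. min \<bar>Y n \<omega>\<bar> A) + expectation (\<lambda>\<omega>. (Y n \<omega>)\<^sup>2) / A"
      using im int by simp
    also have "\<dots> < r / 2 + r / 2"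
    proof (rule add_less_le_mono)
      show "expectation (\<lambda>\<omega>. min \<bar>Y n \<omega>\<bar> A) < r / 2" using N[OF n] by simp
      have "expectation (\<lambda>\<omega>. (Y n \<omega>)\<^sup>2) / A \<le> C / A" using C A by (intro divide_right_mono) auto
      also have "\<dots> \<le> r / 2" using C0 r by (simp add: A_def field_simps)
      finally show "expectation (\<lambda>\<omega>. (Y n \<omega>)\<^sup>2) / A \<le> r / 2" .
    qed
    finally show "norm (expectation (Y n) - 0) < r" by simp
  qed
qed

text \<open>From y \<le> exp y at y = |z|^2 / (4 h) and the exponential integral, which equals 2.
  Only the linear order in h matters later.\<close>

lemma gauss_square:
  assumes h: "0 < h"
  shows "integrable (gauss h) (\<lambda>z. (norm z)\<^sup>2)" and "(\<integral>z. (norm z)\<^sup>2 \<partial>gauss h) \<le> 8 * h"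
proof -
  have le: "(norm z)\<^sup>2 \<le> 4 * h * exp (- (- 1 / (4 * h)) * (norm (0 + z))\<^sup>2)" for z :: "real^2"
  proof -
    have "(norm z)\<^sup>2 / (4 * h) \<le> exp ((norm z)\<^sup>2 / (4 * h))"
      by (smt (verit) exp_ge_add_one_self)
    then have "4 * h * ((norm z)\<^sup>2 / (4 * h)) \<le> 4 * h * exp ((norm z)\<^sup>2 / (4 * h))"
      using h by (intro mult_left_mono) auto
    then show ?thesis using h by simp
  qed
  have int: "integrable (gauss h) (\<lambda>z. 4 * h * exp (- (- 1 / (4 * h)) * (norm (0 + z))\<^sup>2))"
    using h by (intro integrable_mult_right gauss_integrable_exp) auto
  show i: "integrable (gauss h) (\<lambda>z. (norm z)\<^sup>2)"
    by (rule Bochner_Integration.integrable_bound[OF int]) (use le h in \<open>auto simp: abs_mult\<close>)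
  have "(\<integral>z. (norm z)\<^sup>2 \<partial>gauss h) \<le> (\<integral>z. 4 * h * exp (- (- 1 / (4 * h)) * (norm (0 + z))\<^sup>2) \<partial>gauss h)"
    by (rule integral_mono[OF i int le])
  also have "\<dots> = 8 * h" using h gauss_integral_exp[of h "- 1 / (4 * h)" 0] by simp
  finally show "(\<integral>z. (norm z)\<^sup>2 \<partial>gauss h) \<le> 8 * h" .
qed

lemma gauss_linear:
  fixes f :: "real^2 \<Rightarrow> real"
  assumes h: "0 < h" and f: "linear f"
  shows "integrable (gauss h) f" and "(\<integral>z. f z \<partial>gauss h) = 0"
proof -
  interpret prob_space "gauss h" by (rule prob_space_gauss[OF h])
  have bf: "bounded_linear f" using f by (simp add: linear_conv_bounded_linear)
  have [measurable]: "f \<in> borel_measurable borel"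
    by (intro borel_measurable_continuous_onI linear_continuous_on bf)
  have "integrable (gauss h) (\<lambda>z. norm z)"
    by (rule square_integrable_imp_integrable) (use gauss_square(1)[OF h] in auto)
  then have "integrable (gauss h) (\<lambda>z. onorm f * norm z)" by simp
  then show "integrable (gauss h) f"
    by (rule Bochner_Integration.integrable_bound)
       (use onorm[OF bf] in \<open>auto simp: onorm_pos_le[OF bf] abs_mult\<close>)
  have "orthogonal_transformation (uminus :: real^2 \<Rightarrow> real^2)"
    by (simp add: orthogonal_transformation linear_uminus)
  from orthogonal_gauss_distr[OF this, of h]
  have "(\<integral>z. f z \<partial>gauss h) = (\<integral>z. f z \<partial>distr (gauss h) borel uminus)" by simp
  also have "\<dots> = (\<integral>z. f (- z) \<partial>gauss h)" by (subst integral_distr) auto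
  also have "\<dots> = - (\<integral>z. f z \<partial>gauss h)" by (simp add: linear_neg[OF f])
  finally show "(\<integral>z. f z \<partial>gauss h) = 0" by simp
qed

text \<open>For |z| \<le> 1 the square is at most |z| and the Taylor bound suffices; for |z| > 1 the
  uniform bound does. Thus a bounded function with a bounded gradient and a quadratic remainder is
  Lipschitz.\<close>

lemma abs_diff_le_of_quadratic_remainder:
  fixes v gz :: real and z :: "'a::real_normed_vector"
  assumes K: "0 \<le> K" and b: "\<bar>v\<bar> \<le> 2 * K" and t: "\<bar>v - gz\<bar> \<le> K * (norm z)\<^sup>2" and g: "\<bar>gz\<bar> \<le> K * norm z"
  shows "\<bar>v\<bar> \<le> 2 * K * norm z"
proof (cases "norm z \<le> 1")
  case True
  then have "(norm z)\<^sup>2 \<le> norm z" by (simp add: power2_eq_square mult_left_le)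
  then have "K * (norm z)\<^sup>2 \<le> K * norm z" using K by (intro mult_left_mono)
  then show ?thesis using t g by linarith
next
  case False
  then have "2 * K * 1 \<le> 2 * K * norm z" using K by (intro mult_left_mono) auto
  then show ?thesis using b by simp
qed

text \<open>The linear term has Gaussian mean 0 by symmetry, and the quadratic remainder has mean of
  order h.\<close>

lemma gauss_smoothing_error:
  fixes v :: "real^2 \<Rightarrow> real"
  assumes h: "0 < h" and [measurable]: "v \<in> borel_measurable borel" and vb: "\<And>z. \<bar>v z\<bar> \<le> K"
    and lin: "linear g" and tay: "\<And>w. \<bar>v (z + w) - v z - g w\<bar> \<le> K * (norm w)\<^sup>2"
  shows "\<bar>(\<integral>w. v (z + w) \<partial>gauss h) - v z\<bar> \<le> 8 * K * h"
proof -
  interpret prob_space "gauss h" by (rule prob_space_gauss[OF h])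
  have K: "0 \<le> K" using order_trans[OF abs_ge_zero vb] .
  have iv: "integrable (gauss h) (\<lambda>w. v (z + w))"
    by (rule Bochner_Integration.integrable_bound[of _ "\<lambda>_. K"]) (use vb K in auto)
  have "(\<integral>w. v (z + w) \<partial>gauss h) - v z = (\<integral>w. v (z + w) - v z - g w \<partial>gauss h)"
    using iv gauss_linear[OF h lin] prob_space by simp
  also have "\<bar>\<dots>\<bar> \<le> (\<integral>w. K * (norm w)\<^sup>2 \<partial>gauss h)"
    unfolding real_norm_def[symmetric]
  proof (rule order_trans[OF integral_norm_bound integral_mono])
    show "integrable (gauss h) (\<lambda>w. norm (v (z + w) - v z - g w))"
      using iv gauss_linear(1)[OF h lin] by (intro integrable_norm Bochner_Integration.integrable_diff) auto
    show "integrable (gauss h) (\<lambda>w. K * (norm w)\<^sup>2)" using gauss_square(1)[OF h] by simp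
  qed (use tay in auto)
  also have "\<dots> \<le> K * (8 * h)"
    using gauss_square(2)[OF h] K by (simp add: mult_left_mono)
  finally show ?thesis by simp
qed

text \<open>Pythagoras for martingale differences: each new term is orthogonal to the sum of its
  predecessors, so the mixed term vanishes at every step of the induction.\<close>

lemma (in prob_space) expectation_square_orthogonal_sum:
  fixes Z :: "nat \<Rightarrow> 'a \<Rightarrow> real"
  assumes m[measurable]: "\<And>i. i < n \<Longrightarrow> Z i \<in> borel_measurable M"
    and b: "\<And>i \<omega>. i < n \<Longrightarrow> \<omega> \<in> space M \<Longrightarrow> \<bar>Z i \<omega>\<bar> \<le> B"
    and orth: "\<And>i. i < n \<Longrightarrow> expectation (\<lambda>\<omega>. (\<Sum>j<i. Z j \<omega>) * Z i \<omega>) = 0"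
    and sq: "\<And>i. i < n \<Longrightarrow> expectation (\<lambda>\<omega>. (Z i \<omega>)\<^sup>2) \<le> c"
  shows "expectation (\<lambda>\<omega>. (\<Sum>i<n. Z i \<omega>)\<^sup>2) \<le> real n * c"
proof -
  have "k \<le> n \<Longrightarrow> expectation (\<lambda>\<omega>. (\<Sum>i<k. Z i \<omega>)\<^sup>2) \<le> real k * c" for k
  proof (induction k)
    case (Suc k)
    have k: "k < n" using Suc by simp
    have mS[measurable]: "(\<lambda>\<omega>. \<Sum>i<k. Z i \<omega>) \<in> borel_measurable M"
      using k by (intro borel_measurable_sum m) auto
    have mZ[measurable]: "Z k \<in> borel_measurable M" using k by (rule m)
    have bS: "\<bar>\<Sum>i<k. Z i \<omega>\<bar> \<le> real k * B" if "\<omega> \<in> space M" for \<omega>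
      using order_trans[OF sum_abs sum_bounded_above[of "{..<k}" "\<lambda>i. \<bar>Z i \<omega>\<bar>" B]] b k that by auto
    have bd: "integrable M f" if "f \<in> borel_measurable M" "\<And>\<omega>. \<omega> \<in> space M \<Longrightarrow> \<bar>f \<omega>\<bar> \<le> C" for f :: "'a \<Rightarrow> real" and C
      using that by (intro integrable_const_bound[where B=C]) auto
    have 1: "integrable M (\<lambda>\<omega>. (\<Sum>i<k. Z i \<omega>)\<^sup>2)"
      using bS by (intro bd[of _ "(real k * B)\<^sup>2"]) (auto simp: abs_le_square_iff[symmetric] intro: order_trans[OF _ abs_ge_self])
    have 2: "integrable M (\<lambda>\<omega>. (\<Sum>i<k. Z i \<omega>) * Z k \<omega>)"
      using bS b[OF k] by (intro bd[of _ "real k * B * B"]) (auto simp: abs_mult intro!: mult_mono intro: order_trans[OF abs_ge_zero])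
    have 3: "integrable M (\<lambda>\<omega>. (Z k \<omega>)\<^sup>2)"
      using b[OF k] by (intro bd[of _ "B\<^sup>2"]) (auto simp: abs_le_square_iff[symmetric] intro: order_trans[OF _ abs_ge_self])
    have "expectation (\<lambda>\<omega>. (\<Sum>i<Suc k. Z i \<omega>)\<^sup>2)
      = expectation (\<lambda>\<omega>. (\<Sum>i<k. Z i \<omega>)\<^sup>2 + 2 * ((\<Sum>i<k. Z i \<omega>) * Z k \<omega>) + (Z k \<omega>)\<^sup>2)"
      by (simp add: power2_sum algebra_simps)
    also have "\<dots> = expectation (\<lambda>\<omega>. (\<Sum>i<k. Z i \<omega>)\<^sup>2) + 2 * expectation (\<lambda>\<omega>. (\<Sum>i<k. Z i \<omega>) * Z k \<omega>) + expectation (\<lambda>\<omega>. (Z k \<omega>)\<^sup>2)"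
      using 1 2 3 by simp
    also have "\<dots> \<le> real k * c + 0 + c"
      using Suc.IH k sq[OF k] orth[OF k] by simp
    finally show ?case by (simp add: algebra_simps)
  qed simp
  then show ?thesis by simp
qed

section \<open>Increments of the driving Brownian motion and the discrete Ito formula\<close>

locale wedge_rbm = normally_reflected_brownian_motion M F W x "wedge \<alpha>" n X L
  for M :: "'a measure" and F :: "real \<Rightarrow> 'a measure" and W :: "real \<Rightarrow> 'a \<Rightarrow> real^2"
    and x :: "real^2" and \<alpha> :: real and n :: "real^2 \<Rightarrow> real^2" and X L :: "real \<Rightarrow> 'a \<Rightarrow> real^2" +
  assumes \<alpha>: "0 < \<alpha>" "\<alpha> < 2 * pi"
begin

lemma measurable_F_M: "0 \<le> t \<Longrightarrow> f \<in> F t \<rightarrow>\<^sub>M N \<Longrightarrow> f \<in> M \<rightarrow>\<^sub>M N"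
  using measurable_from_subalg[OF subalgebra_F] .

lemma measurable_F_mono: "0 \<le> s \<Longrightarrow> s \<le> t \<Longrightarrow> f \<in> F s \<rightarrow>\<^sub>M N \<Longrightarrow> f \<in> F t \<rightarrow>\<^sub>M N"
  using measurable_from_subalg[of "F t" "F s"] sets_F_mono[of s t] space_F by (simp add: subalgebra_def)

lemma adapted_X: "0 \<le> t \<Longrightarrow> X t \<in> borel_measurable (F t)"
proof -
  assume t: "0 \<le> t"
  have "(\<lambda>\<omega>. W t \<omega> + L t \<omega>) \<in> borel_measurable (F t)"
    using adapted_W[OF t] adapted_L[OF t] by measurable
  then show ?thesis
    by (rule measurable_cong[THEN iffD1, rotated]) (simp add: X_eq[OF t] space_F)
qed

lemma measurable_X[measurable]: "0 \<le> t \<Longrightarrow> X t \<in> borel_measurable M"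
  and measurable_W[measurable]: "0 \<le> t \<Longrightarrow> W t \<in> borel_measurable M"
  and measurable_L[measurable]: "0 \<le> t \<Longrightarrow> L t \<in> borel_measurable M"
  using measurable_F_M adapted_X adapted_W adapted_L by blast+

lemma AE_X0: "AE \<omega> in M. X 0 \<omega> = x"
  using start_W start_L AE_space by eventually_elim (simp add: X_eq)

text \<open>Independence of the increment from \<open>F s\<close> gives the product formula on
  measurable rectangles, which determine the joint law.\<close>

lemma increment_law:
  assumes st: "0 \<le> s" "s < t" and Z: "Z \<in> F s \<rightarrow>\<^sub>M N"
  shows "distr M (N \<Otimes>\<^sub>M borel) (\<lambda>\<omega>. (Z \<omega>, W t \<omega> - W s \<omega>)) = distr M N Z \<Otimes>\<^sub>M gauss (t - s)"
proof -
  have Zm: "Z \<in> M \<rightarrow>\<^sub>M N" using Z st by (intro measurable_F_M)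
  have Wm: "(\<lambda>\<omega>. W t \<omega> - W s \<omega>) \<in> borel_measurable M"
    using st measurable_W[of s] measurable_W[of t] by simp
  have "distr M borel (\<lambda>\<omega>. W t \<omega> - W s \<omega>) = distr M lborel (\<lambda>\<omega>. W t \<omega> - W s \<omega>)"
    by (rule distr_cong) auto
  also have "\<dots> = gauss (t - s)"
    using gaussian_increments[OF st] st unfolding distributed_def
    by (simp add: gauss_def prod_normal_density_eq_gauss_density)
  finally have g: "gauss (t - s) = distr M borel (\<lambda>\<omega>. W t \<omega> - W s \<omega>)" ..
  interpret D: prob_space "distr M N Z" by (rule prob_space_distr[OF Zm])
  interpret G: prob_space "gauss (t - s)" using st by (intro prob_space_gauss) simp
  have pm: "(\<lambda>\<omega>. (Z \<omega>, W t \<omega> - W s \<omega>)) \<in> M \<rightarrow>\<^sub>M N \<Otimes>\<^sub>M borel" using Zm Wm by measurable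
  show ?thesis
  proof (rule pair_measure_eqI[symmetric])
    show "sigma_finite_measure (distr M N Z)" "sigma_finite_measure (gauss (t - s))" by unfold_locales
    show "sets (distr M N Z \<Otimes>\<^sub>M gauss (t - s)) = sets (distr M (N \<Otimes>\<^sub>M borel) (\<lambda>\<omega>. (Z \<omega>, W t \<omega> - W s \<omega>)))"
      by (simp cong: sets_pair_measure_cong)
    fix A B assume A: "A \<in> sets (distr M N Z)" and B: "B \<in> sets (gauss (t - s))"
    have "Z -` A \<inter> space M \<in> sets (F s)" using measurable_sets[OF Z, of A] A by (simp add: space_F)
    moreover have "(\<lambda>\<omega>. W t \<omega> - W s \<omega>) -` B \<inter> space M \<in> {(\<lambda>\<omega>. W t \<omega> - W s \<omega>) -` A \<inter> space M | A. A \<in> sets borel}"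
      using B by auto
    ultimately have "prob ((Z -` A \<inter> space M) \<inter> ((\<lambda>\<omega>. W t \<omega> - W s \<omega>) -` B \<inter> space M))
       = prob (Z -` A \<inter> space M) * prob ((\<lambda>\<omega>. W t \<omega> - W s \<omega>) -` B \<inter> space M)"
      by (rule indep_setD[OF indep_increments[OF st]])
    moreover have "(Z -` A \<inter> space M) \<inter> ((\<lambda>\<omega>. W t \<omega> - W s \<omega>) -` B \<inter> space M)
       = (\<lambda>\<omega>. (Z \<omega>, W t \<omega> - W s \<omega>)) -` (A \<times> B) \<inter> space M" by auto
    ultimately show "emeasure (distr M N Z) A * emeasure (gauss (t - s)) B
      = emeasure (distr M (N \<Otimes>\<^sub>M borel) (\<lambda>\<omega>. (Z \<omega>, W t \<omega> - W s \<omega>))) (A \<times> B)"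
      using A B Zm Wm pm unfolding g
      by (simp add: emeasure_distr emeasure_eq_measure ennreal_mult')
  qed
qed

lemma increment_square:
  assumes st: "0 \<le> s" "s < t"
  shows "integrable M (\<lambda>\<omega>. (norm (W t \<omega> - W s \<omega>))\<^sup>2)"
    and "expectation (\<lambda>\<omega>. (norm (W t \<omega> - W s \<omega>))\<^sup>2) \<le> 8 * (t - s)"
proof -
  have Wm[measurable]: "(\<lambda>\<omega>. W t \<omega> - W s \<omega>) \<in> borel_measurable M"
    using st measurable_W[of s] measurable_W[of t] by simp
  have "distr M borel (\<lambda>\<omega>. W t \<omega> - W s \<omega>) = distr M lborel (\<lambda>\<omega>. W t \<omega> - W s \<omega>)"
    by (rule distr_cong) auto
  also have "\<dots> = gauss (t - s)"
    using gaussian_increments[OF st] st unfolding distributed_def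
    by (simp add: gauss_def prod_normal_density_eq_gauss_density)
  finally have d: "gauss (t - s) = distr M borel (\<lambda>\<omega>. W t \<omega> - W s \<omega>)" ..
  show "integrable M (\<lambda>\<omega>. (norm (W t \<omega> - W s \<omega>))\<^sup>2)"
    using gauss_square(1)[of "t - s"] st unfolding d by (simp add: integrable_distr_eq)
  show "expectation (\<lambda>\<omega>. (norm (W t \<omega> - W s \<omega>))\<^sup>2) \<le> 8 * (t - s)"
    using gauss_square(2)[of "t - s"] st unfolding d by (simp add: integral_distr)
qed

text \<open>The inner Gaussian integral is the conditional expectation given \<open>F s\<close>; by
  the product law of (H, X_s) and the increment, Fubini integrates the increment first. The weight H
  is later 1, for the mean, and a sum of earlier increments, for orthogonality.\<close>

lemma martingale_increment:
  fixes v :: "real^2 \<Rightarrow> real"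
  assumes st: "0 \<le> s" "s < t" and H: "H \<in> borel_measurable (F s)" and Hb: "\<And>\<omega>. \<omega> \<in> space M \<Longrightarrow> \<bar>H \<omega>\<bar> \<le> B"
    and v[measurable]: "v \<in> borel_measurable borel" and vb: "\<And>z. \<bar>v z\<bar> \<le> K"
  shows "expectation (\<lambda>\<omega>. H \<omega> * (v (X s \<omega> + (W t \<omega> - W s \<omega>)) - (\<integral>z. v (X s \<omega> + z) \<partial>gauss (t - s)))) = 0"
proof -
  have K: "0 \<le> K" using order_trans[OF abs_ge_zero vb] .
  interpret G: prob_space "gauss (t - s)" using st by (intro prob_space_gauss) simp
  define \<Phi> where "\<Phi> y = (\<integral>z. v (y + z) \<partial>gauss (t - s))" for y
  have \<Phi>m[measurable]: "\<Phi> \<in> borel_measurable borel" unfolding \<Phi>_def[abs_def] by measurable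
  have iv: "integrable (gauss (t - s)) (\<lambda>z. v (y + z))" for y
    by (rule G.integrable_const_bound[where B=K]) (use vb in auto)
  have \<Phi>b: "\<bar>\<Phi> y\<bar> \<le> K" for y
  proof -
    have "\<bar>\<Phi> y\<bar> \<le> (\<integral>z. \<bar>v (y + z)\<bar> \<partial>gauss (t - s))"
      unfolding \<Phi>_def by (rule integral_abs_bound)
    also have "\<dots> \<le> (\<integral>z. K \<partial>gauss (t - s))"
      using iv vb by (intro integral_mono) auto
    finally show ?thesis using G.prob_space by simp
  qed
  define Z where "Z \<omega> = (H \<omega>, X s \<omega>)" for \<omega>
  have Z: "Z \<in> F s \<rightarrow>\<^sub>M borel \<Otimes>\<^sub>M borel" unfolding Z_def[abs_def] using H adapted_X[OF st(1)] by measurable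
  have Zm: "Z \<in> M \<rightarrow>\<^sub>M borel \<Otimes>\<^sub>M borel" using Z st by (intro measurable_F_M)
  have Wm[measurable]: "(\<lambda>\<omega>. W t \<omega> - W s \<omega>) \<in> borel_measurable M"
    using st measurable_W[of s] measurable_W[of t] by simp
  interpret D: prob_space "distr M (borel \<Otimes>\<^sub>M borel) Z" by (rule prob_space_distr[OF Zm])
  interpret P: pair_prob_space "distr M (borel \<Otimes>\<^sub>M borel) Z" "gauss (t - s)" ..
  define f where "f p = fst (fst p) * (v (snd (fst p) + snd p) - \<Phi> (snd (fst p)))" for p :: "(real \<times> (real^2)) \<times> (real^2)"
  have fm[measurable]: "f \<in> borel_measurable ((borel \<Otimes>\<^sub>M borel) \<Otimes>\<^sub>M borel)" unfolding f_def[abs_def] by measurable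
  have jm: "(\<lambda>\<omega>. (Z \<omega>, W t \<omega> - W s \<omega>)) \<in> M \<rightarrow>\<^sub>M (borel \<Otimes>\<^sub>M borel) \<Otimes>\<^sub>M borel" using Zm by measurable
  have Hm: "H \<in> borel_measurable M" using H st by (intro measurable_F_M)
  have Xm: "X s \<in> borel_measurable M" using st by measurable
  have int: "integrable M (\<lambda>\<omega>. f (Z \<omega>, W t \<omega> - W s \<omega>))"
  proof (rule integrable_const_bound[where B="B * (2 * K)"])
    show "AE \<omega> in M. norm (f (Z \<omega>, W t \<omega> - W s \<omega>)) \<le> B * (2 * K)"
    proof (rule AE_I2)
      fix \<omega> assume \<omega>: "\<omega> \<in> space M"
      have "\<bar>v (X s \<omega> + (W t \<omega> - W s \<omega>)) - \<Phi> (X s \<omega>)\<bar> \<le> 2 * K"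
        using vb[of "X s \<omega> + (W t \<omega> - W s \<omega>)"] \<Phi>b[of "X s \<omega>"] by linarith
      then show "norm (f (Z \<omega>, W t \<omega> - W s \<omega>)) \<le> B * (2 * K)"
        using Hb[OF \<omega>] K by (auto simp: f_def Z_def abs_mult intro!: mult_mono intro: order_trans[OF abs_ge_zero])
    qed
    show "(\<lambda>\<omega>. f (Z \<omega>, W t \<omega> - W s \<omega>)) \<in> borel_measurable M"
      by (rule measurable_compose[OF jm fm])
  qed
  have law: "distr M ((borel \<Otimes>\<^sub>M borel) \<Otimes>\<^sub>M borel) (\<lambda>\<omega>. (Z \<omega>, W t \<omega> - W s \<omega>)) = distr M (borel \<Otimes>\<^sub>M borel) Z \<Otimes>\<^sub>M gauss (t - s)"
    by (rule increment_law[OF st Z])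
  have fm': "f \<in> borel_measurable (distr M (borel \<Otimes>\<^sub>M borel) Z \<Otimes>\<^sub>M gauss (t - s))"
    using fm unfolding law[symmetric] by simp
  have int': "integrable (distr M (borel \<Otimes>\<^sub>M borel) Z \<Otimes>\<^sub>M gauss (t - s)) f"
    unfolding law[symmetric] using int by (subst integrable_distr_eq[OF jm fm])
  have "expectation (\<lambda>\<omega>. f (Z \<omega>, W t \<omega> - W s \<omega>)) = (\<integral>p. f p \<partial>(distr M (borel \<Otimes>\<^sub>M borel) Z \<Otimes>\<^sub>M gauss (t - s)))"
    unfolding law[symmetric] by (rule integral_distr[OF jm fm, symmetric])
  also have "\<dots> = (\<integral>b. (\<integral>z. f (b, z) \<partial>gauss (t - s)) \<partial>distr M (borel \<Otimes>\<^sub>M borel) Z)"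
    by (rule P.integral_fst'[OF int', symmetric])
  also have "\<dots> = (\<integral>b. 0 \<partial>distr M (borel \<Otimes>\<^sub>M borel) Z)"
  proof (rule Bochner_Integration.integral_cong[OF refl])
    fix b :: "real \<times> (real^2)"
    obtain a y where b: "b = (a, y)" by fastforce
    have "(\<integral>z. v (y + z) - \<Phi> y \<partial>gauss (t - s)) = 0"
      using iv[of y] G.prob_space by (simp add: \<Phi>_def[symmetric])
    then show "(\<integral>z. f (b, z) \<partial>gauss (t - s)) = 0" by (simp add: f_def b)
  qed
  finally show ?thesis by (simp add: f_def Z_def \<Phi>_def)
qed

end

context wedge_rbm
begin

definition reflection_field :: "real^2 \<Rightarrow> real^2" where
  "reflection_field z = indicator (frontier (wedge \<alpha>)) z *\<^sub>R n z"

lemma normal_on_rays: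
  assumes "0 < r"
  shows "n (polar r 0) = vector [0, 1]" "n (polar r \<alpha>) = vector [sin \<alpha>, - cos \<alpha>]"
  using normal inward_unit_normal_wedge[OF \<alpha> assms] by blast+

text \<open>Off the vertex the field is a unit normal or 0; at the vertex n is an arbitrary but
  fixed vector, which enters only through its norm.\<close>

lemma norm_reflection_field_le: "norm (reflection_field z) \<le> max 1 (norm (n 0))"
proof (cases "z \<in> frontier (wedge \<alpha>)")
  case True
  then obtain r where r: "0 \<le> r" "z = polar r 0 \<or> z = polar r \<alpha>"
    using frontier_wedge[OF \<alpha>] by blast
  show ?thesis
  proof (cases "r = 0")
    case True
    then have "z = 0" using r by (auto simp: polar_def vec_eq_iff forall_2)
    then show ?thesis by (auto simp: reflection_field_def indicator_def)
  next
    case False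
    then have "inward_unit_normal (wedge \<alpha>) z (n z)"
      using r inward_unit_normal_wedge[OF \<alpha>, of r] normal_on_rays[of r] by auto
    then have "norm (n z) = 1" by (simp add: inward_unit_normal_def)
    then show ?thesis by (simp add: reflection_field_def indicator_def le_max_iff_disj)
  qed
qed (simp add: reflection_field_def)

text \<open>Nothing is assumed about measurability of n, but its values are forced on the two open
  sides, each carrying a constant normal, and a single point remains.\<close>

lemma borel_measurable_reflection_field[measurable]: "reflection_field \<in> borel_measurable borel"
proof -
  have f[measurable]: "frontier (wedge \<alpha>) \<in> sets borel" by simp
  have e: "reflection_field = (\<lambda>z. if z = 0 then reflection_field 0 else if z \<in> frontier (wedge \<alpha>) then
      (if z $ 2 = 0 \<and> 0 \<le> z $ 1 then vector [0, 1] else vector [sin \<alpha>, - cos \<alpha>]) else 0)"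
  proof
    fix z
    show "reflection_field z = (if z = 0 then reflection_field 0 else if z \<in> frontier (wedge \<alpha>) then
      (if z $ 2 = 0 \<and> 0 \<le> z $ 1 then vector [0, 1] else vector [sin \<alpha>, - cos \<alpha>]) else 0)"
    proof (cases "z \<in> frontier (wedge \<alpha>) \<and> z \<noteq> 0")
      case True
      then obtain r where r: "0 \<le> r" "z = polar r 0 \<or> z = polar r \<alpha>"
        using frontier_wedge[OF \<alpha>] by blast
      have "r \<noteq> 0" using True r by (auto simp: polar_def vec_eq_iff forall_2)
      then have rp: "0 < r" using r by simp
      \<comment> \<open>The test that recognises the first side must fail on the second one: within
        (0, 2 pi), sin \<alpha> = 0 forces \<alpha> = pi, where the cosine is negative.\<close>
      have "\<not> (polar r \<alpha> $ 2 = 0 \<and> 0 \<le> polar r \<alpha> $ 1)"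
      proof
        assume a: "polar r \<alpha> $ 2 = 0 \<and> 0 \<le> polar r \<alpha> $ 1"
        then have s0: "sin \<alpha> = 0" and c0: "0 \<le> cos \<alpha>" using rp by (auto simp: polar_def zero_le_mult_iff)
        have "\<alpha> = pi"
          using s0 sin_gt_zero[of \<alpha>] sin_lt_zero[of \<alpha>] \<alpha> by linarith
        then show False using c0 by simp
      qed
      moreover have "polar r 0 $ 2 = 0" "0 \<le> polar r 0 $ 1" using rp by (auto simp: polar_def)
      ultimately show ?thesis
        using True r(2) normal_on_rays[OF rp] by (auto simp: reflection_field_def)
    qed (auto simp: reflection_field_def)
  qed
  show ?thesis by (subst e) measurable
qed

lemma AE_path:
  "AE \<omega> in M. continuous_on {0..} (\<lambda>t. X t \<omega>) \<and> continuous_on {0..} (\<lambda>t. L t \<omega>) \<and> (\<forall>t\<ge>0. X t \<omega> \<in> wedge \<alpha>) \<and>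
    (\<forall>t\<ge>0. L t \<omega> = (LINT s:{0..t}|variation_measure (\<lambda>s. L s \<omega>). reflection_field (X s \<omega>)))"
  using continuous_W continuous_L X_in reflection AE_space
proof eventually_elim
  case (elim \<omega>)
  have "continuous_on {0..} (\<lambda>t. W t \<omega> + L t \<omega>)" using elim by (intro continuous_intros)
  then have "continuous_on {0..} (\<lambda>t. X t \<omega>)"
    by (rule continuous_on_eq) (use elim X_eq in auto)
  then show ?case using elim by (simp add: reflection_field_def)
qed

lemma AE_in_wedge: "0 \<le> t \<Longrightarrow> AE \<omega> in M. X t \<omega> \<in> wedge \<alpha>"
  using X_in by eventually_elim simp

text \<open>For a bounded function that has a uniform quadratic Taylor remainder at points of the
  wedge, is Lipschitz in time and satisfies the Neumann condition. Since X_t - (L_t - L_s) = X_s +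
  (W_t - W_s), each increment of u(s, X_s) splits into a reflection part, a martingale increment
  \<open>Mi\<close> and the drift \<open>Gi\<close> of one Gaussian step. The martingale parts have
  mean 0 and the reflection parts vanish in the limit, so the expected drifts alone account for the
  difference between time T and time 0. For functions close to a heat solution these drifts can be
  computed.\<close>

lemma discrete_ito:
  fixes u :: "real \<Rightarrow> real^2 \<Rightarrow> real" and g :: "real \<Rightarrow> real^2 \<Rightarrow> real^2 \<Rightarrow> real"
  assumes T: "0 < T"
    and um[measurable]: "\<And>s. u s \<in> borel_measurable borel"
    and ub: "\<And>s z. 0 \<le> s \<Longrightarrow> s \<le> T \<Longrightarrow> \<bar>u s z\<bar> \<le> K"
    and lin: "\<And>s z. 0 \<le> s \<Longrightarrow> s \<le> T \<Longrightarrow> z \<in> wedge \<alpha> \<Longrightarrow> linear (g s z)"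
    and gb: "\<And>s z w. 0 \<le> s \<Longrightarrow> s \<le> T \<Longrightarrow> z \<in> wedge \<alpha> \<Longrightarrow> \<bar>g s z w\<bar> \<le> K * norm w"
    and tay: "\<And>s z w. 0 \<le> s \<Longrightarrow> s \<le> T \<Longrightarrow> z \<in> wedge \<alpha> \<Longrightarrow> \<bar>u s (z + w) - u s z - g s z w\<bar> \<le> K * (norm w)\<^sup>2"
    and time: "\<And>s t z. 0 \<le> s \<Longrightarrow> s \<le> t \<Longrightarrow> t \<le> T \<Longrightarrow> z \<in> wedge \<alpha> \<Longrightarrow> \<bar>u t z - u s z\<bar> \<le> K * (t - s)"
    and gn: "\<And>s z. 0 \<le> s \<Longrightarrow> s \<le> T \<Longrightarrow> z \<in> frontier (wedge \<alpha>) \<Longrightarrow> g s z (n z) = 0"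
  shows "(\<lambda>N. \<Sum>i<Suc N. expectation (\<lambda>\<omega>.
      (\<integral>z. u (real (Suc i) * (T / real (Suc N))) (X (real i * (T / real (Suc N))) \<omega> + z) \<partial>gauss (T / real (Suc N)))
       - u (real i * (T / real (Suc N))) (X (real i * (T / real (Suc N))) \<omega>)))
     \<longlonglongrightarrow> expectation (\<lambda>\<omega>. u T (X T \<omega>)) - u 0 x"
proof -
  have K: "0 \<le> K" using order_trans[OF abs_ge_zero ub[of 0]] T by simp
  define h where "h N = T / real (Suc N)" for N
  define tt where "tt N i = real i * h N" for N i
  have h: "0 < h N" for N using T by (simp add: h_def)
  have hT: "real (Suc N) * h N = T" for N by (simp add: h_def)
  have tt0: "0 \<le> tt N i" for N i using h[of N] by (simp add: tt_def)
  have tts: "tt N (Suc i) = tt N i + h N" for N i by (simp add: tt_def algebra_simps)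
  have ttT: "tt N i \<le> T" if "i \<le> Suc N" for N i
  proof -
    have "real i * h N \<le> real (Suc N) * h N" using that h[of N] by (intro mult_right_mono) auto
    then show ?thesis by (simp only: hT tt_def)
  qed
  define \<Phi> where "\<Phi> N i y = (\<integral>z. u (tt N (Suc i)) (y + z) \<partial>gauss (h N))" for N i y
  have \<Phi>m[measurable]: "\<Phi> N i \<in> borel_measurable borel" for N i
  proof -
    interpret G: prob_space "gauss (h N)" by (rule prob_space_gauss[OF h])
    show ?thesis unfolding \<Phi>_def[abs_def] by measurable
  qed
  have \<Phi>b: "\<bar>\<Phi> N i y\<bar> \<le> K" if "i < Suc N" for N i y
  proof -
    interpret G: prob_space "gauss (h N)" by (rule prob_space_gauss[OF h])
    have b: "\<bar>u (tt N (Suc i)) z\<bar> \<le> K" for z using that by (intro ub tt0 ttT) auto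
    have iv: "integrable (gauss (h N)) (\<lambda>z. u (tt N (Suc i)) (y + z))"
      by (rule G.integrable_const_bound[where B=K]) (use b in auto)
    have "\<bar>\<Phi> N i y\<bar> \<le> (\<integral>z. \<bar>u (tt N (Suc i)) (y + z)\<bar> \<partial>gauss (h N))"
      unfolding \<Phi>_def by (rule integral_abs_bound)
    also have "\<dots> \<le> (\<integral>z. K \<partial>gauss (h N))" using iv b by (intro integral_mono) auto
    finally show ?thesis using G.prob_space by simp
  qed
  have \<Phi>u: "\<bar>\<Phi> N i y - u (tt N (Suc i)) y\<bar> \<le> 8 * K * h N" if "i < Suc N" "y \<in> wedge \<alpha>" for N i y
    unfolding \<Phi>_def
    by (rule gauss_smoothing_error[OF h um, where g = "g (tt N (Suc i)) y"])
       (use that in \<open>auto intro!: ub lin tay tt0 ttT\<close>)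
  \<comment> \<open>\<open>Mi\<close> compares u after a free Brownian step with its conditional
    mean; \<open>Gi\<close> compares that conditional mean with the value before the step.\<close>
  define Mi where "Mi N i \<omega> = u (tt N (Suc i)) (X (tt N i) \<omega> + (W (tt N (Suc i)) \<omega> - W (tt N i) \<omega>)) - \<Phi> N i (X (tt N i) \<omega>)" for N i \<omega>
  define Gi where "Gi N i \<omega> = \<Phi> N i (X (tt N i) \<omega>) - u (tt N i) (X (tt N i) \<omega>)" for N i \<omega>
  define Y where "Y N \<omega> = (\<Sum>i<Suc N. u (tt N (Suc i)) (X (tt N (Suc i)) \<omega>)
      - u (tt N (Suc i)) (X (tt N (Suc i)) \<omega> - (L (tt N (Suc i)) \<omega> - L (tt N i) \<omega>)))" for N \<omega>
  have Xm[measurable]: "X (tt N i) \<in> borel_measurable M" and Wm[measurable]: "W (tt N i) \<in> borel_measurable M"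
    and Lm[measurable]: "L (tt N i) \<in> borel_measurable M" for N i
    using measurable_X measurable_W measurable_L tt0 by auto
  have XTm[measurable]: "X T \<in> borel_measurable M" "X 0 \<in> borel_measurable M" using measurable_X T by auto
  have MiF: "Mi N i \<in> borel_measurable (F (tt N (Suc i)))" for N i
  proof -
    have le: "tt N i \<le> tt N (Suc i)" using tts[of N i] h[of N] by simp
    have [measurable]: "X (tt N i) \<in> borel_measurable (F (tt N (Suc i)))"
      "W (tt N i) \<in> borel_measurable (F (tt N (Suc i)))" "W (tt N (Suc i)) \<in> borel_measurable (F (tt N (Suc i)))"
      by (auto intro: measurable_F_mono[OF tt0 le] adapted_X[OF tt0] adapted_W[OF tt0])
    show ?thesis unfolding Mi_def[abs_def] by measurable
  qed
  have Mim[measurable]: "Mi N i \<in> borel_measurable M" for N i unfolding Mi_def[abs_def] by measurable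
  have Gim[measurable]: "Gi N i \<in> borel_measurable M" for N i unfolding Gi_def[abs_def] by measurable
  have Mib: "\<bar>Mi N i \<omega>\<bar> \<le> 2 * K" if "i < Suc N" for N i \<omega>
  proof -
    have "\<bar>u (tt N (Suc i)) z\<bar> \<le> K" for z using that by (intro ub tt0 ttT) auto
    from this[of "X (tt N i) \<omega> + (W (tt N (Suc i)) \<omega> - W (tt N i) \<omega>)"] \<Phi>b[OF that, of "X (tt N i) \<omega>"]
    show ?thesis unfolding Mi_def by linarith
  qed
  have mart: "expectation (\<lambda>\<omega>. H \<omega> * Mi N i \<omega>) = 0"
    if "i < Suc N" "H \<in> borel_measurable (F (tt N i))" "\<And>\<omega>. \<omega> \<in> space M \<Longrightarrow> \<bar>H \<omega>\<bar> \<le> B" for H B N i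
  proof -
    have d: "tt N (Suc i) - tt N i = h N" by (simp add: tts)
    have b: "\<bar>u (tt N (Suc i)) z\<bar> \<le> K" for z using that by (intro ub tt0 ttT) auto
    show ?thesis
      using martingale_increment[OF tt0 _ that(2,3) um b, of "tt N (Suc i)"] h[of N]
      by (simp add: d Mi_def \<Phi>_def) (simp add: tts)
  qed
  have orth: "expectation (\<lambda>\<omega>. (\<Sum>j<i. Mi N j \<omega>) * Mi N i \<omega>) = 0" if i: "i < Suc N" for N i
  proof (rule mart[OF i])
    show "(\<lambda>\<omega>. \<Sum>j<i. Mi N j \<omega>) \<in> borel_measurable (F (tt N i))"
    proof (rule borel_measurable_sum)
      fix j assume "j \<in> {..<i}"
      then have "tt N (Suc j) \<le> tt N i" using h[of N] by (auto simp: tt_def intro!: mult_right_mono)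
      then show "Mi N j \<in> borel_measurable (F (tt N i))" using MiF by (rule measurable_F_mono[OF tt0])
    qed
    show "\<bar>\<Sum>j<i. Mi N j \<omega>\<bar> \<le> real i * (2 * K)" for \<omega>
      using order_trans[OF sum_abs sum_bounded_above[of "{..<i}" "\<lambda>j. \<bar>Mi N j \<omega>\<bar>" "2 * K"]] Mib i by auto
  qed
  \<comment> \<open>The martingale increment is a difference of two terms: one at most 2 K |d|, the
    other with square at most 16 K^2 h, being bounded both by 8 K h and by 2 K. With the second
    moment of d at most 8 h, the sum is 64 + 32 = 96.\<close>
  have sqM: "expectation (\<lambda>\<omega>. (Mi N i \<omega>)\<^sup>2) \<le> 96 * K\<^sup>2 * h N" if i: "i < Suc N" for N i
  proof -
    define d where "d \<omega> = W (tt N (Suc i)) \<omega> - W (tt N i) \<omega>" for \<omega>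
    have dm[measurable]: "d \<in> borel_measurable M" unfolding d_def[abs_def] by measurable
    have di: "integrable M (\<lambda>\<omega>. (norm (d \<omega>))\<^sup>2)" "expectation (\<lambda>\<omega>. (norm (d \<omega>))\<^sup>2) \<le> 8 * h N"
      using increment_square[OF tt0, of N i "tt N (Suc i)"] h[of N] by (auto simp: d_def tts)
    have "expectation (\<lambda>\<omega>. (Mi N i \<omega>)\<^sup>2) \<le> expectation (\<lambda>\<omega>. 8 * K\<^sup>2 * (norm (d \<omega>))\<^sup>2 + 32 * K\<^sup>2 * h N)"
    proof (rule integral_mono_AE)
      show "integrable M (\<lambda>\<omega>. (Mi N i \<omega>)\<^sup>2)"
      proof (rule integrable_const_bound[where B="(2 * K)\<^sup>2"])
        show "AE \<omega> in M. norm ((Mi N i \<omega>)\<^sup>2) \<le> (2 * K)\<^sup>2"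
          using abs_le_square_iff[of "Mi N i _" "2 * K"] Mib[OF i] K by (intro AE_I2) simp
      qed measurable
      show "integrable M (\<lambda>\<omega>. 8 * K\<^sup>2 * (norm (d \<omega>))\<^sup>2 + 32 * K\<^sup>2 * h N)" using di by simp
      show "AE \<omega> in M. (Mi N i \<omega>)\<^sup>2 \<le> 8 * K\<^sup>2 * (norm (d \<omega>))\<^sup>2 + 32 * K\<^sup>2 * h N"
        using AE_in_wedge[OF tt0, of N i]
      proof eventually_elim
        case (elim \<omega>)
        let ?u = "u (tt N (Suc i))" and ?x = "X (tt N i) \<omega>"
        have ub': "\<bar>?u z\<bar> \<le> K" for z using i by (intro ub tt0 ttT) auto
        have a: "\<bar>?u (?x + d \<omega>) - ?u ?x\<bar> \<le> 2 * K * norm (d \<omega>)"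
        proof (rule abs_diff_le_of_quadratic_remainder[OF K])
          show "\<bar>?u (?x + d \<omega>) - ?u ?x\<bar> \<le> 2 * K" using ub'[of "?x + d \<omega>"] ub'[of ?x] by linarith
          show "\<bar>?u (?x + d \<omega>) - ?u ?x - g (tt N (Suc i)) ?x (d \<omega>)\<bar> \<le> K * (norm (d \<omega>))\<^sup>2"
            using i elim by (intro tay tt0 ttT) auto
          show "\<bar>g (tt N (Suc i)) ?x (d \<omega>)\<bar> \<le> K * norm (d \<omega>)"
            using i elim by (intro gb tt0 ttT) auto
        qed
        have b1: "\<bar>\<Phi> N i ?x - ?u ?x\<bar> \<le> 8 * K * h N" by (rule \<Phi>u[OF i elim])
        have b2: "\<bar>\<Phi> N i ?x - ?u ?x\<bar> \<le> 2 * K" using \<Phi>b[OF i, of ?x] ub'[of ?x] by linarith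
        have "(?u (?x + d \<omega>) - ?u ?x)\<^sup>2 \<le> (2 * K * norm (d \<omega>))\<^sup>2"
          using a K by (simp add: abs_le_square_iff[symmetric])
        moreover have "(\<Phi> N i ?x - ?u ?x)\<^sup>2 \<le> (8 * K * h N) * (2 * K)"
        proof -
          have "(\<Phi> N i ?x - ?u ?x)\<^sup>2 = \<bar>\<Phi> N i ?x - ?u ?x\<bar> * \<bar>\<Phi> N i ?x - ?u ?x\<bar>"
            by (simp add: power2_eq_square)
          also have "\<dots> \<le> (8 * K * h N) * (2 * K)"
            by (rule mult_mono[OF b1 b2]) (use K h[of N] in auto)
          finally show ?thesis .
        qed
        moreover have "(Mi N i \<omega>)\<^sup>2 \<le> 2 * (?u (?x + d \<omega>) - ?u ?x)\<^sup>2 + 2 * (\<Phi> N i ?x - ?u ?x)\<^sup>2"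
        proof -
          have "Mi N i \<omega> = (?u (?x + d \<omega>) - ?u ?x) - (\<Phi> N i ?x - ?u ?x)" by (simp add: Mi_def d_def)
          moreover have "(a - b)\<^sup>2 \<le> 2 * a\<^sup>2 + 2 * b\<^sup>2" for a b :: real
            using zero_le_power2[of "a + b"] by (simp add: power2_eq_square algebra_simps)
          ultimately show ?thesis by metis
        qed
        ultimately have "(Mi N i \<omega>)\<^sup>2 \<le> 2 * (2 * K * norm (d \<omega>))\<^sup>2 + 2 * ((8 * K * h N) * (2 * K))" by linarith
        then show ?case by (simp add: power2_eq_square algebra_simps)
      qed
    qed
    also have "\<dots> = 8 * K\<^sup>2 * expectation (\<lambda>\<omega>. (norm (d \<omega>))\<^sup>2) + 32 * K\<^sup>2 * h N"
      using di prob_space by simp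
    also have "\<dots> \<le> 8 * K\<^sup>2 * (8 * h N) + 32 * K\<^sup>2 * h N"
      using di(2) by (intro add_right_mono mult_left_mono) auto
    finally show ?thesis by (simp add: mult_ac)
  qed
  \<comment> \<open>The number of steps times h is T, so the second moment of the martingale sum is
    bounded uniformly in the mesh.\<close>
  have sqS: "expectation (\<lambda>\<omega>. (\<Sum>i<Suc N. Mi N i \<omega>)\<^sup>2) \<le> 96 * K\<^sup>2 * T" for N
  proof -
    have "expectation (\<lambda>\<omega>. (\<Sum>i<Suc N. Mi N i \<omega>)\<^sup>2) \<le> real (Suc N) * (96 * K\<^sup>2 * h N)"
      by (rule expectation_square_orthogonal_sum[where B="2 * K"]; (rule Mim | erule Mib | erule orth | erule sqM))
    also have "\<dots> = 96 * K\<^sup>2 * (real (Suc N) * h N)" by (simp only: mult_ac)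
    finally show ?thesis by (simp only: hT)
  qed
  have GiAE: "AE \<omega> in M. \<bar>Gi N i \<omega>\<bar> \<le> 9 * K * h N" if i: "i < Suc N" for N i
    using AE_in_wedge[OF tt0, of N i]
  proof eventually_elim
    case (elim \<omega>)
    have "\<bar>u (tt N (Suc i)) (X (tt N i) \<omega>) - u (tt N i) (X (tt N i) \<omega>)\<bar> \<le> K * (tt N (Suc i) - tt N i)"
      using i elim h[of N] by (intro time tt0 ttT) (auto simp: tts)
    then show ?case
      using \<Phi>u[OF i elim] by (simp add: tts Gi_def)
  qed
  \<comment> \<open>\<open>Y\<close> is the sum of the reflection parts; solving the telescoping
    identity for it gives access to its second moment.\<close>
  have decomp: "Y N \<omega> = u T (X T \<omega>) - u 0 (X 0 \<omega>) - (\<Sum>i<Suc N. Mi N i \<omega>) - (\<Sum>i<Suc N. Gi N i \<omega>)"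
    if \<omega>: "\<omega> \<in> space M" for N \<omega>
  proof -
    have e: "X (tt N (Suc i)) \<omega> - (L (tt N (Suc i)) \<omega> - L (tt N i) \<omega>) = X (tt N i) \<omega> + (W (tt N (Suc i)) \<omega> - W (tt N i) \<omega>)" for i
      using X_eq[OF tt0 \<omega>, of N i] X_eq[OF tt0 \<omega>, of N "Suc i"] by simp
    have "Y N \<omega> = (\<Sum>i<Suc N. (u (tt N (Suc i)) (X (tt N (Suc i)) \<omega>) - u (tt N i) (X (tt N i) \<omega>)) - Mi N i \<omega> - Gi N i \<omega>)"
      unfolding Y_def e by (intro sum.cong refl) (simp add: Mi_def Gi_def)
    also have "\<dots> = (\<Sum>i<Suc N. (u (tt N (Suc i)) (X (tt N (Suc i)) \<omega>) - u (tt N i) (X (tt N i) \<omega>)))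
        - (\<Sum>i<Suc N. Mi N i \<omega>) - (\<Sum>i<Suc N. Gi N i \<omega>)"
      by (simp only: sum_subtractf)
    also have "(\<Sum>i<Suc N. (u (tt N (Suc i)) (X (tt N (Suc i)) \<omega>) - u (tt N i) (X (tt N i) \<omega>)))
       = u (tt N (Suc N)) (X (tt N (Suc N)) \<omega>) - u (tt N 0) (X (tt N 0) \<omega>)"
      by (rule sum_lessThan_telescope)
    also have "tt N (Suc N) = T" by (simp only: tt_def hT)
    also have "tt N 0 = 0" by (simp add: tt_def)
    finally show ?thesis .
  qed
  have Ym[measurable]: "Y N \<in> borel_measurable M" for N unfolding Y_def[abs_def] by measurable
  have uTi: "integrable M (\<lambda>\<omega>. u T (X T \<omega>))" "integrable M (\<lambda>\<omega>. u 0 (X 0 \<omega>))"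
    using ub T by (auto intro!: integrable_const_bound[where B=K])
  have Mii: "integrable M (Mi N i)" if "i < Suc N" for N i
    using Mib[OF that] by (auto intro!: integrable_const_bound[where B="2 * K"])
  have Gii: "integrable M (Gi N i)" if "i < Suc N" for N i
    using GiAE[OF that] by (auto intro!: integrable_const_bound[where B="9 * K * h N"])
  have Sb: "\<bar>\<Sum>i<Suc N. Mi N i \<omega>\<bar> \<le> real (Suc N) * (2 * K)" for N \<omega>
    using order_trans[OF sum_abs sum_bounded_above[of "{..<Suc N}" "\<lambda>j. \<bar>Mi N j \<omega>\<bar>" "2 * K"]] Mib by auto
  have YAE: "AE \<omega> in M. (Y N \<omega>)\<^sup>2 \<le> 3 * ((2 * K)\<^sup>2 + (\<Sum>i<Suc N. Mi N i \<omega>)\<^sup>2 + (9 * K * T)\<^sup>2)" for N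
  proof -
    have "AE \<omega> in M. \<forall>i\<in>{..<Suc N}. \<bar>Gi N i \<omega>\<bar> \<le> 9 * K * h N"
      by (rule AE_finite_allI) (use GiAE in auto)
    then show ?thesis
      using AE_space
    proof eventually_elim
      case (elim \<omega>)
      have "\<bar>\<Sum>i<Suc N. Gi N i \<omega>\<bar> \<le> real (Suc N) * (9 * K * h N)"
        using order_trans[OF sum_abs sum_bounded_above[of "{..<Suc N}" "\<lambda>j. \<bar>Gi N j \<omega>\<bar>" "9 * K * h N"]] elim by auto
      also have "\<dots> = 9 * K * (real (Suc N) * h N)" by (simp only: mult_ac)
      finally have G: "\<bar>\<Sum>i<Suc N. Gi N i \<omega>\<bar> \<le> 9 * K * T" by (simp only: hT)
      have U: "\<bar>u T (X T \<omega>) - u 0 (X 0 \<omega>)\<bar> \<le> 2 * K"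
        using ub[of T "X T \<omega>"] ub[of 0 "X 0 \<omega>"] T by auto
      have "(a - b - c)\<^sup>2 \<le> 3 * (a\<^sup>2 + b\<^sup>2 + c\<^sup>2)" for a b c :: real
        using zero_le_power2[of "a + b"] zero_le_power2[of "a + c"] zero_le_power2[of "b - c"]
        by (simp add: power2_eq_square algebra_simps)
      then have "(Y N \<omega>)\<^sup>2 \<le> 3 * ((u T (X T \<omega>) - u 0 (X 0 \<omega>))\<^sup>2 + (\<Sum>i<Suc N. Mi N i \<omega>)\<^sup>2 + (\<Sum>i<Suc N. Gi N i \<omega>)\<^sup>2)"
        unfolding decomp[OF elim(2)] .
      moreover have "(u T (X T \<omega>) - u 0 (X 0 \<omega>))\<^sup>2 \<le> (2 * K)\<^sup>2"
        using U K by (intro power2_le_iff_abs_le[THEN iffD2]) auto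
      moreover have "(\<Sum>i<Suc N. Gi N i \<omega>)\<^sup>2 \<le> (9 * K * T)\<^sup>2"
        using G K T by (intro power2_le_iff_abs_le[THEN iffD2]) auto
      moreover have "y \<le> 3 * (a' + b + c')" if "y \<le> 3 * (a + b + c)" "a \<le> a'" "c \<le> c'" for y a b c a' c' :: real
        using that by (simp add: distrib_left)
      ultimately show ?case by blast
    qed
  qed
  have S2i: "integrable M (\<lambda>\<omega>. (\<Sum>i<Suc N. Mi N i \<omega>)\<^sup>2)" for N
  proof (rule integrable_const_bound[where B="(real (Suc N) * (2 * K))\<^sup>2"])
    show "AE \<omega> in M. norm ((\<Sum>i<Suc N. Mi N i \<omega>)\<^sup>2) \<le> (real (Suc N) * (2 * K))\<^sup>2"
      unfolding real_norm_def abs_power2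
      using Sb[of N] K by (intro AE_I2 power2_le_iff_abs_le[THEN iffD2]) (auto simp del: sum.lessThan_Suc)
  qed measurable
  have bi: "integrable M (\<lambda>\<omega>. 3 * ((2 * K)\<^sup>2 + (\<Sum>i<Suc N. Mi N i \<omega>)\<^sup>2 + (9 * K * T)\<^sup>2))" for N
    using S2i[of N] by (intro integrable_mult_right Bochner_Integration.integrable_add integrable_const)
  have Y2i: "integrable M (\<lambda>\<omega>. (Y N \<omega>)\<^sup>2)" for N
  proof (rule Bochner_Integration.integrable_bound[OF bi[of N]])
    show "AE \<omega> in M. norm ((Y N \<omega>)\<^sup>2) \<le> norm (3 * ((2 * K)\<^sup>2 + (\<Sum>i<Suc N. Mi N i \<omega>)\<^sup>2 + (9 * K * T)\<^sup>2))"
      using YAE[of N]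
    proof eventually_elim
      case (elim \<omega>)
      have "norm ((Y N \<omega>)\<^sup>2) = (Y N \<omega>)\<^sup>2" by (simp only: real_norm_def abs_power2)
      also note elim
      also have "3 * ((2 * K)\<^sup>2 + (\<Sum>i<Suc N. Mi N i \<omega>)\<^sup>2 + (9 * K * T)\<^sup>2)
         \<le> norm (3 * ((2 * K)\<^sup>2 + (\<Sum>i<Suc N. Mi N i \<omega>)\<^sup>2 + (9 * K * T)\<^sup>2))"
        unfolding real_norm_def by (rule abs_ge_self)
      finally show ?case .
    qed
  qed measurable
  \<comment> \<open>Almost sure convergence comes from the pathwise lemma, uniform square
    integrability from \<open>decomp\<close>.\<close>
  have "(\<lambda>N. expectation (Y N)) \<longlonglongrightarrow> 0"
  proof (rule expectation_tendsto_0_L2[OF Y2i Ym])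
    fix N
    have "expectation (\<lambda>\<omega>. (Y N \<omega>)\<^sup>2) \<le> expectation (\<lambda>\<omega>. 3 * ((2 * K)\<^sup>2 + (\<Sum>i<Suc N. Mi N i \<omega>)\<^sup>2 + (9 * K * T)\<^sup>2))"
      by (rule integral_mono_AE[OF Y2i bi YAE])
    also have "\<dots> = 3 * ((2 * K)\<^sup>2 + expectation (\<lambda>\<omega>. (\<Sum>i<Suc N. Mi N i \<omega>)\<^sup>2) + (9 * K * T)\<^sup>2)"
      using S2i[of N] by (simp only: integral_mult_right_zero Bochner_Integration.integral_add integrable_const
          Bochner_Integration.integrable_add integral_const prob_space) (simp add: prob_space)
    also have "\<dots> \<le> 3 * ((2 * K)\<^sup>2 + 96 * K\<^sup>2 * T + (9 * K * T)\<^sup>2)" by (intro mult_left_mono add_mono order_refl sqS) simp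
    finally show "expectation (\<lambda>\<omega>. (Y N \<omega>)\<^sup>2) \<le> 3 * ((2 * K)\<^sup>2 + 96 * K\<^sup>2 * T + (9 * K * T)\<^sup>2)" .
  next
    show "AE \<omega> in M. (\<lambda>N. Y N \<omega>) \<longlonglongrightarrow> 0"
      using AE_path
    proof eventually_elim
      case (elim \<omega>)
      have sV: "sets (variation_measure (\<lambda>s. L s \<omega>)) = sets borel" by (simp add: variation_measure_def)
      have cX: "continuous_on {0..T} (\<lambda>t. X t \<omega>)" and cL: "continuous_on {0..T} (\<lambda>t. L t \<omega>)"
        using elim by (auto intro: continuous_on_subset)
      have "(\<lambda>N. \<Sum>i<Suc N. let s = real i * (T / real (Suc N)); t = real (Suc i) * (T / real (Suc N)) in
          u t (X t \<omega>) - u t (X t \<omega> - (L t \<omega> - L s \<omega>))) \<longlonglongrightarrow> 0"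
      proof (rule pathwise_reflection_sum_tendsto[OF T K _ sV, where B = "max 1 (norm (n 0))" and
            D = "wedge \<alpha>" and q = "\<lambda>s. reflection_field (X s \<omega>)" and g = g])
        show "emeasure (variation_measure (\<lambda>s. L s \<omega>)) {- 1<..T} < \<infinity>"
          unfolding variation_measure_def using T by (intro emeasure_interval_measure_finite) simp
        show "set_borel_measurable (variation_measure (\<lambda>s. L s \<omega>)) {0..T} (\<lambda>s. reflection_field (X s \<omega>))"
        proof -
          have i: "(\<lambda>s. indicat_real {0..T} s *\<^sub>R X s \<omega>) \<in> borel_measurable borel"
            by (rule borel_measurable_continuous_on_indicator[OF _ cX]) simp
          \<comment> \<open>Inserting the indicator inside the argument as well makes the inner
            function Borel on the whole line, although the path is continuous only for nonnegative
            times.\<close>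
          have e: "(\<lambda>s. indicat_real {0..T} s *\<^sub>R reflection_field (X s \<omega>))
            = (\<lambda>s. indicat_real {0..T} s *\<^sub>R reflection_field (indicat_real {0..T} s *\<^sub>R X s \<omega>))"
            by (auto simp: indicator_def)
          have "(\<lambda>s. indicat_real {0..T} s *\<^sub>R reflection_field (X s \<omega>)) \<in> borel_measurable borel"
            unfolding e using i by measurable
          then show ?thesis
            unfolding set_borel_measurable_def by (simp add: measurable_cong_sets[OF sV refl])
        qed
        show "norm (reflection_field (X s \<omega>)) \<le> max 1 (norm (n 0))" for s by (rule norm_reflection_field_le)
        show "g s (X t \<omega>) (reflection_field (X t \<omega>)) = 0" if "0 \<le> s" "s \<le> T" "0 \<le> t" "t \<le> T" for s t
        proof (cases "X t \<omega> \<in> frontier (wedge \<alpha>)")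
          case True
          then show ?thesis using gn[of s "X t \<omega>"] that by (simp add: reflection_field_def)
        next
          case False
          then show ?thesis using linear_0[OF lin[of s "X t \<omega>"]] that elim by (simp add: reflection_field_def)
        qed
      qed (use elim cX cL lin tay in auto)
      then show ?case by (simp only: Y_def tt_def h_def Let_def)
    qed
  qed
  moreover have "expectation (Y N) = expectation (\<lambda>\<omega>. u T (X T \<omega>)) - u 0 x - (\<Sum>i<Suc N. expectation (Gi N i))" for N
  proof -
    have "expectation (Y N) = expectation (\<lambda>\<omega>. u T (X T \<omega>) - u 0 (X 0 \<omega>) - (\<Sum>i<Suc N. Mi N i \<omega>) - (\<Sum>i<Suc N. Gi N i \<omega>))"
      by (intro Bochner_Integration.integral_cong refl decomp)
    also have "\<dots> = expectation (\<lambda>\<omega>. u T (X T \<omega>)) - expectation (\<lambda>\<omega>. u 0 (X 0 \<omega>)) - (\<Sum>i<Suc N. expectation (Mi N i)) - (\<Sum>i<Suc N. expectation (Gi N i))"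
    proof -
      have iM: "integrable M (\<lambda>\<omega>. \<Sum>i<Suc N. Mi N i \<omega>)" "integrable M (\<lambda>\<omega>. \<Sum>i<Suc N. Gi N i \<omega>)"
        using Mii Gii by (auto intro!: Bochner_Integration.integrable_sum simp del: sum.lessThan_Suc)
      have s: "expectation (\<lambda>\<omega>. \<Sum>i<Suc N. Mi N i \<omega>) = (\<Sum>i<Suc N. expectation (Mi N i))"
        "expectation (\<lambda>\<omega>. \<Sum>i<Suc N. Gi N i \<omega>) = (\<Sum>i<Suc N. expectation (Gi N i))"
        using Mii Gii by (auto intro!: Bochner_Integration.integral_sum simp del: sum.lessThan_Suc)
      show ?thesis
        unfolding s[symmetric] using uTi iM
        by (simp only: Bochner_Integration.integral_diff Bochner_Integration.integrable_diff)
    qed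
    also have "(\<Sum>i<Suc N. expectation (Mi N i)) = 0"
      by (rule sum.neutral) (use mart[of _ _ "\<lambda>_. 1" 1] in auto)
    also have "expectation (\<lambda>\<omega>. u 0 (X 0 \<omega>)) = expectation (\<lambda>\<omega>. u 0 x)"
      by (rule integral_cong_AE) (use AE_X0 in \<open>auto elim!: eventually_mono\<close>)
    finally show ?thesis using prob_space by simp
  qed
  ultimately have "(\<lambda>N. (expectation (\<lambda>\<omega>. u T (X T \<omega>)) - u 0 x) - (\<Sum>i<Suc N. expectation (Gi N i))) \<longlonglongrightarrow> 0"
    by simp
  from tendsto_diff[OF tendsto_const this, of "expectation (\<lambda>\<omega>. u T (X T \<omega>)) - u 0 x"]
  have "(\<lambda>N. \<Sum>i<Suc N. expectation (Gi N i)) \<longlonglongrightarrow> expectation (\<lambda>\<omega>. u T (X T \<omega>)) - u 0 x" by simp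
  then show ?thesis by (simp only: Gi_def[abs_def] \<Phi>_def tt_def h_def)
qed

end

section \<open>Second-order Taylor bounds for radially damped modes\<close>

text \<open>The radial part r^\<nu> of the n-th mode. The case n = 0 is separate so that it equals 1
  also at r = 0.\<close>

definition rpow :: "real \<Rightarrow> nat \<Rightarrow> real \<Rightarrow> real" where
  "rpow \<alpha> n r = (if n = 0 then 1 else r powr (real n * pi / \<alpha>))"

lemma rpow_nonneg[simp]: "0 \<le> rpow \<alpha> n r"
  by (simp add: rpow_def)

lemma norm_Fw_rpow: "norm (Fw \<alpha> n \<zeta>) = rpow \<alpha> n (norm \<zeta>)"
  by (simp add: norm_Fw rpow_def)

lemma abs_P_le_rpow: "\<bar>P \<alpha> n z\<bar> \<le> rpow \<alpha> n (norm z)"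
  using abs_P_le[of \<alpha> n z] by (simp add: rpow_def)

lemma rpow_exp_bounded:
  assumes "0 < \<alpha>" "0 < m"
  obtains A where "0 \<le> A" "\<And>r. 0 \<le> r \<Longrightarrow> rpow \<alpha> n r * r ^ k * exp (- m * r\<^sup>2) \<le> A"
proof -
  define a where "a = (if n = 0 then 0 else real n * pi / \<alpha>) + real k"
  have a: "0 \<le> a" using assms by (simp add: a_def)
  define A where "A = 1 + (1 + (a/2) / m) powr (a/2)"
  have "rpow \<alpha> n r * r ^ k * exp (- m * r\<^sup>2) \<le> A" if r: "0 \<le> r" for r
  proof (cases "r = 0")
    case True
    then show ?thesis using assms by (auto simp: rpow_def A_def power_0_left)
  next
    case False
    then have r: "0 < r" using that by simp
    have "rpow \<alpha> n r * r ^ k = r powr a" using r by (simp add: rpow_def a_def powr_add powr_realpow)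
    also have "\<dots> = (r\<^sup>2) powr (a/2)" using r by (simp add: powr_powr flip: powr_numeral)
    also have "\<dots> \<le> (1 + (a/2) / m) powr (a/2) * exp (m * r\<^sup>2)"
      using a assms by (intro powr_le_exp) auto
    finally have "rpow \<alpha> n r * r ^ k * exp (- m * r\<^sup>2) \<le> (1 + (a/2) / m) powr (a/2) * exp (m * r\<^sup>2) * exp (- m * r\<^sup>2)"
      by (intro mult_right_mono) auto
    also have "\<dots> = (1 + (a/2) / m) powr (a/2)" by (simp add: mult.assoc exp_add[symmetric])
    finally show ?thesis by (simp add: A_def)
  qed
  moreover have "0 \<le> A" unfolding A_def by (intro add_nonneg_nonneg) auto
  ultimately show thesis by (intro that[of A])
qed

text \<open>The derivative at z in direction w of P(z) \<psi>(|z|^2), where \<psi>' is the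
  derivative of \<psi>, written with F' = \<nu> F / \<zeta>. At the vertex, division by 0 yields 0
  and this becomes the zero map, the correct gradient for profiles that vanish fast enough
  there.\<close>

definition grad_P_radial :: "real \<Rightarrow> nat \<Rightarrow> (real \<Rightarrow> real) \<Rightarrow> (real \<Rightarrow> real) \<Rightarrow> real^2 \<Rightarrow> real^2 \<Rightarrow> real" where
  "grad_P_radial \<alpha> n \<psi> \<psi>' z w =
     Re (of_real (real n * pi / \<alpha>) * Fw \<alpha> n (cplx z) / cplx z * cplx w) * \<psi> ((norm z)\<^sup>2)
     + P \<alpha> n z * (\<psi>' ((norm z)\<^sup>2) * (2 * (z \<bullet> w)))"

lemma linear_grad_P_radial: "linear (grad_P_radial \<alpha> n \<psi> \<psi>' z)"
proof -
  define k where "k = of_real (real n * pi / \<alpha>) * Fw \<alpha> n (cplx z) / cplx z"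
  have a: "Re (k * cplx (x + y)) = Re (k * cplx x) + Re (k * cplx y)" for x y
    by (simp only: cplx_simps distrib_left plus_complex.sel)
  have b: "Re (k * cplx (c *\<^sub>R x)) = c * Re (k * cplx x)" for c x
    by (simp add: algebra_simps)
  show ?thesis
    unfolding grad_P_radial_def k_def[symmetric]
    by (rule linearI) (simp_all only: a b inner_add_right inner_scaleR_right, simp_all add: algebra_simps)
qed

text \<open>The Neumann condition. The radial factor contributes nothing because the normal is
  orthogonal to z. On both sides F is real, with angular factor 1 or (-1)^n, and the normal is i or
  - i times the direction of z, so F' times the normal is purely imaginary.\<close>

lemma grad_P_radial_normal:
  assumes \<alpha>: "0 < \<alpha>" "\<alpha> < 2 * pi" and r: "0 < r"
  shows "grad_P_radial \<alpha> n \<psi> \<psi>' (polar r 0) (vector [0, 1]) = 0"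
    and "grad_P_radial \<alpha> n \<psi> \<psi>' (polar r \<alpha>) (vector [sin \<alpha>, - cos \<alpha>]) = 0"
proof -
  have c: "cplx (vector [sin \<alpha>, - cos \<alpha>]) = - \<i> * cis \<alpha>" "cplx (vector [0, 1]) = \<i>"
    by (auto simp: cplx_def complex_eq_iff)
  have d: "cis t / (of_real r * cis t) = 1 / of_real r" for t by (simp add: cis_neq_zero)
  have rr: "rpow \<alpha> n r = (if n = 0 then 1 else r powr (real n * pi / \<alpha>))" by (simp add: rpow_def)
  have F0: "Fw \<alpha> n (cplx (polar r 0)) = of_real (rpow \<alpha> n r)"
    using Fw_polar[OF \<alpha>, of r 0 n] r \<alpha> unfolding rr by simp
  have Fa: "Fw \<alpha> n (cplx (polar r \<alpha>)) = of_real (rpow \<alpha> n r) * cis (real n * pi)"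
    using Fw_polar[OF \<alpha>, of r \<alpha> n] r \<alpha> unfolding rr by simp
  have ci: "polar r 0 \<bullet> vector [0, 1] = 0" "polar r \<alpha> \<bullet> vector [sin \<alpha>, - cos \<alpha>] = 0"
    by (auto simp: inner_real2 polar_def)
  show "grad_P_radial \<alpha> n \<psi> \<psi>' (polar r 0) (vector [0, 1]) = 0"
    unfolding grad_P_radial_def F0 ci c by (simp add: cplx_polar)
  have "of_real (real n * pi / \<alpha>) * (of_real (rpow \<alpha> n r) * cis (real n * pi)) / (of_real r * cis \<alpha>) * (- \<i> * cis \<alpha>)
      = of_real (real n * pi / \<alpha> * rpow \<alpha> n r / r) * (- \<i> * cis (real n * pi))"
    by (simp add: cis_neq_zero)
  moreover have "Re (of_real y * (- \<i> * cis (real n * pi))) = 0" for y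
    by simp
  ultimately show "grad_P_radial \<alpha> n \<psi> \<psi>' (polar r \<alpha>) (vector [sin \<alpha>, - cos \<alpha>]) = 0"
    unfolding grad_P_radial_def Fa ci c unfolding cplx_polar by simp
qed

lemma second_order_remainder:
  fixes f :: "real \<Rightarrow> real"
  assumes f: "\<And>t. 0 \<le> t \<Longrightarrow> t \<le> 1 \<Longrightarrow> (f has_real_derivative f' t) (at t)"
    and f': "\<And>t. 0 \<le> t \<Longrightarrow> t \<le> 1 \<Longrightarrow> (f' has_real_derivative f'' t) (at t)"
    and B: "\<And>t. 0 \<le> t \<Longrightarrow> t \<le> 1 \<Longrightarrow> \<bar>f'' t\<bar> \<le> B"
  shows "\<bar>f 1 - f 0 - f' 0\<bar> \<le> B"
proof -
  have B0: "0 \<le> B" using B[of 0] by simp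
  obtain s where s: "0 < s" "s < 1" "f 1 - f 0 = f' s"
    using MVT2[of 0 1 f f'] f by auto
  obtain r where r: "0 < r" "r < s" "f' s - f' 0 = s * f'' r"
    using MVT2[of 0 s f' f''] f' s by auto
  have "\<bar>s * f'' r\<bar> \<le> 1 * B"
    unfolding abs_mult using s r B[of r] B0 by (intro mult_mono) auto
  then show ?thesis using s r by simp
qed

text \<open>When |w| < sin(\<alpha> / 2) |z|, the segment from z to z + w avoids the branch cut, and
  the second derivative along it can be bounded directly. Differentiating the mode twice costs
  r^(-2), which \<open>B1\<close> compensates by quadratic vanishing of the profile at the vertex.
  In the constant, \<nu> |\<nu> - 1| comes from F'', 4 \<nu> from the mixed term and 6 from the two
  derivatives of the profile.\<close>

lemma taylor_P_radial_near:
  assumes \<alpha>: "0 < \<alpha>" "\<alpha> < 2 * pi"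
    and d1: "\<And>q. (\<psi> has_real_derivative \<psi>' q) (at q)" and d2: "\<And>q. (\<psi>' has_real_derivative \<psi>'' q) (at q)"
    and B1: "\<And>r. 0 \<le> r \<Longrightarrow> rpow \<alpha> n r * \<bar>\<psi> (r\<^sup>2)\<bar> \<le> C * r\<^sup>2"
    and B2: "\<And>r. 0 \<le> r \<Longrightarrow> rpow \<alpha> n r * \<bar>\<psi>' (r\<^sup>2)\<bar> \<le> C"
    and B3: "\<And>r. 0 \<le> r \<Longrightarrow> rpow \<alpha> n r * \<bar>\<psi>'' (r\<^sup>2)\<bar> * r\<^sup>2 \<le> C"
    and z: "z \<in> wedge \<alpha>" and near: "norm w < sin (\<alpha> / 2) * norm z"
  defines "\<nu> \<equiv> real n * pi / \<alpha>"
  shows "\<bar>P \<alpha> n (z + w) * \<psi> ((norm (z + w))\<^sup>2) - P \<alpha> n z * \<psi> ((norm z)\<^sup>2) - grad_P_radial \<alpha> n \<psi> \<psi>' z w\<bar>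
     \<le> (\<nu> * \<bar>\<nu> - 1\<bar> + 4 * \<nu> + 6) * C * (norm w)\<^sup>2"
proof -
  have \<nu>: "0 \<le> \<nu>" using \<alpha> by (simp add: \<nu>_def)
  define \<eta> where "\<eta> t = cplx z + of_real t * cplx w" for t
  define Q where "Q t = (norm (z + t *\<^sub>R w))\<^sup>2" for t
  define F1 where "F1 \<zeta> = of_real \<nu> * Fw \<alpha> n \<zeta> / \<zeta>" for \<zeta>
  define F2 where "F2 \<zeta> = of_real (\<nu> * (\<nu> - 1)) * Fw \<alpha> n \<zeta> / \<zeta>\<^sup>2" for \<zeta>
  define f where "f t = Re (Fw \<alpha> n (\<eta> t)) * \<psi> (Q t)" for t
  define f' where "f' t = Re (F1 (\<eta> t) * cplx w) * \<psi> (Q t) + Re (Fw \<alpha> n (\<eta> t)) * (\<psi>' (Q t) * (2 * ((z + t *\<^sub>R w) \<bullet> w)))" for t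
  define f'' where "f'' t = Re (F2 (\<eta> t) * (cplx w)\<^sup>2) * \<psi> (Q t)
      + 2 * Re (F1 (\<eta> t) * cplx w) * (\<psi>' (Q t) * (2 * ((z + t *\<^sub>R w) \<bullet> w)))
      + Re (Fw \<alpha> n (\<eta> t)) * (\<psi>'' (Q t) * (2 * ((z + t *\<^sub>R w) \<bullet> w))\<^sup>2 + \<psi>' (Q t) * (2 * (norm w)\<^sup>2))" for t
  have \<eta>: "\<eta> t = cplx (z + t *\<^sub>R w)" for t by (simp add: \<eta>_def)
  have slit: "\<eta> t \<in> slit \<alpha>" if "0 \<le> t" "t \<le> 1" for t
  proof (rule slit_nbhd[OF \<alpha> z])
    have "norm (\<eta> t - cplx z) = \<bar>t\<bar> * norm w" by (simp add: \<eta>_def norm_mult)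
    also have "\<dots> \<le> 1 * norm w" using that by (intro mult_right_mono) auto
    finally show "norm (\<eta> t - cplx z) < sin (\<alpha> / 2) * norm z" using near by simp
  qed
  have \<eta>0: "\<eta> t \<noteq> 0" if "0 \<le> t" "t \<le> 1" for t using slit[OF that] by (auto simp: slit_def)
  have dF: "(Fw \<alpha> n has_field_derivative F1 (\<eta> t)) (at (\<eta> t))" if "0 \<le> t" "t \<le> 1" for t
    using Fw_has_field_derivative[OF slit[OF that]] by (simp add: F1_def \<nu>_def)
  have dF1: "(F1 has_field_derivative F2 (\<eta> t)) (at (\<eta> t))" if "0 \<le> t" "t \<le> 1" for t
    unfolding F1_def[abs_def]
    apply (rule derivative_eq_intros refl dF[OF that, unfolded F1_def] \<eta>0[OF that])+
    using \<eta>0[OF that] by (simp add: F2_def power2_eq_square field_simps)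
  have d\<eta>: "(\<eta> has_vector_derivative cplx w) (at t)" for t
    unfolding \<eta>_def[abs_def] by (auto intro!: derivative_eq_intros simp: has_vector_derivative_def scaleR_conv_of_real)
  have dRe: "((\<lambda>t. Re (G (\<eta> t) * k)) has_real_derivative Re (G' * cplx w * k)) (at t)"
    if "(G has_field_derivative G') (at (\<eta> t))" for G G' t k
  proof -
    have "((G \<circ> \<eta>) has_vector_derivative (cplx w * G')) (at t)"
      by (rule field_vector_diff_chain_at[OF d\<eta> that])
    then have "((\<lambda>t. G (\<eta> t) * k) has_vector_derivative (cplx w * G') * k) (at t)"
      by (intro has_vector_derivative_mult_left) (simp add: o_def)
    from bounded_linear.has_vector_derivative[OF bounded_linear_Re this] show ?thesis
      by (simp add: has_real_derivative_iff_has_vector_derivative mult.commute)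
  qed
  have dQ: "(Q has_real_derivative 2 * ((z + t *\<^sub>R w) \<bullet> w)) (at t)" for t
    unfolding Q_def[abs_def] power2_norm_eq_inner
    by (auto intro!: derivative_eq_intros simp: has_field_derivative_def has_vector_derivative_def inner_commute algebra_simps)
  have dl: "((\<lambda>t. 2 * ((z + t *\<^sub>R w) \<bullet> w)) has_real_derivative 2 * (norm w)\<^sup>2) (at t)" for t
    by (auto intro!: derivative_eq_intros simp: inner_add_left power2_norm_eq_inner)
  have d\<psi>: "((\<lambda>t. \<psi> (Q t)) has_real_derivative \<psi>' (Q t) * (2 * ((z + t *\<^sub>R w) \<bullet> w))) (at t)" for t
    by (rule DERIV_chain2[OF d1 dQ])
  have d\<psi>': "((\<lambda>t. \<psi>' (Q t)) has_real_derivative \<psi>'' (Q t) * (2 * ((z + t *\<^sub>R w) \<bullet> w))) (at t)" for t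
    by (rule DERIV_chain2[OF d2 dQ])
  have "\<bar>f 1 - f 0 - f' 0\<bar> \<le> (\<nu> * \<bar>\<nu> - 1\<bar> + 4 * \<nu> + 6) * C * (norm w)\<^sup>2"
  proof (rule second_order_remainder)
    fix t :: real assume t: "0 \<le> t" "t \<le> 1"
    have 1: "((\<lambda>t. Re (Fw \<alpha> n (\<eta> t))) has_real_derivative Re (F1 (\<eta> t) * cplx w)) (at t)"
      using dRe[OF dF[OF t], of 1] by simp
    have 2: "((\<lambda>t. Re (F1 (\<eta> t) * cplx w)) has_real_derivative Re (F2 (\<eta> t) * (cplx w)\<^sup>2)) (at t)"
      using dRe[OF dF1[OF t], of "cplx w"] by (simp add: power2_eq_square mult.assoc)
    show "(f has_real_derivative f' t) (at t)"
      unfolding f_def[abs_def] f'_def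
      by (rule DERIV_cong[OF DERIV_mult[OF 1 d\<psi>]]) (simp add: mult_ac)
    show "(f' has_real_derivative f'' t) (at t)"
      unfolding f'_def[abs_def] f''_def
      by (rule DERIV_cong[OF DERIV_add[OF DERIV_mult[OF 2 d\<psi>] DERIV_mult[OF 1 DERIV_mult[OF d\<psi>' dl]]]])
         (simp add: power2_eq_square algebra_simps)
    define y where "y = z + t *\<^sub>R w"
    define N where "N = norm y"
    define R where "R = rpow \<alpha> n N"
    have N: "0 < N" using \<eta>0[OF t] by (auto simp: N_def y_def \<eta> simp flip: norm_cplx)
    have N\<eta>: "norm (\<eta> t) = N" by (simp only: \<eta> norm_cplx N_def y_def)
    have QN: "Q t = N\<^sup>2" by (simp add: Q_def N_def y_def)
    have yw: "\<bar>y \<bullet> w\<bar> \<le> N * norm w" unfolding N_def by (rule Cauchy_Schwarz_ineq2)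
    have a0: "\<bar>Re (Fw \<alpha> n (\<eta> t))\<bar> \<le> R"
      using abs_Re_le_cmod[of "Fw \<alpha> n (\<eta> t)"] by (simp add: norm_Fw_rpow N\<eta> R_def)
    have a1: "\<bar>Re (F1 (\<eta> t) * cplx w)\<bar> \<le> \<nu> * R / N * norm w"
      using abs_Re_le_cmod[of "F1 (\<eta> t) * cplx w"] \<nu>
      by (simp add: F1_def norm_mult norm_divide norm_Fw_rpow N\<eta> R_def)
    have a2: "\<bar>Re (F2 (\<eta> t) * (cplx w)\<^sup>2)\<bar> \<le> \<nu> * \<bar>\<nu> - 1\<bar> * R / N\<^sup>2 * (norm w)\<^sup>2"
    proof -
      have "norm (F2 (\<eta> t) * (cplx w)\<^sup>2) = \<nu> * \<bar>\<nu> - 1\<bar> * R / N\<^sup>2 * (norm w)\<^sup>2"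
        unfolding F2_def norm_mult norm_divide norm_power norm_Fw_rpow N\<eta> norm_of_real norm_cplx R_def abs_mult
        using \<nu> by (simp only: abs_of_nonneg)
      then show ?thesis using abs_Re_le_cmod[of "F2 (\<eta> t) * (cplx w)\<^sup>2"] by simp
    qed
    have b1: "R * \<bar>\<psi> (N\<^sup>2)\<bar> \<le> C * N\<^sup>2" and b2: "R * \<bar>\<psi>' (N\<^sup>2)\<bar> \<le> C" and b3: "R * \<bar>\<psi>'' (N\<^sup>2)\<bar> * N\<^sup>2 \<le> C"
      unfolding R_def using N by (intro B1 B2 B3, simp)+
    have R0: "0 \<le> R" by (simp add: R_def)
    have t1: "\<bar>Re (F2 (\<eta> t) * (cplx w)\<^sup>2) * \<psi> (N\<^sup>2)\<bar> \<le> \<nu> * \<bar>\<nu> - 1\<bar> * C * (norm w)\<^sup>2"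
    proof -
      have "\<bar>Re (F2 (\<eta> t) * (cplx w)\<^sup>2) * \<psi> (N\<^sup>2)\<bar> \<le> (\<nu> * \<bar>\<nu> - 1\<bar> * R / N\<^sup>2 * (norm w)\<^sup>2) * \<bar>\<psi> (N\<^sup>2)\<bar>"
        unfolding abs_mult[of _ "\<psi> (N\<^sup>2)"] by (rule mult_right_mono[OF a2]) simp
      also have "\<dots> = \<nu> * \<bar>\<nu> - 1\<bar> * (norm w)\<^sup>2 / N\<^sup>2 * (R * \<bar>\<psi> (N\<^sup>2)\<bar>)" by simp
      also have "\<dots> \<le> \<nu> * \<bar>\<nu> - 1\<bar> * (norm w)\<^sup>2 / N\<^sup>2 * (C * N\<^sup>2)"
        using \<nu> by (intro mult_left_mono[OF b1]) auto
      also have "\<dots> = \<nu> * \<bar>\<nu> - 1\<bar> * C * (norm w)\<^sup>2" using N by simp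
      finally show ?thesis .
    qed
    have t2: "\<bar>2 * Re (F1 (\<eta> t) * cplx w) * (\<psi>' (N\<^sup>2) * (2 * (y \<bullet> w)))\<bar> \<le> 4 * \<nu> * C * (norm w)\<^sup>2"
    proof -
      have "\<bar>2 * Re (F1 (\<eta> t) * cplx w) * (\<psi>' (N\<^sup>2) * (2 * (y \<bullet> w)))\<bar>
         = 4 * \<bar>\<psi>' (N\<^sup>2)\<bar> * (\<bar>Re (F1 (\<eta> t) * cplx w)\<bar> * \<bar>y \<bullet> w\<bar>)" by (simp add: abs_mult del: times_complex.sel)
      also have "\<dots> \<le> 4 * \<bar>\<psi>' (N\<^sup>2)\<bar> * ((\<nu> * R / N * norm w) * (N * norm w))"
        using \<nu> R0 N by (intro mult_left_mono mult_mono a1 yw) auto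
      also have "\<dots> = 4 * \<nu> * (norm w)\<^sup>2 * (R * \<bar>\<psi>' (N\<^sup>2)\<bar>)" using N by (simp add: power2_eq_square)
      also have "\<dots> \<le> 4 * \<nu> * (norm w)\<^sup>2 * C" using \<nu> by (intro mult_left_mono[OF b2]) auto
      finally show ?thesis by (simp add: mult_ac)
    qed
    have t3: "\<bar>Re (Fw \<alpha> n (\<eta> t)) * (\<psi>'' (N\<^sup>2) * (2 * (y \<bullet> w))\<^sup>2)\<bar> \<le> 4 * C * (norm w)\<^sup>2"
    proof -
      have yw2: "(y \<bullet> w)\<^sup>2 \<le> (N * norm w)\<^sup>2"
        using yw N by (intro power2_le_iff_abs_le[THEN iffD2]) auto
      have "\<bar>Re (Fw \<alpha> n (\<eta> t)) * (\<psi>'' (N\<^sup>2) * (2 * (y \<bullet> w))\<^sup>2)\<bar>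
         = 4 * \<bar>\<psi>'' (N\<^sup>2)\<bar> * (\<bar>Re (Fw \<alpha> n (\<eta> t))\<bar> * (y \<bullet> w)\<^sup>2)" by (simp add: abs_mult power_mult_distrib)
      also have "\<dots> \<le> 4 * \<bar>\<psi>'' (N\<^sup>2)\<bar> * (R * (N * norm w)\<^sup>2)"
        using R0 by (intro mult_left_mono mult_mono a0 yw2) auto
      also have "\<dots> = 4 * (norm w)\<^sup>2 * (R * \<bar>\<psi>'' (N\<^sup>2)\<bar> * N\<^sup>2)" by (simp add: power_mult_distrib)
      also have "\<dots> \<le> 4 * (norm w)\<^sup>2 * C" by (intro mult_left_mono[OF b3]) auto
      finally show ?thesis by (simp add: mult_ac)
    qed
    have t4: "\<bar>Re (Fw \<alpha> n (\<eta> t)) * (\<psi>' (N\<^sup>2) * (2 * (norm w)\<^sup>2))\<bar> \<le> 2 * C * (norm w)\<^sup>2"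
    proof -
      have "\<bar>Re (Fw \<alpha> n (\<eta> t)) * (\<psi>' (N\<^sup>2) * (2 * (norm w)\<^sup>2))\<bar>
         = 2 * (norm w)\<^sup>2 * (\<bar>Re (Fw \<alpha> n (\<eta> t))\<bar> * \<bar>\<psi>' (N\<^sup>2)\<bar>)" by (simp add: abs_mult)
      also have "\<dots> \<le> 2 * (norm w)\<^sup>2 * C"
        by (intro mult_left_mono order_trans[OF mult_right_mono[OF a0] b2]) auto
      finally show ?thesis by (simp add: mult_ac)
    qed
    have "f'' t = Re (F2 (\<eta> t) * (cplx w)\<^sup>2) * \<psi> (N\<^sup>2) + 2 * Re (F1 (\<eta> t) * cplx w) * (\<psi>' (N\<^sup>2) * (2 * (y \<bullet> w)))
       + Re (Fw \<alpha> n (\<eta> t)) * (\<psi>'' (N\<^sup>2) * (2 * (y \<bullet> w))\<^sup>2) + Re (Fw \<alpha> n (\<eta> t)) * (\<psi>' (N\<^sup>2) * (2 * (norm w)\<^sup>2))"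
      by (simp only: f''_def QN y_def distrib_left add.assoc)
    then have "\<bar>f'' t\<bar> \<le> \<nu> * \<bar>\<nu> - 1\<bar> * C * (norm w)\<^sup>2 + 4 * \<nu> * C * (norm w)\<^sup>2 + 4 * C * (norm w)\<^sup>2 + 2 * C * (norm w)\<^sup>2"
      using t1 t2 t3 t4 by linarith
    also have "\<dots> = (\<nu> * \<bar>\<nu> - 1\<bar> + 4 * \<nu> + 6) * C * (norm w)\<^sup>2" by (simp add: algebra_simps)
    finally show "\<bar>f'' t\<bar> \<le> (\<nu> * \<bar>\<nu> - 1\<bar> + 4 * \<nu> + 6) * C * (norm w)\<^sup>2" .
  qed
  then show ?thesis
    by (simp add: f_def f'_def \<eta> Q_def P_def F1_def \<nu>_def grad_P_radial_def)
qed

lemma taylor_P_radial: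
  assumes \<alpha>: "0 < \<alpha>" "\<alpha> < 2 * pi"
    and d1: "\<And>q. (\<psi> has_real_derivative \<psi>' q) (at q)" and d2: "\<And>q. (\<psi>' has_real_derivative \<psi>'' q) (at q)"
    and B1: "\<And>r. 0 \<le> r \<Longrightarrow> rpow \<alpha> n r * \<bar>\<psi> (r\<^sup>2)\<bar> \<le> C * r\<^sup>2"
    and B2: "\<And>r. 0 \<le> r \<Longrightarrow> rpow \<alpha> n r * \<bar>\<psi>' (r\<^sup>2)\<bar> \<le> C"
    and B3: "\<And>r. 0 \<le> r \<Longrightarrow> rpow \<alpha> n r * \<bar>\<psi>'' (r\<^sup>2)\<bar> * r\<^sup>2 \<le> C"
    and z: "z \<in> wedge \<alpha>"
  defines "\<nu> \<equiv> real n * pi / \<alpha>" and "\<kappa> \<equiv> sin (\<alpha> / 2)"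
  shows "\<bar>P \<alpha> n (z + w) * \<psi> ((norm (z + w))\<^sup>2) - P \<alpha> n z * \<psi> ((norm z)\<^sup>2) - grad_P_radial \<alpha> n \<psi> \<psi>' z w\<bar>
     \<le> ((\<nu> * \<bar>\<nu> - 1\<bar> + 4 * \<nu> + 6) + (1 + 1 / \<kappa>)\<^sup>2 + (1 / \<kappa>)\<^sup>2 + (\<nu> + 2) / \<kappa>) * C * (norm w)\<^sup>2"
proof -
  have \<nu>: "0 \<le> \<nu>" using \<alpha> by (simp add: \<nu>_def)
  have \<kappa>: "0 < \<kappa>" using \<alpha> by (simp add: \<kappa>_def sin_gt_zero)
  have C: "0 \<le> C" using order_trans[OF _ B2[of 0]] by simp
  define A where "A = \<nu> * \<bar>\<nu> - 1\<bar> + 4 * \<nu> + 6"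
  define B where "B = (1 + 1 / \<kappa>)\<^sup>2 + (1 / \<kappa>)\<^sup>2 + (\<nu> + 2) / \<kappa>"
  have A0: "0 \<le> A" and B0: "0 \<le> B" using \<nu> \<kappa> by (auto simp: A_def B_def)
  have "\<bar>P \<alpha> n (z + w) * \<psi> ((norm (z + w))\<^sup>2) - P \<alpha> n z * \<psi> ((norm z)\<^sup>2) - grad_P_radial \<alpha> n \<psi> \<psi>' z w\<bar>
     \<le> (A + B) * C * (norm w)\<^sup>2"
  proof (cases "norm w < \<kappa> * norm z")
    case True
    have "\<bar>P \<alpha> n (z + w) * \<psi> ((norm (z + w))\<^sup>2) - P \<alpha> n z * \<psi> ((norm z)\<^sup>2) - grad_P_radial \<alpha> n \<psi> \<psi>' z w\<bar>
     \<le> A * C * (norm w)\<^sup>2"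
      unfolding A_def \<nu>_def by (rule taylor_P_radial_near[OF \<alpha> d1 d2 B1 B2 B3 z True[unfolded \<kappa>_def]])
    also have "\<dots> \<le> (A + B) * C * (norm w)\<^sup>2" using B0 C by (intro mult_right_mono) auto
    finally show ?thesis .
  next
    case False
    then have zw: "norm z \<le> norm w / \<kappa>" using \<kappa> by (simp add: field_simps)
    have U: "\<bar>P \<alpha> n y * \<psi> ((norm y)\<^sup>2)\<bar> \<le> C * (norm y)\<^sup>2" for y
    proof -
      have "\<bar>P \<alpha> n y * \<psi> ((norm y)\<^sup>2)\<bar> \<le> rpow \<alpha> n (norm y) * \<bar>\<psi> ((norm y)\<^sup>2)\<bar>"
        unfolding abs_mult by (rule mult_right_mono[OF abs_P_le_rpow]) simp
      also have "\<dots> \<le> C * (norm y)\<^sup>2" by (rule B1) simp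
      finally show ?thesis .
    qed
    have u1: "\<bar>P \<alpha> n (z + w) * \<psi> ((norm (z + w))\<^sup>2)\<bar> \<le> (1 + 1 / \<kappa>)\<^sup>2 * C * (norm w)\<^sup>2"
    proof -
      have "norm (z + w) \<le> (1 + 1 / \<kappa>) * norm w" using norm_triangle_ineq[of z w] zw by (simp add: algebra_simps)
      then have "(norm (z + w))\<^sup>2 \<le> ((1 + 1 / \<kappa>) * norm w)\<^sup>2" by (intro power_mono) auto
      from order_trans[OF U mult_left_mono[OF this C]] show ?thesis by (simp add: power_mult_distrib mult_ac)
    qed
    have u2: "\<bar>P \<alpha> n z * \<psi> ((norm z)\<^sup>2)\<bar> \<le> (1 / \<kappa>)\<^sup>2 * C * (norm w)\<^sup>2"
    proof -
      have "(norm z)\<^sup>2 \<le> (norm w / \<kappa>)\<^sup>2" using zw by (intro power_mono) auto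
      from order_trans[OF U mult_left_mono[OF this C]] show ?thesis by (simp add: power_divide mult_ac)
    qed
    have u3: "\<bar>grad_P_radial \<alpha> n \<psi> \<psi>' z w\<bar> \<le> (\<nu> + 2) / \<kappa> * C * (norm w)\<^sup>2"
    proof (cases "z = 0")
      case True
      then show ?thesis using \<nu> \<kappa> C by (simp add: grad_P_radial_def)
    next
      case False
      define N where "N = norm z"
      define R where "R = rpow \<alpha> n N"
      have N: "0 < N" using False by (simp add: N_def)
      have b1: "R * \<bar>\<psi> (N\<^sup>2)\<bar> \<le> C * N\<^sup>2" and b2: "R * \<bar>\<psi>' (N\<^sup>2)\<bar> \<le> C"
        unfolding R_def using N by (intro B1 B2, simp)+
      have "\<bar>Re (of_real (real n * pi / \<alpha>) * Fw \<alpha> n (cplx z) / cplx z * cplx w)\<bar> \<le> \<nu> * R / N * norm w"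
        using abs_Re_le_cmod[of "of_real (real n * pi / \<alpha>) * Fw \<alpha> n (cplx z) / cplx z * cplx w"] \<nu> \<alpha>
        by (simp add: norm_mult norm_divide norm_Fw_rpow R_def N_def \<nu>_def)
      then have "\<bar>Re (of_real (real n * pi / \<alpha>) * Fw \<alpha> n (cplx z) / cplx z * cplx w) * \<psi> (N\<^sup>2)\<bar> \<le> \<nu> * R / N * norm w * \<bar>\<psi> (N\<^sup>2)\<bar>"
        unfolding abs_mult[of _ "\<psi> (N\<^sup>2)"] by (rule mult_right_mono) simp
      also have "\<dots> = \<nu> * norm w / N * (R * \<bar>\<psi> (N\<^sup>2)\<bar>)" by simp
      also have "\<dots> \<le> \<nu> * norm w / N * (C * N\<^sup>2)" using \<nu> N by (intro mult_left_mono[OF b1]) auto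
      also have "\<dots> = \<nu> * C * norm w * N" using N by (simp add: power2_eq_square)
      finally have g1: "\<bar>Re (of_real (real n * pi / \<alpha>) * Fw \<alpha> n (cplx z) / cplx z * cplx w) * \<psi> (N\<^sup>2)\<bar> \<le> \<nu> * C * norm w * N" .
      have "\<bar>P \<alpha> n z * (\<psi>' (N\<^sup>2) * (2 * (z \<bullet> w)))\<bar> = 2 * (\<bar>P \<alpha> n z\<bar> * \<bar>\<psi>' (N\<^sup>2)\<bar>) * \<bar>z \<bullet> w\<bar>" by (simp add: abs_mult)
      also have "\<dots> \<le> 2 * C * (N * norm w)"
      proof (intro mult_mono)
        show "\<bar>P \<alpha> n z\<bar> * \<bar>\<psi>' (N\<^sup>2)\<bar> \<le> C"
        proof -
          have "\<bar>P \<alpha> n z\<bar> * \<bar>\<psi>' (N\<^sup>2)\<bar> \<le> R * \<bar>\<psi>' (N\<^sup>2)\<bar>"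
            unfolding R_def N_def by (rule mult_right_mono[OF abs_P_le_rpow]) simp
          then show ?thesis using b2 by linarith
        qed
        show "\<bar>z \<bullet> w\<bar> \<le> N * norm w" unfolding N_def by (rule Cauchy_Schwarz_ineq2)
      qed (use C in auto)
      finally have g2: "\<bar>P \<alpha> n z * (\<psi>' (N\<^sup>2) * (2 * (z \<bullet> w)))\<bar> \<le> 2 * C * (N * norm w)" .
      have "\<bar>grad_P_radial \<alpha> n \<psi> \<psi>' z w\<bar> \<le> \<nu> * C * norm w * N + 2 * C * (N * norm w)"
        using g1 g2 unfolding grad_P_radial_def N_def by linarith
      also have "\<dots> = (\<nu> + 2) * C * norm w * N" by (simp add: algebra_simps)
      also have "\<dots> \<le> (\<nu> + 2) * C * norm w * (norm w / \<kappa>)"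
        using zw \<nu> C by (intro mult_left_mono) (auto simp: N_def)
      finally show ?thesis by (simp add: power2_eq_square)
    qed
    have "\<bar>P \<alpha> n (z + w) * \<psi> ((norm (z + w))\<^sup>2) - P \<alpha> n z * \<psi> ((norm z)\<^sup>2) - grad_P_radial \<alpha> n \<psi> \<psi>' z w\<bar>
       \<le> (1 + 1 / \<kappa>)\<^sup>2 * C * (norm w)\<^sup>2 + (1 / \<kappa>)\<^sup>2 * C * (norm w)\<^sup>2 + (\<nu> + 2) / \<kappa> * C * (norm w)\<^sup>2"
      using u1 u2 u3 by linarith
    also have "\<dots> = B * C * (norm w)\<^sup>2" by (simp add: B_def algebra_simps)
    also have "\<dots> \<le> (A + B) * C * (norm w)\<^sup>2" using A0 C by (intro mult_right_mono) auto
    finally show ?thesis .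
  qed
  then show ?thesis by (simp add: A_def B_def add.assoc)
qed

lemma exp_diff_le:
  fixes a b :: real
  assumes "a \<le> b"
  shows "exp (- a) - exp (- b) \<le> (b - a) * exp (- a)"
proof -
  have "1 + (a - b) \<le> exp (a - b)" by (rule exp_ge_add_one_self)
  then have "exp (- a) * (1 + (a - b)) \<le> exp (- a) * exp (a - b)" by (intro mult_left_mono) auto
  also have "exp (- a) * exp (a - b) = exp (- b)" by (simp add: exp_add[symmetric])
  finally show ?thesis by (simp add: algebra_simps)
qed

lemma mult_exp_neg_le_1: "y * exp (- y) \<le> (1::real)"
proof -
  have "y * exp (- y) \<le> exp y * exp (- y)"
  proof (rule mult_right_mono)
    show "y \<le> exp y" using exp_ge_add_one_self[of y] by linarith
  qed simp
  then show ?thesis by (simp add: exp_add[symmetric])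
qed

text \<open>Supplies constants for \<open>taylor_P_radial\<close> with the profile exp(- m q) -
  exp(- \<Lambda> q), uniformly for m in [m0, m1]. The difference vanishes at q = 0, which gives the
  quadratic bound. Either \<Lambda> > 0 and everything decays, or \<Lambda> = 0 is combined with the
  bounded mode k = 0.\<close>

lemma radial_profile_bounds:
  assumes \<alpha>: "0 < \<alpha>" and m0: "0 < m0" and L: "(k = 0 \<and> \<Lambda> = 0) \<or> 0 < \<Lambda>"
  obtains C where "0 \<le> C"
    and "\<And>m r. m0 \<le> m \<Longrightarrow> m \<le> m1 \<Longrightarrow> 0 \<le> r \<Longrightarrow> rpow \<alpha> k r * \<bar>exp (- m * r\<^sup>2) - exp (- \<Lambda> * r\<^sup>2)\<bar> \<le> C * r\<^sup>2"
    and "\<And>m r. m0 \<le> m \<Longrightarrow> m \<le> m1 \<Longrightarrow> 0 \<le> r \<Longrightarrow> rpow \<alpha> k r * \<bar>exp (- m * r\<^sup>2) - exp (- \<Lambda> * r\<^sup>2)\<bar> \<le> C"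
    and "\<And>m r. m0 \<le> m \<Longrightarrow> m \<le> m1 \<Longrightarrow> 0 \<le> r \<Longrightarrow> rpow \<alpha> k r * \<bar>\<Lambda> * exp (- \<Lambda> * r\<^sup>2) - m * exp (- m * r\<^sup>2)\<bar> \<le> C"
    and "\<And>m r. m0 \<le> m \<Longrightarrow> m \<le> m1 \<Longrightarrow> 0 \<le> r \<Longrightarrow> rpow \<alpha> k r * \<bar>m\<^sup>2 * exp (- m * r\<^sup>2) - \<Lambda>\<^sup>2 * exp (- \<Lambda> * r\<^sup>2)\<bar> * r\<^sup>2 \<le> C"
    and "\<And>m r. m0 \<le> m \<Longrightarrow> m \<le> m1 \<Longrightarrow> 0 \<le> r \<Longrightarrow> rpow \<alpha> k r * (r\<^sup>2 * exp (- m * r\<^sup>2)) \<le> C"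
proof -
  have L0: "0 \<le> \<Lambda>" using L by auto
  \<comment> \<open>A common decay rate for all exponentials that do decay.\<close>
  define \<mu> where "\<mu> = (if \<Lambda> = 0 then m0 else min m0 \<Lambda>)"
  have \<mu>: "0 < \<mu>" "\<mu> \<le> m0" using m0 L by (auto simp: \<mu>_def)
  obtain A0 where A0: "0 \<le> A0" "\<And>r. 0 \<le> r \<Longrightarrow> rpow \<alpha> k r * r ^ 0 * exp (- \<mu> * r\<^sup>2) \<le> A0"
    using rpow_exp_bounded[OF \<alpha> \<mu>(1)] by blast
  obtain A2 where A2: "0 \<le> A2" "\<And>r. 0 \<le> r \<Longrightarrow> rpow \<alpha> k r * r ^ 2 * exp (- \<mu> * r\<^sup>2) \<le> A2"
    using rpow_exp_bounded[OF \<alpha> \<mu>(1)] by blast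
  define B where "B = max A0 (max A2 1)"
  have B: "0 \<le> B" "A0 \<le> B" "A2 \<le> B" "1 \<le> B" by (auto simp: B_def)
  define C where "C = ((\<bar>m1\<bar> + \<Lambda>) + 2 + (m1\<^sup>2 + \<Lambda>\<^sup>2) + 1) * B"
  have Cs: "(\<bar>m1\<bar> + \<Lambda>) * B \<le> C" "2 * B \<le> C" "(m1\<^sup>2 + \<Lambda>\<^sup>2) * B \<le> C" "1 * B \<le> C"
    unfolding C_def using B L0 by (intro mult_right_mono; simp)+
  have C0: "0 \<le> C" using Cs(4) B by simp
  have em: "exp (- m * r\<^sup>2) \<le> exp (- \<mu> * r\<^sup>2)" if "m0 \<le> m" for m r :: real
    using that \<mu> by (simp add: mult_right_mono)
  have eL: "rpow \<alpha> k r * exp (- \<Lambda> * r\<^sup>2) \<le> B" if "0 \<le> r" for r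
  proof (cases "\<Lambda> = 0")
    case True
    then have "k = 0" using L by auto
    then show ?thesis using True B by (simp add: rpow_def)
  next
    case False
    then have "\<mu> \<le> \<Lambda>" by (simp add: \<mu>_def)
    then have "exp (- \<Lambda> * r\<^sup>2) \<le> exp (- \<mu> * r\<^sup>2)" by (simp add: mult_right_mono)
    then have "rpow \<alpha> k r * exp (- \<Lambda> * r\<^sup>2) \<le> rpow \<alpha> k r * exp (- \<mu> * r\<^sup>2)" by (intro mult_left_mono) auto
    then show ?thesis using A0(2)[OF that] B by simp
  qed
  have eM: "rpow \<alpha> k r * exp (- m * r\<^sup>2) \<le> B" if "0 \<le> r" "m0 \<le> m" for r m
  proof -
    have "rpow \<alpha> k r * exp (- m * r\<^sup>2) \<le> rpow \<alpha> k r * exp (- \<mu> * r\<^sup>2)" using em[OF that(2)] by (intro mult_left_mono) auto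
    then show ?thesis using A0(2)[OF that(1)] B by simp
  qed
  have eM2: "rpow \<alpha> k r * (r\<^sup>2 * exp (- m * r\<^sup>2)) \<le> B" if "0 \<le> r" "m0 \<le> m" for r m
  proof -
    have "rpow \<alpha> k r * (r\<^sup>2 * exp (- m * r\<^sup>2)) \<le> rpow \<alpha> k r * (r\<^sup>2 * exp (- \<mu> * r\<^sup>2))"
      using em[OF that(2)] by (intro mult_left_mono) auto
    then show ?thesis using A2(2)[OF that(1)] B by (simp add: mult.assoc)
  qed
  have eL2: "\<Lambda>\<^sup>2 * (rpow \<alpha> k r * (r\<^sup>2 * exp (- \<Lambda> * r\<^sup>2))) \<le> \<Lambda>\<^sup>2 * B" if "0 \<le> r" for r
  proof (cases "\<Lambda> = 0")
    case False
    then have "\<mu> \<le> \<Lambda>" by (simp add: \<mu>_def)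
    then have "exp (- \<Lambda> * r\<^sup>2) \<le> exp (- \<mu> * r\<^sup>2)" by (simp add: mult_right_mono)
    then have "rpow \<alpha> k r * (r\<^sup>2 * exp (- \<Lambda> * r\<^sup>2)) \<le> rpow \<alpha> k r * (r\<^sup>2 * exp (- \<mu> * r\<^sup>2))"
      by (intro mult_left_mono) auto
    then have "rpow \<alpha> k r * (r\<^sup>2 * exp (- \<Lambda> * r\<^sup>2)) \<le> B"
      using A2(2)[OF that] B by (simp add: mult.assoc)
    then show ?thesis by (intro mult_left_mono) auto
  qed simp
  show thesis
  proof (rule that[OF C0])
    fix m r :: real assume m: "m0 \<le> m" "m \<le> m1" and r: "0 \<le> r"
    have m': "0 < m" "0 \<le> m1" using m m0 by auto
    let ?R = "rpow \<alpha> k r"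
    have R0: "0 \<le> ?R" by simp
    show "?R * \<bar>exp (- m * r\<^sup>2) - exp (- \<Lambda> * r\<^sup>2)\<bar> \<le> C * r\<^sup>2"
    proof -
      have "?R * \<bar>exp (- m * r\<^sup>2) - exp (- \<Lambda> * r\<^sup>2)\<bar> \<le> (m1 + \<Lambda>) * r\<^sup>2 * B"
      proof (cases "m \<le> \<Lambda>")
        case True
        then have mr: "m * r\<^sup>2 \<le> \<Lambda> * r\<^sup>2" by (intro mult_right_mono) auto
        have "\<bar>exp (- m * r\<^sup>2) - exp (- \<Lambda> * r\<^sup>2)\<bar> \<le> (\<Lambda> * r\<^sup>2 - m * r\<^sup>2) * exp (- m * r\<^sup>2)"
          using exp_diff_le[OF mr] mr by simp
        then have "?R * \<bar>exp (- m * r\<^sup>2) - exp (- \<Lambda> * r\<^sup>2)\<bar> \<le> ?R * ((\<Lambda> * r\<^sup>2 - m * r\<^sup>2) * exp (- m * r\<^sup>2))"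
          by (intro mult_left_mono) auto
        also have "\<dots> = (\<Lambda> - m) * r\<^sup>2 * (?R * exp (- m * r\<^sup>2))" by (simp add: algebra_simps)
        also have "\<dots> \<le> (m1 + \<Lambda>) * r\<^sup>2 * B"
          using eM[OF r m(1)] True m' L0 B by (intro mult_mono) auto
        finally show ?thesis .
      next
        case False
        then have mr: "\<Lambda> * r\<^sup>2 \<le> m * r\<^sup>2" by (intro mult_right_mono) auto
        have "\<bar>exp (- m * r\<^sup>2) - exp (- \<Lambda> * r\<^sup>2)\<bar> \<le> (m * r\<^sup>2 - \<Lambda> * r\<^sup>2) * exp (- \<Lambda> * r\<^sup>2)"
          using exp_diff_le[OF mr] mr by simp
        then have "?R * \<bar>exp (- m * r\<^sup>2) - exp (- \<Lambda> * r\<^sup>2)\<bar> \<le> ?R * ((m * r\<^sup>2 - \<Lambda> * r\<^sup>2) * exp (- \<Lambda> * r\<^sup>2))"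
          by (intro mult_left_mono) auto
        also have "\<dots> = (m - \<Lambda>) * r\<^sup>2 * (?R * exp (- \<Lambda> * r\<^sup>2))" by (simp add: algebra_simps)
        also have "\<dots> \<le> (m1 + \<Lambda>) * r\<^sup>2 * B"
          using eL[OF r] False m m' L0 B by (intro mult_mono) auto
        finally show ?thesis .
      qed
      also have "\<dots> = ((\<bar>m1\<bar> + \<Lambda>) * B) * r\<^sup>2" using m' by simp
      also have "\<dots> \<le> C * r\<^sup>2" by (intro mult_right_mono Cs) auto
      finally show ?thesis .
    qed
    show "?R * \<bar>exp (- m * r\<^sup>2) - exp (- \<Lambda> * r\<^sup>2)\<bar> \<le> C"
    proof -
      have "?R * \<bar>exp (- m * r\<^sup>2) - exp (- \<Lambda> * r\<^sup>2)\<bar> \<le> ?R * (exp (- m * r\<^sup>2) + exp (- \<Lambda> * r\<^sup>2))"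
        by (intro mult_left_mono) (auto simp: abs_le_iff intro: add_increasing add_increasing2)
      then show ?thesis using eM[OF r m(1)] eL[OF r] Cs(2) by (simp add: distrib_left)
    qed
    show "?R * \<bar>\<Lambda> * exp (- \<Lambda> * r\<^sup>2) - m * exp (- m * r\<^sup>2)\<bar> \<le> C"
    proof -
      have "\<bar>\<Lambda> * exp (- \<Lambda> * r\<^sup>2) - m * exp (- m * r\<^sup>2)\<bar> \<le> \<Lambda> * exp (- \<Lambda> * r\<^sup>2) + m * exp (- m * r\<^sup>2)"
        using L0 m' by (simp add: abs_le_iff)
      then have "?R * \<bar>\<Lambda> * exp (- \<Lambda> * r\<^sup>2) - m * exp (- m * r\<^sup>2)\<bar> \<le> ?R * (\<Lambda> * exp (- \<Lambda> * r\<^sup>2) + m * exp (- m * r\<^sup>2))"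
        by (intro mult_left_mono) auto
      also have "\<dots> = \<Lambda> * (?R * exp (- \<Lambda> * r\<^sup>2)) + m * (?R * exp (- m * r\<^sup>2))" by (simp add: algebra_simps)
      also have "\<dots> \<le> \<Lambda> * B + m1 * B"
        using eL[OF r] eM[OF r m(1)] L0 m m' B by (intro add_mono mult_mono) auto
      also have "\<dots> \<le> C" using Cs(1) m' by (simp add: algebra_simps)
      finally show ?thesis .
    qed
    show "?R * \<bar>m\<^sup>2 * exp (- m * r\<^sup>2) - \<Lambda>\<^sup>2 * exp (- \<Lambda> * r\<^sup>2)\<bar> * r\<^sup>2 \<le> C"
    proof -
      have "\<bar>m\<^sup>2 * exp (- m * r\<^sup>2) - \<Lambda>\<^sup>2 * exp (- \<Lambda> * r\<^sup>2)\<bar> \<le> m\<^sup>2 * exp (- m * r\<^sup>2) + \<Lambda>\<^sup>2 * exp (- \<Lambda> * r\<^sup>2)"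
        by (simp add: abs_le_iff)
      then have "?R * \<bar>m\<^sup>2 * exp (- m * r\<^sup>2) - \<Lambda>\<^sup>2 * exp (- \<Lambda> * r\<^sup>2)\<bar> * r\<^sup>2 \<le> ?R * (m\<^sup>2 * exp (- m * r\<^sup>2) + \<Lambda>\<^sup>2 * exp (- \<Lambda> * r\<^sup>2)) * r\<^sup>2"
        by (intro mult_right_mono mult_left_mono) auto
      also have "\<dots> = m\<^sup>2 * (?R * (r\<^sup>2 * exp (- m * r\<^sup>2))) + \<Lambda>\<^sup>2 * (?R * (r\<^sup>2 * exp (- \<Lambda> * r\<^sup>2)))"
        by (simp add: algebra_simps)
      also have "\<dots> \<le> m1\<^sup>2 * B + \<Lambda>\<^sup>2 * B"
        using eM2[OF r m(1)] m m' B by (intro add_mono[OF _ eL2[OF r]] mult_mono power_mono) auto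
      also have "\<dots> \<le> C" using Cs(3) by (simp add: algebra_simps)
      finally show ?thesis .
    qed
    show "?R * (r\<^sup>2 * exp (- m * r\<^sup>2)) \<le> C" using eM2[OF r m(1)] Cs(4) by simp
  qed
qed

section \<open>Damped heat modes\<close>

text \<open>The heat flow over time t turns exp(- l |z|^2) into c exp(- l c |z|^2) with c =
  \<open>contr l t\<close>.\<close>

definition contr :: "real \<Rightarrow> real \<Rightarrow> real" where
  "contr l t = 1 / (1 + 2 * l * t)"

lemma contr_bounds:
  assumes "0 \<le> l" "0 \<le> t"
  shows "0 < contr l t" "contr l t \<le> 1" "1 - contr l t \<le> 2 * l * t"
proof -
  have lt: "0 \<le> l * t" using assms by simp
  show "0 < contr l t" "contr l t \<le> 1" using lt by (auto simp: contr_def)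
  have "1 - contr l t = 2 * (l * t) / (1 + 2 * (l * t))" using lt by (simp add: contr_def field_simps)
  also have "\<dots> \<le> 2 * (l * t) / 1" using lt by (intro divide_left_mono) auto
  finally show "1 - contr l t \<le> 2 * l * t" by simp
qed

text \<open>The semigroup law of the heat flow, read off from Gaussian profiles. Because of it the
  main terms of successive time steps cancel exactly.\<close>

lemma contr_semigroup:
  assumes "0 \<le> l" "0 \<le> s" "0 \<le> t"
  shows "contr l s * contr (l * contr l s) t = contr l (s + t)"
proof -
  have "0 \<le> l * s" "0 \<le> l * t" using assms by simp_all
  then have "1 + 2 * l * s \<noteq> 0" "1 + 2 * l * (s + t) \<noteq> 0" by (simp_all add: distrib_left)
  then show ?thesis by (simp add: contr_def divide_simps) (simp add: algebra_simps)
qed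

text \<open>The summand with exponent \<open>l * contr l (T - s)\<close> is the backward heat
  solution with terminal value P(z) exp(- l |z|^2). The subtracted summand is a cut-off at the
  vertex: it makes the function of order |z|^(\<nu> + 2) there, so that a quadratic Taylor bound
  holds, but it does not solve the heat equation.\<close>

definition heat_mode :: "real \<Rightarrow> nat \<Rightarrow> real \<Rightarrow> real \<Rightarrow> real \<Rightarrow> real \<Rightarrow> real^2 \<Rightarrow> real" where
  "heat_mode \<alpha> k l \<Lambda> T s z = P \<alpha> k z * (contr l (T - s) powr (real k * pi / \<alpha> + 1) *
     (exp (- (l * contr l (T - s)) * (norm z)\<^sup>2) - exp (- \<Lambda> * (norm z)\<^sup>2)))"

context wedge_rbm
begin

text \<open>The hypotheses of \<open>discrete_ito\<close> hold for the damped modes: the Taylor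
  bound comes from \<open>taylor_P_radial\<close>, the Neumann condition from
  \<open>grad_P_radial_normal\<close>, and the time regularity from the mean value theorem.\<close>

lemma heat_mode_limit:
  assumes T: "0 < T" and l: "0 < l" and L: "(k = 0 \<and> \<Lambda> = 0) \<or> 0 < \<Lambda>"
  shows "(\<lambda>N. \<Sum>i<Suc N. expectation (\<lambda>\<omega>.
      (\<integral>z. heat_mode \<alpha> k l \<Lambda> T (real (Suc i) * (T / real (Suc N))) (X (real i * (T / real (Suc N))) \<omega> + z) \<partial>gauss (T / real (Suc N)))
       - heat_mode \<alpha> k l \<Lambda> T (real i * (T / real (Suc N))) (X (real i * (T / real (Suc N))) \<omega>)))
     \<longlonglongrightarrow> expectation (\<lambda>\<omega>. heat_mode \<alpha> k l \<Lambda> T T (X T \<omega>)) - heat_mode \<alpha> k l \<Lambda> T 0 x"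
proof -
  define \<nu> where "\<nu> = real k * pi / \<alpha>"
  define p where "p = \<nu> + 1"
  have \<nu>: "0 \<le> \<nu>" using \<alpha> by (simp add: \<nu>_def)
  then have p: "1 \<le> p" by (simp add: p_def)
  define c where "c s = contr l (T - s)" for s
  \<comment> \<open>The exponent l c(s) increases from \<open>m0\<close> at s = 0 to l at s = T, so
    it stays in a compact interval of positive rates.\<close>
  define m0 where "m0 = l * contr l T"
  have c: "0 < c s" "c s \<le> 1" "m0 \<le> l * c s" "l * c s \<le> l" if "0 \<le> s" "s \<le> T" for s
  proof -
    show c1: "0 < c s" "c s \<le> 1" using contr_bounds[of l "T - s"] l that by (auto simp: c_def)
    show "l * c s \<le> l" using c1 l by simp
    have "1 + 2 * l * (T - s) \<le> 1 + 2 * l * T" using l that by simp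
    moreover have "0 < 1 + 2 * l * (T - s)" using l that by (intro add_pos_nonneg) auto
    ultimately have "contr l T \<le> c s" unfolding c_def contr_def by (intro divide_left_mono mult_pos_pos) auto
    then show "m0 \<le> l * c s" using l by (simp add: m0_def)
  qed
  have m0: "0 < m0" using contr_bounds(1)[of l T] l T by (simp add: m0_def)
  obtain C where C: "0 \<le> C"
    "\<And>m r. m0 \<le> m \<Longrightarrow> m \<le> l \<Longrightarrow> 0 \<le> r \<Longrightarrow> rpow \<alpha> k r * \<bar>exp (- m * r\<^sup>2) - exp (- \<Lambda> * r\<^sup>2)\<bar> \<le> C * r\<^sup>2"
    "\<And>m r. m0 \<le> m \<Longrightarrow> m \<le> l \<Longrightarrow> 0 \<le> r \<Longrightarrow> rpow \<alpha> k r * \<bar>exp (- m * r\<^sup>2) - exp (- \<Lambda> * r\<^sup>2)\<bar> \<le> C"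
    "\<And>m r. m0 \<le> m \<Longrightarrow> m \<le> l \<Longrightarrow> 0 \<le> r \<Longrightarrow> rpow \<alpha> k r * \<bar>\<Lambda> * exp (- \<Lambda> * r\<^sup>2) - m * exp (- m * r\<^sup>2)\<bar> \<le> C"
    "\<And>m r. m0 \<le> m \<Longrightarrow> m \<le> l \<Longrightarrow> 0 \<le> r \<Longrightarrow> rpow \<alpha> k r * \<bar>m\<^sup>2 * exp (- m * r\<^sup>2) - \<Lambda>\<^sup>2 * exp (- \<Lambda> * r\<^sup>2)\<bar> * r\<^sup>2 \<le> C"
    "\<And>m r. m0 \<le> m \<Longrightarrow> m \<le> l \<Longrightarrow> 0 \<le> r \<Longrightarrow> rpow \<alpha> k r * (r\<^sup>2 * exp (- m * r\<^sup>2)) \<le> C"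
  proof (rule radial_profile_bounds[OF \<alpha>(1) m0 L, of l])
  qed (rule that)
  define a where "a s = c s powr p" for s
  have a: "0 \<le> a s" "a s \<le> 1" if "0 \<le> s" "s \<le> T" for s
    using c(1,2)[OF that] p powr_mono2[of p "c s" 1] by (auto simp: a_def)
  define \<psi> where "\<psi> s q = a s * (exp (- (l * c s) * q) - exp (- \<Lambda> * q))" for s q
  define \<psi>' where "\<psi>' s q = a s * (\<Lambda> * exp (- \<Lambda> * q) - (l * c s) * exp (- (l * c s) * q))" for s q
  define \<psi>'' where "\<psi>'' s q = a s * ((l * c s)\<^sup>2 * exp (- (l * c s) * q) - \<Lambda>\<^sup>2 * exp (- \<Lambda> * q))" for s q
  have d1: "(\<psi> s has_real_derivative \<psi>' s q) (at q)" for s q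
    unfolding \<psi>_def[abs_def] \<psi>'_def by (auto intro!: derivative_eq_intros simp: algebra_simps)
  have d2: "(\<psi>' s has_real_derivative \<psi>'' s q) (at q)" for s q
    unfolding \<psi>'_def[abs_def] \<psi>''_def by (auto intro!: derivative_eq_intros simp: power2_eq_square algebra_simps)
  have am: "R * \<bar>a s * e\<bar> * t \<le> B" if "R * \<bar>e\<bar> * t \<le> B" "0 \<le> s" "s \<le> T" "0 \<le> R" "0 \<le> t" for R e t B s :: real
  proof -
    have "R * \<bar>a s * e\<bar> * t = a s * (R * \<bar>e\<bar> * t)" using a[OF that(2,3)] by (simp add: abs_mult)
    also have "\<dots> \<le> 1 * (R * \<bar>e\<bar> * t)" using a[OF that(2,3)] that by (intro mult_right_mono) auto
    finally show ?thesis using that by simp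
  qed
  have am1: "R * \<bar>a s * e\<bar> \<le> B" if "R * \<bar>e\<bar> \<le> B" "0 \<le> s" "s \<le> T" "0 \<le> R" for R e B s :: real
    using am[of R e 1 B s] that by simp
  have B1: "rpow \<alpha> k r * \<bar>\<psi> s (r\<^sup>2)\<bar> \<le> C * r\<^sup>2" "rpow \<alpha> k r * \<bar>\<psi> s (r\<^sup>2)\<bar> \<le> C"
    and B2: "rpow \<alpha> k r * \<bar>\<psi>' s (r\<^sup>2)\<bar> \<le> C"
    and B3: "rpow \<alpha> k r * \<bar>\<psi>'' s (r\<^sup>2)\<bar> * r\<^sup>2 \<le> C" if s: "0 \<le> s" "s \<le> T" and r: "0 \<le> r" for r s
    unfolding \<psi>_def \<psi>'_def \<psi>''_def
    using C(2-5)[OF c(3,4)[OF s] r] s by (auto intro!: am am1)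
  define K1 where "K1 = ((\<nu> * \<bar>\<nu> - 1\<bar> + 4 * \<nu> + 6) + (1 + 1 / sin (\<alpha>/2))\<^sup>2 + (1 / sin (\<alpha>/2))\<^sup>2 + (\<nu> + 2) / sin (\<alpha>/2)) * C"
  define K2 where "K2 = p * (2 * l) * C + 2 * l * l * C"
  define K where "K = K1 + 2 * C + K2"
  have sin0: "0 < sin (\<alpha>/2)" using \<alpha> by (simp add: sin_gt_zero)
  have K1: "0 \<le> K1" using C \<nu> sin0 by (auto simp: K1_def intro!: mult_nonneg_nonneg add_nonneg_nonneg)
  have K2: "0 \<le> K2" using C l p by (auto simp: K2_def)
  have u: "heat_mode \<alpha> k l \<Lambda> T s z = P \<alpha> k z * \<psi> s ((norm z)\<^sup>2)" for s z
    by (simp add: heat_mode_def \<psi>_def a_def c_def p_def \<nu>_def)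
  have ub: "\<bar>heat_mode \<alpha> k l \<Lambda> T s z\<bar> \<le> C" if "0 \<le> s" "s \<le> T" for s z
  proof -
    have "\<bar>heat_mode \<alpha> k l \<Lambda> T s z\<bar> \<le> rpow \<alpha> k (norm z) * \<bar>\<psi> s ((norm z)\<^sup>2)\<bar>"
      unfolding u abs_mult by (rule mult_right_mono[OF abs_P_le_rpow]) simp
    also have "\<dots> \<le> C" using that by (intro B1) auto
    finally show ?thesis .
  qed
  have tay: "\<bar>heat_mode \<alpha> k l \<Lambda> T s (z + w) - heat_mode \<alpha> k l \<Lambda> T s z - grad_P_radial \<alpha> k (\<psi> s) (\<psi>' s) z w\<bar> \<le> K1 * (norm w)\<^sup>2"
    if "0 \<le> s" "s \<le> T" "z \<in> wedge \<alpha>" for s z w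
    unfolding u K1_def \<nu>_def
    by (rule taylor_P_radial[OF \<alpha> d1 d2 B1(1)[OF that(1,2)] B2[OF that(1,2)] B3[OF that(1,2)] that(3)])
  show ?thesis
  proof (rule discrete_ito[OF T, where K = K and g = "\<lambda>s. grad_P_radial \<alpha> k (\<psi> s) (\<psi>' s)"])
    show "heat_mode \<alpha> k l \<Lambda> T s \<in> borel_measurable borel" for s
      unfolding heat_mode_def[abs_def] by measurable
    show "\<bar>heat_mode \<alpha> k l \<Lambda> T s z\<bar> \<le> K" if "0 \<le> s" "s \<le> T" for s z
      using ub[OF that, of z] K1 K2 C(1) by (simp add: K_def)
    show "linear (grad_P_radial \<alpha> k (\<psi> s) (\<psi>' s) z)" for s z by (rule linear_grad_P_radial)
    show "\<bar>heat_mode \<alpha> k l \<Lambda> T s (z + w) - heat_mode \<alpha> k l \<Lambda> T s z - grad_P_radial \<alpha> k (\<psi> s) (\<psi>' s) z w\<bar> \<le> K * (norm w)\<^sup>2"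
      if "0 \<le> s" "s \<le> T" "z \<in> wedge \<alpha>" for s z w
      using tay[OF that, of w] K2 C(1) mult_right_mono[of K1 K "(norm w)\<^sup>2"] by (simp add: K_def)
    show "\<bar>grad_P_radial \<alpha> k (\<psi> s) (\<psi>' s) z w\<bar> \<le> K * norm w" if sz: "0 \<le> s" "s \<le> T" "z \<in> wedge \<alpha>" for s z w
    proof (cases "w = 0")
      case True
      then show ?thesis using linear_0[OF linear_grad_P_radial] by simp
    next
      case False
      \<comment> \<open>The gradient bound follows from the Taylor bound at a unit vector together
        with the uniform bound C on the function.\<close>
      let ?g = "grad_P_radial \<alpha> k (\<psi> s) (\<psi>' s) z" and ?e = "(1 / norm w) *\<^sub>R w"
      have "\<bar>?g ?e\<bar> \<le> K1 + 2 * C"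
        using tay[OF sz, of ?e] ub[OF sz(1,2), of z] ub[OF sz(1,2), of "z + ?e"] False by simp
      moreover have "?g w = norm w * ?g ?e"
        using False by (simp add: linear_scale[OF linear_grad_P_radial])
      ultimately have "\<bar>?g w\<bar> \<le> norm w * (K1 + 2 * C)"
        by (simp add: abs_mult mult_left_mono)
      also have "\<dots> \<le> norm w * K" using K2 by (intro mult_left_mono) (auto simp: K_def)
      finally show ?thesis by (simp add: mult.commute)
    qed
    show "grad_P_radial \<alpha> k (\<psi> s) (\<psi>' s) z (n z) = 0" if z: "z \<in> frontier (wedge \<alpha>)" for s z
    proof -
      obtain r where r: "0 \<le> r" "z = polar r 0 \<or> z = polar r \<alpha>"
        using frontier_wedge[OF \<alpha> z] by blast
      show ?thesis
      proof (cases "r = 0")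
        case True
        then have "z = 0" using r by (auto simp: polar_def vec_eq_iff forall_2)
        then show ?thesis by (simp add: grad_P_radial_def)
      next
        case False
        then have rp: "0 < r" using r by simp
        then show ?thesis using r(2) normal_on_rays[OF rp] grad_P_radial_normal[OF \<alpha> rp] by auto
      qed
    qed
    show "\<bar>heat_mode \<alpha> k l \<Lambda> T t z - heat_mode \<alpha> k l \<Lambda> T s z\<bar> \<le> K * (t - s)"
      if st: "0 \<le> s" "s \<le> t" "t \<le> T" for s t z
    proof (cases "s = t")
      case False
      then have lt: "s < t" using st by simp
      let ?q = "(norm z)\<^sup>2"
      \<comment> \<open>The time derivative of the profile, using c' = 2 l c^2.\<close>
      define v' where "v' r = p * c r powr (p - 1) * (2 * l * (c r)\<^sup>2) * (exp (- (l * c r) * ?q) - exp (- \<Lambda> * ?q))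
          + c r powr p * (- (l * (2 * l * (c r)\<^sup>2)) * ?q * exp (- (l * c r) * ?q))" for r
      have dc: "(c has_real_derivative 2 * l * (c r)\<^sup>2) (at r)" if "0 \<le> r" "r \<le> T" for r
      proof -
        have nz: "1 + 2 * l * (T - r) \<noteq> 0" using l that by (smt (verit) mult_nonneg_nonneg)
        show ?thesis unfolding c_def[abs_def] contr_def
          by (rule derivative_eq_intros refl nz)+ (use nz in \<open>simp add: power2_eq_square\<close>)
      qed
      have dv: "((\<lambda>r. \<psi> r ?q) has_real_derivative v' r) (at r)" if r: "0 \<le> r" "r \<le> T" for r
      proof -
        have e: "((\<lambda>r. exp (- (l * c r) * ?q)) has_real_derivative - (l * (2 * l * (c r)\<^sup>2)) * ?q * exp (- (l * c r) * ?q)) (at r)"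
          by (auto intro!: derivative_eq_intros dc r)
        have pw: "((\<lambda>r. c r powr p) has_real_derivative p * c r powr (p - 1) * (2 * l * (c r)\<^sup>2)) (at r)"
          by (rule DERIV_cong[OF DERIV_fun_powr[OF dc[OF r] c(1)[OF r]]]) simp
        show ?thesis
          unfolding \<psi>_def a_def v'_def
          by (rule DERIV_cong[OF DERIV_mult[OF pw DERIV_diff[OF e DERIV_const]]]) simp
      qed
      obtain r where r: "s < r" "r < t" "\<psi> t ?q - \<psi> s ?q = (t - s) * v' r"
        using MVT2[OF lt, of "\<lambda>r. \<psi> r ?q" v'] dv st by auto
      have rT: "0 \<le> r" "r \<le> T" using r st by auto
      have cr: "0 < c r" "c r \<le> 1" using c[OF rT] by auto
      have cp: "c r powr (p - 1) \<le> 1" "c r powr p \<le> 1" using cr p powr_mono2[of _ "c r" 1] by auto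
      have c2: "(c r)\<^sup>2 \<le> 1" using cr by (simp add: power_le_one)
      let ?R = "rpow \<alpha> k (norm z)"
      have v1: "\<bar>p * c r powr (p - 1) * (2 * l * (c r)\<^sup>2) * (exp (- (l * c r) * ?q) - exp (- \<Lambda> * ?q))\<bar>
          \<le> p * (2 * l) * \<bar>exp (- (l * c r) * ?q) - exp (- \<Lambda> * ?q)\<bar>"
      proof -
        have "p * c r powr (p - 1) * (2 * l * (c r)\<^sup>2) \<le> p * 1 * (2 * l * 1)"
          using p l cp c2 by (intro mult_mono) auto
        then show ?thesis using p l by (simp add: abs_mult mult_right_mono)
      qed
      have v2: "\<bar>c r powr p * (- (l * (2 * l * (c r)\<^sup>2)) * ?q * exp (- (l * c r) * ?q))\<bar> \<le> 2 * l * l * (?q * exp (- (l * c r) * ?q))"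
      proof -
        have "c r powr p * (l * (2 * l * (c r)\<^sup>2)) \<le> 1 * (l * (2 * l * 1))"
          using p l cp c2 by (intro mult_mono) auto
        then have "(c r powr p * (l * (2 * l * (c r)\<^sup>2))) * (?q * exp (- (l * c r) * ?q)) \<le> (1 * (l * (2 * l * 1))) * (?q * exp (- (l * c r) * ?q))"
          by (rule mult_right_mono) simp
        then show ?thesis using l by (simp add: abs_mult mult_ac)
      qed
      have "?R * \<bar>v' r\<bar> \<le> ?R * (p * (2 * l) * \<bar>exp (- (l * c r) * ?q) - exp (- \<Lambda> * ?q)\<bar> + 2 * l * l * (?q * exp (- (l * c r) * ?q)))"
        unfolding v'_def using v1 v2 by (intro mult_left_mono) auto
      also have "\<dots> = p * (2 * l) * (?R * \<bar>exp (- (l * c r) * ?q) - exp (- \<Lambda> * ?q)\<bar>) + 2 * l * l * (?R * (?q * exp (- (l * c r) * ?q)))"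
        by (simp add: algebra_simps)
      also have "\<dots> \<le> p * (2 * l) * C + 2 * l * l * C"
        using p l C(3,6)[OF c(3,4)[OF rT], of "norm z"] by (intro add_mono mult_left_mono) auto
      finally have Rv: "?R * \<bar>v' r\<bar> \<le> K2" by (simp add: K2_def)
      have "\<bar>heat_mode \<alpha> k l \<Lambda> T t z - heat_mode \<alpha> k l \<Lambda> T s z\<bar> = \<bar>P \<alpha> k z\<bar> * ((t - s) * \<bar>v' r\<bar>)"
        unfolding u right_diff_distrib[symmetric] r(3) abs_mult using lt by simp
      also have "\<dots> \<le> ?R * ((t - s) * \<bar>v' r\<bar>)"
        using lt by (intro mult_right_mono abs_P_le_rpow) auto
      also have "\<dots> = (t - s) * (?R * \<bar>v' r\<bar>)" by simp
      also have "\<dots> \<le> (t - s) * K" using lt Rv K1 C(1) by (intro mult_left_mono) (auto simp: K_def)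
      finally show ?thesis by (simp add: mult.commute)
    qed simp
  qed
qed

end

section \<open>Moments of the modes and removal of the cut-off\<close>

text \<open>Comparison of a Riemann sum with the integral of 1 / (1 + b s); the term at i = 0 is
  paid for by the extra h.\<close>

lemma sum_inverse_linear_le:
  fixes b h :: real
  assumes b: "0 < b" and h: "0 < h"
  shows "(\<Sum>i<N. h / (1 + b * (real i * h))) \<le> h + (1 / b) * ln (1 + b * (real N * h))"
proof -
  have ln0: "0 \<le> (1 / b) * ln (1 + b * (real N * h))" for N using b h by simp
  have "(\<Sum>i<Suc N. h / (1 + b * (real i * h))) \<le> h + (1 / b) * ln (1 + b * (real N * h))" for N
  proof (induction N)
    case (Suc N)
    define u where "u = 1 + b * (real N * h)"
    define v where "v = 1 + b * (real (Suc N) * h)"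
    have u: "0 < u" using b h by (simp add: u_def add_pos_nonneg)
    have vu: "v = u + b * h" by (simp add: v_def u_def algebra_simps)
    have v: "0 < v" using u b h by (simp add: vu add_pos_pos)
    have "ln (u / v) \<le> u / v - 1" using u v by (intro ln_le_minus_one) simp
    also have "\<dots> = - (b * h / v)" using v by (simp add: vu field_simps)
    finally have "b * h / v \<le> ln v - ln u" using u v by (simp add: ln_div)
    then have "h / v \<le> (1 / b) * (ln v - ln u)" using b by (simp add: field_simps)
    then have "(\<Sum>i<Suc (Suc N). h / (1 + b * (real i * h))) \<le> h + (1 / b) * ln u + (1 / b) * (ln v - ln u)"
      using Suc.IH by (simp add: u_def v_def)
    then show ?case by (simp add: v_def algebra_simps)
  qed simp
  from this[of "N - 1"] show ?thesis
  proof (cases N)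
    case 0
    then show ?thesis using h by simp
  next
    case (Suc m)
    have "(1 / b) * ln (1 + b * (real m * h)) \<le> (1 / b) * ln (1 + b * (real N * h))"
      using b h Suc by (intro mult_left_mono ln_mono add_left_mono mult_right_mono add_pos_nonneg) auto
    then show ?thesis using \<open>(\<Sum>i<Suc (N - 1). _) \<le> _\<close> Suc by simp
  qed
qed

lemma one_minus_powr_le:
  fixes y p :: real
  assumes "0 < y" "y \<le> 1" "1 \<le> p"
  shows "1 - y powr p \<le> p * (1 - y)"
proof (cases "y = 1")
  case False
  then have y: "y < 1" using assms by simp
  have "\<exists>z. y < z \<and> z < 1 \<and> 1 powr p - y powr p = (1 - y) * (p * z powr (p - 1))"
    using assms by (intro MVT2[OF y]) (auto intro!: derivative_eq_intros)
  then obtain z where z: "y < z" "z < 1" "1 - y powr p = (1 - y) * (p * z powr (p - 1))" by auto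
  have "z powr (p - 1) \<le> 1" using z assms powr_mono2[of "p - 1" z 1] by auto
  then have "(1 - y) * (p * z powr (p - 1)) \<le> (1 - y) * (p * 1)" using assms by (intro mult_left_mono) auto
  then show ?thesis using z by (simp add: mult.commute)
qed simp

context wedge_rbm
begin

text \<open>For k = 0 the mode is constant, there is no branch cut, and one Gaussian step is
  computed exactly. With \<Lambda> = 0 the cut-off subtracts c(T - s), so every step has a
  deterministic drift, and these telescope to \<open>contr l T - 1\<close>.\<close>

lemma radial_moment:
  assumes T: "0 < T" and l: "0 < l"
  shows "expectation (\<lambda>\<omega>. exp (- l * (norm (X T \<omega>))\<^sup>2)) = contr l T * exp (- (l * contr l T) * (norm x)\<^sup>2)"
proof -
  have hm: "heat_mode \<alpha> 0 l 0 T s z = contr l (T - s) * (exp (- (l * contr l (T - s)) * (norm z)\<^sup>2) - 1)" if "s \<le> T" for s z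
    using contr_bounds(1)[of l "T - s"] l that by (simp add: heat_mode_def P_def Fw_def)
  have "(\<Sum>i<Suc N. expectation (\<lambda>\<omega>.
      (\<integral>z. heat_mode \<alpha> 0 l 0 T (real (Suc i) * (T / real (Suc N))) (X (real i * (T / real (Suc N))) \<omega> + z) \<partial>gauss (T / real (Suc N)))
       - heat_mode \<alpha> 0 l 0 T (real i * (T / real (Suc N))) (X (real i * (T / real (Suc N))) \<omega>))) = contr l T - 1" for N
  proof -
    define h where "h = T / real (Suc N)"
    have h: "0 < h" using T by (simp add: h_def)
    interpret G: prob_space "gauss h" by (rule prob_space_gauss[OF h])
    have hT: "real (Suc N) * h = T" by (simp add: h_def)
    have tT: "real i * h \<le> T" if "i \<le> Suc N" for i
    proof -
      have "real i * h \<le> real (Suc N) * h" using that h by (intro mult_right_mono) auto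
      then show ?thesis by (simp only: hT)
    qed
    have "(\<integral>z. heat_mode \<alpha> 0 l 0 T (real (Suc i) * h) (y + z) \<partial>gauss h) - heat_mode \<alpha> 0 l 0 T (real i * h) y
       = contr l (T - real i * h) - contr l (T - real (Suc i) * h)" if i: "i < Suc N" for i y
    proof -
      define t where "t = T - real (Suc i) * h"
      have t: "0 \<le> t" using tT[of "Suc i"] i by (simp add: t_def)
      have tt: "T - real i * h = t + h" by (simp add: t_def algebra_simps)
      define m where "m = l * contr l t"
      have c: "0 < contr l t" using contr_bounds(1)[of l t] l t by simp
      have m: "0 < m" using l c by (simp add: m_def)
      have mh: "0 < 1 + 2 * m * h" using m h by (simp add: add_pos_pos)
      have int: "integrable (gauss h) (\<lambda>z. exp (- m * (norm (y + z))\<^sup>2))"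
        by (rule gauss_integrable_exp[OF h mh])
      have "(\<integral>z. heat_mode \<alpha> 0 l 0 T (real (Suc i) * h) (y + z) \<partial>gauss h)
         = (\<integral>z. contr l t * (exp (- m * (norm (y + z))\<^sup>2) - 1) \<partial>gauss h)"
        using tT[of "Suc i"] i by (simp add: hm t_def m_def)
      also have "\<dots> = contr l t * ((\<integral>z. exp (- m * (norm (y + z))\<^sup>2) \<partial>gauss h) - 1)"
        using int G.prob_space by simp
      also have "(\<integral>z. exp (- m * (norm (y + z))\<^sup>2) \<partial>gauss h) = contr m h * exp (- m * contr m h * (norm y)\<^sup>2)"
        using gauss_integral_exp[OF h mh, of y] by (simp add: contr_def)
      finally have "(\<integral>z. heat_mode \<alpha> 0 l 0 T (real (Suc i) * h) (y + z) \<partial>gauss h)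
         = contr l t * contr m h * exp (- l * (contr l t * contr m h) * (norm y)\<^sup>2) - contr l t"
        by (simp add: m_def algebra_simps)
      also have "contr l t * contr m h = contr l (t + h)"
        unfolding m_def using l t h by (intro contr_semigroup) auto
      finally have I: "(\<integral>z. heat_mode \<alpha> 0 l 0 T (real (Suc i) * h) (y + z) \<partial>gauss h)
         = contr l (t + h) * exp (- l * contr l (t + h) * (norm y)\<^sup>2) - contr l t" .
      show ?thesis
        unfolding I using tT[of i] i by (simp add: hm tt algebra_simps) (simp add: t_def algebra_simps)
    qed
    then have "(\<Sum>i<Suc N. expectation (\<lambda>\<omega>.
      (\<integral>z. heat_mode \<alpha> 0 l 0 T (real (Suc i) * h) (X (real i * h) \<omega> + z) \<partial>gauss h)
       - heat_mode \<alpha> 0 l 0 T (real i * h) (X (real i * h) \<omega>)))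
      = (\<Sum>i<Suc N. contr l (T - real i * h) - contr l (T - real (Suc i) * h))"
      using prob_space by (intro sum.cong refl) simp
    also have "\<dots> = contr l (T - real 0 * h) - contr l (T - real (Suc N) * h)"
      by (rule sum_lessThan_telescope')
    also have "\<dots> = contr l T - 1" by (simp only: hT) (simp add: contr_def)
    finally show ?thesis unfolding h_def .
  qed
  then have "(\<lambda>N::nat. contr l T - 1) \<longlonglongrightarrow> expectation (\<lambda>\<omega>. heat_mode \<alpha> 0 l 0 T T (X T \<omega>)) - heat_mode \<alpha> 0 l 0 T 0 x"
    using heat_mode_limit[OF T l, of 0 0] by simp
  then have "contr l T - 1 = expectation (\<lambda>\<omega>. heat_mode \<alpha> 0 l 0 T T (X T \<omega>)) - heat_mode \<alpha> 0 l 0 T 0 x"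
    by (rule LIMSEQ_unique[OF tendsto_const])
  also have "expectation (\<lambda>\<omega>. heat_mode \<alpha> 0 l 0 T T (X T \<omega>)) = expectation (\<lambda>\<omega>. exp (- l * (norm (X T \<omega>))\<^sup>2) - 1)"
    by (simp add: hm contr_def)
  also have "\<dots> = expectation (\<lambda>\<omega>. exp (- l * (norm (X T \<omega>))\<^sup>2)) - 1"
  proof -
    have [measurable]: "X T \<in> borel_measurable M" using T by (intro measurable_X) simp
    have "integrable M (\<lambda>\<omega>. exp (- l * (norm (X T \<omega>))\<^sup>2))"
      using l by (intro integrable_const_bound[where B=1]) auto
    then show ?thesis using prob_space by simp
  qed
  also have "heat_mode \<alpha> 0 l 0 T 0 x = contr l T * (exp (- (l * contr l T) * (norm x)\<^sup>2) - 1)"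
    using T by (simp add: hm)
  finally show ?thesis by (simp add: algebra_simps)
qed

text \<open>For large l the exponential acts as a smooth indicator of the disc of radius l^(-1/2)
  about the vertex, so this bounds the probability of being close to the vertex at time s.\<close>

lemma radial_moment_le:
  assumes "0 \<le> s" "0 < l"
  shows "expectation (\<lambda>\<omega>. exp (- l * (norm (X s \<omega>))\<^sup>2)) \<le> 1 / (1 + 2 * l * s)"
proof (cases "s = 0")
  case True
  have [measurable]: "X s \<in> borel_measurable M" using assms by (intro measurable_X) simp
  have "expectation (\<lambda>\<omega>. exp (- l * (norm (X s \<omega>))\<^sup>2)) \<le> expectation (\<lambda>\<omega>. 1)"
    using assms by (intro integral_mono integrable_const_bound[where B=1]) auto
  then show ?thesis using True prob_space by simp
next
  case False
  then have s: "0 < s" using assms by simp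
  have c: "0 < contr l s" using contr_bounds(1)[of l s] assms by simp
  have "contr l s * exp (- (l * contr l s) * (norm x)\<^sup>2) \<le> contr l s * 1"
    using c assms by (intro mult_left_mono) auto
  then show ?thesis using radial_moment[OF s assms(2)] by (simp add: contr_def)
qed

text \<open>Two sources of error: the branch cut, felt within a distance of order sqrt h of the
  vertex, and the cut-off, which is not a heat solution. In the second, a time step changes the
  cut-off by a relative amount of order \<Lambda> h, while r^\<nu> exp(- \<Lambda> r^2 / 4) has size
  \<Lambda>^(-\<nu>/2); this gives \<Lambda>^(1 - \<nu>/2) h, still with Gaussian decay at rate
  \<Lambda> / 8.\<close>

lemma heat_mode_step_error:
  assumes k: "0 < k" and l: "0 < l" and T: "0 < T"
  obtains C B where "0 \<le> C" "0 \<le> B"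
    "\<And>\<Lambda> h t y. 1 \<le> \<Lambda> \<Longrightarrow> l \<le> \<Lambda> \<Longrightarrow> 0 < h \<Longrightarrow> 2 * \<Lambda> * h \<le> 1 \<Longrightarrow> 0 \<le> t \<Longrightarrow> t + h \<le> T \<Longrightarrow> y \<in> wedge \<alpha> \<Longrightarrow>
     \<bar>(\<integral>z. heat_mode \<alpha> k l \<Lambda> T (t + h) (y + z) \<partial>gauss h) - heat_mode \<alpha> k l \<Lambda> T t y\<bar>
     \<le> C * h powr (real k * pi / \<alpha> / 2) * exp (- ((sin (\<alpha> / 2))\<^sup>2 / (16 * h)) * (norm y)\<^sup>2)
       + B * \<Lambda> powr (1 - real k * pi / \<alpha> / 2) * (h * exp (- (\<Lambda> / 8) * (norm y)\<^sup>2))"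
proof -
  define \<nu> where "\<nu> = real k * pi / \<alpha>"
  define p where "p = \<nu> + 1"
  have \<nu>: "0 < \<nu>" using \<alpha> k by (simp add: \<nu>_def)
  have p: "1 \<le> p" using \<nu> by (simp add: p_def)
  define \<kappa> where "\<kappa> = sin (\<alpha> / 2)"
  obtain C where C: "0 \<le> C" "\<And>x h l c. x \<in> wedge \<alpha> \<Longrightarrow> 0 < h \<Longrightarrow> 0 \<le> l \<Longrightarrow> c = 1 / (1 + 2 * l * h) \<Longrightarrow>
    \<bar>(\<integral>z. exp (- l * (norm (x + z))\<^sup>2) * P \<alpha> k (x + z) \<partial>gauss h)
       - c powr (real k * pi / \<alpha> + 1) * (exp (- l * c * (norm x)\<^sup>2) * P \<alpha> k x)\<bar>
     \<le> C * h powr (real k * pi / \<alpha> / 2) * exp (- (sin (\<alpha> / 2))\<^sup>2 * c * (norm x)\<^sup>2 / (8 * h))"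
    using gauss_integral_exp_P[OF \<alpha>] by blast
  define A where "A = (1 + (\<nu>/2) / (1/4)) powr (\<nu>/2)"
  have A0: "0 \<le> A" by (simp add: A_def)
  define B where "B = A * (4 * p + 16)"
  have B0: "0 \<le> B" using A0 p by (simp add: B_def)
  show thesis
  proof (rule that[of "2 * C" B])
    show "0 \<le> 2 * C" "0 \<le> B" using C B0 by auto
    fix \<Lambda> h t and y :: "real^2"
    assume L: "1 \<le> \<Lambda>" "l \<le> \<Lambda>" and h: "0 < h" and Lh: "2 * \<Lambda> * h \<le> 1" and t: "0 \<le> t" "t + h \<le> T" and y: "y \<in> wedge \<alpha>"
    define q where "q = (norm y)\<^sup>2"
    have q0: "0 \<le> q" by (simp add: q_def)
    define c' where "c' = contr l (T - (t + h))"
    define m where "m = l * c'"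
    define c where "c = contr l (T - t)"
    have c': "0 < c'" "c' \<le> 1" using contr_bounds[of l "T - (t + h)"] l t by (auto simp: c'_def)
    have m: "0 < m" "m \<le> l" using l c' by (auto simp: m_def)
    have mh0: "0 \<le> m * h" using m h by simp
    have mL: "m * h \<le> \<Lambda> * h" using m L h by (intro mult_right_mono) auto
    have semi: "c' * contr m h = c"
      using contr_semigroup[of l "T - (t + h)" h] l t h by (simp add: c'_def m_def c_def)
    define d where "d = contr m h"
    define e where "e = contr \<Lambda> h"
    have d: "0 < d" "d \<le> 1" "1 - d \<le> 2 * m * h" using contr_bounds[of m h] m h by (auto simp: d_def)
    have e: "0 < e" "e \<le> 1" "1 - e \<le> 2 * \<Lambda> * h" using contr_bounds[of \<Lambda> h] L h by (auto simp: e_def)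
    \<comment> \<open>The condition 2 \<Lambda> h \<le> 1 keeps both contraction factors at least
      1/2, so the decay of the branch cut error is only halved.\<close>
    have half: "1 / 2 \<le> d" "1 / 2 \<le> e"
    proof -
      have "2 * m * h \<le> 1" using mL Lh by simp
      then have "1 + 2 * m * h \<le> 2" "0 < 1 + 2 * m * h" using mh0 by auto
      then show "1 / 2 \<le> d" unfolding d_def contr_def by (simp add: field_simps)
      have "0 \<le> \<Lambda> * h" using L h by simp
      then have "1 + 2 * \<Lambda> * h \<le> 2" "0 < 1 + 2 * \<Lambda> * h" using Lh by auto
      then show "1 / 2 \<le> e" unfolding e_def contr_def by (simp add: field_simps)
    qed
    define I where "I m = (\<integral>z. exp (- m * (norm (y + z))\<^sup>2) * P \<alpha> k (y + z) \<partial>gauss h)" for m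
    have II: "(\<integral>z. heat_mode \<alpha> k l \<Lambda> T (t + h) (y + z) \<partial>gauss h) = c' powr p * (I m - I \<Lambda>)"
    proof -
      have int: "integrable (gauss h) (\<lambda>z. exp (- r * (norm (y + z))\<^sup>2) * P \<alpha> k (y + z))" if "0 \<le> r" for r
      proof (rule Bochner_Integration.integrable_bound)
        show "integrable (gauss h) (\<lambda>z. Fw \<alpha> k (cplx y + cplx z))" by (rule integrable_Fw[OF \<alpha>(1) h])
        show "AE z in gauss h. norm (exp (- r * (norm (y + z))\<^sup>2) * P \<alpha> k (y + z)) \<le> norm (Fw \<alpha> k (cplx y + cplx z))"
        proof (rule AE_I2)
          fix z
          have "norm (exp (- r * (norm (y + z))\<^sup>2) * P \<alpha> k (y + z)) \<le> 1 * \<bar>P \<alpha> k (y + z)\<bar>"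
            unfolding real_norm_def abs_mult using that by (intro mult_right_mono) auto
          also have "\<dots> \<le> norm (Fw \<alpha> k (cplx y + cplx z))"
            using abs_Re_le_cmod[of "Fw \<alpha> k (cplx y + cplx z)"] by (simp add: P_def)
          finally show "norm (exp (- r * (norm (y + z))\<^sup>2) * P \<alpha> k (y + z)) \<le> norm (Fw \<alpha> k (cplx y + cplx z))" .
        qed
      qed measurable
      have "(\<integral>z. heat_mode \<alpha> k l \<Lambda> T (t + h) (y + z) \<partial>gauss h)
        = (\<integral>z. c' powr p * (exp (- m * (norm (y + z))\<^sup>2) * P \<alpha> k (y + z) - exp (- \<Lambda> * (norm (y + z))\<^sup>2) * P \<alpha> k (y + z)) \<partial>gauss h)"
        by (simp add: heat_mode_def c'_def m_def p_def \<nu>_def algebra_simps)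
      also have "\<dots> = c' powr p * (I m - I \<Lambda>)"
        unfolding I_def using int[of m] int[of \<Lambda>] m L by simp
      finally show ?thesis .
    qed
    define R where "R = rpow \<alpha> k (norm y)"
    define E where "E = C * h powr (\<nu> / 2) * exp (- (\<kappa>\<^sup>2 / (16 * h)) * q)"
    have errm: "\<bar>I m - d powr p * (exp (- m * d * q) * P \<alpha> k y)\<bar> \<le> E"
      and errL: "\<bar>I \<Lambda> - e powr p * (exp (- \<Lambda> * e * q) * P \<alpha> k y)\<bar> \<le> E"
    proof -
      have le: "C * h powr (\<nu> / 2) * exp (- \<kappa>\<^sup>2 * c * q / (8 * h)) \<le> E" if "1 / 2 \<le> c" for c
      proof -
        have "\<kappa>\<^sup>2 * q * (1/2) \<le> \<kappa>\<^sup>2 * q * c" using that q0 by (intro mult_left_mono) auto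
        then have "exp (- \<kappa>\<^sup>2 * c * q / (8 * h)) \<le> exp (- (\<kappa>\<^sup>2 / (16 * h)) * q)" using h by (simp add: field_simps)
        then show ?thesis unfolding E_def using C(1) by (intro mult_left_mono) auto
      qed
      show "\<bar>I m - d powr p * (exp (- m * d * q) * P \<alpha> k y)\<bar> \<le> E"
        using C(2)[OF y h, of m d] m le[OF half(1)] by (simp add: I_def d_def contr_def p_def \<nu>_def q_def \<kappa>_def)
      show "\<bar>I \<Lambda> - e powr p * (exp (- \<Lambda> * e * q) * P \<alpha> k y)\<bar> \<le> E"
        using C(2)[OF y h, of \<Lambda> e] L le[OF half(2)] by (simp add: I_def e_def contr_def p_def \<nu>_def q_def \<kappa>_def)
    qed
    have hm: "heat_mode \<alpha> k l \<Lambda> T t y = P \<alpha> k y * (c powr p * (exp (- (l * c) * q) - exp (- \<Lambda> * q)))"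
      by (simp add: heat_mode_def c_def p_def \<nu>_def q_def)
    have cp: "c powr p = c' powr p * d powr p"
      using semi c' d by (simp add: d_def powr_mult flip: semi)
    have lc: "l * c = m * d" by (simp add: m_def d_def semi[symmetric])
    \<comment> \<open>By the semigroup law the main part of the kept mode cancels exactly against
      the value before the step. Only the cut-off remains: before the step it carries the factor d^p
      of the kept mode, after the step its own factor e^p and a contracted exponent.\<close>
    define W where "W = P \<alpha> k y * (c' powr p * (d powr p * exp (- \<Lambda> * q) - e powr p * exp (- \<Lambda> * e * q)))"
    have split: "(\<integral>z. heat_mode \<alpha> k l \<Lambda> T (t + h) (y + z) \<partial>gauss h) - heat_mode \<alpha> k l \<Lambda> T t y
       = c' powr p * (I m - d powr p * (exp (- m * d * q) * P \<alpha> k y))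
         - c' powr p * (I \<Lambda> - e powr p * (exp (- \<Lambda> * e * q) * P \<alpha> k y)) + W"
      unfolding II hm cp lc W_def by (simp add: algebra_simps)
    have c'p: "0 \<le> c' powr p" "c' powr p \<le> 1" using c' p powr_mono2[of p c' 1] by auto
    have b1: "\<bar>c' powr p * r\<bar> \<le> B" if "\<bar>r\<bar> \<le> B" for r B :: real
    proof -
      have "c' powr p * \<bar>r\<bar> \<le> 1 * \<bar>r\<bar>" using c'p by (intro mult_right_mono) auto
      then show ?thesis using that c'p by (simp add: abs_mult)
    qed
    have Wle: "\<bar>W\<bar> \<le> B * \<Lambda> powr (1 - \<nu> / 2) * (h * exp (- (\<Lambda> / 8) * q))"
    proof -
      have d1: "\<bar>d powr p - e powr p\<bar> \<le> 2 * p * \<Lambda> * h"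
      proof -
        have dp: "d powr p \<le> 1" "e powr p \<le> 1" using d e p powr_mono2[of p _ 1] by auto
        have "1 - d powr p \<le> p * (2 * m * h)"
          using order_trans[OF one_minus_powr_le[OF d(1,2) p] mult_left_mono[OF d(3)]] p by simp
        moreover have "1 - e powr p \<le> p * (2 * \<Lambda> * h)"
          using order_trans[OF one_minus_powr_le[OF e(1,2) p] mult_left_mono[OF e(3)]] p by simp
        moreover have "p * (2 * m * h) \<le> p * (2 * \<Lambda> * h)" using mL p by (intro mult_left_mono) auto
        ultimately show ?thesis using dp by (simp add: abs_le_iff mult_ac)
      qed
      have d2: "\<bar>exp (- \<Lambda> * q) - exp (- \<Lambda> * e * q)\<bar> \<le> 16 * \<Lambda> * h * exp (- (3 * \<Lambda> / 8) * q)"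
      proof -
        have le: "\<Lambda> * e * q \<le> \<Lambda> * q" using e L q0 by (intro mult_right_mono) auto
        have "\<bar>exp (- \<Lambda> * q) - exp (- \<Lambda> * e * q)\<bar> \<le> (\<Lambda> * q - \<Lambda> * e * q) * exp (- (\<Lambda> * e * q))"
          using exp_diff_le[OF le] le by (simp add: abs_if)
        also have "\<Lambda> * q - \<Lambda> * e * q = (\<Lambda> * q) * (1 - e)" by (simp add: algebra_simps)
        also have "(\<Lambda> * q) * (1 - e) * exp (- (\<Lambda> * e * q)) \<le> (\<Lambda> * q) * (2 * \<Lambda> * h) * exp (- (\<Lambda> / 2) * q)"
        proof (intro mult_mono)
          have "\<Lambda> * q * (1/2) \<le> \<Lambda> * q * e" using half L q0 by (intro mult_left_mono) auto
          then show "exp (- (\<Lambda> * e * q)) \<le> exp (- (\<Lambda> / 2) * q)" by (simp add: mult_ac)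
        qed (use e L q0 h in auto)
        \<comment> \<open>The rate \<Lambda> / 2 is split: one eighth absorbs the factor \<Lambda>
          q, and three eighths remain. Of these, two will be spent on the growth of the mode and one
          is kept as decay.\<close>
        also have "\<dots> = 16 * \<Lambda> * h * ((\<Lambda> * q / 8) * exp (- (\<Lambda> * q / 8))) * exp (- (3 * \<Lambda> / 8) * q)"
          by (simp add: exp_add[symmetric] mult_ac)
        also have "\<dots> \<le> 16 * \<Lambda> * h * 1 * exp (- (3 * \<Lambda> / 8) * q)"
          using L h by (intro mult_right_mono mult_left_mono mult_exp_neg_le_1) auto
        finally show ?thesis by simp
      qed
      have "\<bar>d powr p * exp (- \<Lambda> * q) - e powr p * exp (- \<Lambda> * e * q)\<bar>
         = \<bar>(d powr p - e powr p) * exp (- \<Lambda> * q) + e powr p * (exp (- \<Lambda> * q) - exp (- \<Lambda> * e * q))\<bar>"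
        by (simp add: algebra_simps)
      also have "\<dots> \<le> \<bar>d powr p - e powr p\<bar> * exp (- \<Lambda> * q) + e powr p * \<bar>exp (- \<Lambda> * q) - exp (- \<Lambda> * e * q)\<bar>"
        by (rule order_trans[OF abs_triangle_ineq]) (simp add: abs_mult)
      also have "\<dots> \<le> (2 * p * \<Lambda> * h) * exp (- (3 * \<Lambda> / 8) * q) + 1 * (16 * \<Lambda> * h * exp (- (3 * \<Lambda> / 8) * q))"
      proof (intro add_mono mult_mono d1 d2)
        show "e powr p \<le> 1" using e p powr_mono2[of p e 1] by auto
        show "exp (- \<Lambda> * q) \<le> exp (- (3 * \<Lambda> / 8) * q)" using L q0 by (simp add: mult_right_mono)
      qed (use p L h in auto)
      also have "\<dots> = (2 * p + 16) * \<Lambda> * h * exp (- (3 * \<Lambda> / 8) * q)" by (simp add: algebra_simps)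
      also have "\<dots> \<le> (4 * p + 16) * \<Lambda> * h * exp (- (3 * \<Lambda> / 8) * q)"
        using p L h by (intro mult_right_mono) auto
      finally have D: "\<bar>d powr p * exp (- \<Lambda> * q) - e powr p * exp (- \<Lambda> * e * q)\<bar> \<le> (4 * p + 16) * \<Lambda> * h * exp (- (3 * \<Lambda> / 8) * q)" .
      \<comment> \<open>The scaled variable \<Lambda> q turns q^(\<nu>/2) into \<Lambda>^(-\<nu>/2)
        times a power that the exponential dominates.\<close>
      have Rle: "R * exp (- (\<Lambda> / 4) * q) \<le> A * \<Lambda> powr (- \<nu> / 2)"
      proof (cases "y = 0")
        case True
        then show ?thesis using k A0 \<nu> by (simp add: R_def rpow_def)
      next
        case False
        have "R = norm y powr \<nu>" using k by (simp add: R_def rpow_def \<nu>_def)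
        also have "\<dots> = q powr (\<nu> / 2)" using False by (simp add: q_def powr_powr flip: powr_numeral)
        also have "\<dots> = (\<Lambda> * q) powr (\<nu> / 2) * \<Lambda> powr (- \<nu> / 2)"
          using L q0 by (simp add: powr_mult powr_minus field_simps)
        also have "\<dots> \<le> (A * exp (1 / 4 * (\<Lambda> * q))) * \<Lambda> powr (- \<nu> / 2)"
          unfolding A_def using \<nu> L q0 by (intro mult_right_mono powr_le_exp) auto
        finally have "R * exp (- (\<Lambda> / 4) * q) \<le> (A * exp (1 / 4 * (\<Lambda> * q))) * \<Lambda> powr (- \<nu> / 2) * exp (- (\<Lambda> / 4) * q)"
          by (rule mult_right_mono) simp
        also have "\<dots> = A * \<Lambda> powr (- \<nu> / 2) * (exp (1 / 4 * (\<Lambda> * q)) * exp (- (\<Lambda> / 4) * q))" by simp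
        also have "exp (1 / 4 * (\<Lambda> * q)) * exp (- (\<Lambda> / 4) * q) = 1" by (simp add: exp_add[symmetric])
        finally show ?thesis by simp
      qed
      have "\<bar>W\<bar> \<le> R * ((4 * p + 16) * \<Lambda> * h * exp (- (3 * \<Lambda> / 8) * q))"
        unfolding W_def abs_mult[of "P \<alpha> k y"] R_def
        by (intro mult_mono abs_P_le_rpow b1 D) auto
      also have "\<dots> = (R * exp (- (\<Lambda> / 4) * q)) * ((4 * p + 16) * \<Lambda> * h * exp (- (\<Lambda> / 8) * q))"
        by (simp add: exp_add[symmetric] mult_ac)
      also have "\<dots> \<le> (A * \<Lambda> powr (- \<nu> / 2)) * ((4 * p + 16) * \<Lambda> * h * exp (- (\<Lambda> / 8) * q))"
        using p L h by (intro mult_right_mono Rle) auto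
      also have "\<dots> = B * (\<Lambda> powr (- \<nu> / 2) * \<Lambda> powr 1) * (h * exp (- (\<Lambda> / 8) * q))"
        using L by (simp add: B_def)
      also have "\<Lambda> powr (- \<nu> / 2) * \<Lambda> powr 1 = \<Lambda> powr (1 - \<nu> / 2)" by (simp only: powr_add[symmetric]) simp
      finally show ?thesis .
    qed
    have "\<bar>(\<integral>z. heat_mode \<alpha> k l \<Lambda> T (t + h) (y + z) \<partial>gauss h) - heat_mode \<alpha> k l \<Lambda> T t y\<bar> \<le> E + E + B * \<Lambda> powr (1 - \<nu> / 2) * (h * exp (- (\<Lambda> / 8) * q))"
      unfolding split using b1[OF errm] b1[OF errL] Wle by linarith
    then show "\<bar>(\<integral>z. heat_mode \<alpha> k l \<Lambda> T (t + h) (y + z) \<partial>gauss h) - heat_mode \<alpha> k l \<Lambda> T t y\<bar>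
     \<le> 2 * C * h powr (real k * pi / \<alpha> / 2) * exp (- ((sin (\<alpha> / 2))\<^sup>2 / (16 * h)) * (norm y)\<^sup>2)
       + B * \<Lambda> powr (1 - real k * pi / \<alpha> / 2) * (h * exp (- (\<Lambda> / 8) * (norm y)\<^sup>2))"
      by (simp add: E_def \<nu>_def \<kappa>_def q_def)
  qed
qed

end

lemma rpow_exp_scaling:
  assumes \<alpha>: "0 < \<alpha>" and k: "0 < k"
  obtains A where "0 \<le> A" "\<And>\<Lambda> r. 1 \<le> \<Lambda> \<Longrightarrow> 0 \<le> r \<Longrightarrow> rpow \<alpha> k r * exp (- \<Lambda> * r\<^sup>2) \<le> A * \<Lambda> powr (- (real k * pi / \<alpha> / 2))"
proof -
  define \<nu> where "\<nu> = real k * pi / \<alpha>"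
  have \<nu>: "0 < \<nu>" using \<alpha> k by (simp add: \<nu>_def)
  define A where "A = (1 + (\<nu>/2) / 1) powr (\<nu>/2)"
  have A0: "0 \<le> A" by (simp add: A_def)
  have "rpow \<alpha> k r * exp (- \<Lambda> * r\<^sup>2) \<le> A * \<Lambda> powr (- (\<nu> / 2))" if L: "1 \<le> \<Lambda>" and r: "0 \<le> r" for \<Lambda> r
  proof (cases "r = 0")
    case True
    then show ?thesis using k A0 by (simp add: rpow_def)
  next
    case False
    have "rpow \<alpha> k r = r powr \<nu>" using k by (simp add: rpow_def \<nu>_def)
    also have "\<dots> = (r\<^sup>2) powr (\<nu> / 2)" using False r by (simp add: powr_powr flip: powr_numeral)
    also have "\<dots> = (\<Lambda> * r\<^sup>2) powr (\<nu> / 2) * \<Lambda> powr (- (\<nu> / 2))"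
      using L r by (simp add: powr_mult powr_minus field_simps)
    also have "\<dots> \<le> (A * exp (1 * (\<Lambda> * r\<^sup>2))) * \<Lambda> powr (- (\<nu> / 2))"
      unfolding A_def using \<nu> L by (intro mult_right_mono powr_le_exp) auto
    finally have "rpow \<alpha> k r * exp (- \<Lambda> * r\<^sup>2) \<le> (A * exp (1 * (\<Lambda> * r\<^sup>2))) * \<Lambda> powr (- (\<nu> / 2)) * exp (- \<Lambda> * r\<^sup>2)"
      by (rule mult_right_mono) simp
    also have "\<dots> = A * \<Lambda> powr (- (\<nu> / 2)) * (exp (\<Lambda> * r\<^sup>2) * exp (- \<Lambda> * r\<^sup>2))" by simp
    also have "exp (\<Lambda> * r\<^sup>2) * exp (- \<Lambda> * r\<^sup>2) = 1" by (simp add: exp_add[symmetric])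
    finally show ?thesis by simp
  qed
  then show thesis using that A0 by (simp add: \<nu>_def)
qed

context wedge_rbm
begin

text \<open>Taking expectations of the one-step errors, \<open>radial_moment_le\<close> replaces the
  exponentials by 1 / (1 + b s), and summation produces logarithms. The branch cut contributes
  h^(\<nu>/2) log(1 / h), which tends to 0 as the mesh shrinks; the contribution of the cut-off
  survives and is the stated bound.\<close>

lemma heat_mode_bound:
  assumes k: "0 < k" and l: "0 < l" and T: "0 < T"
  obtains B where "0 \<le> B" "\<And>\<Lambda>. 1 \<le> \<Lambda> \<Longrightarrow> l \<le> \<Lambda> \<Longrightarrow>
    \<bar>expectation (\<lambda>\<omega>. heat_mode \<alpha> k l \<Lambda> T T (X T \<omega>)) - heat_mode \<alpha> k l \<Lambda> T 0 x\<bar>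
     \<le> B * \<Lambda> powr (1 - real k * pi / \<alpha> / 2) * ((4 / \<Lambda>) * ln (1 + \<Lambda> / 4 * T))"
proof -
  define \<nu> where "\<nu> = real k * pi / \<alpha>"
  have \<nu>: "0 < \<nu>" using \<alpha> k by (simp add: \<nu>_def)
  define \<kappa> where "\<kappa> = sin (\<alpha> / 2)"
  have \<kappa>: "0 < \<kappa>" using \<alpha> by (simp add: \<kappa>_def sin_gt_zero)
  obtain C B where C: "0 \<le> C" "0 \<le> B"
    "\<And>\<Lambda> h t y. 1 \<le> \<Lambda> \<Longrightarrow> l \<le> \<Lambda> \<Longrightarrow> 0 < h \<Longrightarrow> 2 * \<Lambda> * h \<le> 1 \<Longrightarrow> 0 \<le> t \<Longrightarrow> t + h \<le> T \<Longrightarrow> y \<in> wedge \<alpha> \<Longrightarrow>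
     \<bar>(\<integral>z. heat_mode \<alpha> k l \<Lambda> T (t + h) (y + z) \<partial>gauss h) - heat_mode \<alpha> k l \<Lambda> T t y\<bar>
     \<le> C * h powr (real k * pi / \<alpha> / 2) * exp (- ((sin (\<alpha> / 2))\<^sup>2 / (16 * h)) * (norm y)\<^sup>2)
       + B * \<Lambda> powr (1 - real k * pi / \<alpha> / 2) * (h * exp (- (\<Lambda> / 8) * (norm y)\<^sup>2))"
    using heat_mode_step_error[OF k l T] by blast
  show thesis
  proof (rule that[OF C(2)])
    fix \<Lambda> :: real assume L: "1 \<le> \<Lambda>" "l \<le> \<Lambda>"
    define D where "D = B * \<Lambda> powr (1 - \<nu> / 2)"
    have D: "0 \<le> D" using C by (simp add: D_def)
    define S where "S N = (\<Sum>i<Suc N. expectation (\<lambda>\<omega>.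
      (\<integral>z. heat_mode \<alpha> k l \<Lambda> T (real (Suc i) * (T / real (Suc N))) (X (real i * (T / real (Suc N))) \<omega> + z) \<partial>gauss (T / real (Suc N)))
       - heat_mode \<alpha> k l \<Lambda> T (real i * (T / real (Suc N))) (X (real i * (T / real (Suc N))) \<omega>)))" for N
    have lim: "S \<longlonglongrightarrow> expectation (\<lambda>\<omega>. heat_mode \<alpha> k l \<Lambda> T T (X T \<omega>)) - heat_mode \<alpha> k l \<Lambda> T 0 x"
      unfolding S_def[abs_def] using L by (intro heat_mode_limit[OF T l]) auto
    have bound: "\<bar>S N\<bar> \<le> C * ((T / real (Suc N)) powr (\<nu> / 2) * (1 + (8 / \<kappa>\<^sup>2) * ln (1 + \<kappa>\<^sup>2 / 8 * real (Suc N))))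
        + D * (T / real (Suc N) + (4 / \<Lambda>) * ln (1 + \<Lambda> / 4 * T))" if N: "2 * \<Lambda> * T \<le> real (Suc N)" for N
    proof -
      define h where "h = T / real (Suc N)"
      have h: "0 < h" using T by (simp add: h_def)
      interpret G: prob_space "gauss h" by (rule prob_space_gauss[OF h])
      have hT: "real (Suc N) * h = T" by (simp add: h_def)
      have Lh: "2 * \<Lambda> * h \<le> 1" using N by (simp add: h_def field_simps)
      have tT: "real i * h + h \<le> T" if "i < Suc N" for i
      proof -
        have "real (Suc i) * h \<le> real (Suc N) * h" using that h by (intro mult_right_mono) auto
        then show ?thesis unfolding hT by (simp add: algebra_simps)
      qed
      have ti: "0 \<le> real i * h" for i using h by simp
      have summand: "\<bar>expectation (\<lambda>\<omega>.
          (\<integral>z. heat_mode \<alpha> k l \<Lambda> T (real (Suc i) * h) (X (real i * h) \<omega> + z) \<partial>gauss h)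
           - heat_mode \<alpha> k l \<Lambda> T (real i * h) (X (real i * h) \<omega>))\<bar>
         \<le> C * h powr (\<nu> / 2) * (1 / (1 + \<kappa>\<^sup>2 / 8 * (real i * 1))) + D * (h / (1 + \<Lambda> / 4 * (real i * h)))" if i: "i < Suc N" for i
      proof -
        define t where "t = real i * h"
        have t: "0 \<le> t" "t + h \<le> T" using tT[OF i] ti by (auto simp: t_def)
        have si: "real (Suc i) * h = t + h" by (simp add: t_def algebra_simps)
        have Xm[measurable]: "X t \<in> borel_measurable M" using t by (intro measurable_X)
        have [measurable]: "heat_mode \<alpha> k l \<Lambda> T r \<in> borel_measurable borel" for r
          unfolding heat_mode_def[abs_def] by measurable
        define g where "g y = (\<integral>z. heat_mode \<alpha> k l \<Lambda> T (t + h) (y + z) \<partial>gauss h) - heat_mode \<alpha> k l \<Lambda> T t y" for y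
        have [measurable]: "g \<in> borel_measurable borel" unfolding g_def[abs_def] by measurable
        define e1 where "e1 \<omega> = exp (- (\<kappa>\<^sup>2 / (16 * h)) * (norm (X t \<omega>))\<^sup>2)" for \<omega>
        define e2 where "e2 \<omega> = exp (- (\<Lambda> / 8) * (norm (X t \<omega>))\<^sup>2)" for \<omega>
        have ei: "integrable M e1" "integrable M e2"
          unfolding e1_def[abs_def] e2_def[abs_def] using h L by (auto intro!: integrable_const_bound[where B=1] divide_nonneg_nonneg mult_nonneg_nonneg)
        have bi: "integrable M (\<lambda>\<omega>. C * h powr (\<nu> / 2) * e1 \<omega> + D * (h * e2 \<omega>))"
          using ei by (intro Bochner_Integration.integrable_add integrable_mult_right)
        have AEb: "AE \<omega> in M. \<bar>g (X t \<omega>)\<bar> \<le> C * h powr (\<nu> / 2) * e1 \<omega> + D * (h * e2 \<omega>)"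
          using AE_in_wedge[OF t(1)]
        proof eventually_elim
          case (elim \<omega>)
          then show ?case using C(3)[OF L h Lh t elim] by (simp add: g_def e1_def e2_def D_def \<nu>_def \<kappa>_def)
        qed
        have gi: "integrable M (\<lambda>\<omega>. g (X t \<omega>))"
        proof (rule Bochner_Integration.integrable_bound[OF bi])
          show "AE \<omega> in M. norm (g (X t \<omega>)) \<le> norm (C * h powr (\<nu> / 2) * e1 \<omega> + D * (h * e2 \<omega>))"
            using AEb by eventually_elim (metis abs_ge_self order_trans real_norm_def)
        qed measurable
        have "\<bar>expectation (\<lambda>\<omega>. g (X t \<omega>))\<bar> \<le> expectation (\<lambda>\<omega>. \<bar>g (X t \<omega>)\<bar>)" by (rule integral_abs_bound)
        also have "\<dots> \<le> expectation (\<lambda>\<omega>. C * h powr (\<nu> / 2) * e1 \<omega> + D * (h * e2 \<omega>))"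
          using gi by (intro integral_mono_AE bi AEb) auto
        also have "\<dots> = C * h powr (\<nu> / 2) * expectation e1 + D * (h * expectation e2)"
          using ei by simp
        \<comment> \<open>At time t = i h the rate \<kappa>^2 / (16 h) gives 1 / (1 + \<kappa>^2 i /
          8), which no longer contains h; the rate \<Lambda> / 8 gives 1 / (1 + \<Lambda> t /
          4).\<close>
        also have "\<dots> \<le> C * h powr (\<nu> / 2) * (1 / (1 + 2 * (\<kappa>\<^sup>2 / (16 * h)) * t)) + D * (h * (1 / (1 + 2 * (\<Lambda> / 8) * t)))"
          unfolding e1_def e2_def using C D h L \<kappa> t
          by (intro add_mono mult_left_mono radial_moment_le) auto
        also have "2 * (\<kappa>\<^sup>2 / (16 * h)) * t = \<kappa>\<^sup>2 / 8 * (real i * 1)" using h by (simp add: t_def)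
        also have "D * (h * (1 / (1 + 2 * (\<Lambda> / 8) * t))) = D * (h / (1 + \<Lambda> / 4 * (real i * h)))" by (simp add: t_def)
        finally show ?thesis unfolding g_def si t_def[symmetric] by simp
      qed
      have "\<bar>S N\<bar> \<le> (\<Sum>i<Suc N. C * h powr (\<nu> / 2) * (1 / (1 + \<kappa>\<^sup>2 / 8 * (real i * 1))) + D * (h / (1 + \<Lambda> / 4 * (real i * h))))"
        unfolding S_def h_def[symmetric] by (rule order_trans[OF sum_abs sum_mono]) (simp only: lessThan_iff summand)
      also have "\<dots> = C * h powr (\<nu> / 2) * (\<Sum>i<Suc N. 1 / (1 + \<kappa>\<^sup>2 / 8 * (real i * 1))) + D * (\<Sum>i<Suc N. h / (1 + \<Lambda> / 4 * (real i * h)))"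
        by (simp only: sum.distrib sum_distrib_left)
      also have "\<dots> \<le> C * h powr (\<nu> / 2) * (1 + (1 / (\<kappa>\<^sup>2 / 8)) * ln (1 + \<kappa>\<^sup>2 / 8 * (real (Suc N) * 1)))
         + D * (h + (1 / (\<Lambda> / 4)) * ln (1 + \<Lambda> / 4 * (real (Suc N) * h)))"
        using C D h L \<kappa> by (intro add_mono mult_left_mono sum_inverse_linear_le) auto
      also have "\<dots> = C * (h powr (\<nu> / 2) * (1 + (8 / \<kappa>\<^sup>2) * ln (1 + \<kappa>\<^sup>2 / 8 * real (Suc N))))
         + D * (h + (4 / \<Lambda>) * ln (1 + \<Lambda> / 4 * T))"
        unfolding hT by simp
      finally show ?thesis by (simp only: h_def)
    qed
    have l1: "(\<lambda>N. (T / real (Suc N)) powr (\<nu> / 2) * (1 + (8 / \<kappa>\<^sup>2) * ln (1 + \<kappa>\<^sup>2 / 8 * real (Suc N)))) \<longlonglongrightarrow> 0"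
    proof -
      define a where "a = \<nu> / 2" define b where "b = 8 / \<kappa>\<^sup>2" define d where "d = \<kappa>\<^sup>2 / 8"
      have "0 < a" "0 < b" "0 < d" using \<nu> \<kappa> by (auto simp: a_def b_def d_def)
      then have "(\<lambda>N. (T / real (Suc N)) powr a * (1 + b * ln (1 + d * real (Suc N)))) \<longlonglongrightarrow> 0"
        using T by real_asymp
      then show ?thesis by (simp only: a_def b_def d_def)
    qed
    have l2: "(\<lambda>N. T / real (Suc N)) \<longlonglongrightarrow> 0" by real_asymp
    have "(\<lambda>N. C * ((T / real (Suc N)) powr (\<nu> / 2) * (1 + (8 / \<kappa>\<^sup>2) * ln (1 + \<kappa>\<^sup>2 / 8 * real (Suc N))))
        + D * (T / real (Suc N) + (4 / \<Lambda>) * ln (1 + \<Lambda> / 4 * T))) \<longlonglongrightarrow> C * 0 + D * (0 + (4 / \<Lambda>) * ln (1 + \<Lambda> / 4 * T))"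
      by (intro tendsto_intros l1 l2)
    moreover have "\<forall>\<^sub>F N in sequentially. \<bar>S N\<bar> \<le> C * ((T / real (Suc N)) powr (\<nu> / 2) * (1 + (8 / \<kappa>\<^sup>2) * ln (1 + \<kappa>\<^sup>2 / 8 * real (Suc N))))
        + D * (T / real (Suc N) + (4 / \<Lambda>) * ln (1 + \<Lambda> / 4 * T))"
    proof -
      obtain N0 :: nat where N0: "2 * \<Lambda> * T \<le> real N0" using real_arch_simple by blast
      show ?thesis
        unfolding eventually_sequentially
      proof (intro exI[of _ N0] allI impI bound)
        fix N assume "N0 \<le> N"
        then show "2 * \<Lambda> * T \<le> real (Suc N)" using N0 by linarith
      qed
    qed
    ultimately have "\<bar>expectation (\<lambda>\<omega>. heat_mode \<alpha> k l \<Lambda> T T (X T \<omega>)) - heat_mode \<alpha> k l \<Lambda> T 0 x\<bar>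
       \<le> C * 0 + D * (0 + (4 / \<Lambda>) * ln (1 + \<Lambda> / 4 * T))"
      by (intro tendsto_le[OF _ _ tendsto_rabs[OF lim]]) auto
    then show "\<bar>expectation (\<lambda>\<omega>. heat_mode \<alpha> k l \<Lambda> T T (X T \<omega>)) - heat_mode \<alpha> k l \<Lambda> T 0 x\<bar>
     \<le> B * \<Lambda> powr (1 - real k * pi / \<alpha> / 2) * ((4 / \<Lambda>) * ln (1 + \<Lambda> / 4 * T))"
      by (simp add: D_def \<nu>_def)
  qed
qed

text \<open>The martingale identity for the uncut modes. For k > 0 both the error of
  \<open>heat_mode_bound\<close> and the terms containing the cut-off are at most of order
  \<Lambda>^(-\<nu>/2) log \<Lambda>, with \<nu> > 0, so \<Lambda> may be sent to infinity. For k =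
  0 the identity is \<open>radial_moment\<close>.\<close>

theorem mode_moment:
  assumes T: "0 < T" and l: "0 < l"
  shows "expectation (\<lambda>\<omega>. P \<alpha> k (X T \<omega>) * exp (- l * (norm (X T \<omega>))\<^sup>2))
    = contr l T powr (real k * pi / \<alpha> + 1) * (P \<alpha> k x * exp (- (l * contr l T) * (norm x)\<^sup>2))"
proof (cases "k = 0")
  case True
  then show ?thesis using radial_moment[OF T l] contr_bounds(1)[of l T] T l by (simp add: P_def Fw_def)
next
  case False
  then have k: "0 < k" by simp
  define \<nu> where "\<nu> = real k * pi / \<alpha>"
  have \<nu>: "0 < \<nu>" using \<alpha> k by (simp add: \<nu>_def)
  obtain B where B: "0 \<le> B" "\<And>\<Lambda>. 1 \<le> \<Lambda> \<Longrightarrow> l \<le> \<Lambda> \<Longrightarrow>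
    \<bar>expectation (\<lambda>\<omega>. heat_mode \<alpha> k l \<Lambda> T T (X T \<omega>)) - heat_mode \<alpha> k l \<Lambda> T 0 x\<bar>
     \<le> B * \<Lambda> powr (1 - real k * pi / \<alpha> / 2) * ((4 / \<Lambda>) * ln (1 + \<Lambda> / 4 * T))"
    using heat_mode_bound[OF k l T] by blast
  obtain A where A: "0 \<le> A" "\<And>\<Lambda> r. 1 \<le> \<Lambda> \<Longrightarrow> 0 \<le> r \<Longrightarrow> rpow \<alpha> k r * exp (- \<Lambda> * r\<^sup>2) \<le> A * \<Lambda> powr (- (real k * pi / \<alpha> / 2))"
    using rpow_exp_scaling[OF \<alpha>(1) k] by blast
  have Pe: "\<bar>P \<alpha> k z * exp (- \<Lambda> * (norm z)\<^sup>2)\<bar> \<le> A * \<Lambda> powr (- (\<nu> / 2))" if "1 \<le> \<Lambda>" for \<Lambda> z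
  proof -
    have "\<bar>P \<alpha> k z * exp (- \<Lambda> * (norm z)\<^sup>2)\<bar> \<le> rpow \<alpha> k (norm z) * exp (- \<Lambda> * (norm z)\<^sup>2)"
      by (simp add: abs_mult abs_P_le_rpow)
    also have "\<dots> \<le> A * \<Lambda> powr (- (real k * pi / \<alpha> / 2))" using that by (intro A(2)) auto
    finally show ?thesis by (simp add: \<nu>_def)
  qed
  have Xm[measurable]: "X T \<in> borel_measurable M" using T by (intro measurable_X) simp
  obtain A' where A': "0 \<le> A'" "\<And>r. 0 \<le> r \<Longrightarrow> rpow \<alpha> k r * r ^ 0 * exp (- l * r\<^sup>2) \<le> A'"
    using rpow_exp_bounded[OF \<alpha>(1) l] by blast
  have i1: "integrable M (\<lambda>\<omega>. P \<alpha> k (X T \<omega>) * exp (- l * (norm (X T \<omega>))\<^sup>2))"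
  proof (rule integrable_const_bound[where B=A'])
    show "AE \<omega> in M. norm (P \<alpha> k (X T \<omega>) * exp (- l * (norm (X T \<omega>))\<^sup>2)) \<le> A'"
    proof (rule AE_I2)
      fix \<omega>
      have "norm (P \<alpha> k (X T \<omega>) * exp (- l * (norm (X T \<omega>))\<^sup>2)) \<le> rpow \<alpha> k (norm (X T \<omega>)) * exp (- l * (norm (X T \<omega>))\<^sup>2)"
        by (simp add: abs_mult abs_P_le_rpow)
      then show "norm (P \<alpha> k (X T \<omega>) * exp (- l * (norm (X T \<omega>))\<^sup>2)) \<le> A'" using A'(2)[of "norm (X T \<omega>)"] by simp
    qed
  qed measurable
  define V where "V = expectation (\<lambda>\<omega>. P \<alpha> k (X T \<omega>) * exp (- l * (norm (X T \<omega>))\<^sup>2))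
    - contr l T powr (\<nu> + 1) * (P \<alpha> k x * exp (- (l * contr l T) * (norm x)\<^sup>2))"
  have bound: "\<bar>V\<bar> \<le> B * \<Lambda> powr (1 - \<nu> / 2) * ((4 / \<Lambda>) * ln (1 + \<Lambda> / 4 * T)) + 2 * (A * \<Lambda> powr (- (\<nu> / 2)))"
    if L: "1 \<le> \<Lambda>" "l \<le> \<Lambda>" for \<Lambda>
  proof -
    have i2: "integrable M (\<lambda>\<omega>. P \<alpha> k (X T \<omega>) * exp (- \<Lambda> * (norm (X T \<omega>))\<^sup>2))"
      using Pe[OF L(1)] by (intro integrable_const_bound[where B="A * \<Lambda> powr (- (\<nu> / 2))"] AE_I2) auto
    have e1: "expectation (\<lambda>\<omega>. heat_mode \<alpha> k l \<Lambda> T T (X T \<omega>))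
      = expectation (\<lambda>\<omega>. P \<alpha> k (X T \<omega>) * exp (- l * (norm (X T \<omega>))\<^sup>2)) - expectation (\<lambda>\<omega>. P \<alpha> k (X T \<omega>) * exp (- \<Lambda> * (norm (X T \<omega>))\<^sup>2))"
      using i1 i2 by (simp add: heat_mode_def contr_def right_diff_distrib)
    have e2: "\<bar>expectation (\<lambda>\<omega>. P \<alpha> k (X T \<omega>) * exp (- \<Lambda> * (norm (X T \<omega>))\<^sup>2))\<bar> \<le> A * \<Lambda> powr (- (\<nu> / 2))"
    proof -
      have "\<bar>expectation (\<lambda>\<omega>. P \<alpha> k (X T \<omega>) * exp (- \<Lambda> * (norm (X T \<omega>))\<^sup>2))\<bar> \<le> expectation (\<lambda>\<omega>. \<bar>P \<alpha> k (X T \<omega>) * exp (- \<Lambda> * (norm (X T \<omega>))\<^sup>2)\<bar>)"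
        by (rule integral_abs_bound)
      also have "\<dots> \<le> expectation (\<lambda>\<omega>. A * \<Lambda> powr (- (\<nu> / 2)))"
        using i2 Pe[OF L(1)] by (intro integral_mono) auto
      finally show ?thesis using prob_space by simp
    qed
    have e3: "heat_mode \<alpha> k l \<Lambda> T 0 x = contr l T powr (\<nu> + 1) * (P \<alpha> k x * exp (- (l * contr l T) * (norm x)\<^sup>2))
       - contr l T powr (\<nu> + 1) * (P \<alpha> k x * exp (- \<Lambda> * (norm x)\<^sup>2))"
      by (simp add: heat_mode_def \<nu>_def algebra_simps)
    have e4: "\<bar>contr l T powr (\<nu> + 1) * (P \<alpha> k x * exp (- \<Lambda> * (norm x)\<^sup>2))\<bar> \<le> 1 * (A * \<Lambda> powr (- (\<nu> / 2)))"
      unfolding abs_mult[of "contr l T powr (\<nu> + 1)"]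
    proof (intro mult_mono Pe L)
      show "\<bar>contr l T powr (\<nu> + 1)\<bar> \<le> 1"
        using contr_bounds[of l T] l T \<nu> powr_mono2[of "\<nu> + 1" "contr l T" 1] by auto
    qed auto
    show ?thesis
      using B(2)[OF L] e2 e4 unfolding e1 e3 V_def \<nu>_def[symmetric] by linarith
  qed
  have "((\<lambda>\<Lambda>. B * \<Lambda> powr (1 - \<nu> / 2) * ((4 / \<Lambda>) * ln (1 + \<Lambda> / 4 * T)) + 2 * (A * \<Lambda> powr (- (\<nu> / 2)))) \<longlongrightarrow> B * 0 + 2 * (A * 0)) at_top"
  proof -
    define a where "a = \<nu> / 2"
    have a: "0 < a" using \<nu> by (simp add: a_def)
    have 1: "((\<lambda>\<Lambda>. \<Lambda> powr (1 - a) * ((4 / \<Lambda>) * ln (1 + \<Lambda> / 4 * T))) \<longlongrightarrow> 0) at_top"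
      using a T by real_asymp
    have 2: "((\<lambda>\<Lambda>. \<Lambda> powr (- a)) \<longlongrightarrow> 0) at_top" using a by real_asymp
    show ?thesis unfolding a_def[symmetric] mult.assoc by (intro tendsto_intros 1 2)
  qed
  moreover have "\<forall>\<^sub>F \<Lambda> in at_top. \<bar>V\<bar> \<le> B * \<Lambda> powr (1 - \<nu> / 2) * ((4 / \<Lambda>) * ln (1 + \<Lambda> / 4 * T)) + 2 * (A * \<Lambda> powr (- (\<nu> / 2)))"
    using eventually_ge_at_top[of "max 1 l"] by eventually_elim (rule bound; simp)
  ultimately have "\<bar>V\<bar> \<le> B * 0 + 2 * (A * 0)"
    by (intro tendsto_le[OF _ _ tendsto_const]) auto
  then show ?thesis by (simp add: V_def \<nu>_def)
qed

end

section \<open>The modes determine a measure on the wedge\<close>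

text \<open>The indicator of a closed set is the pointwise limit of the continuous functions max(0,
  1 - k dist), and closed sets form an intersection-stable generator.\<close>

lemma finite_measure_eq_on_closed:
  fixes M N :: "'a::metric_space measure"
  assumes "finite_measure M" "finite_measure N" and sM: "sets M = sets borel" and sN: "sets N = sets borel"
    and eq: "\<And>f. continuous_on UNIV f \<Longrightarrow> (\<And>x. \<bar>f x\<bar> \<le> (1::real)) \<Longrightarrow> (\<integral>x. f x \<partial>M) = (\<integral>x. f x \<partial>N)"
  shows "M = N"
proof -
  interpret M: finite_measure M by fact
  interpret N: finite_measure N by fact
  have [measurable_cong]: "sets M = sets borel" "sets N = sets borel" by fact+
  have sp: "space M = UNIV" "space N = UNIV" using sets_eq_imp_space_eq[OF sM] sets_eq_imp_space_eq[OF sN] by auto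
  have "measure M C = measure N C" if C: "closed C" for C
  proof (cases "C = {}")
    case False
    define f where "f k x = max 0 (1 - real k * infdist x C)" for k x
    have fc: "continuous_on UNIV (f k)" for k
      unfolding f_def[abs_def] by (intro continuous_intros)
    have fb: "\<bar>f k x\<bar> \<le> 1" for k x using infdist_nonneg[of x C] by (auto simp: f_def)
    have [measurable]: "f k \<in> borel_measurable borel" for k by (rule borel_measurable_continuous_onI[OF fc])
    have [measurable]: "C \<in> sets borel" using C by simp
    have lim: "(\<lambda>k. f k x) \<longlonglongrightarrow> indicator C x" for x
    proof (cases "x \<in> C")
      case True
      then show ?thesis by (simp add: f_def)
    next
      case notC: False
      then have pos: "0 < infdist x C" using C False infdist_pos_not_in_closed by blast
      obtain k0 :: nat where k0: "1 / infdist x C < real k0" using reals_Archimedean2 by blast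
      have "f k x = 0" if "k0 \<le> k" for k
      proof -
        have "1 / infdist x C < real k" using k0 that by linarith
        then have "1 < real k * infdist x C" using pos by (simp add: pos_divide_less_eq)
        then show ?thesis by (simp add: f_def)
      qed
      then have "\<forall>\<^sub>F k in sequentially. f k x = 0" by (auto simp: eventually_sequentially)
      then show ?thesis using notC by (simp add: tendsto_eventually)
    qed
    have "(\<lambda>k. \<integral>x. f k x \<partial>M) \<longlonglongrightarrow> (\<integral>x. indicator C x \<partial>M)"
      by (rule integral_dominated_convergence[where w="\<lambda>_. 1"]) (use fb lim in auto)
    moreover have "(\<lambda>k. \<integral>x. f k x \<partial>M) \<longlonglongrightarrow> (\<integral>x. indicator C x \<partial>N)"
      unfolding eq[OF fc fb]
      by (rule integral_dominated_convergence[where w="\<lambda>_. 1"]) (use fb lim in auto)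
    ultimately show ?thesis using LIMSEQ_unique by (fastforce simp: sp)
  qed simp
  then have e: "emeasure M C = emeasure N C" if "closed C" for C
    using that by (simp add: M.emeasure_eq_measure N.emeasure_eq_measure)
  show ?thesis
  proof (rule measure_eqI_generator_eq[of "Collect closed" UNIV])
    show "Int_stable (Collect (closed :: 'a set \<Rightarrow> bool))" by (auto simp: Int_stable_def)
    show "sets M = sigma_sets UNIV (Collect closed)" "sets N = sigma_sets UNIV (Collect closed)"
      unfolding sM sN by (simp_all add: borel_eq_closed)
    show "range (\<lambda>_::nat. UNIV) \<subseteq> Collect (closed :: 'a set \<Rightarrow> bool)" by auto
  qed (use e sp in \<open>auto simp: M.emeasure_eq_measure\<close>)
qed

text \<open>By Stone-Weierstrass on the compact set carrying both measures, polynomials approximate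
  every continuous function uniformly, and integrals of polynomials are combinations of the
  moments.\<close>

lemma finite_measure_eq_moments:
  fixes M N :: "(real \<times> real) measure"
  assumes fM: "finite_measure M" and fN: "finite_measure N" and sM: "sets M = sets borel" and sN: "sets N = sets borel"
    and K: "compact K" and aM: "AE v in M. v \<in> K" and aN: "AE v in N. v \<in> K"
    and mom: "\<And>i j. (\<integral>v. fst v ^ i * snd v ^ j \<partial>M) = (\<integral>v. fst v ^ i * snd v ^ j \<partial>N)"
  shows "M = N"
proof -
  interpret M: finite_measure M by fact
  interpret N: finite_measure N by fact
  have [measurable_cong]: "sets M = sets borel" "sets N = sets borel" by fact+
  have int: "integrable M f" "integrable N f" if [measurable]: "f \<in> borel_measurable borel" and b: "\<And>v. v \<in> K \<Longrightarrow> \<bar>f v\<bar> \<le> B" for f :: "real \<times> real \<Rightarrow> real" and B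
  proof -
    have "AE v in M. norm (f v) \<le> B" using aM by eventually_elim (use b in auto)
    then show "integrable M f" by (intro M.integrable_const_bound[where B=B]) auto
    have "AE v in N. norm (f v) \<le> B" using aN by eventually_elim (use b in auto)
    then show "integrable N f" by (intro N.integrable_const_bound[where B=B]) auto
  qed
  have cb: "\<exists>B. \<forall>v\<in>K. \<bar>f v\<bar> \<le> B" if "continuous_on UNIV f" for f :: "real \<times> real \<Rightarrow> real"
    using compact_imp_bounded[OF compact_continuous_image[OF continuous_on_subset[OF that] K]]
    by (auto simp: bounded_iff)
  \<comment> \<open>\<open>real_polynomial_function\<close> is inductive and offers no monomial
    expansion, so the induction carries a class of functions whose products with all monomials have
    equal integrals; it is closed under multiplication by polynomials.\<close>
  define Q where "Q q \<longleftrightarrow> continuous_on UNIV q \<and>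
      (\<forall>i j. (\<integral>v. fst v ^ i * snd v ^ j * q v \<partial>M) = (\<integral>v. fst v ^ i * snd v ^ j * q v \<partial>N))" for q :: "real \<times> real \<Rightarrow> real"
  have mono: "integrable M (\<lambda>v. fst v ^ i * snd v ^ j * q v)" "integrable N (\<lambda>v. fst v ^ i * snd v ^ j * q v)"
    if "continuous_on UNIV q" for q :: "real \<times> real \<Rightarrow> real" and i j
  proof -
    have c: "continuous_on UNIV (\<lambda>v. fst v ^ i * snd v ^ j * q v)" using that by (intro continuous_intros)
    then have m: "(\<lambda>v. fst v ^ i * snd v ^ j * q v) \<in> borel_measurable borel" by (rule borel_measurable_continuous_onI)
    obtain B where "\<forall>v\<in>K. \<bar>fst v ^ i * snd v ^ j * q v\<bar> \<le> B" using cb[OF c] by blast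
    then show "integrable M (\<lambda>v. fst v ^ i * snd v ^ j * q v)" "integrable N (\<lambda>v. fst v ^ i * snd v ^ j * q v)"
      by (intro int[OF m]; blast)+
  qed
  have Qmult: "Q q \<Longrightarrow> Q (\<lambda>v. p v * q v)" if "real_polynomial_function p" for p q
    using that
  proof (induction arbitrary: q rule: real_polynomial_function.induct)
    case (linear f)
    have f: "f v = fst v * f (1, 0) + snd v * f (0, 1)" for v
    proof -
      interpret bounded_linear f by fact
      have "v = fst v *\<^sub>R (1, 0) + snd v *\<^sub>R (0, 1)" by (simp add: prod_eq_iff)
      then have "f v = f (fst v *\<^sub>R (1, 0) + snd v *\<^sub>R (0, 1))" by (rule arg_cong)
      then show ?thesis by (simp only: add scaleR real_scaleR_def)
    qed
    have c: "continuous_on UNIV f" using linear.hyps by (rule linear_continuous_on)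
    have qc: "continuous_on UNIV q" using linear.prems by (simp add: Q_def)
    have e: "fst v ^ i * snd v ^ j * (f v * q v)
        = f (1, 0) * (fst v ^ Suc i * snd v ^ j * q v) + f (0, 1) * (fst v ^ i * snd v ^ Suc j * q v)" for v i j
      by (subst f) (simp add: algebra_simps)
    have "(\<integral>v. fst v ^ i * snd v ^ j * (f v * q v) \<partial>M) = (\<integral>v. fst v ^ i * snd v ^ j * (f v * q v) \<partial>N)" for i j
      unfolding e using linear.prems mono[OF qc, of "Suc i" j] mono[OF qc, of i "Suc j"]
      by (simp only: Q_def Bochner_Integration.integral_add integrable_mult_right integral_mult_right_zero)
    then show ?case using c qc by (auto simp: Q_def intro: continuous_intros)
  next
    case (const c)
    have qc: "continuous_on UNIV q" using const by (simp add: Q_def)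
    have "(\<integral>v. fst v ^ i * snd v ^ j * (c * q v) \<partial>M) = (\<integral>v. fst v ^ i * snd v ^ j * (c * q v) \<partial>N)" for i j
      using const by (simp add: Q_def mult.left_commute[of _ c])
    then show ?case using qc by (auto simp: Q_def intro: continuous_intros)
  next
    case (add f g)
    have a: "Q (\<lambda>v. f v * q v)" "Q (\<lambda>v. g v * q v)" using add by auto
    have c: "continuous_on UNIV (\<lambda>v. f v * q v)" "continuous_on UNIV (\<lambda>v. g v * q v)" using a by (auto simp: Q_def)
    have e: "fst v ^ i * snd v ^ j * ((f v + g v) * q v) = fst v ^ i * snd v ^ j * (f v * q v) + fst v ^ i * snd v ^ j * (g v * q v)" for v i j
      by (simp add: algebra_simps)
    have "(\<integral>v. fst v ^ i * snd v ^ j * ((f v + g v) * q v) \<partial>M) = (\<integral>v. fst v ^ i * snd v ^ j * ((f v + g v) * q v) \<partial>N)" for i j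
      unfolding e using a mono[OF c(1), of i j] mono[OF c(2), of i j]
      by (simp only: Q_def Bochner_Integration.integral_add)
    moreover have "continuous_on UNIV (\<lambda>v. (f v + g v) * q v)"
      using continuous_on_add[OF c] by (simp add: distrib_right)
    ultimately show ?case by (simp add: Q_def)
  next
    case (mult f g)
    then have "Q (\<lambda>v. f v * (g v * q v))" by blast
    then show ?case by (simp add: mult.assoc)
  qed
  have Q1: "Q (\<lambda>_. 1)" using mom by (simp add: Q_def)
  have poly: "(\<integral>v. p v \<partial>M) = (\<integral>v. p v \<partial>N)" if "real_polynomial_function p" for p
  proof -
    have "Q (\<lambda>v. p v * 1)" by (rule Qmult[OF that Q1])
    then have "(\<integral>v. fst v ^ 0 * snd v ^ 0 * (p v * 1) \<partial>M) = (\<integral>v. fst v ^ 0 * snd v ^ 0 * (p v * 1) \<partial>N)"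
      unfolding Q_def by blast
    then show ?thesis by simp
  qed
  show ?thesis
  proof (rule finite_measure_eq_on_closed[OF fM fN sM sN])
    fix f :: "real \<times> real \<Rightarrow> real" assume fc: "continuous_on UNIV f"
    have fm[measurable]: "f \<in> borel_measurable borel" by (rule borel_measurable_continuous_onI[OF fc])
    obtain B where B: "\<And>v. v \<in> K \<Longrightarrow> \<bar>f v\<bar> \<le> B" using cb[OF fc] by blast
    have "\<bar>(\<integral>x. f x \<partial>M) - (\<integral>x. f x \<partial>N)\<bar> \<le> e * (measure M (space M) + measure N (space N))" if e: "0 < e" for e
    proof -
      obtain p where p: "real_polynomial_function p" "\<And>v. v \<in> K \<Longrightarrow> \<bar>f v - p v\<bar> < e"
        by (rule Stone_Weierstrass_real_polynomial_function[OF K continuous_on_subset[OF fc subset_UNIV] e]) blast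
      have pc: "continuous_on UNIV p"
        using p(1) continuous_on_polymonial_function real_polynomial_function_eq by blast
      have pm[measurable]: "p \<in> borel_measurable borel" by (rule borel_measurable_continuous_onI[OF pc])
      obtain B' where B': "\<And>v. v \<in> K \<Longrightarrow> \<bar>p v\<bar> \<le> B'" using cb[OF pc] by blast
      note fi = int[OF fm B] and pi = int[OF pm B']
      have est: "\<bar>(\<integral>x. f x \<partial>R) - (\<integral>x. p x \<partial>R)\<bar> \<le> e * measure R (space R)"
        if "finite_measure R" "integrable R f" "integrable R p" "AE v in R. v \<in> K" for R
      proof -
        interpret R: finite_measure R by fact
        have "\<bar>(\<integral>x. f x \<partial>R) - (\<integral>x. p x \<partial>R)\<bar> = \<bar>\<integral>x. f x - p x \<partial>R\<bar>" using that by simp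
        also have "\<dots> \<le> (\<integral>x. \<bar>f x - p x\<bar> \<partial>R)" by (rule integral_abs_bound)
        also have "\<dots> \<le> (\<integral>x. e \<partial>R)"
        proof (rule integral_mono_AE)
          show "AE x in R. \<bar>f x - p x\<bar> \<le> e" using that(4) by eventually_elim (use p(2) in \<open>auto intro: less_imp_le\<close>)
        qed (use that in auto)
        finally show ?thesis by (simp add: mult.commute)
      qed
      show ?thesis
        using est[OF fM fi(1) pi(1) aM] est[OF fN fi(2) pi(2) aN] poly[OF p(1)] unfolding distrib_left by linarith
    qed
    then have "\<bar>(\<integral>x. f x \<partial>M) - (\<integral>x. f x \<partial>N)\<bar> \<le> e" if "0 < e" for e
    proof -
      define m where "m = measure M (space M) + measure N (space N) + 1"
      have m: "0 < m" by (simp add: m_def add_nonneg_pos)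
      have "\<bar>(\<integral>x. f x \<partial>M) - (\<integral>x. f x \<partial>N)\<bar> \<le> (e / m) * (measure M (space M) + measure N (space N))"
        using \<open>\<And>e. 0 < e \<Longrightarrow> _\<close>[of "e / m"] that m by simp
      also have "\<dots> \<le> (e / m) * m" using that m by (intro mult_left_mono) (auto simp: m_def)
      finally show ?thesis using m by simp
    qed
    then show "(\<integral>x. f x \<partial>M) = (\<integral>x. f x \<partial>N)"
      by (metis abs_le_zero_iff dense_ge eq_iff_diff_eq_0)
  qed
qed

text \<open>A function of s = exp(- r^2), for which - ln s = r^2 and 1 / ln s = - 1 / r^2. The
  factor (- ln s)^(-a) with a = \<nu> / 2 cancels the radial part r^\<nu> of a mode, and exp(- 1 /
  r^2) keeps the result continuous at s = 1, which is the vertex.\<close>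

definition radial_weight :: "real \<Rightarrow> nat \<Rightarrow> real \<Rightarrow> real" where
  "radial_weight a j s = (if 0 < s \<and> s < 1 then s ^ j * (s * exp (1 / ln s) * (- ln s) powr (- a)) else 0)"

lemma continuous_on_radial_weight:
  assumes a: "0 \<le> a"
  shows "continuous_on {0..1} (radial_weight a j)"
proof (rule continuous_on_IccI)
  have r: "((\<lambda>s::real. s * exp (1 / ln s) * (- ln s) powr (- a)) \<longlongrightarrow> 0) (at_right 0)"
    and l: "((\<lambda>s::real. s * exp (1 / ln s) * (- ln s) powr (- a)) \<longlongrightarrow> 0) (at_left 1)"
  proof -
    show "((\<lambda>s::real. s * exp (1 / ln s) * (- ln s) powr (- a)) \<longlongrightarrow> 0) (at_right 0)"
    proof (cases "a = 0")
      case True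
      have "((\<lambda>s::real. s * exp (1 / ln s)) \<longlongrightarrow> 0) (at_right 0)" by real_asymp
      moreover have "\<forall>\<^sub>F s in at_right 0. s * exp (1 / ln s) = s * exp (1 / ln s) * (- ln s) powr (- a)"
        unfolding eventually_at_right_field by (intro exI[of _ 1]) (auto simp: True)
      ultimately show ?thesis by (rule Lim_transform_eventually)
    next
      case False
      then have "0 < a" using a by simp
      then show ?thesis by real_asymp
    qed
    show "((\<lambda>s::real. s * exp (1 / ln s) * (- ln s) powr (- a)) \<longlongrightarrow> 0) (at_left 1)"
    proof (cases "a = 0")
      case True
      have "((\<lambda>s::real. s * exp (1 / ln s)) \<longlongrightarrow> 0) (at_left 1)" by real_asymp
      moreover have "\<forall>\<^sub>F s in at_left 1. s * exp (1 / ln s) = s * exp (1 / ln s) * (- ln s) powr (- a)"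
        unfolding eventually_at_left_field by (intro exI[of _ 0]) (auto simp: True)
      ultimately show ?thesis by (rule Lim_transform_eventually)
    next
      case False
      then have "0 < a" using a by simp
      then show ?thesis by real_asymp
    qed
  qed
  have "((\<lambda>s::real. s ^ j * (s * exp (1 / ln s) * (- ln s) powr (- a))) \<longlongrightarrow> 0 ^ j * 0) (at_right 0)"
    by (intro tendsto_intros r)
  moreover have "\<forall>\<^sub>F s in at_right 0. s ^ j * (s * exp (1 / ln s) * (- ln s) powr (- a)) = radial_weight a j s"
    unfolding eventually_at_right_field by (intro exI[of _ 1]) (auto simp: radial_weight_def)
  ultimately show "(radial_weight a j \<longlongrightarrow> radial_weight a j 0) (at_right 0)"
    using Lim_transform_eventually by (force simp: radial_weight_def[of a j 0])
  have "((\<lambda>s::real. s ^ j * (s * exp (1 / ln s) * (- ln s) powr (- a))) \<longlongrightarrow> 1 ^ j * 0) (at_left 1)"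
    by (intro tendsto_intros l)
  moreover have "\<forall>\<^sub>F s in at_left 1. s ^ j * (s * exp (1 / ln s) * (- ln s) powr (- a)) = radial_weight a j s"
    unfolding eventually_at_left_field by (intro exI[of _ 0]) (auto simp: radial_weight_def)
  ultimately show "(radial_weight a j \<longlongrightarrow> radial_weight a j 1) (at_left 1)"
    using Lim_transform_eventually by (force simp: radial_weight_def[of a j 1])
  show "radial_weight a j \<midarrow>x\<rightarrow> radial_weight a j x" if x: "0 < x" "x < 1" for x
  proof -
    have "((\<lambda>s::real. s ^ j * (s * exp (1 / ln s) * (- ln s) powr (- a))) \<longlongrightarrow> x ^ j * (x * exp (1 / ln x) * (- ln x) powr (- a))) (at x)"
      using x by (intro tendsto_intros) auto
    moreover have "\<forall>\<^sub>F s in at x. s ^ j * (s * exp (1 / ln s) * (- ln s) powr (- a)) = radial_weight a j s"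
    proof -
      have "\<forall>\<^sub>F s in at x. s \<in> {0<..<1}" using x by (intro eventually_at_in_open') auto
      then show ?thesis by eventually_elim (simp add: radial_weight_def)
    qed
    ultimately show ?thesis
      using Lim_transform_eventually x by (force simp: radial_weight_def[of a j x])
  qed
qed simp

definition cosine :: "real \<Rightarrow> nat \<Rightarrow> real^2 \<Rightarrow> real" where
  "cosine \<alpha> k z = P \<alpha> k z / rpow \<alpha> k (norm z)"

lemma borel_measurable_cosine[measurable]: "cosine \<alpha> k \<in> borel_measurable borel"
  unfolding cosine_def[abs_def] rpow_def[abs_def] by measurable

lemma abs_cosine_le_1: "\<bar>cosine \<alpha> k z\<bar> \<le> 1"
  using abs_P_le_rpow[of \<alpha> k z] by (auto simp: cosine_def abs_divide divide_le_eq_1)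

lemma cosine_polar:
  assumes "0 < \<alpha>" "\<alpha> < 2 * pi" "0 < r" "0 \<le> t" "t \<le> \<alpha>"
  shows "cosine \<alpha> k (polar r t) = cos (real k * pi * t / \<alpha>)"
  using P_polar[of \<alpha> r t k] assms by (auto simp: cosine_def rpow_def norm_polar)

lemma cosine_product:
  assumes \<alpha>: "0 < \<alpha>" "\<alpha> < 2 * pi" and z: "z \<in> wedge \<alpha>" "z \<noteq> 0"
  shows "cosine \<alpha> 1 z * cosine \<alpha> (Suc i) z = (cosine \<alpha> (Suc (Suc i)) z + cosine \<alpha> i z) / 2"
proof -
  obtain r t where rt: "z = polar r t" "0 \<le> r" "0 \<le> t" "t \<le> \<alpha>" using z by (auto simp: wedge_def)
  have r: "0 < r" using rt z by (cases "r = 0") (auto simp: polar_def vec_eq_iff forall_2)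
  define u where "u = pi * t / \<alpha>"
  have c: "cosine \<alpha> k z = cos (real k * u)" for k
    unfolding rt(1) cosine_polar[OF \<alpha> r rt(3,4)] by (simp add: u_def mult.assoc)
  have e: "real (Suc (Suc i)) * u = real (Suc i) * u + u" "real i * u = real (Suc i) * u - u"
    by (simp_all add: algebra_simps)
  show ?thesis unfolding c e cos_add cos_diff by simp
qed

text \<open>What is left of the radial factors once r^\<nu> is cancelled. It is the same for all
  modes, positive off the vertex and 0 at the vertex. One factor exp(- r^2) comes from the damping
  of the modes, one from \<open>radial_weight\<close>.\<close>

definition vertex_weight :: "real^2 \<Rightarrow> real" where
  "vertex_weight z = (if z = 0 then 0 else exp (- 2 * (norm z)\<^sup>2) * exp (- 1 / (norm z)\<^sup>2))"

lemma vertex_weight_bounds: "0 \<le> vertex_weight z" "vertex_weight z \<le> 1" "z \<noteq> 0 \<Longrightarrow> 0 < vertex_weight z"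
  by (auto simp: vertex_weight_def intro!: mult_le_one)

lemma borel_measurable_vertex_weight[measurable]: "vertex_weight \<in> borel_measurable borel"
  unfolding vertex_weight_def[abs_def] by measurable

lemma vertex_weight_measurable:
  assumes [measurable]: "A \<in> sets borel"
  shows "(\<lambda>z. ennreal (vertex_weight z)) \<in> borel_measurable borel"
    "(\<lambda>z. ennreal (1 / vertex_weight z) * indicator A z) \<in> borel_measurable borel"
proof -
  show "(\<lambda>z. ennreal (vertex_weight z)) \<in> borel_measurable borel"
    by (rule measurable_compose[OF borel_measurable_vertex_weight measurable_ennreal])
  have "(\<lambda>z. 1 / vertex_weight z) \<in> borel_measurable borel"
    by (rule borel_measurable_divide[OF borel_measurable_const borel_measurable_vertex_weight])
  from borel_measurable_times_ennreal[OF measurable_compose[OF this measurable_ennreal] borel_measurable_indicator[OF assms]]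
  show "(\<lambda>z. ennreal (1 / vertex_weight z) * indicator A z) \<in> borel_measurable borel" .
qed

lemma radial_weight_mode:
  assumes \<alpha>: "0 < \<alpha>"
  shows "P \<alpha> k z * exp (- (norm z)\<^sup>2) * radial_weight (real k * pi / \<alpha> / 2) j (exp (- (norm z)\<^sup>2))
     = vertex_weight z * exp (- (norm z)\<^sup>2) ^ j * cosine \<alpha> k z"
proof (cases "z = 0")
  case False
  define q where "q = (norm z)\<^sup>2"
  have q: "0 < q" using False by (simp add: q_def)
  have rp: "q powr - (real k * pi / \<alpha> / 2) = 1 / rpow \<alpha> k (norm z)"
  proof -
    have n2: "q = norm z powr 2" using False by (simp add: q_def)
    have "q powr (real k * pi / \<alpha> / 2) = norm z powr (real k * pi / \<alpha>)"
      unfolding n2 powr_powr by simp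
    also have "\<dots> = rpow \<alpha> k (norm z)" using False by (simp add: rpow_def)
    finally show ?thesis by (simp only: powr_minus_divide)
  qed
  have "radial_weight (real k * pi / \<alpha> / 2) j (exp (- q)) = exp (- q) ^ j * (exp (- q) * exp (- 1 / q) * (1 / rpow \<alpha> k (norm z)))"
  proof -
    have "0 < exp (- q) \<and> exp (- q) < 1" using q by simp
    then have "radial_weight (real k * pi / \<alpha> / 2) j (exp (- q))
      = exp (- q) ^ j * (exp (- q) * exp (1 / (- q)) * q powr - (real k * pi / \<alpha> / 2))"
      unfolding radial_weight_def by (simp only: simp_thms if_True ln_exp minus_minus)
    then show ?thesis unfolding rp by (simp only: divide_minus_right minus_divide_left)
  qed
  moreover have "exp (- 2 * q) = exp (- q) * exp (- q)" by (simp add: exp_add[symmetric])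
  ultimately show ?thesis using False by (simp add: vertex_weight_def cosine_def q_def[symmetric])
qed (simp add: vertex_weight_def radial_weight_def)

text \<open>For a fixed mode, the rates l = 1, 2, ... give all powers of s = exp(- r^2), so
  Weierstrass replaces the exponential by any continuous function of s; \<open>radial_weight\<close>
  then removes the radial part of the mode. This leaves the integrals of s^j cos(k pi \<theta> /
  \<alpha>) against the weighted measures, hence all moments of the pair of s and cos(pi \<theta> /
  \<alpha>). The pair determines a point of the wedge, so the weighted measures agree; dividing out
  the weight gives agreement off the vertex, and the total mass fixes the vertex.\<close>

lemma wedge_measure_eqI:
  fixes \<mu> \<nu> :: "(real^2) measure"
  assumes \<alpha>: "0 < \<alpha>" "\<alpha> < 2 * pi" and f\<mu>: "finite_measure \<mu>" and f\<nu>: "finite_measure \<nu>"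
    and s\<mu>: "sets \<mu> = sets borel" and s\<nu>: "sets \<nu> = sets borel"
    and a\<mu>: "AE z in \<mu>. z \<in> wedge \<alpha>" and a\<nu>: "AE z in \<nu>. z \<in> wedge \<alpha>"
    and mom: "\<And>k l. 0 < l \<Longrightarrow> (\<integral>z. P \<alpha> k z * exp (- l * (norm z)\<^sup>2) \<partial>\<mu>) = (\<integral>z. P \<alpha> k z * exp (- l * (norm z)\<^sup>2) \<partial>\<nu>)"
  shows "\<mu> = \<nu>"
proof -
  interpret M: finite_measure \<mu> by fact
  interpret N: finite_measure \<nu> by fact
  have [measurable_cong]: "sets \<mu> = sets borel" "sets \<nu> = sets borel" by fact+
  have sp: "space \<mu> = UNIV" "space \<nu> = UNIV" using sets_eq_imp_space_eq[OF s\<mu>] sets_eq_imp_space_eq[OF s\<nu>] by auto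
  have int: "integrable \<mu> f" "integrable \<nu> f" if "f \<in> borel_measurable borel" "\<And>z. \<bar>f z\<bar> \<le> B" for f :: "real^2 \<Rightarrow> real" and B
    using that by (auto intro!: M.integrable_const_bound[where B=B] N.integrable_const_bound[where B=B])
  have Pb: "\<exists>A. \<forall>z. \<bar>P \<alpha> k z * exp (- l * (norm z)\<^sup>2)\<bar> \<le> A" if l: "0 < l" for k l
  proof -
    obtain A where A: "0 \<le> A" "\<And>r. 0 \<le> r \<Longrightarrow> rpow \<alpha> k r * r ^ 0 * exp (- l * r\<^sup>2) \<le> A"
      using rpow_exp_bounded[OF \<alpha>(1) l] by blast
    have "\<bar>P \<alpha> k z * exp (- l * (norm z)\<^sup>2)\<bar> \<le> A" for z
    proof -
      have "\<bar>P \<alpha> k z * exp (- l * (norm z)\<^sup>2)\<bar> \<le> rpow \<alpha> k (norm z) * exp (- l * (norm z)\<^sup>2)"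
        by (simp add: abs_mult abs_P_le_rpow)
      then show ?thesis using A(2)[of "norm z"] by simp
    qed
    then show ?thesis by blast
  qed
  have eq1: "(\<integral>z. P \<alpha> k z * exp (- (norm z)\<^sup>2) * g (exp (- (norm z)\<^sup>2)) \<partial>\<mu>) = (\<integral>z. P \<alpha> k z * exp (- (norm z)\<^sup>2) * g (exp (- (norm z)\<^sup>2)) \<partial>\<nu>)"
    if g: "continuous_on {0..1} g" for k and g :: "real \<Rightarrow> real"
  proof -
    have cc: "continuous_on UNIV (\<lambda>z::real^2. g (exp (- (norm z)\<^sup>2)))" if "continuous_on {0..1} g" for g :: "real \<Rightarrow> real"
      by (rule continuous_on_compose2[OF that]) (auto intro!: continuous_intros)
    obtain A where A: "\<And>z. \<bar>P \<alpha> k z * exp (- 1 * (norm z)\<^sup>2)\<bar> \<le> A" using Pb[of 1 k] by auto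
    have A0: "0 \<le> A" using order_trans[OF abs_ge_zero A] .
    have gen: "integrable \<mu> (\<lambda>z. P \<alpha> k z * exp (- (norm z)\<^sup>2) * g (exp (- (norm z)\<^sup>2)))"
      "integrable \<nu> (\<lambda>z. P \<alpha> k z * exp (- (norm z)\<^sup>2) * g (exp (- (norm z)\<^sup>2)))" if g: "continuous_on {0..1} g" for g :: "real \<Rightarrow> real"
    proof -
      have gm[measurable]: "(\<lambda>z::real^2. g (exp (- (norm z)\<^sup>2))) \<in> borel_measurable borel"
        by (rule borel_measurable_continuous_onI[OF cc[OF g]])
      have "\<exists>B. \<forall>s\<in>{0..1}. \<bar>g s\<bar> \<le> B"
        using compact_imp_bounded[OF compact_continuous_image[OF g compact_Icc]] by (simp add: bounded_iff)
      then obtain B where B: "\<And>s. s \<in> {0..1} \<Longrightarrow> \<bar>g s\<bar> \<le> B" by blast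
      have "\<bar>P \<alpha> k z * exp (- (norm z)\<^sup>2) * g (exp (- (norm z)\<^sup>2))\<bar> \<le> A * B" for z
        unfolding abs_mult[of _ "g _"] using A[of z] A0 by (intro mult_mono B) auto
      then show "integrable \<mu> (\<lambda>z. P \<alpha> k z * exp (- (norm z)\<^sup>2) * g (exp (- (norm z)\<^sup>2)))"
        "integrable \<nu> (\<lambda>z. P \<alpha> k z * exp (- (norm z)\<^sup>2) * g (exp (- (norm z)\<^sup>2)))"
        by (intro int[where B="A * B"]; simp)+
    qed
    define I where "I R g = (\<integral>z. P \<alpha> k z * exp (- (norm z)\<^sup>2) * g (exp (- (norm z)\<^sup>2)) \<partial>R)" for R and g :: "real \<Rightarrow> real"
    have small: "\<bar>I \<mu> g - I \<nu> g\<bar> \<le> e * (A * measure \<mu> UNIV + A * measure \<nu> UNIV)" if e: "0 < e" for e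
    proof -
      obtain p where p: "real_polynomial_function p" "\<And>s. s \<in> {0..1} \<Longrightarrow> \<bar>g s - p s\<bar> < e"
        by (rule Stone_Weierstrass_real_polynomial_function[OF compact_Icc g e]) blast
      obtain a m where pam: "p = (\<lambda>s. \<Sum>i\<le>m. a i * s ^ i)" using p(1) real_polynomial_function_iff_sum by blast
      have pc: "continuous_on {0..1} p" unfolding pam by (intro continuous_intros)
      \<comment> \<open>The damping factor supplies one power of s, so the monomial of degree i
        corresponds to the rate i + 1.\<close>
      have mono: "(\<lambda>z. P \<alpha> k z * exp (- (norm z)\<^sup>2) * exp (- (norm z)\<^sup>2) ^ i) = (\<lambda>z. P \<alpha> k z * exp (- (real (Suc i)) * (norm z)\<^sup>2))" for i
        by (auto simp: fun_eq_iff exp_of_nat_mult[symmetric] exp_add[symmetric] algebra_simps)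
      have e1: "P \<alpha> k z * exp (- (norm z)\<^sup>2) * p (exp (- (norm z)\<^sup>2)) = (\<Sum>i\<le>m. a i * (P \<alpha> k z * exp (- (norm z)\<^sup>2) * exp (- (norm z)\<^sup>2) ^ i))" for z
        by (simp add: pam sum_distrib_left mult_ac)
      have pc': "continuous_on {0..1} (\<lambda>s::real. s ^ i)" for i by (intro continuous_intros)
      note gi1 = gen(1)[OF pc'] and gi2 = gen(2)[OF pc']
      have "I \<mu> p = (\<Sum>i\<le>m. a i * (\<integral>z. P \<alpha> k z * exp (- (norm z)\<^sup>2) * exp (- (norm z)\<^sup>2) ^ i \<partial>\<mu>))"
        unfolding I_def e1 by (subst Bochner_Integration.integral_sum) (simp_all add: gi1)
      also have "\<dots> = (\<Sum>i\<le>m. a i * (\<integral>z. P \<alpha> k z * exp (- (norm z)\<^sup>2) * exp (- (norm z)\<^sup>2) ^ i \<partial>\<nu>))"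
        unfolding mono by (intro sum.cong refl arg_cong2[where f=times] mom) simp
      also have "\<dots> = I \<nu> p"
        unfolding I_def e1 by (subst Bochner_Integration.integral_sum) (simp_all add: gi2)
      finally have Ip: "I \<mu> p = I \<nu> p" .
      have pt: "\<bar>P \<alpha> k z * exp (- (norm z)\<^sup>2) * g (exp (- (norm z)\<^sup>2)) - P \<alpha> k z * exp (- (norm z)\<^sup>2) * p (exp (- (norm z)\<^sup>2))\<bar> \<le> A * e" for z
      proof -
        have "\<bar>P \<alpha> k z * exp (- (norm z)\<^sup>2) * (g (exp (- (norm z)\<^sup>2)) - p (exp (- (norm z)\<^sup>2)))\<bar> \<le> A * e"
          unfolding abs_mult[of _ "g _ - _"] using A[of z] A0 p(2)[of "exp (- (norm z)\<^sup>2)"] by (intro mult_mono) auto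
        then show ?thesis by (simp add: right_diff_distrib)
      qed
      have est: "\<bar>I R g - I R p\<bar> \<le> e * (A * measure R UNIV)"
        if "finite_measure R" "space R = UNIV" "integrable R (\<lambda>z. P \<alpha> k z * exp (- (norm z)\<^sup>2) * g (exp (- (norm z)\<^sup>2)))"
          "integrable R (\<lambda>z. P \<alpha> k z * exp (- (norm z)\<^sup>2) * p (exp (- (norm z)\<^sup>2)))" for R
      proof -
        interpret R: finite_measure R by fact
        have "\<bar>I R g - I R p\<bar> = \<bar>\<integral>z. P \<alpha> k z * exp (- (norm z)\<^sup>2) * g (exp (- (norm z)\<^sup>2)) - P \<alpha> k z * exp (- (norm z)\<^sup>2) * p (exp (- (norm z)\<^sup>2)) \<partial>R\<bar>"
          unfolding I_def using that(3,4) by (subst Bochner_Integration.integral_diff) auto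
        also have "\<dots> \<le> (\<integral>z. \<bar>P \<alpha> k z * exp (- (norm z)\<^sup>2) * g (exp (- (norm z)\<^sup>2)) - P \<alpha> k z * exp (- (norm z)\<^sup>2) * p (exp (- (norm z)\<^sup>2))\<bar> \<partial>R)"
          by (rule integral_abs_bound)
        also have "\<dots> \<le> (\<integral>z. A * e \<partial>R)"
          by (rule integral_mono) (use that(3,4) pt in auto)
        finally show ?thesis using that(2) by (simp add: mult_ac)
      qed
      show ?thesis
        using est[OF f\<mu> sp(1) gen(1)[OF g] gen(1)[OF pc]] est[OF f\<nu> sp(2) gen(2)[OF g] gen(2)[OF pc]] Ip
        unfolding distrib_left by linarith
    qed
    have "\<bar>I \<mu> g - I \<nu> g\<bar> \<le> e" if "0 < e" for e
    proof -
      define m where "m = A * measure \<mu> UNIV + A * measure \<nu> UNIV + 1"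
      have m: "0 < m" using A0 by (simp add: m_def add_nonneg_pos)
      have "\<bar>I \<mu> g - I \<nu> g\<bar> \<le> (e / m) * (A * measure \<mu> UNIV + A * measure \<nu> UNIV)" using small[of "e / m"] that m by simp
      also have "\<dots> \<le> (e / m) * m" using that m by (intro mult_left_mono) (auto simp: m_def)
      finally show ?thesis using m by simp
    qed
    then have "I \<mu> g = I \<nu> g" by (metis abs_le_zero_iff dense_ge eq_iff_diff_eq_0)
    then show ?thesis by (simp add: I_def)
  qed
  define S where "S z = exp (- (norm z)\<^sup>2)" for z :: "real^2"
  have S: "0 < S z" "S z \<le> 1" for z by (auto simp: S_def)
  have [measurable]: "S \<in> borel_measurable borel" unfolding S_def[abs_def] by measurable
  have eq2: "(\<integral>z. vertex_weight z * S z ^ j * cosine \<alpha> k z \<partial>\<mu>) = (\<integral>z. vertex_weight z * S z ^ j * cosine \<alpha> k z \<partial>\<nu>)" for k j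
    using eq1[OF continuous_on_radial_weight, of "real k * pi / \<alpha> / 2" k j] \<alpha>
    unfolding radial_weight_mode[OF \<alpha>(1)] S_def by simp
  \<comment> \<open>These functions interpolate between multiple-angle cosines, m = 0, and powers of
    the first cosine, i = 0. The product formula trades one power of the first cosine for two
    neighbouring frequencies.\<close>
  define h where "h j m i z = vertex_weight z * S z ^ j * cosine \<alpha> 1 z ^ m * cosine \<alpha> i z" for j m i z
  have hm[measurable]: "h j m i \<in> borel_measurable borel" for j m i unfolding h_def[abs_def] by measurable
  have hb: "\<bar>h j m i z\<bar> \<le> 1" for j m i z
    unfolding h_def abs_mult power_abs
    using vertex_weight_bounds[of z] S[of z] abs_cosine_le_1[of \<alpha>]
    by (intro mult_le_one power_le_one) (auto intro!: power_le_one)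
  note hi = int[OF hm hb]
  have h_rec: "AE z in R. h j (Suc m) (Suc i) z = (h j m (Suc (Suc i)) z + h j m i z) / 2" if "AE z in R. z \<in> wedge \<alpha>" for j m i R
    using that
  proof eventually_elim
    case (elim z)
    show ?case
    proof (cases "z = 0")
      case False
      have "h j (Suc m) (Suc i) z = vertex_weight z * S z ^ j * cosine \<alpha> 1 z ^ m * (cosine \<alpha> 1 z * cosine \<alpha> (Suc i) z)"
        by (simp add: h_def)
      also have "\<dots> = (h j m (Suc (Suc i)) z + h j m i z) / 2"
        unfolding cosine_product[OF \<alpha> elim False] by (simp add: h_def algebra_simps)
      finally show ?thesis .
    qed (simp add: h_def vertex_weight_def)
  qed
  have h_rec0: "h j (Suc m) 0 z = h j m 1 z" for j m z
    by (simp add: h_def cosine_def P_def Fw_def rpow_def)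
  have eq3: "(\<integral>z. h j m i z \<partial>\<mu>) = (\<integral>z. h j m i z \<partial>\<nu>)" for j m i
  proof (induction m arbitrary: i)
    case 0
    then show ?case using eq2 by (simp add: h_def)
  next
    case (Suc m)
    show ?case
    proof (cases i)
      case 0
      then show ?thesis using Suc.IH by (simp add: h_rec0)
    next
      case (Suc i')
      have "(\<integral>z. h j (Suc m) (Suc i') z \<partial>\<mu>) = (\<integral>z. (h j m (Suc (Suc i')) z + h j m i' z) / 2 \<partial>\<mu>)"
        by (rule integral_cong_AE) (use h_rec[OF a\<mu>] in auto)
      also have "\<dots> = ((\<integral>z. h j m (Suc (Suc i')) z \<partial>\<mu>) + (\<integral>z. h j m i' z \<partial>\<mu>)) / 2" using hi by simp
      also have "\<dots> = ((\<integral>z. h j m (Suc (Suc i')) z \<partial>\<nu>) + (\<integral>z. h j m i' z \<partial>\<nu>)) / 2" by (simp only: Suc.IH)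
      also have "\<dots> = (\<integral>z. (h j m (Suc (Suc i')) z + h j m i' z) / 2 \<partial>\<nu>)" using hi by simp
      also have "\<dots> = (\<integral>z. h j (Suc m) (Suc i') z \<partial>\<nu>)"
      proof (rule integral_cong_AE)
        show "AE z in \<nu>. (h j m (Suc (Suc i')) z + h j m i' z) / 2 = h j (Suc m) (Suc i') z"
          using h_rec[OF a\<nu>, of j m i'] by eventually_elim simp
      qed measurable
      finally show ?thesis using Suc by simp
    qed
  qed
  have [measurable]: "fst \<in> borel_measurable (borel :: (real \<times> real) measure)"
    "snd \<in> borel_measurable (borel :: (real \<times> real) measure)"
    by (intro borel_measurable_continuous_onI continuous_intros)+
  define \<Psi> where "\<Psi> z = (S z, cosine \<alpha> 1 z)" for z
  have [measurable]: "\<Psi> \<in> borel_measurable borel" unfolding \<Psi>_def[abs_def] by measurable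
  define D where "D R = density R (\<lambda>z. ennreal (vertex_weight z))" for R :: "(real^2) measure"
  have Dfin: "finite_measure (D R)" if "finite_measure R" "sets R = sets borel" for R
  proof -
    interpret R: finite_measure R by fact
    have [measurable_cong]: "sets R = sets borel" by fact
    have "emeasure (D R) (space (D R)) = (\<integral>\<^sup>+z. ennreal (vertex_weight z) \<partial>R)"
      unfolding D_def by (simp add: emeasure_density)
    also have "\<dots> \<le> (\<integral>\<^sup>+z. 1 \<partial>R)"
      using vertex_weight_bounds by (intro nn_integral_mono) (auto simp: ennreal_le_1)
    also have "\<dots> < \<infinity>" by (simp add: R.emeasure_finite less_top[symmetric])
    finally show ?thesis by (intro finite_measureI) auto
  qed
  have Dsets[measurable_cong]: "sets (D \<mu>) = sets borel" "sets (D \<nu>) = sets borel" by (simp_all add: D_def s\<mu> s\<nu>)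
  have Dmom: "(\<integral>v. fst v ^ i * snd v ^ j \<partial>distr (D R) borel \<Psi>) = (\<integral>z. h i j 0 z \<partial>R)" if R[measurable_cong]: "sets R = sets borel" for R i j
  proof -
    have [measurable_cong]: "sets (D R) = sets borel" by (simp add: D_def R)
    have "(\<integral>v. fst v ^ i * snd v ^ j \<partial>distr (D R) borel \<Psi>) = (\<integral>z. S z ^ i * cosine \<alpha> 1 z ^ j \<partial>D R)"
      by (subst integral_distr) (auto simp: \<Psi>_def)
    also have "\<dots> = (\<integral>z. vertex_weight z *\<^sub>R (S z ^ i * cosine \<alpha> 1 z ^ j) \<partial>R)"
      unfolding D_def by (rule integral_density) (auto simp: vertex_weight_bounds)
    also have "\<dots> = (\<integral>z. h i j 0 z \<partial>R)"
      by (simp add: h_def cosine_def[of _ 0] P_def Fw_def rpow_def mult_ac)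
    finally show ?thesis .
  qed
  have "distr (D \<mu>) borel \<Psi> = distr (D \<nu>) borel \<Psi>"
  proof (rule finite_measure_eq_moments[of _ _ "{0..1} \<times> {-1..1}"])
    show "finite_measure (distr (D \<mu>) borel \<Psi>)" by (rule finite_measure.finite_measure_distr[OF Dfin[OF f\<mu> s\<mu>]]) measurable
    show "finite_measure (distr (D \<nu>) borel \<Psi>)" by (rule finite_measure.finite_measure_distr[OF Dfin[OF f\<nu> s\<nu>]]) measurable
    show "compact ({0..1::real} \<times> {-1..1::real})" by (intro compact_Times compact_Icc)
    have "\<Psi> z \<in> {0..1} \<times> {-1..1}" for z
      using S[of z] abs_cosine_le_1[of \<alpha> 1 z] by (auto simp: \<Psi>_def abs_le_iff less_imp_le)
    then show "AE v in distr (D \<mu>) borel \<Psi>. v \<in> {0..1} \<times> {-1..1}" "AE v in distr (D \<nu>) borel \<Psi>. v \<in> {0..1} \<times> {-1..1}"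
      by (subst AE_distr_iff; simp add: borel_closed closed_Times)+
  qed (use Dmom[OF s\<mu>] Dmom[OF s\<nu>] eq3 in auto)
  note Deq = this
  define ac where "ac y = indicator {-1..1} y *\<^sub>R arccos y" for y :: real
  have [measurable]: "ac \<in> borel_measurable borel"
    unfolding ac_def[abs_def] by (rule borel_measurable_continuous_on_indicator) (auto intro!: continuous_on_arccos')
  \<comment> \<open>A measurable left inverse of \<open>\<Psi>\<close> on the wedge: the radius is
    recovered by the logarithm, the angle by arccos. At the vertex the radius is 0, so the angle
    does not matter.\<close>
  define \<Phi> where "\<Phi> v = polar (sqrt (- ln (fst v))) (\<alpha> / pi * ac (snd v))" for v
  have polar_m: "(\<lambda>v. polar (fst v) (snd v)) \<in> borel_measurable borel"
  proof (intro borel_measurable_continuous_onI)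
    have e: "(\<lambda>v. polar (fst v) (snd v)) = (\<lambda>v. \<chi> i. if i = 1 then fst v * cos (snd v) else fst v * sin (snd v))"
      by (auto simp: polar_def vec_eq_iff forall_2)
    have "continuous_on UNIV (\<lambda>v::real \<times> real. if i = 1 then fst v * cos (snd v) else fst v * sin (snd v))" for i :: 2
      by (cases "i = 1") (auto intro!: continuous_intros)
    then show "continuous_on UNIV (\<lambda>v. polar (fst v) (snd v))" unfolding e by (rule continuous_on_vec_lambda)
  qed
  have \<Phi>m[measurable]: "\<Phi> \<in> borel_measurable borel"
  proof -
    have "(\<lambda>v::real \<times> real. (sqrt (- ln (fst v)), \<alpha> / pi * ac (snd v))) \<in> borel \<rightarrow>\<^sub>M borel" by measurable
    from measurable_compose[OF this polar_m] show ?thesis by (simp add: \<Phi>_def[abs_def])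
  qed
  have inv: "\<Phi> (\<Psi> z) = z" if zw: "z \<in> wedge \<alpha>" for z
  proof -
    obtain r t where rt: "z = polar r t" "0 \<le> r" "0 \<le> t" "t \<le> \<alpha>" using zw by (auto simp: wedge_def)
    show ?thesis
    proof (cases "r = 0")
      case True
      have p0: "polar 0 u = 0" for u by (simp add: polar_def vec_eq_iff forall_2)
      have "z = 0" using True by (simp add: rt(1) p0)
      then show ?thesis by (simp add: \<Phi>_def \<Psi>_def S_def p0)
    next
      case False
      then have r: "0 < r" using rt by simp
      have u: "0 \<le> pi * t / \<alpha>" "pi * t / \<alpha> \<le> pi" using rt \<alpha> by (auto simp: field_simps)
      have "ac (cosine \<alpha> 1 z) = pi * t / \<alpha>"
        unfolding rt(1) cosine_polar[OF \<alpha> r rt(3,4)] ac_def using arccos_cos[OF u] by (simp add: indicator_def)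
      moreover have "sqrt (- ln (S z)) = r" using r by (simp add: S_def rt(1) norm_polar)
      ultimately show ?thesis using \<alpha> by (simp add: \<Phi>_def \<Psi>_def rt(1))
    qed
  qed
  have recov: "distr (distr (D R) borel \<Psi>) borel \<Phi> = D R" if R[measurable_cong]: "sets R = sets borel" and aR: "AE z in R. z \<in> wedge \<alpha>" for R
  proof -
    have sD[measurable_cong]: "sets (D R) = sets borel" by (simp add: D_def R)
    have "AE z in D R. z \<in> wedge \<alpha>"
      unfolding D_def using aR by (subst AE_density) auto
    then have "AE z in D R. \<Phi> (\<Psi> z) = z" by eventually_elim (rule inv)
    then have "distr (D R) borel (\<lambda>z. \<Phi> (\<Psi> z)) = distr (D R) borel (\<lambda>z. z)"
      by (intro distr_cong_AE) auto
    also have "\<dots> = D R" by (rule distr_id2) (simp add: sD)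
    finally show ?thesis by (subst distr_distr) (auto simp: o_def)
  qed
  have DD: "D \<mu> = D \<nu>" using recov[OF s\<mu> a\<mu>] unfolding Deq recov[OF s\<nu> a\<nu>] by (rule sym)
  \<comment> \<open>The weight is positive exactly off the vertex, so dividing by it recovers the
    measure there.\<close>
  have recover: "emeasure R (A - {0}) = (\<integral>\<^sup>+z. ennreal (1 / vertex_weight z) * indicator A z \<partial>D R)" if R: "sets R = sets borel" and A: "A \<in> sets borel" for R A
  proof -
    have "(\<integral>\<^sup>+z. ennreal (1 / vertex_weight z) * indicator A z \<partial>D R) = (\<integral>\<^sup>+z. ennreal (vertex_weight z) * (ennreal (1 / vertex_weight z) * indicator A z) \<partial>R)"
    proof -
      have eqm: "(borel_measurable R :: (real^2 \<Rightarrow> ennreal) set) = borel_measurable borel"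
        by (rule measurable_cong_sets[OF R refl])
      show ?thesis
        unfolding D_def
      proof (rule nn_integral_density)
        show "(\<lambda>z. ennreal (vertex_weight z)) \<in> borel_measurable R"
          unfolding eqm by (rule vertex_weight_measurable(1)[OF A])
        show "(\<lambda>z. ennreal (1 / vertex_weight z) * indicator A z) \<in> borel_measurable R"
          unfolding eqm by (rule vertex_weight_measurable(2)[OF A])
      qed
    qed
    also have "\<dots> = (\<integral>\<^sup>+z. indicator (A - {0}) z \<partial>R)"
    proof (rule nn_integral_cong)
      fix z
      show "ennreal (vertex_weight z) * (ennreal (1 / vertex_weight z) * indicator A z) = indicator (A - {0}) z"
      proof (cases "z = 0")
        case False
        then have "ennreal (vertex_weight z) * ennreal (1 / vertex_weight z) = 1"
          using vertex_weight_bounds[of z] by (simp flip: ennreal_mult)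
        then show ?thesis using False by (auto simp: indicator_def)
      qed (simp add: vertex_weight_def)
    qed
    also have "\<dots> = emeasure R (A - {0})" using A by (simp add: R)
    finally show ?thesis by simp
  qed
  have off: "measure \<mu> (A - {0}) = measure \<nu> (A - {0})" if "A \<in> sets borel" for A
    using recover[OF s\<mu> that] recover[OF s\<nu> that] DD by (simp add: measure_def)
  \<comment> \<open>The mode k = 0 with rate tending to 0 recovers the total mass; the mass at the
    vertex then follows by subtraction.\<close>
  have tot: "measure \<mu> UNIV = measure \<nu> UNIV"
  proof -
    have lim: "(\<lambda>m. \<integral>z. P \<alpha> 0 z * exp (- (1 / real (Suc m)) * (norm z)\<^sup>2) \<partial>R) \<longlonglongrightarrow> measure R UNIV"
      if "finite_measure R" and R[measurable_cong]: "sets R = sets borel" for R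
    proof -
      interpret R: finite_measure R by fact
      have "(\<lambda>m. \<integral>z. P \<alpha> 0 z * exp (- (1 / real (Suc m)) * (norm z)\<^sup>2) \<partial>R) \<longlonglongrightarrow> (\<integral>z. 1 \<partial>R)"
      proof (rule integral_dominated_convergence[where w="\<lambda>_. 1"])
        have "(\<lambda>m. exp (- (1 / real (Suc m)) * q)) \<longlonglongrightarrow> 1" for q :: real by real_asymp
        then show "AE z in R. (\<lambda>m. P \<alpha> 0 z * exp (- (1 / real (Suc m)) * (norm z)\<^sup>2)) \<longlonglongrightarrow> 1"
          by (simp add: P_def Fw_def)
      qed (auto simp: P_def Fw_def)
      then show ?thesis using sets_eq_imp_space_eq[OF R] by simp
    qed
    show ?thesis
      by (rule LIMSEQ_unique[OF lim[OF f\<mu> s\<mu>]]) (subst mom, simp, rule lim[OF f\<nu> s\<nu>])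
  qed
  have zero: "measure \<mu> {0} = measure \<nu> {0}"
    using off[of UNIV] tot M.finite_measure_compl[of "{0}"] N.finite_measure_compl[of "{0}"] by (simp add: sp s\<mu> s\<nu>)
  show ?thesis
  proof (rule measure_eqI)
    fix A assume "A \<in> sets \<mu>"
    then have A[measurable]: "A \<in> sets borel" by (simp add: s\<mu>)
    have "measure \<mu> A = measure \<nu> A"
    proof (cases "0 \<in> A")
      case True
      then have e: "A = {0} \<union> (A - {0})" by auto
      have "measure \<mu> A = measure \<mu> {0} + measure \<mu> (A - {0})" by (subst e, rule M.finite_measure_Union) (auto simp: s\<mu>)
      moreover have "measure \<nu> A = measure \<nu> {0} + measure \<nu> (A - {0})" by (subst e, rule N.finite_measure_Union) (auto simp: s\<nu>)
      ultimately show ?thesis using off[OF A] zero by simp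
    next
      case False
      then show ?thesis using off[OF A] by simp
    qed
    then show "emeasure \<mu> A = emeasure \<nu> A" by (simp add: M.emeasure_eq_measure N.emeasure_eq_measure)
  qed (simp add: s\<mu> s\<nu>)
qed

section \<open>Gamma integrals and modified Bessel functions\<close>

lemma has_bochner_integral_Gamma:
  assumes s: "0 < s"
  shows "has_bochner_integral lborel (\<lambda>t. indicator {0<..} t * (t powr (s - 1) * exp (- t))) (Gamma s :: real)"
proof -
  have e: "indicator {0<..} t * (t powr (s - 1) * exp (- t)) = indicator {0..} t * t powr (s - 1) / exp t" for t :: real
    by (auto simp: indicator_def exp_minus divide_inverse)
  have "has_bochner_integral lborel (\<lambda>t. indicator {0..} t * t powr (s - 1) / exp t) (Gamma s)"
    by (rule has_bochner_integral_nn_integral)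
       (use s Gamma_conv_nn_integral_real[OF s] Gamma_real_pos[OF s] in auto)
  then show ?thesis by (simp add: e)
qed

lemma radial_substitution:
  fixes u \<mu> p :: real
  assumes u: "0 < u" and \<mu>: "0 < \<mu>"
  shows "sqrt (u / \<mu>) powr p * exp (- \<mu> * (sqrt (u / \<mu>))\<^sup>2) * (1 / \<mu> / (2 * sqrt (u / \<mu>)))
    = 1 / 2 * \<mu> powr (- ((p + 1) / 2)) * (u powr ((p + 1) / 2 - 1) * exp (- u))"
proof -
  define q where "q = u / \<mu>"
  have q: "0 < q" using u \<mu> by (simp add: q_def)
  have uq: "u = \<mu> * q" using \<mu> by (simp add: q_def)
  have 1: "sqrt q powr p = q powr (p / 2)" using q powr_half_sqrt[of q] powr_powr[of q "1 / 2" p] by simp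
  have 2: "(sqrt q)\<^sup>2 = q" using q by simp
  have 3: "1 / sqrt q = q powr (- (1 / 2))" using q powr_half_sqrt[of q] powr_minus_divide[of q "1 / 2"] by simp
  have 4: "q powr (p / 2) * q powr (- (1 / 2)) = q powr ((p + 1) / 2 - 1)"
    unfolding powr_add[symmetric] by (rule arg_cong[where f = "\<lambda>e. q powr e"]) (simp add: field_simps)
  have 5: "u powr ((p + 1) / 2 - 1) = \<mu> powr ((p + 1) / 2 - 1) * q powr ((p + 1) / 2 - 1)"
    unfolding uq using q \<mu> by (intro powr_mult)
  have 6: "\<mu> powr (- ((p + 1) / 2)) * \<mu> powr ((p + 1) / 2 - 1) = 1 / \<mu>"
  proof -
    have "- ((p + 1) / 2) + ((p + 1) / 2 - 1) = - 1" by (simp add: field_simps)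
    then show ?thesis using \<mu> powr_minus_divide[of \<mu> 1] by (simp only: powr_add[symmetric] powr_one less_imp_le)
  qed
  have "sqrt q powr p * exp (- \<mu> * (sqrt q)\<^sup>2) * (1 / \<mu> / (2 * sqrt q)) = 1 / 2 * (1 / \<mu>) * (sqrt q powr p * (1 / sqrt q)) * exp (- (\<mu> * q))"
    unfolding 2 by (simp only: divide_inverse inverse_mult_distrib mult_1 mult_ac minus_mult_left)
  also have "\<dots> = 1 / 2 * (\<mu> powr (- ((p + 1) / 2)) * \<mu> powr ((p + 1) / 2 - 1)) * q powr ((p + 1) / 2 - 1) * exp (- u)"
    unfolding 1 3 4 6 uq ..
  also have "\<dots> = 1 / 2 * \<mu> powr (- ((p + 1) / 2)) * (u powr ((p + 1) / 2 - 1) * exp (- u))"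
    unfolding 5 by (simp only: mult.assoc)
  finally show ?thesis unfolding q_def .
qed

text \<open>The substitution u = \<mu> r^2 turns the Gaussian moment into Euler's integral.\<close>

lemma radial_Gamma_integral:
  fixes p \<mu> :: real
  assumes p: "0 \<le> p" and \<mu>: "0 < \<mu>"
  shows "integrable lborel (\<lambda>r. indicator {0..} r * (r powr p * exp (- \<mu> * r\<^sup>2)))"
    and "(\<integral>r. indicator {0..} r * (r powr p * exp (- \<mu> * r\<^sup>2)) \<partial>lborel) = 1 / 2 * \<mu> powr (- ((p + 1) / 2)) * Gamma ((p + 1) / 2)"
proof -
  define s where "s = (p + 1) / 2"
  have s: "0 < s" using p by (simp add: s_def)
  define f where "f r = r powr p * exp (- \<mu> * r\<^sup>2)" for r
  define g where "g u = sqrt (u / \<mu>)" for u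
  define g' where "g' u = (1 / \<mu>) / (2 * sqrt (u / \<mu>))" for u
  have ei: "einterval 0 \<infinity> = {0<..}" by (auto simp: einterval_def)
  have fg: "f (g u) * g' u = 1 / 2 * \<mu> powr (- s) * (u powr (s - 1) * exp (- u))" if u: "0 < u" for u
    using radial_substitution[OF u \<mu>, of p] by (simp only: f_def g_def g'_def s_def)
  have gi: "set_integrable lborel (einterval 0 \<infinity>) (\<lambda>u. f (g u) * g' u)"
  proof -
    have "integrable lborel (\<lambda>u. 1 / 2 * \<mu> powr (- s) * (indicator {0<..} u * (u powr (s - 1) * exp (- u))))"
      using has_bochner_integral_Gamma[OF s] by (intro integrable_mult_right) (auto simp: has_bochner_integral_iff)
    moreover have "(\<lambda>u. 1 / 2 * \<mu> powr (- s) * (indicator {0<..} u * (u powr (s - 1) * exp (- u)))) = (\<lambda>u. indicator {0<..} u *\<^sub>R (f (g u) * g' u))"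
    proof
      show "1 / 2 * \<mu> powr (- s) * (indicator {0<..} u * (u powr (s - 1) * exp (- u))) = indicator {0<..} u *\<^sub>R (f (g u) * g' u)" for u
        using fg[of u] by (cases "0 < u") simp_all
    qed
    ultimately show ?thesis by (simp only: set_integrable_def ei)
  qed
  have sub: "set_integrable lborel (einterval 0 \<infinity>) f" "(LBINT x=0..\<infinity>. f x) = (LBINT u=0..\<infinity>. f (g u) * g' u)"
  proof -
    have dg: "DERIV g u :> g' u" if "0 < u" for u
    proof -
      have "0 < u / \<mu>" using that \<mu> by simp
      moreover have "DERIV (\<lambda>u. u / \<mu>) u :> 1 / \<mu>" by (intro DERIV_cdivide DERIV_ident)
      ultimately have D: "DERIV (\<lambda>u. sqrt (u / \<mu>)) u :> inverse (sqrt (u / \<mu>)) / 2 * (1 / \<mu>)"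
        by (rule DERIV_chain2[OF DERIV_real_sqrt])
      have e: "inverse (sqrt (u / \<mu>)) / 2 * (1 / \<mu>) = g' u"
        unfolding g'_def by (simp only: divide_inverse inverse_mult_distrib mult_1 mult_ac)
      show ?thesis unfolding g_def[abs_def] using D unfolding e .
    qed
    have cf: "isCont f (g u)" if "0 < u" for u
    proof -
      have "g u \<noteq> 0" unfolding g_def using that \<mu> by simp
      then show ?thesis unfolding f_def[abs_def] by (intro continuous_intros) auto
    qed
    have cg: "isCont g' u" if "0 < u" for u
    proof -
      have "sqrt (u / \<mu>) \<noteq> 0" using that \<mu> by simp
      then show ?thesis unfolding g'_def[abs_def] using \<mu> by (intro continuous_intros) auto
    qed
    have A: "((ereal \<circ> g \<circ> real_of_ereal) \<longlongrightarrow> 0) (at_right 0)"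
    proof -
      have "(g \<longlongrightarrow> 0) (at_right 0)" unfolding g_def[abs_def] using \<mu> by real_asymp
      then show ?thesis
        unfolding zero_ereal_def ereal_tendsto_simps1 ereal_tendsto_simps2 .
    qed
    have B: "((ereal \<circ> g \<circ> real_of_ereal) \<longlongrightarrow> \<infinity>) (at_left \<infinity>)"
    proof -
      have "filterlim g at_top at_top" unfolding g_def[abs_def] using \<mu> by real_asymp
      then show ?thesis unfolding ereal_tendsto_simps1 ereal_tendsto_simps2 .
    qed
    have lt: "(0::ereal) < \<infinity>" by simp
    have nf: "0 \<le> f (g u)" for u by (simp add: f_def)
    have ng: "0 \<le> g' u" if "0 \<le> u" for u using that \<mu> by (simp add: g'_def)
    note S = interval_integral_substitution_nonneg[OF lt _ _ _ _ _ A B gi]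
    show "set_integrable lborel (einterval 0 \<infinity>) f" by (rule S(1)) (simp_all add: dg cf cg nf ng)
    show "(LBINT x=0..\<infinity>. f x) = (LBINT u=0..\<infinity>. f (g u) * g' u)" by (rule S(2)) (simp_all add: dg cf cg nf ng)
  qed
  have e: "indicator {0..} r * (r powr p * exp (- \<mu> * r\<^sup>2)) = indicator {0<..} r *\<^sub>R f r" for r
    by (auto simp: indicator_def f_def)
  show "integrable lborel (\<lambda>r. indicator {0..} r * (r powr p * exp (- \<mu> * r\<^sup>2)))"
    unfolding e using sub(1) by (simp add: set_integrable_def ei)
  have "(\<integral>r. indicator {0..} r * (r powr p * exp (- \<mu> * r\<^sup>2)) \<partial>lborel) = (LBINT x=0..\<infinity>. f x)"
    unfolding e by (simp add: interval_lebesgue_integral_def set_lebesgue_integral_def ei)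
  also have "\<dots> = (\<integral>u. indicator {0<..} u *\<^sub>R (f (g u) * g' u) \<partial>lborel)"
    unfolding sub(2) by (simp add: interval_lebesgue_integral_def set_lebesgue_integral_def ei)
  also have "\<dots> = (\<integral>u. 1 / 2 * \<mu> powr (- s) * (indicator {0<..} u * (u powr (s - 1) * exp (- u))) \<partial>lborel)"
  proof (intro Bochner_Integration.integral_cong refl)
    show "indicator {0<..} u *\<^sub>R (f (g u) * g' u) = 1 / 2 * \<mu> powr (- s) * (indicator {0<..} u * (u powr (s - 1) * exp (- u)))" for u
      using fg[of u] by (cases "0 < u") simp_all
  qed
  also have "\<dots> = 1 / 2 * \<mu> powr (- s) * Gamma s"
    using has_bochner_integral_Gamma[OF s] by (simp add: has_bochner_integral_iff)
  finally show "(\<integral>r. indicator {0..} r * (r powr p * exp (- \<mu> * r\<^sup>2)) \<partial>lborel) = 1 / 2 * \<mu> powr (- ((p + 1) / 2)) * Gamma ((p + 1) / 2)"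
    by (simp add: s_def)
qed

text \<open>Euler's integral restricted to t > x, where t^a \<ge> x^a and exp(- t) integrates to
  exp(- x). It allows x^a to be absorbed by the Gamma function uniformly in the order a.\<close>

lemma Gamma_ge_powr_exp:
  assumes a: "0 \<le> a" and x: "0 \<le> x"
  shows "x powr a * exp (- x) \<le> Gamma (a + 1 :: real)"
proof (cases "x = 0")
  case True
  then show ?thesis using Gamma_real_pos[of "a + 1"] a by simp
next
  case False
  then have xp: "0 < x" using x by simp
  have G: "has_bochner_integral lborel (\<lambda>t. indicator {0<..} t * (t powr a * exp (- t))) (Gamma (a + 1))"
    using has_bochner_integral_Gamma[of "a + 1"] a by simp
  have G1: "has_bochner_integral lborel (\<lambda>t. indicator {0<..} t * exp (- t)) (Gamma (1::real))"
  proof -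
    have e: "indicator {0<..} t * (t powr (1 - 1) * exp (- t)) = indicator {0<..} t * exp (- t)" for t :: real
      by (auto simp: indicator_def)
    show ?thesis using has_bochner_integral_Gamma[of 1] by (simp only: e zero_less_one)
  qed
  have "has_bochner_integral lborel (\<lambda>t. indicator {0<..} (- x + 1 * t) * exp (- (- x + 1 * t))) (Gamma (1::real) /\<^sub>R \<bar>1\<bar>)"
    using G1 by (subst lborel_has_bochner_integral_real_affine_iff[symmetric]) auto
  then have G2: "has_bochner_integral lborel (\<lambda>t. indicator {x<..} t * exp (x - t)) 1"
    by (simp add: indicator_def)
  have "x powr a * exp (- x) = (\<integral>t. (x powr a * exp (- x)) * (indicator {x<..} t * exp (x - t)) \<partial>lborel)"
    using G2 by (simp add: has_bochner_integral_iff)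
  also have "\<dots> \<le> (\<integral>t. indicator {0<..} t * (t powr a * exp (- t)) \<partial>lborel)"
  proof (rule integral_mono)
    show "integrable lborel (\<lambda>t. (x powr a * exp (- x)) * (indicator {x<..} t * exp (x - t)))"
      using G2 by (intro integrable_mult_right) (auto simp: has_bochner_integral_iff)
    show "integrable lborel (\<lambda>t. indicator {0<..} t * (t powr a * exp (- t)))" using G by (simp add: has_bochner_integral_iff)
    fix t :: real
    show "(x powr a * exp (- x)) * (indicator {x<..} t * exp (x - t)) \<le> indicator {0<..} t * (t powr a * exp (- t))"
    proof (cases "x < t")
      case True
      have "(x powr a * exp (- x)) * exp (x - t) = x powr a * exp (- t)" by (simp add: exp_add[symmetric] exp_diff exp_minus field_simps)
      also have "\<dots> \<le> t powr a * exp (- t)" using True xp a by (intro mult_right_mono powr_mono2) auto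
      finally show ?thesis using True xp by (simp add: indicator_def)
    qed (auto simp: indicator_def)
  qed
  also have "\<dots> = Gamma (a + 1)" using G by (simp add: has_bochner_integral_iff)
  finally show ?thesis .
qed

definition bessel_power :: "real \<Rightarrow> nat \<Rightarrow> real \<Rightarrow> real" where
  "bessel_power a k x = (if a + 2 * real k = 0 then 1 else x powr (a + 2 * real k))"

definition bessel_term :: "real \<Rightarrow> real \<Rightarrow> nat \<Rightarrow> real" where
  "bessel_term a x k = bessel_power a k x / (2 powr (a + 2 * real k) * fact k * Gamma (real k + a + 1))"

lemma bessel_I_eq: "bessel_I a x = (\<Sum>k. bessel_term a x k)"
  by (simp add: bessel_I_def bessel_term_def bessel_power_def)

lemma bessel_power_mult:
  assumes "0 \<le> a" "0 \<le> s" "0 < r"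
  shows "bessel_power a k (s * r) = bessel_power a k s * r powr (a + 2 * real k)"
  using assms by (auto simp: bessel_power_def powr_mult)

lemma sums_exp_real: "(\<lambda>k. y ^ k / fact k) sums exp (y :: real)"
  using exp_converges[of y] by (simp add: divide_inverse mult.commute)

text \<open>The factor 2^(-a) is the point: it decays geometrically in the order, which makes the
  series over the modes converge. It is isolated by \<Gamma>(k + a + 1) \<ge> k! \<Gamma>(a + 1) and
  x^a \<le> exp x \<Gamma>(a + 1); of the two resulting factors (x / 2)^k / k! one is bounded by
  exp(x / 2), and the other is kept for summation.\<close>

lemma bessel_power_bound:
  assumes a: "0 \<le> a" and x: "0 \<le> x"
  shows "0 \<le> bessel_term a x k" and "bessel_term a x k \<le> 2 powr (- a) * exp (3/2 * x) * ((x / 2) ^ k / fact k)"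
proof -
  have Gp: "0 < Gamma (real k + a + 1)" using a by (intro Gamma_real_pos) auto
  show "0 \<le> bessel_term a x k" using Gp by (simp add: bessel_term_def bessel_power_def)
  have Gp1: "0 < Gamma (a + 1)" using a by (intro Gamma_real_pos) auto
  have Gk: "Gamma (a + 1) * fact k \<le> Gamma (real k + a + 1)"
  proof -
    have "(fact k :: real) = pochhammer 1 k" by (simp add: pochhammer_fact)
    also have "\<dots> \<le> pochhammer (a + 1) k"
      unfolding pochhammer_prod using a by (intro prod_mono) auto
    also have "\<dots> = Gamma (a + 1 + real k) / Gamma (a + 1)"
      using a by (intro pochhammer_Gamma) (auto simp: nonpos_Ints_def)
    finally show ?thesis using Gp1 by (simp add: pos_le_divide_eq mult_ac add_ac)
  qed
  have pw: "bessel_power a k x \<le> (if a = 0 then 1 else x powr a) * x ^ (2 * k)"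
  proof (cases "x = 0")
    case True
    have "a + 2 * real k = 0 \<longleftrightarrow> a = 0 \<and> k = 0" using a by linarith
    with True show ?thesis by (auto simp: bessel_power_def power_0_left)
  next
    case False
    then have xp: "0 < x" using x by simp
    have "x powr (2 * real k) = x ^ (2 * k)" using powr_realpow[OF xp, of "2 * k"] by simp
    moreover have "a + 2 * real k = 0 \<longleftrightarrow> a = 0 \<and> k = 0" using a by linarith
    ultimately show ?thesis using xp by (simp add: bessel_power_def powr_add)
  qed
  have ck: "(x / 2) ^ k / fact k \<le> exp (x / 2)"
  proof -
    have "(x / 2) ^ k / fact k \<le> (\<Sum>n<Suc k. (x / 2) ^ n / fact n)" using x by (auto intro: sum_nonneg)
    also have "\<dots> \<le> (\<Sum>n. (x / 2) ^ n / fact n)"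
      using x sums_exp_real[of "x / 2"] by (intro sum_le_suminf) (auto simp only: sums_iff intro!: divide_nonneg_nonneg zero_le_power fact_ge_zero half_gt_zero)
    also have "\<dots> = exp (x / 2)" using sums_exp_real[of "x / 2"] by (simp only: sums_iff)
    finally show ?thesis .
  qed
  have xa: "(if a = 0 then 1 else x powr a) \<le> exp x * Gamma (a + 1)"
  proof (cases "a = 0")
    case True
    then show ?thesis using x by simp
  next
    case False
    have "exp x * (x powr a * exp (- x)) \<le> exp x * Gamma (a + 1)" by (intro mult_left_mono Gamma_ge_powr_exp a x) auto
    also have "exp x * (x powr a * exp (- x)) = x powr a" by (simp add: exp_minus)
    finally show ?thesis using False by simp
  qed
  have "bessel_term a x k \<le> ((exp x * Gamma (a + 1)) * x ^ (2 * k)) / (2 powr (a + 2 * real k) * fact k * (Gamma (a + 1) * fact k))"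
    unfolding bessel_term_def
  proof (rule frac_le)
    show "bessel_power a k x \<le> exp x * Gamma (a + 1) * x ^ (2 * k)"
      by (rule order_trans[OF pw mult_right_mono[OF xa]]) simp
    show "2 powr (a + 2 * real k) * fact k * (Gamma (a + 1) * fact k) \<le> 2 powr (a + 2 * real k) * fact k * Gamma (real k + a + 1)"
      by (intro mult_left_mono Gk) auto
  qed (use Gp1 in auto)
  also have "\<dots> = 2 powr (- a) * exp x * (((x / 2) ^ k / fact k) * ((x / 2) ^ k / fact k))"
  proof -
    have "(2::real) powr (2 * real k) = 2 ^ k * 2 ^ k"
      using powr_realpow[of 2 "k + k"] unfolding power_add of_nat_add mult_2 by (simp only: zero_less_numeral)
    then have 2: "(2::real) powr (a + 2 * real k) = 2 powr a * (2 ^ k * 2 ^ k)" by (simp only: powr_add)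
    have xk: "x ^ (2 * k) = x ^ k * x ^ k" by (simp only: mult_2 power_add)
    have "E * G * (y * y) / (A * (w * w) * f * (G * f)) = inverse A * E * ((y / w / f) * (y / w / f))"
      if "G \<noteq> 0" for E G y A w f :: real
      using that by (simp add: divide_inverse)
    from this[of "Gamma (a + 1)" "exp x" "x ^ k" "2 powr a" "2 ^ k" "fact k"] Gp1 show ?thesis
      unfolding 2 xk powr_minus power_divide by simp
  qed
  also have "\<dots> \<le> 2 powr (- a) * exp x * (exp (x / 2) * ((x / 2) ^ k / fact k))"
    using x ck by (intro mult_left_mono mult_right_mono) auto
  also have "\<dots> = 2 powr (- a) * (exp x * exp (x / 2)) * ((x / 2) ^ k / fact k)" by simp
  also have "exp x * exp (x / 2) = exp (3/2 * x)" by (simp add: exp_add[symmetric])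
  finally show "bessel_term a x k \<le> 2 powr (- a) * exp (3/2 * x) * ((x / 2) ^ k / fact k)" .
qed

lemma summable_bessel_term:
  assumes "0 \<le> a" "0 \<le> x"
  shows "summable (bessel_term a x)"
proof (rule summable_comparison_test'[of _ 0])
  show "summable (\<lambda>k. 2 powr (- a) * exp (3/2 * x) * ((x / 2) ^ k / fact k))"
    using sums_exp_real[of "x / 2"] by (intro summable_mult) (auto simp: sums_iff)
  show "norm (bessel_term a x k) \<le> 2 powr (- a) * exp (3/2 * x) * ((x / 2) ^ k / fact k)" for k
    using bessel_power_bound[OF assms, of k] by simp
qed

lemma bessel_I_bounds:
  assumes "0 \<le> a" "0 \<le> x"
  shows "0 \<le> bessel_I a x" "bessel_I a x \<le> 2 powr (- a) * exp (2 * x)"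
proof -
  show "0 \<le> bessel_I a x"
    unfolding bessel_I_eq by (intro suminf_nonneg summable_bessel_term assms bessel_power_bound)
  have "bessel_I a x \<le> (\<Sum>k. 2 powr (- a) * exp (3/2 * x) * ((x / 2) ^ k / fact k))"
    unfolding bessel_I_eq using sums_exp_real[of "x / 2"]
    by (intro suminf_le bessel_power_bound assms summable_bessel_term summable_mult) (auto simp: sums_iff)
  also have "\<dots> = 2 powr (- a) * exp (3/2 * x) * exp (x / 2)"
    using sums_exp_real[of "x / 2"] by (subst suminf_mult) (auto simp: sums_iff)
  also have "\<dots> = 2 powr (- a) * exp (2 * x)" by (simp add: mult.assoc exp_add[symmetric])
  finally show "bessel_I a x \<le> 2 powr (- a) * exp (2 * x)" .
qed

lemma borel_measurable_bessel_I[measurable]: "bessel_I a \<in> borel_measurable borel"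
  unfolding bessel_I_def[abs_def] by measurable

text \<open>Weber's first exponential integral, obtained by integrating the series termwise.\<close>

lemma weber_integral:
  assumes a: "0 \<le> a" and s: "0 \<le> s" and \<mu>: "0 < \<mu>"
  shows "integrable lborel (\<lambda>r. indicator {0..} r * (r powr (a + 1) * exp (- \<mu> * r\<^sup>2) * bessel_I a (s * r)))"
    and "(\<integral>r. indicator {0..} r * (r powr (a + 1) * exp (- \<mu> * r\<^sup>2) * bessel_I a (s * r)) \<partial>lborel)
      = 1 / 2 * (if a = 0 then 1 else (s / 2) powr a) * \<mu> powr (- (a + 1)) * exp (s\<^sup>2 / (4 * \<mu>))"
proof -
  define C where "C k = bessel_power a k s / (2 powr (a + 2 * real k) * fact k * Gamma (real k + a + 1))" for k
  define f where "f k r = C k * (indicator {0..} r * (r powr (2 * a + 2 * real k + 1) * exp (- \<mu> * r\<^sup>2)))" for k and r :: real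
  have Gp: "0 < Gamma (real k + a + 1)" for k using a by (intro Gamma_real_pos) auto
  have C0: "0 \<le> C k" for k using Gp[of k] by (simp add: C_def bessel_power_def)
  have f0: "0 \<le> f k r" for k r using C0[of k] by (simp add: f_def)
  have p0: "0 \<le> 2 * a + 2 * real k + 1" for k using a by simp
  have fi: "integrable lborel (f k)" for k
    unfolding f_def[abs_def] by (intro integrable_mult_right radial_Gamma_integral(1) p0 \<mu>)
  define E where "E k = 1 / 2 * (if a = 0 then 1 else (s / 2) powr a) * \<mu> powr (- (a + 1)) * ((s\<^sup>2 / (4 * \<mu>)) ^ k / fact k)" for k
  have fint: "(\<integral>r. f k r \<partial>lborel) = E k" for k
  proof -
    \<comment> \<open>The power of r in the k-th term is (a + 1) + (a + 2 k); its radial integral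
      contains \<Gamma>(k + a + 1), which cancels the Gamma factor of the Bessel series, and an
      exponential series is left.\<close>
    have h: "(2 * a + 2 * real k + 1 + 1) / 2 = real k + a + 1" by (simp add: field_simps)
    have "(\<integral>r. f k r \<partial>lborel) = C k * (1 / 2 * \<mu> powr (- (real k + a + 1)) * Gamma (real k + a + 1))"
      unfolding f_def by (simp only: integral_mult_right_zero radial_Gamma_integral(2)[OF p0 \<mu>] h)
    also have "\<dots> = 1 / 2 * (bessel_power a k s / (2 powr (a + 2 * real k))) * \<mu> powr (- (real k + a + 1)) / fact k"
      using Gp[of k] by (simp add: C_def)
    also have "bessel_power a k s / (2 powr (a + 2 * real k)) = (if a = 0 then 1 else (s / 2) powr a) * (s\<^sup>2 / 4) ^ k"
    proof -
      have 4: "(2::real) powr (2 * real k) = 4 ^ k"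
        using powr_realpow[of 2 "2 * k"] by (simp add: power_mult)
      show ?thesis
      proof (cases "s = 0")
        case True
        have "a + 2 * real k = 0 \<longleftrightarrow> a = 0 \<and> k = 0" using a by linarith
        with True show ?thesis by (auto simp: bessel_power_def power_0_left)
      next
        case False
        then have sp: "0 < s" using s by simp
        have "s powr (2 * real k) = (s\<^sup>2) ^ k" using powr_realpow[OF sp, of "2 * k"] by (simp add: power_mult)
        moreover have "a + 2 * real k = 0 \<longleftrightarrow> a = 0 \<and> k = 0" using a by linarith
        ultimately show ?thesis using sp 4 by (simp add: bessel_power_def powr_add powr_divide power_divide)
      qed
    qed
    also have "\<mu> powr (- (real k + a + 1)) = \<mu> powr (- (a + 1)) / \<mu> ^ k"
      using \<mu> by (simp add: powr_diff powr_minus powr_add powr_realpow field_simps)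
    finally show ?thesis by (simp add: E_def power_divide power_mult_distrib mult_ac)
  qed
  have Es: "E sums (1 / 2 * (if a = 0 then 1 else (s / 2) powr a) * \<mu> powr (- (a + 1)) * exp (s\<^sup>2 / (4 * \<mu>)))"
    unfolding E_def by (intro sums_mult sums_exp_real)
  have pt: "f k r = indicator {0..} r * (r powr (a + 1) * exp (- \<mu> * r\<^sup>2)) * bessel_term a (s * r) k" for k r
  proof (cases "0 < r")
    case True
    have "r powr (2 * a + 2 * real k + 1) = r powr (a + 1) * r powr (a + 2 * real k)"
      unfolding powr_add[symmetric] by (rule arg_cong[where f = "\<lambda>e. r powr e"]) simp
    then show ?thesis using True bessel_power_mult[OF a s True, of k] by (simp add: f_def C_def bessel_term_def)
  qed (auto simp: f_def indicator_def)
  have pts: "summable (\<lambda>k. f k r)" "(\<Sum>k. f k r) = indicator {0..} r * (r powr (a + 1) * exp (- \<mu> * r\<^sup>2) * bessel_I a (s * r))" for r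
  proof -
    show sm: "summable (\<lambda>k. f k r)"
    proof (cases "0 \<le> r")
      case True
      then show ?thesis unfolding pt using a s by (intro summable_mult summable_bessel_term) auto
    qed (simp add: f_def)
    show "(\<Sum>k. f k r) = indicator {0..} r * (r powr (a + 1) * exp (- \<mu> * r\<^sup>2) * bessel_I a (s * r))"
    proof (cases "0 \<le> r")
      case True
      then show ?thesis unfolding pt bessel_I_eq using a s by (subst suminf_mult) (auto intro!: summable_bessel_term)
    qed (simp add: f_def)
  qed
  have nf: "norm (f k r) = f k r" for k r using f0 by simp
  have AEs: "AE r in lborel. summable (\<lambda>k. norm (f k r))" unfolding nf using pts(1) by simp
  have Si: "summable (\<lambda>k. \<integral>r. norm (f k r) \<partial>lborel)" unfolding nf fint using Es by (simp add: sums_iff)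
  show "integrable lborel (\<lambda>r. indicator {0..} r * (r powr (a + 1) * exp (- \<mu> * r\<^sup>2) * bessel_I a (s * r)))"
    using integrable_suminf[OF fi AEs Si] by (simp only: pts(2))
  show "(\<integral>r. indicator {0..} r * (r powr (a + 1) * exp (- \<mu> * r\<^sup>2) * bessel_I a (s * r)) \<partial>lborel)
      = 1 / 2 * (if a = 0 then 1 else (s / 2) powr a) * \<mu> powr (- (a + 1)) * exp (s\<^sup>2 / (4 * \<mu>))"
    using integral_suminf[OF fi AEs Si] Es by (simp only: pts(2) fint sums_iff)
qed

section \<open>Moments of the Bessel series density\<close>

text \<open>The index is an integer because the product-to-sum formula produces differences of
  frequencies.\<close>

lemma integral_cos_multiple:
  fixes k :: int
  assumes \<alpha>: "0 < \<alpha>"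
  shows "has_bochner_integral lborel (\<lambda>\<theta>. cos (of_int k * pi * \<theta> / \<alpha>) * indicator {0..\<alpha>} \<theta>) (if k = 0 then \<alpha> else 0)"
proof (cases "k = 0")
  case True
  have "has_bochner_integral lborel (\<lambda>\<theta>. indicator {0..\<alpha>} \<theta> *\<^sub>R (1::real)) (measure lborel {0..\<alpha>} *\<^sub>R 1)"
    using \<alpha> by (intro has_bochner_integral_indicator) (auto simp: emeasure_lborel_Icc_eq)
  then show ?thesis using True \<alpha> by simp
next
  case False
  have "has_bochner_integral lborel (\<lambda>\<theta>. cos (of_int k * pi * \<theta> / \<alpha>) * indicator {0..\<alpha>} \<theta>)
      (\<alpha> / (of_int k * pi) * sin (of_int k * pi * \<alpha> / \<alpha>) - \<alpha> / (of_int k * pi) * sin (of_int k * pi * 0 / \<alpha>))"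
  proof (rule has_bochner_integral_FTC_Icc_real)
    fix \<theta> :: real
    have "((\<lambda>\<theta>. of_int k * pi * \<theta> / \<alpha>) has_real_derivative of_int k * pi / \<alpha>) (at \<theta>)"
      by (intro DERIV_cdivide DERIV_cmult_Id)
    from DERIV_cmult[OF DERIV_chain2[OF DERIV_sin this], of "\<alpha> / (of_int k * pi)"]
    have "((\<lambda>\<theta>. \<alpha> / (of_int k * pi) * sin (of_int k * pi * \<theta> / \<alpha>)) has_real_derivative
      \<alpha> / (of_int k * pi) * (cos (of_int k * pi * \<theta> / \<alpha>) * (of_int k * pi / \<alpha>))) (at \<theta>)" .
    moreover have "\<alpha> / (of_int k * pi) * (cos (of_int k * pi * \<theta> / \<alpha>) * (of_int k * pi / \<alpha>)) = cos (of_int k * pi * \<theta> / \<alpha>)"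
      using \<alpha> False by simp
    ultimately show "((\<lambda>\<theta>. \<alpha> / (of_int k * pi) * sin (of_int k * pi * \<theta> / \<alpha>)) has_real_derivative cos (of_int k * pi * \<theta> / \<alpha>)) (at \<theta>)"
      by (simp only:)
    show "isCont (\<lambda>\<theta>. cos (of_int k * pi * \<theta> / \<alpha>)) \<theta>" using \<alpha> by (intro continuous_intros) auto
  qed (use \<alpha> in simp)
  moreover have "sin (of_int k * pi) = 0" unfolding sin_times_pi_eq_0 by simp
  ultimately show ?thesis using \<alpha> False by simp
qed

lemma cos_orthogonal:
  assumes \<alpha>: "0 < \<alpha>"
  shows "has_bochner_integral lborel (\<lambda>\<theta>. cos (real n * pi * \<theta> / \<alpha>) * cos (real k * pi * \<theta> / \<alpha>) * indicator {0..\<alpha>} \<theta>)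
    (if n = k then (if n = 0 then \<alpha> else \<alpha> / 2) else 0)"
proof -
  have "has_bochner_integral lborel
     (\<lambda>\<theta>. 1 / 2 * (cos (of_int (int n - int k) * pi * \<theta> / \<alpha>) * indicator {0..\<alpha>} \<theta>
        + cos (of_int (int n + int k) * pi * \<theta> / \<alpha>) * indicator {0..\<alpha>} \<theta>))
     (1 / 2 * ((if int n - int k = 0 then \<alpha> else 0) + (if int n + int k = 0 then \<alpha> else 0)))"
    by (intro has_bochner_integral_mult_right has_bochner_integral_add integral_cos_multiple \<alpha>)
  moreover have "(\<lambda>\<theta>. 1 / 2 * (cos (of_int (int n - int k) * pi * \<theta> / \<alpha>) * indicator {0..\<alpha>} \<theta>
        + cos (of_int (int n + int k) * pi * \<theta> / \<alpha>) * indicator {0..\<alpha>} \<theta>))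
      = (\<lambda>\<theta>. cos (real n * pi * \<theta> / \<alpha>) * cos (real k * pi * \<theta> / \<alpha>) * indicator {0..\<alpha>} \<theta>)"
  proof
    fix \<theta>
    have "cos (real n * pi * \<theta> / \<alpha>) * cos (real k * pi * \<theta> / \<alpha>)
      = (cos (real n * pi * \<theta> / \<alpha> - real k * pi * \<theta> / \<alpha>) + cos (real n * pi * \<theta> / \<alpha> + real k * pi * \<theta> / \<alpha>)) / 2"
      by (rule cos_times_cos)
    also have "real n * pi * \<theta> / \<alpha> - real k * pi * \<theta> / \<alpha> = of_int (int n - int k) * pi * \<theta> / \<alpha>"
      by (simp add: diff_divide_distrib algebra_simps)
    also have "real n * pi * \<theta> / \<alpha> + real k * pi * \<theta> / \<alpha> = of_int (int n + int k) * pi * \<theta> / \<alpha>"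
      by (simp add: add_divide_distrib algebra_simps)
    finally show "1 / 2 * (cos (of_int (int n - int k) * pi * \<theta> / \<alpha>) * indicator {0..\<alpha>} \<theta>
        + cos (of_int (int n + int k) * pi * \<theta> / \<alpha>) * indicator {0..\<alpha>} \<theta>)
      = cos (real n * pi * \<theta> / \<alpha>) * cos (real k * pi * \<theta> / \<alpha>) * indicator {0..\<alpha>} \<theta>"
      by (simp add: indicator_def)
  qed
  moreover have "1 / 2 * ((if int n - int k = 0 then \<alpha> else 0) + (if int n + int k = 0 then \<alpha> else 0))
    = (if n = k then (if n = 0 then \<alpha> else \<alpha> / 2) else 0)" by auto
  ultimately show ?thesis by (simp only:)
qed

definition series_term :: "real \<Rightarrow> real \<Rightarrow> real \<Rightarrow> real \<Rightarrow> nat \<Rightarrow> real \<Rightarrow> real \<Rightarrow> real" where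
  "series_term \<alpha> t r\<^sub>0 \<theta>\<^sub>0 n r \<theta> = (if n = 0 then 1 / 2 else 1) * bessel_I (real n * pi / \<alpha>) (r * r\<^sub>0 / t)
     * cos (real n * pi * \<theta> / \<alpha>) * cos (real n * pi * \<theta>\<^sub>0 / \<alpha>)"

definition series_density :: "real \<Rightarrow> real \<Rightarrow> real \<Rightarrow> real \<Rightarrow> real \<Rightarrow> real \<Rightarrow> real" where
  "series_density \<alpha> t r\<^sub>0 \<theta>\<^sub>0 r \<theta> =
     2 * r / (t * \<alpha>) * exp (- (r\<^sup>2 + r\<^sub>0\<^sup>2) / (2 * t)) * (\<Sum>n. series_term \<alpha> t r\<^sub>0 \<theta>\<^sub>0 n r \<theta>)"

context
  fixes \<alpha> t r\<^sub>0 \<theta>\<^sub>0 :: real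
  assumes \<alpha>: "0 < \<alpha>" and t: "0 < t" and r0: "0 \<le> r\<^sub>0"
begin

text \<open>The bound 2^(-a) exp(2 x) for the Bessel function at order a = n pi / \<alpha> is
  geometric in n. Convergence of the series and every exchange of sum and integral rest on
  it.\<close>

lemma abs_bessel_coefficient_le:
  assumes r: "0 \<le> r"
  shows "\<bar>(if n = 0 then 1 / 2 else 1) * bessel_I (real n * pi / \<alpha>) (r * r\<^sub>0 / t)\<bar> \<le> exp (2 * (r * r\<^sub>0 / t)) * (2 powr (- (pi / \<alpha>))) ^ n"
proof -
  have x: "0 \<le> r * r\<^sub>0 / t" and a: "0 \<le> real n * pi / \<alpha>" using r r0 t \<alpha> by auto
  have e: "2 powr (- (real n * pi / \<alpha>)) = (2 powr (- (pi / \<alpha>))) ^ n"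
  proof -
    have "(2 powr (- (pi / \<alpha>))) powr real n = (2 powr (- (pi / \<alpha>))) ^ n"
      by (rule powr_realpow) simp
    moreover have "- (pi / \<alpha>) * real n = - (real n * pi / \<alpha>)" by simp
    ultimately show ?thesis by (simp only: powr_powr)
  qed
  have "\<bar>(if n = 0 then 1 / 2 else 1) * bessel_I (real n * pi / \<alpha>) (r * r\<^sub>0 / t)\<bar> \<le> 1 * \<bar>bessel_I (real n * pi / \<alpha>) (r * r\<^sub>0 / t)\<bar>"
    unfolding abs_mult by (intro mult_right_mono) auto
  also have "\<dots> \<le> 2 powr (- (real n * pi / \<alpha>)) * exp (2 * (r * r\<^sub>0 / t))"
    using bessel_I_bounds[OF a x] by simp
  finally show ?thesis unfolding e by (simp add: mult.commute)
qed

lemma abs_series_term_le: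
  assumes r: "0 \<le> r"
  shows "\<bar>series_term \<alpha> t r\<^sub>0 \<theta>\<^sub>0 n r \<theta>\<bar> \<le> exp (2 * (r * r\<^sub>0 / t)) * (2 powr (- (pi / \<alpha>))) ^ n"
proof -
  define A where "A = (if n = 0 then 1 / 2 else 1) * bessel_I (real n * pi / \<alpha>) (r * r\<^sub>0 / t)"
  have "\<bar>series_term \<alpha> t r\<^sub>0 \<theta>\<^sub>0 n r \<theta>\<bar> = \<bar>A\<bar> * (\<bar>cos (real n * pi * \<theta> / \<alpha>)\<bar> * \<bar>cos (real n * pi * \<theta>\<^sub>0 / \<alpha>)\<bar>)"
    by (simp add: series_term_def A_def abs_mult mult.assoc)
  also have "\<dots> \<le> \<bar>A\<bar> * (1 * 1)" by (intro mult_mono mult_left_mono abs_cos_le_one) auto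
  finally show ?thesis using abs_bessel_coefficient_le[OF r, of n] unfolding A_def by linarith
qed

lemma geometric_ratio: "0 \<le> 2 powr (- (pi / \<alpha>))" "2 powr (- (pi / \<alpha>)) < (1::real)"
proof -
  have "2 powr (- (pi / \<alpha>)) < 2 powr (0::real)" using \<alpha> by (intro powr_less_mono) auto
  then show "2 powr (- (pi / \<alpha>)) < (1::real)" by simp
qed simp

lemma summable_geometric_ratio: "summable (\<lambda>n. c * (2 powr (- (pi / \<alpha>))) ^ n :: real)"
  using geometric_ratio by (intro summable_mult summable_geometric) auto

lemma summable_series_term:
  assumes r: "0 \<le> r"
  shows "summable (\<lambda>n. series_term \<alpha> t r\<^sub>0 \<theta>\<^sub>0 n r \<theta>)"
  by (rule summable_comparison_test'[where N = 0, OF summable_geometric_ratio]) (use abs_series_term_le[OF r] in auto)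

text \<open>The sum over modes is at most a constant times exp(2 r r0 / t), and this growth is
  absorbed by the Gaussian factor at the cost of half its rate.\<close>

lemma series_density_bound:
  obtains K where "0 \<le> K" "\<And>r \<theta>. 0 \<le> r \<Longrightarrow> \<bar>series_density \<alpha> t r\<^sub>0 \<theta>\<^sub>0 r \<theta>\<bar> \<le> K * (r * exp (- (1 / (4 * t)) * r\<^sup>2))"
proof
  define q where "q = (2 powr (- (pi / \<alpha>)) :: real)"
  define K where "K = 2 / (t * \<alpha>) * (1 / (1 - q)) * exp (4 * r\<^sub>0\<^sup>2 / t)"
  have q: "0 \<le> q" "q < 1" using geometric_ratio by (auto simp: q_def)
  show "0 \<le> K" using q t \<alpha> by (simp add: K_def)
  fix r \<theta> :: real assume r: "0 \<le> r"
  have "\<bar>\<Sum>n. series_term \<alpha> t r\<^sub>0 \<theta>\<^sub>0 n r \<theta>\<bar> \<le> (\<Sum>n. exp (2 * (r * r\<^sub>0 / t)) * q ^ n)"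
    unfolding real_norm_def[symmetric]
    by (rule norm_suminf_le) (use abs_series_term_le[OF r] summable_geometric_ratio in \<open>auto simp: q_def\<close>)
  also have "\<dots> = exp (2 * (r * r\<^sub>0 / t)) * (1 / (1 - q))"
    using q by (subst suminf_mult) (auto simp: suminf_geometric summable_geometric)
  finally have S: "\<bar>\<Sum>n. series_term \<alpha> t r\<^sub>0 \<theta>\<^sub>0 n r \<theta>\<bar> \<le> exp (2 * (r * r\<^sub>0 / t)) * (1 / (1 - q))" .
  have "\<bar>series_density \<alpha> t r\<^sub>0 \<theta>\<^sub>0 r \<theta>\<bar> = 2 * r / (t * \<alpha>) * exp (- (r\<^sup>2 + r\<^sub>0\<^sup>2) / (2 * t)) * \<bar>\<Sum>n. series_term \<alpha> t r\<^sub>0 \<theta>\<^sub>0 n r \<theta>\<bar>"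
    using r t \<alpha> by (simp add: series_density_def abs_mult)
  also have "\<dots> \<le> 2 * r / (t * \<alpha>) * exp (- (r\<^sup>2 + r\<^sub>0\<^sup>2) / (2 * t)) * (exp (2 * (r * r\<^sub>0 / t)) * (1 / (1 - q)))"
    using r t \<alpha> by (intro mult_left_mono S) auto
  also have "\<dots> = 2 * r / (t * \<alpha>) * (1 / (1 - q)) * exp (- (r\<^sup>2 + r\<^sub>0\<^sup>2) / (2 * t) + 2 * (r * r\<^sub>0 / t))"
    by (simp only: exp_add mult_ac)
  also have "\<dots> \<le> 2 * r / (t * \<alpha>) * (1 / (1 - q)) * exp (4 * r\<^sub>0\<^sup>2 / t + - (1 / (4 * t)) * r\<^sup>2)"
  proof -
    have "- (r\<^sup>2 + r\<^sub>0\<^sup>2) / (2 * t) + 2 * (r * r\<^sub>0 / t) = (- 2 * r\<^sup>2 - 2 * r\<^sub>0\<^sup>2 + 8 * r * r\<^sub>0) / (4 * t)"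
      using t by (simp add: field_simps)
    also have "\<dots> \<le> (16 * r\<^sub>0\<^sup>2 - r\<^sup>2) / (4 * t)"
    proof (rule divide_right_mono)
      \<comment> \<open>With this square, the mixed term 8 r r0 is at most r^2 + 16 r0^2.\<close>
      have "0 \<le> (r - 4 * r\<^sub>0)\<^sup>2" by simp
      also have "\<dots> = r\<^sup>2 - 8 * r * r\<^sub>0 + 16 * r\<^sub>0\<^sup>2" by (simp add: power2_eq_square algebra_simps)
      finally show "- 2 * r\<^sup>2 - 2 * r\<^sub>0\<^sup>2 + 8 * r * r\<^sub>0 \<le> 16 * r\<^sub>0\<^sup>2 - r\<^sup>2"
        using zero_le_power2[of r\<^sub>0] by linarith
    qed (use t in simp)
    also have "\<dots> = 4 * r\<^sub>0\<^sup>2 / t + - (1 / (4 * t)) * r\<^sup>2" using t by (simp add: field_simps)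
    finally show ?thesis using r t \<alpha> q by (intro mult_left_mono) auto
  qed
  also have "\<dots> = K * (r * exp (- (1 / (4 * t)) * r\<^sup>2))"
    unfolding K_def exp_add by (simp only: mult_ac times_divide_eq_left times_divide_eq_right)
  finally show "\<bar>series_density \<alpha> t r\<^sub>0 \<theta>\<^sub>0 r \<theta>\<bar> \<le> K * (r * exp (- (1 / (4 * t)) * r\<^sup>2))" .
qed

lemma borel_measurable_series_density[measurable]:
  "(\<lambda>z. series_density \<alpha> t r\<^sub>0 \<theta>\<^sub>0 (fst z) (snd z)) \<in> borel_measurable (borel \<Otimes>\<^sub>M borel)"
  unfolding series_density_def[abs_def] series_term_def[abs_def] by measurable

text \<open>Only the mode with the same angular frequency survives the integration over \<open>\<theta>\<close>.\<close>

lemma series_density_angular: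
  assumes r: "0 \<le> r"
  shows "(\<integral>\<theta>. series_density \<alpha> t r\<^sub>0 \<theta>\<^sub>0 r \<theta> * cos (real k * pi * \<theta> / \<alpha>) * indicator {0..\<alpha>} \<theta> \<partial>lborel)
    = r / t * exp (- (r\<^sup>2 + r\<^sub>0\<^sup>2) / (2 * t)) * bessel_I (real k * pi / \<alpha>) (r * r\<^sub>0 / t) * cos (real k * pi * \<theta>\<^sub>0 / \<alpha>)"
proof -
  define A where "A n = (if n = 0 then 1 / 2 else 1) * bessel_I (real n * pi / \<alpha>) (r * r\<^sub>0 / t) * cos (real n * pi * \<theta>\<^sub>0 / \<alpha>)" for n :: nat
  define f where "f n \<theta> = A n * (cos (real n * pi * \<theta> / \<alpha>) * cos (real k * pi * \<theta> / \<alpha>) * indicator {0..\<alpha>} \<theta>)" for n and \<theta> :: real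
  define C where "C = 2 * r / (t * \<alpha>) * exp (- (r\<^sup>2 + r\<^sub>0\<^sup>2) / (2 * t))"
  note o = cos_orthogonal[OF \<alpha>]
  have fi: "integrable lborel (f n)" for n
    unfolding f_def[abs_def] using o[of n k] by (intro integrable_mult_right) (auto simp: has_bochner_integral_iff)
  have Ab: "\<bar>A n\<bar> \<le> exp (2 * (r * r\<^sub>0 / t)) * (2 powr (- (pi / \<alpha>))) ^ n" for n
  proof -
    define B where "B = (if n = 0 then 1 / 2 else 1) * bessel_I (real n * pi / \<alpha>) (r * r\<^sub>0 / t)"
    have "\<bar>A n\<bar> = \<bar>B\<bar> * \<bar>cos (real n * pi * \<theta>\<^sub>0 / \<alpha>)\<bar>" by (simp add: A_def B_def abs_mult)
    also have "\<dots> \<le> \<bar>B\<bar> * 1" by (intro mult_left_mono abs_cos_le_one) auto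
    finally show ?thesis using abs_bessel_coefficient_le[OF r, of n] unfolding B_def by linarith
  qed
  have sA: "summable (\<lambda>n. \<bar>A n\<bar>)"
    by (rule summable_comparison_test'[where N = 0, OF summable_geometric_ratio]) (use Ab in auto)
  have fb: "norm (f n \<theta>) \<le> \<bar>A n\<bar> * indicator {0..\<alpha>} \<theta>" for n \<theta>
  proof -
    have "norm (f n \<theta>) = \<bar>A n\<bar> * (\<bar>cos (real n * pi * \<theta> / \<alpha>)\<bar> * \<bar>cos (real k * pi * \<theta> / \<alpha>)\<bar> * indicator {0..\<alpha>} \<theta>)"
      by (simp add: f_def abs_mult)
    also have "\<dots> \<le> \<bar>A n\<bar> * (1 * 1 * indicator {0..\<alpha>} \<theta>)"
      by (intro mult_left_mono mult_right_mono mult_mono abs_cos_le_one) auto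
    finally show ?thesis by simp
  qed
  have AEs: "AE \<theta> in lborel. summable (\<lambda>n. norm (f n \<theta>))"
  proof (rule AE_I2)
    fix \<theta> :: real
    show "summable (\<lambda>n. norm (f n \<theta>))"
      by (rule summable_comparison_test'[of "\<lambda>n. \<bar>A n\<bar> * indicator {0..\<alpha>} \<theta>" 0]) (use fb sA in \<open>auto intro: summable_mult2\<close>)
  qed
  have ind: "has_bochner_integral lborel (\<lambda>\<theta>::real. c * indicator {0..\<alpha>} \<theta>) (c * \<alpha>)" for c :: real
    using has_bochner_integral_mult_right[OF integral_cos_multiple[OF \<alpha>, of 0], of c] by simp
  have Si: "summable (\<lambda>n. \<integral>\<theta>. norm (f n \<theta>) \<partial>lborel)"
  proof (rule summable_comparison_test'[of "\<lambda>n. \<bar>A n\<bar> * \<alpha>" 0])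
    show "summable (\<lambda>n. \<bar>A n\<bar> * \<alpha>)" using sA by (rule summable_mult2)
    fix n :: nat
    have "(\<integral>\<theta>. norm (f n \<theta>) \<partial>lborel) \<le> (\<integral>\<theta>. \<bar>A n\<bar> * indicator {0..\<alpha>} \<theta> \<partial>lborel)"
      using ind[of "\<bar>A n\<bar>"] fb by (intro integral_mono integrable_norm fi) (auto simp: has_bochner_integral_iff)
    also have "\<dots> = \<bar>A n\<bar> * \<alpha>" using ind[of "\<bar>A n\<bar>"] by (simp add: has_bochner_integral_iff)
    finally show "norm (\<integral>\<theta>. norm (f n \<theta>) \<partial>lborel) \<le> \<bar>A n\<bar> * \<alpha>" by simp
  qed
  have fint: "(\<integral>\<theta>. f n \<theta> \<partial>lborel) = (if n = k then A k * (if k = 0 then \<alpha> else \<alpha> / 2) else 0)" for n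
    unfolding f_def using o[of n k] by (simp add: has_bochner_integral_iff)
  have pt: "series_density \<alpha> t r\<^sub>0 \<theta>\<^sub>0 r \<theta> * cos (real k * pi * \<theta> / \<alpha>) * indicator {0..\<alpha>} \<theta> = C * (\<Sum>n. f n \<theta>)" for \<theta>
  proof -
    have "f n \<theta> = series_term \<alpha> t r\<^sub>0 \<theta>\<^sub>0 n r \<theta> * (cos (real k * pi * \<theta> / \<alpha>) * indicator {0..\<alpha>} \<theta>)" for n
      by (simp only: f_def A_def series_term_def mult_ac)
    then have "(\<Sum>n. f n \<theta>) = (\<Sum>n. series_term \<alpha> t r\<^sub>0 \<theta>\<^sub>0 n r \<theta>) * (cos (real k * pi * \<theta> / \<alpha>) * indicator {0..\<alpha>} \<theta>)"
      using suminf_mult2[OF summable_series_term[OF r]] by (simp only:)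
    then show ?thesis by (simp only: series_density_def C_def mult.assoc)
  qed
  have "(\<integral>\<theta>. series_density \<alpha> t r\<^sub>0 \<theta>\<^sub>0 r \<theta> * cos (real k * pi * \<theta> / \<alpha>) * indicator {0..\<alpha>} \<theta> \<partial>lborel)
    = C * (\<integral>\<theta>. (\<Sum>n. f n \<theta>) \<partial>lborel)" unfolding pt by simp
  also have "(\<integral>\<theta>. (\<Sum>n. f n \<theta>) \<partial>lborel) = (\<Sum>n. \<integral>\<theta>. f n \<theta> \<partial>lborel)"
    by (rule integral_suminf[OF fi AEs Si])
  also have "\<dots> = A k * (if k = 0 then \<alpha> else \<alpha> / 2)"
    unfolding fint by (subst suminf_finite[of "{k}"]) auto
  also have "C * \<dots> = r / t * exp (- (r\<^sup>2 + r\<^sub>0\<^sup>2) / (2 * t)) * bessel_I (real k * pi / \<alpha>) (r * r\<^sub>0 / t) * cos (real k * pi * \<theta>\<^sub>0 / \<alpha>)"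
    using \<alpha> t by (auto simp: C_def A_def)
  finally show ?thesis .
qed

lemma integrable_series_density:
  assumes l: "0 \<le> l"
  shows "integrable lborel (\<lambda>z::real \<times> real. series_density \<alpha> t r\<^sub>0 \<theta>\<^sub>0 (fst z) (snd z) * (rpow \<alpha> k (fst z) * cos (real k * pi * snd z / \<alpha>))
     * exp (- l * (fst z)\<^sup>2) * indicator ({0..} \<times> {0..\<alpha>}) z)"
proof -
  obtain K where K: "0 \<le> K" "\<And>r \<theta>. 0 \<le> r \<Longrightarrow> \<bar>series_density \<alpha> t r\<^sub>0 \<theta>\<^sub>0 r \<theta>\<bar> \<le> K * (r * exp (- (1 / (4 * t)) * r\<^sup>2))"
    using series_density_bound by blast
  define g where "g r = K * (indicator {0..} r * (r powr (real k * pi / \<alpha> + 1) * exp (- (1 / (4 * t)) * r\<^sup>2)))" for r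
  have gm[measurable]: "g \<in> borel_measurable borel" unfolding g_def[abs_def] by measurable
  have gi: "integrable lborel g"
    unfolding g_def[abs_def] using \<alpha> t by (intro integrable_mult_right radial_Gamma_integral(1)) auto
  have prod: "integrable (lborel \<Otimes>\<^sub>M lborel) (\<lambda>z::real \<times> real. g (fst z) * indicator {0..\<alpha>} (snd z))"
  proof (rule lborel_pair.Fubini_integrable)
    have e: "(\<integral>y. norm (g (fst (x, y)) * indicator {0..\<alpha>} (snd (x, y))) \<partial>lborel) = \<bar>g x\<bar> * \<alpha>" for x
      using \<alpha> by (simp add: abs_mult)
    show "integrable lborel (\<lambda>x. \<integral>y. norm (g (fst (x, y)) * indicator {0..\<alpha>} (snd (x, y))) \<partial>lborel)"
      unfolding e using gi by (intro integrable_mult_left) auto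
    show "AE x in lborel. integrable lborel (\<lambda>y. g (fst (x, y)) * indicator {0..\<alpha>} (snd (x, y)))"
      using \<alpha> by (intro AE_I2) (simp add: emeasure_lborel_Icc_eq)
  qed auto
  show ?thesis
  proof (rule Bochner_Integration.integrable_bound)
    show "integrable lborel (\<lambda>z::real \<times> real. g (fst z) * indicator {0..\<alpha>} (snd z))" using prod by (simp only: lborel_prod)
    have rm: "rpow \<alpha> k \<in> borel_measurable borel" unfolding rpow_def[abs_def] by measurable
    note [measurable] = rm
    show "(\<lambda>z::real \<times> real. series_density \<alpha> t r\<^sub>0 \<theta>\<^sub>0 (fst z) (snd z) * (rpow \<alpha> k (fst z) * cos (real k * pi * snd z / \<alpha>))
     * exp (- l * (fst z)\<^sup>2) * indicator ({0..} \<times> {0..\<alpha>}) z) \<in> borel_measurable lborel"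
      unfolding measurable_lborel2 borel_prod[symmetric] by measurable
    show "AE z::real \<times> real in lborel. norm (series_density \<alpha> t r\<^sub>0 \<theta>\<^sub>0 (fst z) (snd z) * (rpow \<alpha> k (fst z) * cos (real k * pi * snd z / \<alpha>))
     * exp (- l * (fst z)\<^sup>2) * indicator ({0..} \<times> {0..\<alpha>}) z) \<le> norm (g (fst z) * indicator {0..\<alpha>} (snd z))"
    proof (rule AE_I2)
      fix z :: "real \<times> real"
      obtain r \<theta> where z: "z = (r, \<theta>)" by (cases z)
      show "norm (series_density \<alpha> t r\<^sub>0 \<theta>\<^sub>0 (fst z) (snd z) * (rpow \<alpha> k (fst z) * cos (real k * pi * snd z / \<alpha>))
     * exp (- l * (fst z)\<^sup>2) * indicator ({0..} \<times> {0..\<alpha>}) z) \<le> norm (g (fst z) * indicator {0..\<alpha>} (snd z))"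
      proof (cases "0 \<le> r \<and> \<theta> \<in> {0..\<alpha>}")
        case True
        then have r: "0 \<le> r" by simp
        have rr: "r * rpow \<alpha> k r = r powr (real k * pi / \<alpha> + 1)"
          using r by (cases "r = 0") (auto simp: rpow_def powr_add)
        have "\<bar>series_density \<alpha> t r\<^sub>0 \<theta>\<^sub>0 r \<theta>\<bar> * (rpow \<alpha> k r * \<bar>cos (real k * pi * \<theta> / \<alpha>)\<bar>) * exp (- l * r\<^sup>2)
          \<le> (K * (r * exp (- (1 / (4 * t)) * r\<^sup>2))) * (rpow \<alpha> k r * 1) * 1"
          using r K l by (intro mult_mono mult_left_mono abs_cos_le_one) auto
        also have "\<dots> = K * (r powr (real k * pi / \<alpha> + 1) * exp (- (1 / (4 * t)) * r\<^sup>2))"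
          unfolding rr[symmetric] by (simp only: mult_ac mult_1_right mult_1)
        also have "\<dots> = \<bar>g r\<bar>" using r K(1) by (simp add: g_def)
        finally show ?thesis using True by (simp add: z abs_mult)
      next
        case False
        then have "indicator ({0..} \<times> {0..\<alpha>}) z = (0::real)" by (auto simp: z indicator_def)
        then show ?thesis by simp
      qed
    qed
  qed
qed

text \<open>Integration over the angle isolates the k-th Bessel function, and Weber's integral with
  \<mu> = l + 1 / (2 t) evaluates the radial part. The result is the value that
  \<open>mode_moment\<close> gives for the starting point with polar coordinates r0 and
  \<theta>0.\<close>

lemma series_density_moment:
  assumes l: "0 < l"
  shows "(\<integral>z. series_density \<alpha> t r\<^sub>0 \<theta>\<^sub>0 (fst z) (snd z) * (rpow \<alpha> k (fst z) * cos (real k * pi * snd z / \<alpha>))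
     * exp (- l * (fst z)\<^sup>2) * indicator ({0..} \<times> {0..\<alpha>}) z \<partial>(lborel :: (real \<times> real) measure))
   = contr l t powr (real k * pi / \<alpha> + 1) * (rpow \<alpha> k r\<^sub>0 * cos (real k * pi * \<theta>\<^sub>0 / \<alpha>) * exp (- (l * contr l t) * r\<^sub>0\<^sup>2))"
    (is "integral\<^sup>L lborel ?f = _")
proof -
  define a where "a = real k * pi / \<alpha>"
  have a: "0 \<le> a" using \<alpha> by (simp add: a_def)
  have a0: "a = 0 \<longleftrightarrow> k = 0" using \<alpha> by (simp add: a_def)
  define c where "c = contr l t"
  \<comment> \<open>The rate of the density plus that of the damping factor; it equals 1 / (2 t c),
    which is how the contraction factor c enters.\<close>
  define \<mu> where "\<mu> = l + 1 / (2 * t)"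
  have \<mu>: "0 < \<mu>" using l t by (simp add: \<mu>_def add_pos_pos)
  have c: "0 < c" using l t by (simp add: c_def contr_def add_pos_pos)
  have \<mu>c: "\<mu> = 1 / (2 * t * c)" using l t by (simp add: \<mu>_def c_def contr_def field_simps)
  define G where "G = cos (real k * pi * \<theta>\<^sub>0 / \<alpha>)"
  have "integral\<^sup>L lborel ?f = integral\<^sup>L (lborel \<Otimes>\<^sub>M lborel) ?f" by (simp only: lborel_prod)
  also have "\<dots> = (\<integral>r. (\<integral>\<theta>. ?f (r, \<theta>) \<partial>lborel) \<partial>lborel)"
    using integrable_series_density[of l k] l by (intro lborel_pair.integral_fst'[symmetric]) (simp add: lborel_prod)
  also have "\<dots> = (\<integral>r. (1 / t * exp (- r\<^sub>0\<^sup>2 / (2 * t)) * G) * (indicator {0..} r * (r powr (a + 1) * exp (- \<mu> * r\<^sup>2) * bessel_I a (r\<^sub>0 / t * r))) \<partial>lborel)"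
  proof (intro Bochner_Integration.integral_cong refl)
    fix r :: real
    show "(\<integral>\<theta>. ?f (r, \<theta>) \<partial>lborel) = (1 / t * exp (- r\<^sub>0\<^sup>2 / (2 * t)) * G) * (indicator {0..} r * (r powr (a + 1) * exp (- \<mu> * r\<^sup>2) * bessel_I a (r\<^sub>0 / t * r)))"
    proof (cases "0 \<le> r")
      case True
      have rr: "r * rpow \<alpha> k r = r powr (a + 1)"
        using True by (cases "r = 0") (auto simp: rpow_def powr_add a_def)
      have ee: "exp (- (r\<^sup>2 + r\<^sub>0\<^sup>2) / (2 * t)) * exp (- l * r\<^sup>2) = exp (- r\<^sub>0\<^sup>2 / (2 * t)) * exp (- \<mu> * r\<^sup>2)"
        unfolding exp_add[symmetric] by (rule arg_cong[where f = exp]) (simp add: \<mu>_def add_divide_distrib diff_divide_distrib algebra_simps)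
      have "?f (r, \<theta>) = (rpow \<alpha> k r * exp (- l * r\<^sup>2)) * (series_density \<alpha> t r\<^sub>0 \<theta>\<^sub>0 r \<theta> * cos (real k * pi * \<theta> / \<alpha>) * indicator {0..\<alpha>} \<theta>)" for \<theta>
        using True by (simp add: indicator_def)
      then have "(\<integral>\<theta>. ?f (r, \<theta>) \<partial>lborel) = (rpow \<alpha> k r * exp (- l * r\<^sup>2)) *
         (r / t * exp (- (r\<^sup>2 + r\<^sub>0\<^sup>2) / (2 * t)) * bessel_I a (r * r\<^sub>0 / t) * G)"
        using series_density_angular[OF True, of k] by (simp only: integral_mult_right_zero a_def G_def)
      also have "\<dots> = 1 / t * (r * rpow \<alpha> k r) * (exp (- (r\<^sup>2 + r\<^sub>0\<^sup>2) / (2 * t)) * exp (- l * r\<^sup>2)) * bessel_I a (r\<^sub>0 / t * r) * G"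
        by (simp add: mult_ac)
      also have "\<dots> = (1 / t * exp (- r\<^sub>0\<^sup>2 / (2 * t)) * G) * (indicator {0..} r * (r powr (a + 1) * exp (- \<mu> * r\<^sup>2) * bessel_I a (r\<^sub>0 / t * r)))"
        unfolding rr ee using True by (simp add: mult_ac)
      finally show ?thesis .
    qed simp
  qed
  also have "\<dots> = (1 / t * exp (- r\<^sub>0\<^sup>2 / (2 * t)) * G) * (1 / 2 * (if a = 0 then 1 else (r\<^sub>0 / t / 2) powr a) * \<mu> powr (- (a + 1)) * exp ((r\<^sub>0 / t)\<^sup>2 / (4 * \<mu>)))"
    using weber_integral(2)[OF a _ \<mu>, of "r\<^sub>0 / t"] r0 t by (simp only: integral_mult_right_zero divide_nonneg_pos)
  also have "\<mu> powr (- (a + 1)) = (2 * t) powr (a + 1) * c powr (a + 1)"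
  proof -
    have "0 < 2 * t * c" using t c by simp
    then have "\<mu> = (2 * t * c) powr (- 1)" unfolding \<mu>c powr_minus_divide by simp
    then have "\<mu> powr (- (a + 1)) = (2 * t * c) powr (- 1 * - (a + 1))" by (simp only: powr_powr)
    also have "- 1 * - (a + 1) = a + 1" by simp
    finally show ?thesis by (simp only: powr_mult)
  qed
  also have "(1 / t * exp (- r\<^sub>0\<^sup>2 / (2 * t)) * G) * (1 / 2 * (if a = 0 then 1 else (r\<^sub>0 / t / 2) powr a) * ((2 * t) powr (a + 1) * c powr (a + 1)) * exp ((r\<^sub>0 / t)\<^sup>2 / (4 * \<mu>)))
    = c powr (a + 1) * (((if a = 0 then 1 else (r\<^sub>0 / t / 2) powr a) * ((2 * t) powr (a + 1) / (2 * t))) * G * (exp (- r\<^sub>0\<^sup>2 / (2 * t)) * exp ((r\<^sub>0 / t)\<^sup>2 / (4 * \<mu>))))"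
    by (simp add: mult_ac)
  also have "(if a = 0 then 1 else (r\<^sub>0 / t / 2) powr a) * ((2 * t) powr (a + 1) / (2 * t)) = rpow \<alpha> k r\<^sub>0"
  proof -
    have "(2 * t) powr (a + 1) / (2 * t) = (2 * t) powr a" using t by (simp add: powr_add)
    moreover have "(r\<^sub>0 / t / 2) powr a * (2 * t) powr a = r\<^sub>0 powr a"
    proof -
      have "r\<^sub>0 / t / 2 * (2 * t) = r\<^sub>0" using t by simp
      then show ?thesis by (simp only: powr_mult[symmetric])
    qed
    ultimately show ?thesis using a0 t by (cases "a = 0") (auto simp: rpow_def a_def)
  qed
  also have "exp (- r\<^sub>0\<^sup>2 / (2 * t)) * exp ((r\<^sub>0 / t)\<^sup>2 / (4 * \<mu>)) = exp (- (l * c) * r\<^sub>0\<^sup>2)"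
  proof -
    have "0 < 1 + 2 * l * t" using l t by (simp add: add_pos_pos)
    \<comment> \<open>With 2 l t c = 1 - c, the two exponentials combine into exp(- l c
      r0^2).\<close>
    then have lc: "2 * l * t * c = 1 - c" by (simp add: c_def contr_def field_simps)
    have "(r\<^sub>0 / t)\<^sup>2 / (4 * \<mu>) = r\<^sub>0\<^sup>2 * c / (2 * t)" unfolding \<mu>c using t c by (simp add: field_simps power2_eq_square)
    then have "- r\<^sub>0\<^sup>2 / (2 * t) + (r\<^sub>0 / t)\<^sup>2 / (4 * \<mu>) = - (r\<^sub>0\<^sup>2 * (1 - c)) / (2 * t)" by (simp add: diff_divide_distrib algebra_simps)
    also have "\<dots> = - (l * c) * r\<^sub>0\<^sup>2" unfolding lc[symmetric] using t by simp
    finally show ?thesis by (simp only: exp_add[symmetric])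
  qed
  finally show ?thesis by (simp add: a_def c_def G_def)
qed

end

section \<open>Identification of the law with the series\<close>

lemma borel_measurable_polar[measurable]: "(\<lambda>v. polar (fst v) (snd v)) \<in> borel_measurable borel"
proof (intro borel_measurable_continuous_onI)
  have e: "(\<lambda>v. polar (fst v) (snd v)) = (\<lambda>v. \<chi> i. if i = 1 then fst v * cos (snd v) else fst v * sin (snd v))"
    by (auto simp: polar_def vec_eq_iff forall_2)
  have "continuous_on UNIV (\<lambda>v::real \<times> real. if i = 1 then fst v * cos (snd v) else fst v * sin (snd v))" for i :: 2
    by (cases "i = 1") (auto intro!: continuous_intros)
  then show "continuous_on UNIV (\<lambda>v. polar (fst v) (snd v))" unfolding e by (rule continuous_on_vec_lambda)
qed

text \<open>The sum of two measures on the same sigma-algebra. It serves to state equality with a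
  signed density by moving the negative part to the other side.\<close>

definition add_measure :: "'a measure \<Rightarrow> 'a measure \<Rightarrow> 'a measure" where
  "add_measure \<mu> \<nu> = measure_of (space \<mu>) (sets \<mu>) (\<lambda>A. emeasure \<mu> A + emeasure \<nu> A)"

lemma sets_add_measure[simp, measurable_cong]: "sets (add_measure \<mu> \<nu>) = sets \<mu>"
  by (simp add: add_measure_def sets.space_closed sets.sigma_sets_eq)

lemma emeasure_add_measure:
  assumes s: "sets \<nu> = sets \<mu>" and A: "A \<in> sets \<mu>"
  shows "emeasure (add_measure \<mu> \<nu>) A = emeasure \<mu> A + emeasure \<nu> A"
proof (rule emeasure_measure_of[OF add_measure_def])
  show "sets \<mu> \<subseteq> Pow (space \<mu>)" by (rule sets.space_closed)
  show "positive (sets (add_measure \<mu> \<nu>)) (\<lambda>A. emeasure \<mu> A + emeasure \<nu> A)" by (simp add: positive_def)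
  show "countably_additive (sets (add_measure \<mu> \<nu>)) (\<lambda>A. emeasure \<mu> A + emeasure \<nu> A)"
  proof (rule countably_additiveI)
    fix B :: "nat \<Rightarrow> _" assume B: "range B \<subseteq> sets (add_measure \<mu> \<nu>)" "disjoint_family B"
    then show "(\<Sum>i. emeasure \<mu> (B i) + emeasure \<nu> (B i)) = emeasure \<mu> (\<Union>i. B i) + emeasure \<nu> (\<Union>i. B i)"
      using s by (simp add: suminf_add[symmetric] suminf_emeasure)
  qed
  show "A \<in> sets (add_measure \<mu> \<nu>)" using A by simp
qed

lemma nn_integral_add_measure:
  assumes s: "sets \<nu> = sets \<mu>" and f: "f \<in> borel_measurable \<mu>"
  shows "(\<integral>\<^sup>+z. f z \<partial>add_measure \<mu> \<nu>) = (\<integral>\<^sup>+z. f z \<partial>\<mu>) + (\<integral>\<^sup>+z. f z \<partial>\<nu>)"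
  using f
proof (induction rule: borel_measurable_induct)
  case (cong f g)
  have "space \<nu> = space \<mu>" "space (add_measure \<mu> \<nu>) = space \<mu>" by (rule sets_eq_imp_space_eq, simp add: s)+
  then have "(\<integral>\<^sup>+z. f z \<partial>N) = (\<integral>\<^sup>+z. g z \<partial>N)" if "N \<in> {\<mu>, \<nu>, add_measure \<mu> \<nu>}" for N
    using that cong(3) by (intro nn_integral_cong) auto
  then show ?case using cong(4) by simp
next
  case (set A)
  then show ?case using s by (simp add: emeasure_add_measure)
next
  case (mult u c)
  have "u \<in> borel_measurable \<nu>" "u \<in> borel_measurable (add_measure \<mu> \<nu>)"
    using mult(2) s by (auto cong: measurable_cong_sets)
  then show ?case using mult by (simp add: nn_integral_cmult distrib_left)
next
  case (add u v)
  have "u \<in> borel_measurable \<nu>" "u \<in> borel_measurable (add_measure \<mu> \<nu>)" "v \<in> borel_measurable \<nu>" "v \<in> borel_measurable (add_measure \<mu> \<nu>)"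
    using add(1,3) s by (auto cong: measurable_cong_sets)
  then show ?case using add by (simp add: nn_integral_add add_ac)
next
  case (seq U)
  have inc: "incseq U" by (fact seq)
  have m: "U i \<in> borel_measurable \<nu>" "U i \<in> borel_measurable (add_measure \<mu> \<nu>)" for i
    using seq(1) s by (auto cong: measurable_cong_sets)
  have "(\<integral>\<^sup>+z. (SUP i. U i) z \<partial>N) = (SUP i. \<integral>\<^sup>+z. U i z \<partial>N)" if "N \<in> {\<mu>, \<nu>, add_measure \<mu> \<nu>}" for N
    using that seq(1) inc m unfolding SUP_apply by (intro nn_integral_monotone_convergence_SUP) auto
  moreover have "(SUP i. (\<integral>\<^sup>+z. U i z \<partial>\<mu>) + (\<integral>\<^sup>+z. U i z \<partial>\<nu>)) = (SUP i. \<integral>\<^sup>+z. U i z \<partial>\<mu>) + (SUP i. \<integral>\<^sup>+z. U i z \<partial>\<nu>)"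
    using inc by (intro ennreal_SUP_add) (auto simp: incseq_def le_fun_def intro!: nn_integral_mono)
  ultimately show ?case using seq by simp
qed

lemma integral_add_measure:
  fixes f :: "'a \<Rightarrow> real"
  assumes s: "sets \<nu> = sets \<mu>" and i: "integrable \<mu> f" "integrable \<nu> f"
  shows "integrable (add_measure \<mu> \<nu>) f"
    and "(\<integral>z. f z \<partial>add_measure \<mu> \<nu>) = (\<integral>z. f z \<partial>\<mu>) + (\<integral>z. f z \<partial>\<nu>)"
proof -
  have m: "f \<in> borel_measurable \<mu>" using i by auto
  then have m': "f \<in> borel_measurable (add_measure \<mu> \<nu>)" by (simp cong: measurable_cong_sets)
  have n: "(\<integral>\<^sup>+z. ennreal (g z) \<partial>add_measure \<mu> \<nu>) = (\<integral>\<^sup>+z. ennreal (g z) \<partial>\<mu>) + (\<integral>\<^sup>+z. ennreal (g z) \<partial>\<nu>)"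
    if "g \<in> borel_measurable \<mu>" for g using that by (intro nn_integral_add_measure s) auto
  have fin: "(\<integral>\<^sup>+z. ennreal (g z) \<partial>\<mu>) < \<infinity>" "(\<integral>\<^sup>+z. ennreal (g z) \<partial>\<nu>) < \<infinity>" if "g = f \<or> g = (\<lambda>z. - f z) \<or> g = (\<lambda>z. norm (f z))" for g
  proof -
    have "integrable \<mu> g" "integrable \<nu> g" using that i by auto
    then show "(\<integral>\<^sup>+z. ennreal (g z) \<partial>\<mu>) < \<infinity>" "(\<integral>\<^sup>+z. ennreal (g z) \<partial>\<nu>) < \<infinity>"
      by (auto simp: real_integrable_def less_top)
  qed
  show I: "integrable (add_measure \<mu> \<nu>) f"
    unfolding integrable_iff_bounded using m m' fin[of "\<lambda>z. norm (f z)"] n[of "\<lambda>z. norm (f z)"] by auto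
  show "(\<integral>z. f z \<partial>add_measure \<mu> \<nu>) = (\<integral>z. f z \<partial>\<mu>) + (\<integral>z. f z \<partial>\<nu>)"
    using m fin[of f] fin[of "\<lambda>z. - f z"]
    by (simp add: real_lebesgue_integral_def[OF I] real_lebesgue_integral_def[OF i(1)] real_lebesgue_integral_def[OF i(2)] n enn2real_plus)
qed

lemma mode_bounded:
  assumes "0 < \<alpha>" "0 < l"
  obtains B where "\<And>z. \<bar>P \<alpha> k z * exp (- l * (norm z)\<^sup>2)\<bar> \<le> B"
proof -
  obtain A where A: "\<And>r. 0 \<le> r \<Longrightarrow> rpow \<alpha> k r * r ^ 0 * exp (- l * r\<^sup>2) \<le> A"
    using rpow_exp_bounded[OF assms, of k 0] by blast
  have "\<bar>P \<alpha> k z * exp (- l * (norm z)\<^sup>2)\<bar> \<le> A" for z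
  proof -
    have "\<bar>P \<alpha> k z * exp (- l * (norm z)\<^sup>2)\<bar> \<le> rpow \<alpha> k (norm z) * exp (- l * (norm z)\<^sup>2)"
      unfolding abs_mult by (simp add: abs_P_le_rpow)
    then show ?thesis using A[of "norm z"] by simp
  qed
  then show ?thesis using that by blast
qed

context wedge_rbm
begin

lemma law_moment:
  assumes "0 < t" "0 < l"
  shows "(\<integral>z. P \<alpha> k z * exp (- l * (norm z)\<^sup>2) \<partial>distr M borel (X t))
    = contr l t powr (real k * pi / \<alpha> + 1) * (P \<alpha> k x * exp (- (l * contr l t) * (norm x)\<^sup>2))"
proof -
  have [measurable]: "X t \<in> borel_measurable M" using assms by (intro measurable_X) simp
  show ?thesis using mode_moment[OF assms] by (subst integral_distr) auto
qed

lemma AE_law_in_wedge: "0 \<le> t \<Longrightarrow> AE z in distr M borel (X t). z \<in> wedge \<alpha>"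
  using AE_in_wedge[of t] measurable_X[of t] closed_wedge[OF \<alpha>]
  by (subst AE_distr_iff) (auto intro!: borel_closed)

text \<open>The law plus the negative part of the series measure has the same moments as the
  positive part, so by \<open>wedge_measure_eqI\<close> these measures coincide. Positive and
  negative parts live on disjoint sets; the set carrying the negative part is null for the positive
  part, hence for the sum. So the negative part is 0, and the law is the positive part.\<close>

theorem law_series:
  assumes x: "x = polar r\<^sub>0 \<theta>\<^sub>0" and r0: "0 \<le> r\<^sub>0" and \<theta>0: "0 \<le> \<theta>\<^sub>0" "\<theta>\<^sub>0 \<le> \<alpha>" and t: "0 < t"
  shows "distr M borel (X t) = distr (density lborel (\<lambda>z. ennreal (series_density \<alpha> t r\<^sub>0 \<theta>\<^sub>0 (fst z) (snd z)) *
      indicator ({0..} \<times> {0..\<alpha>}) z)) borel (\<lambda>z. polar (fst z) (snd z))"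
proof -
  let ?S = "{0..} \<times> {0..\<alpha>}" and ?pol = "\<lambda>z. polar (fst z) (snd z)"
  define p where "p z = series_density \<alpha> t r\<^sub>0 \<theta>\<^sub>0 (fst z) (snd z) * indicator ?S z" for z
  \<comment> \<open>\<open>R 1\<close> and \<open>R (- 1)\<close> are the images of the positive and
    of the negative part of the density.\<close>
  define R where "R s = distr (density lborel (\<lambda>z. ennreal (max 0 (s * p z)))) borel ?pol" for s :: real
  have [measurable]: "p \<in> borel_measurable borel"
    unfolding p_def[abs_def] borel_prod[symmetric] using borel_measurable_series_density[OF \<alpha>(1) t r0] by measurable
  have pi: "integrable lborel p"
    using integrable_series_density[OF \<alpha>(1) t r0, of 0 \<theta>\<^sub>0 0] by (simp add: p_def[abs_def] rpow_def)
  have sp: "integrable lborel (\<lambda>z. max 0 (s * p z))" for s using pi by auto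
  have fR: "finite_measure (R s)" for s
    unfolding R_def
  proof (rule finite_measure.finite_measure_distr)
    have "(\<integral>\<^sup>+z. ennreal (max 0 (s * p z)) \<partial>lborel) < \<infinity>"
      using sp[of s] by (simp add: real_integrable_def less_top)
    then show "finite_measure (density lborel (\<lambda>z. ennreal (max 0 (s * p z))))"
      by (intro finite_measureI) (simp add: emeasure_density)
  qed measurable
  have sR: "sets (R s) = sets borel" for s by (simp add: R_def)
  have aR: "AE z in R s. z \<in> wedge \<alpha>" for s
  proof -
    have w[measurable]: "wedge \<alpha> \<in> sets borel" using closed_wedge[OF \<alpha>] by (rule borel_closed)
    have "?pol z \<in> wedge \<alpha>" if "0 < max 0 (s * p z)" for z
    proof -
      have "z \<in> ?S" using that by (cases "z \<in> ?S") (simp_all add: p_def)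
      then show ?thesis by (auto simp: wedge_def mem_Times_iff)
    qed
    then show ?thesis unfolding R_def by (subst AE_distr_iff) (auto simp: AE_density)
  qed
  define f where "f k l z = P \<alpha> k z * exp (- l * (norm z)\<^sup>2)" for k l z
  have [measurable]: "f k l \<in> borel_measurable borel" for k l unfolding f_def[abs_def] by measurable
  have fi: "integrable N (f k l)" if "0 < l" "finite_measure N" "sets N = sets borel" for N k l
  proof -
    obtain B where "\<And>z. \<bar>f k l z\<bar> \<le> B" using mode_bounded[OF \<alpha>(1) \<open>0 < l\<close>, of k] unfolding f_def by blast
    then show ?thesis using that
      by (intro finite_measure.integrable_const_bound[of N _ B]) (auto cong: measurable_cong_sets)
  qed
  have Ri: "integrable lborel (\<lambda>z. max 0 (s * p z) * f k l (?pol z))"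
    "(\<integral>z. f k l z \<partial>R s) = (\<integral>z. max 0 (s * p z) * f k l (?pol z) \<partial>lborel)" if "0 < l" for s k l
  proof -
    have "integrable (R s) (f k l)" by (rule fi[OF that fR sR])
    then have "integrable (density lborel (\<lambda>z. ennreal (max 0 (s * p z)))) (\<lambda>z. f k l (?pol z))"
      unfolding R_def by (subst (asm) integrable_distr_eq) auto
    then show "integrable lborel (\<lambda>z. max 0 (s * p z) * f k l (?pol z))"
      by (subst (asm) integrable_density) auto
    show "(\<integral>z. f k l z \<partial>R s) = (\<integral>z. max 0 (s * p z) * f k l (?pol z) \<partial>lborel)"
    proof -
      have "(\<integral>z. f k l z \<partial>R s) = (\<integral>z. f k l (?pol z) \<partial>density lborel (\<lambda>z. ennreal (max 0 (s * p z))))"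
        unfolding R_def by (rule integral_distr) measurable
      also have "\<dots> = (\<integral>z. max 0 (s * p z) *\<^sub>R f k l (?pol z) \<partial>lborel)"
        by (rule integral_density) auto
      finally show ?thesis by simp
    qed
  qed
  have [measurable]: "X t \<in> borel_measurable M" using t by (intro measurable_X) simp
  let ?L = "distr M borel (X t)"
  have fL: "finite_measure ?L" by (intro finite_measure_distr) measurable
  have sL: "sets ?L = sets borel" by simp
  have key: "add_measure ?L (R (- 1)) = R 1"
  proof (rule wedge_measure_eqI[OF \<alpha>])
    have s1: "sets (R (- 1)) = sets ?L" by (simp add: sR)
    have e: "emeasure (add_measure ?L (R (- 1))) A = emeasure ?L A + emeasure (R (- 1)) A" if "A \<in> sets borel" for A
      using that by (intro emeasure_add_measure s1) simp
    have spc: "space (add_measure ?L (R (- 1))) = UNIV"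
      using sets_eq_imp_space_eq[OF sets_add_measure[of ?L "R (- 1)"]] by simp
    show "finite_measure (add_measure ?L (R (- 1)))"
      using finite_measure.emeasure_finite[OF fL, of UNIV] finite_measure.emeasure_finite[OF fR[of "- 1"], of UNIV]
      by (intro finite_measureI) (simp add: spc e)
    show "finite_measure (R 1)" by (rule fR)
    show "sets (add_measure ?L (R (- 1))) = sets borel" "sets (R 1) = sets borel" by (simp_all add: sR)
    show "AE z in R 1. z \<in> wedge \<alpha>" by (rule aR)
    have w: "UNIV - wedge \<alpha> \<in> sets borel" using borel_closed[OF closed_wedge[OF \<alpha>]] by auto
    have "emeasure ?L (UNIV - wedge \<alpha>) = 0" "emeasure (R (- 1)) (UNIV - wedge \<alpha>) = 0"
      using AE_law_in_wedge[of t] aR[of "- 1"] t w sets_eq_imp_space_eq[OF sR[of "- 1"]]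
      by (auto simp: AE_iff_measurable[OF _ refl] sR Compl_eq_Diff_UNIV[symmetric] Collect_neg_eq)
    then show "AE z in add_measure ?L (R (- 1)). z \<in> wedge \<alpha>"
      using w by (intro AE_I[of _ _ "UNIV - wedge \<alpha>"]) (auto simp: e)
    fix k :: nat and l :: real assume l: "0 < l"
    have "(\<integral>z. f k l z \<partial>R 1) - (\<integral>z. f k l z \<partial>R (- 1)) = (\<integral>z. max 0 (1 * p z) * f k l (?pol z) - max 0 (- 1 * p z) * f k l (?pol z) \<partial>lborel)"
      unfolding Ri(2)[OF l] by (rule Bochner_Integration.integral_diff[symmetric]) (rule Ri(1)[OF l])+
    also have "\<dots> = (\<integral>z. series_density \<alpha> t r\<^sub>0 \<theta>\<^sub>0 (fst z) (snd z) * (rpow \<alpha> k (fst z) * cos (real k * pi * snd z / \<alpha>))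
     * exp (- l * (fst z)\<^sup>2) * indicator ?S z \<partial>lborel)"
    proof (intro Bochner_Integration.integral_cong refl)
      fix z :: "real \<times> real"
      have "max 0 (1 * p z) * f k l (?pol z) - max 0 (- 1 * p z) * f k l (?pol z) = (max 0 (1 * p z) - max 0 (- 1 * p z)) * f k l (?pol z)"
        by (simp add: left_diff_distrib)
      also have "max 0 (1 * p z) - max 0 (- 1 * p z) = p z" by (auto simp: max_def)
      also have "p z * f k l (?pol z) = series_density \<alpha> t r\<^sub>0 \<theta>\<^sub>0 (fst z) (snd z) * (rpow \<alpha> k (fst z) * cos (real k * pi * snd z / \<alpha>))
     * exp (- l * (fst z)\<^sup>2) * indicator ?S z"
      proof (cases "z \<in> ?S")
        case True
        then have "0 \<le> fst z" "0 \<le> snd z" "snd z \<le> \<alpha>" by (auto simp: mem_Times_iff)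
        then show ?thesis using P_polar[OF \<alpha>, of "fst z" "snd z" k]
          by (simp add: p_def f_def norm_polar rpow_def)
      qed (simp add: p_def)
      finally show "max 0 (1 * p z) * f k l (?pol z) - max 0 (- 1 * p z) * f k l (?pol z) = \<dots>" .
    qed
    also have "\<dots> = contr l t powr (real k * pi / \<alpha> + 1) * (rpow \<alpha> k r\<^sub>0 * cos (real k * pi * \<theta>\<^sub>0 / \<alpha>) * exp (- (l * contr l t) * r\<^sub>0\<^sup>2))"
      by (rule series_density_moment[OF \<alpha>(1) t r0 l])
    also have "\<dots> = (\<integral>z. f k l z \<partial>?L)"
      using P_polar[OF \<alpha> r0 \<theta>0, of k] law_moment[OF t l, of k] r0
      unfolding f_def x by (simp add: norm_polar rpow_def)
    finally have "(\<integral>z. f k l z \<partial>?L) + (\<integral>z. f k l z \<partial>R (- 1)) = (\<integral>z. f k l z \<partial>R 1)" by simp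
    then show "(\<integral>z. P \<alpha> k z * exp (- l * (norm z)\<^sup>2) \<partial>add_measure ?L (R (- 1))) = (\<integral>z. P \<alpha> k z * exp (- l * (norm z)\<^sup>2) \<partial>R 1)"
      unfolding f_def[symmetric] by (subst integral_add_measure[OF s1 fi[OF l fL sL] fi[OF l fR sR]])
  qed
  \<comment> \<open>Polar coordinates are recovered with the argument measured from the bisector, so
    that the discontinuity of the logarithm stays outside the wedge.\<close>
  define co where "co z = (norm z, Im (Ln (cplx z * cis (- \<alpha> / 2))) + \<alpha> / 2)" for z
  have com[measurable]: "co \<in> borel_measurable borel" unfolding co_def[abs_def] borel_prod[symmetric] by measurable
  have co: "co (polar r \<theta>) = (r, \<theta>)" if "0 < r" "0 \<le> \<theta>" "\<theta> \<le> \<alpha>" for r \<theta>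
  proof -
    have "cplx (polar r \<theta>) * cis (- \<alpha> / 2) = of_real r * cis (\<theta> - \<alpha> / 2)" by (simp add: cplx_polar cis_mult)
    also have "\<dots> = exp (Complex (ln r) (\<theta> - \<alpha> / 2))"
      using that by (simp add: exp_eq_polar)
    also have "Ln \<dots> = Complex (ln r) (\<theta> - \<alpha> / 2)" using that \<alpha> by (intro Ln_exp) auto
    finally show ?thesis using that by (simp add: co_def norm_polar)
  qed
  \<comment> \<open>The points of the plane whose polar coordinates have negative density.
    Disjointness of the two parts has to be seen in the plane, after the polar map; that map is
    injective where the density is nonzero, since the density vanishes at r = 0.\<close>
  define E where "E = {z. p (co z) < 0}"
  have E[measurable]: "E \<in> sets borel" unfolding E_def by measurable
  have pE: "?pol z \<in> E \<longleftrightarrow> p z < 0" if "p z \<noteq> 0" for z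
  proof -
    have "z \<in> ?S" using that by (cases "z \<in> ?S") (simp_all add: p_def)
    moreover have "fst z \<noteq> 0" using that by (auto simp: p_def series_density_def)
    ultimately have "0 < fst z" "0 \<le> snd z" "snd z \<le> \<alpha>" by (auto simp: mem_Times_iff)
    then have "co (?pol z) = z" using co[of "fst z" "snd z"] by simp
    then show ?thesis by (simp add: E_def)
  qed
  have eR: "emeasure (R s) A = (\<integral>\<^sup>+z. ennreal (max 0 (s * p z)) * indicator (?pol -` A) z \<partial>lborel)" if "A \<in> sets borel" for s A
    using that measurable_sets[OF borel_measurable_polar that] unfolding R_def
    by (subst emeasure_distr) (auto simp: emeasure_density)
  have "emeasure (R 1) E = 0"
  proof -
    have "ennreal (max 0 (1 * p z)) * indicator (?pol -` E) z = 0" for z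
      using pE[of z] by (cases "p z = 0") (auto simp: indicator_def max_def)
    then show ?thesis unfolding eR[OF E] by (simp only: nn_integral_0_iff_AE) simp
  qed
  then have "emeasure (R (- 1)) E = 0"
    using emeasure_add_measure[of "R (- 1)" ?L E] E by (simp add: key sR)
  moreover have "emeasure (R (- 1)) E = emeasure (R (- 1)) UNIV"
  proof -
    have "ennreal (max 0 (- 1 * p z)) * indicator (?pol -` E) z = ennreal (max 0 (- 1 * p z)) * indicator (?pol -` UNIV) z" for z
      using pE[of z] by (cases "p z = 0") (auto simp: indicator_def max_def)
    then show ?thesis unfolding eR[OF E] eR[OF sets.top[of borel, unfolded space_borel]] by (simp only:)
  qed
  ultimately have R0: "emeasure (R (- 1)) UNIV = 0" by simp
  have "?L = R 1"
  proof (rule measure_eqI)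
    fix A assume A: "A \<in> sets ?L"
    have "emeasure (R (- 1)) A \<le> emeasure (R (- 1)) UNIV" by (intro emeasure_mono) (auto simp: sR)
    then have "emeasure (R (- 1)) A = 0" using R0 by simp
    then show "emeasure ?L A = emeasure (R 1) A"
      using emeasure_add_measure[of "R (- 1)" ?L A] A by (simp add: key sR)
  qed (simp add: sR)
  \<comment> \<open>\<open>ennreal\<close> sends negative reals to 0, so the stated density is the
    positive part.\<close>
  also have "(\<lambda>z. ennreal (max 0 (1 * p z))) = (\<lambda>z. ennreal (series_density \<alpha> t r\<^sub>0 \<theta>\<^sub>0 (fst z) (snd z)) * indicator ?S z)"
    by (auto simp: p_def fun_eq_iff indicator_def max_def ennreal_neg)
  then have "R 1 = distr (density lborel (\<lambda>z. ennreal (series_density \<alpha> t r\<^sub>0 \<theta>\<^sub>0 (fst z) (snd z)) * indicator ?S z)) borel ?pol"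
    unfolding R_def by (simp only:)
  finally show ?thesis .
qed

end

section \<open>Reflected copies and the method of images\<close>

definition mirror :: "real^2 \<Rightarrow> real^2" where
  "mirror z = vector [z$1, - z$2]"

lemma cplx_mirror: "cplx (mirror z) = cnj (cplx z)"
  by (simp add: cplx_def mirror_def complex_eq_iff)

lemma orthogonal_mirror: "orthogonal_transformation mirror"
  unfolding orthogonal_transformation
proof
  show "linear mirror" by (rule linearI) (auto simp: mirror_def vec_eq_iff forall_2)
  show "\<forall>v. norm (mirror v) = norm v" by (metis cplx_mirror complex_mod_cnj norm_cplx)
qed

text \<open>A linear isometry of the whole plane that agrees with \<open>wedge_copy\<close> on the
  wedge: a rotation for even k, a reflection in the first axis followed by a rotation for odd
  k.\<close>

definition copy_map :: "real \<Rightarrow> nat \<Rightarrow> real^2 \<Rightarrow> real^2" where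
  "copy_map \<alpha> k = (if even k then rot (real k * \<alpha>) else rot ((real k + 1) * \<alpha>) \<circ> mirror)"

lemma orthogonal_copy_map: "orthogonal_transformation (copy_map \<alpha> k)"
  by (auto simp: copy_map_def orthogonal_rot orthogonal_mirror intro: orthogonal_transformation_compose)

lemma copy_map_polar:
  "copy_map \<alpha> k (polar r \<theta>) = polar r (if even k then real k * \<alpha> + \<theta> else (real k + 1) * \<alpha> - \<theta>)"
proof -
  have "cplx (copy_map \<alpha> k (polar r \<theta>)) = cplx (polar r (if even k then real k * \<alpha> + \<theta> else (real k + 1) * \<alpha> - \<theta>))"
    by (auto simp: copy_map_def cplx_rot cplx_mirror cplx_polar cis_cnj cis_mult[symmetric] diff_conv_add_uminus simp del: add_uminus_conv_diff)
  then show ?thesis by (simp only: cplx_inj)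
qed

text \<open>The description in polar coordinates is realised by a map of the point alone, so every
  admissible choice of coordinates yields the same image and the definite description is legitimate,
  also at the vertex.\<close>

lemma wedge_copy_eq:
  assumes "y \<in> wedge \<alpha>"
  shows "wedge_copy \<alpha> k y = copy_map \<alpha> k y"
  unfolding wedge_copy_def
proof (rule the_equality)
  obtain r \<theta> where "y = polar r \<theta>" "0 \<le> r" "0 \<le> \<theta>" "\<theta> \<le> \<alpha>" using assms by (auto simp: wedge_def)
  then show "\<exists>r \<theta>. 0 \<le> r \<and> 0 \<le> \<theta> \<and> \<theta> \<le> \<alpha> \<and> y = polar r \<theta> \<and>
     copy_map \<alpha> k y = polar r (if even k then real k * \<alpha> + \<theta> else (real k + 1) * \<alpha> - \<theta>)"
    using copy_map_polar by blast
qed (auto simp: copy_map_polar)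

context
  fixes m :: nat and \<alpha> :: real
  assumes m: "1 \<le> m" and am: "\<alpha> = pi / real m"
begin

lemma angle: "0 < \<alpha>" "\<alpha> < 2 * pi" "real (2 * m) * \<alpha> = 2 * pi"
proof -
  have "\<alpha> \<le> pi / 1" unfolding am using m by (intro divide_left_mono) auto
  then show "\<alpha> < 2 * pi" using pi_gt_zero by linarith
  show "0 < \<alpha>" "real (2 * m) * \<alpha> = 2 * pi" using m by (auto simp: am)
qed

text \<open>The k-th copy is the closed sector of angles from k \<alpha> to (k + 1) \<alpha>. All
  these angles lie in [0, 2 pi], so equality modulo 2 pi with an angle in an open sector forces
  equality, and sectors with different indices overlap at most in their boundaries.\<close>

lemma polar_mem_copy_iff:
  assumes r: "0 < r" and j: "j < 2 * m" "real j * \<alpha> < \<phi>" "\<phi> < (real j + 1) * \<alpha>" and k: "k < 2 * m"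
  shows "polar r \<phi> \<in> copy_map \<alpha> k ` wedge \<alpha> \<longleftrightarrow> k = j"
proof
  assume "k = j"
  define \<theta> where "\<theta> = (if even j then \<phi> - real j * \<alpha> else (real j + 1) * \<alpha> - \<phi>)"
  have "polar r \<theta> \<in> wedge \<alpha>"
  proof -
    have "0 \<le> \<theta>" "\<theta> \<le> \<alpha>" using j by (auto simp: \<theta>_def algebra_simps)
    then show ?thesis unfolding wedge_def using r by (blast intro: less_imp_le)
  qed
  moreover have "copy_map \<alpha> k (polar r \<theta>) = polar r \<phi>"
    unfolding copy_map_polar \<open>k = j\<close> by (simp add: \<theta>_def)
  ultimately show "polar r \<phi> \<in> copy_map \<alpha> k ` wedge \<alpha>" by force
next
  assume "polar r \<phi> \<in> copy_map \<alpha> k ` wedge \<alpha>"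
  then obtain s \<theta> where s: "0 \<le> s" "0 \<le> \<theta>" "\<theta> \<le> \<alpha>" "polar r \<phi> = copy_map \<alpha> k (polar s \<theta>)"
    by (auto simp: wedge_def)
  define \<psi> where "\<psi> = (if even k then real k * \<alpha> + \<theta> else (real k + 1) * \<alpha> - \<theta>)"
  have p: "polar r \<phi> = polar s \<psi>" using s(4) by (simp add: copy_map_polar \<psi>_def)
  have "norm (polar r \<phi>) = norm (polar s \<psi>)" by (simp only: p)
  then have rs: "r = s" using r s(1) by (simp add: norm_polar)
  have "cis \<phi> = cis \<psi>" using arg_cong[OF p, of cplx] r rs by (simp add: cplx_polar)
  then have "cos (\<phi> - \<psi>) = 1" by (simp add: cos_diff complex_eq_iff flip: power2_eq_square)
  then obtain i :: int where i: "\<phi> - \<psi> = real_of_int i * 2 * pi" by (auto simp: cos_one_2pi_int)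
  have \<psi>: "real k * \<alpha> \<le> \<psi>" "\<psi> \<le> (real k + 1) * \<alpha>" using s by (auto simp: \<psi>_def algebra_simps)
  have top: "(real k + 1) * \<alpha> \<le> 2 * pi" "(real j + 1) * \<alpha> \<le> 2 * pi"
  proof -
    have "(real i + 1) * \<alpha> \<le> 2 * pi" if "i < 2 * m" for i
    proof -
      have "real i + 1 \<le> real (2 * m)" using that by linarith
      then have "(real i + 1) * \<alpha> \<le> real (2 * m) * \<alpha>" using angle by (intro mult_right_mono) auto
      then show ?thesis by (simp only: angle)
    qed
    then show "(real k + 1) * \<alpha> \<le> 2 * pi" "(real j + 1) * \<alpha> \<le> 2 * pi" using j k by auto
  qed
  have "0 \<le> real k * \<alpha>" "0 \<le> real j * \<alpha>" using angle by auto
  then have "\<bar>\<phi> - \<psi>\<bar> < 2 * pi" using \<psi> top j by linarith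
  then have "\<bar>real_of_int i\<bar> * (2 * pi) < 1 * (2 * pi)" unfolding i by (simp add: abs_mult)
  then have "\<bar>real_of_int i\<bar> < 1" by (rule mult_right_less_imp_less) simp
  then have "i = 0" by simp
  then have "\<phi> = \<psi>" using i by simp
  then have "real k * \<alpha> < (real j + 1) * \<alpha>" "real j * \<alpha> < (real k + 1) * \<alpha>" using \<psi> j by linarith+
  then have "real k < real j + 1" "real j < real k + 1" using angle by (simp_all add: mult_less_cancel_right)
  then show "k = j" by linarith
qed

text \<open>Off the lines through the rays at angles j \<alpha>, a null set, every point has an
  argument strictly inside exactly one of the 2 m sectors.\<close>

lemma AE_copies_tile: "AE z in lborel. (\<Sum>k<2 * m. indicator (copy_map \<alpha> k ` wedge \<alpha>) z) = (1::real)"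
proof -
  \<comment> \<open>\<open>v j\<close> is normal to the ray at angle j \<alpha>; \<open>N\<close> is
    the union of the corresponding lines.\<close>
  define v :: "nat \<Rightarrow> real^2" where "v j = vector [- sin (real j * \<alpha>), cos (real j * \<alpha>)]" for j
  define N where "N = (\<Union>j<2 * m. {z. v j \<bullet> z = 0})"
  have "negligible {z. v j \<bullet> z = 0}" for j
  proof (rule negligible_hyperplane)
    have "v j \<noteq> 0" using sin_zero_abs_cos_one[of "real j * \<alpha>"] by (auto simp: v_def vec_eq_iff forall_2)
    then show "v j \<noteq> 0 \<or> 0 \<noteq> (0::real)" by simp
  qed
  then have "negligible N" unfolding N_def by (intro negligible_Union) auto
  moreover have "N \<in> sets borel" unfolding N_def
    by (intro sets.finite_UN borel_closed closed_hyperplane) auto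
  ultimately have "N \<in> null_sets lborel"
    by (simp add: negligible_iff_null_sets null_sets_completion_iff)
  then have "AE z in lborel. z \<notin> N" by (rule AE_not_in)
  then show ?thesis
  proof eventually_elim
    case (elim z)
    have "v 0 \<bullet> z \<noteq> 0" using elim m by (auto simp: N_def)
    then have z0: "z \<noteq> 0" by auto
    define r where "r = norm z"
    define \<phi> where "\<phi> = Arg2pi (cplx z)"
    have r: "0 < r" using z0 by (simp add: r_def)
    have "cplx z = of_real r * cis \<phi>"
      using Arg2pi[of "cplx z"] by (simp add: r_def \<phi>_def cis_conv_exp is_Arg_def)
    then have z: "z = polar r \<phi>" by (simp only: cplx_polar[symmetric] cplx_inj)
    have \<phi>: "0 \<le> \<phi>" "\<phi> < 2 * pi" using Arg2pi[of "cplx z"] by (auto simp: \<phi>_def)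
    define j where "j = nat \<lfloor>\<phi> / \<alpha>\<rfloor>"
    have "0 \<le> \<phi> / \<alpha>" using \<phi> angle by simp
    then have j: "real j \<le> \<phi> / \<alpha>" "\<phi> / \<alpha> < real j + 1" unfolding j_def by linarith+
    then have j1: "real j * \<alpha> \<le> \<phi>" "\<phi> < (real j + 1) * \<alpha>" using angle by (simp_all add: pos_le_divide_eq pos_divide_less_eq)
    have "real j * \<alpha> < real (2 * m) * \<alpha>" using j1 \<phi> angle by linarith
    then have jm: "j < 2 * m" using angle(1) by (simp only: mult_less_cancel_right_pos of_nat_less_iff)
    have "v j \<bullet> z \<noteq> 0" using elim jm by (auto simp: N_def)
    then have "\<phi> \<noteq> real j * \<alpha>" unfolding z by (auto simp: v_def inner_real2 polar_def)
    then have j2: "real j * \<alpha> < \<phi>" using j1 by simp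
    have "(\<Sum>k<2 * m. indicator (copy_map \<alpha> k ` wedge \<alpha>) z) = (\<Sum>k<2 * m. if k = j then 1 else (0::real))"
      using polar_mem_copy_iff[OF r jm j2 j1(2)] by (intro sum.cong refl) (auto simp: z indicator_def)
    then show "(\<Sum>k<2 * m. indicator (copy_map \<alpha> k ` wedge \<alpha>) z) = (1::real)" using jm by simp
  qed
qed

text \<open>For \<alpha> = pi / m the exponent n pi / \<alpha> is the integer n m, so the mode
  extends from the wedge to a harmonic polynomial on the plane.\<close>

definition power_mode :: "nat \<Rightarrow> real^2 \<Rightarrow> real" where
  "power_mode n z = Re (cplx z ^ (n * m))"

lemma borel_measurable_power_mode[measurable]: "power_mode n \<in> borel_measurable borel"
  unfolding power_mode_def[abs_def] by measurable

lemma exponent: "real n * pi / \<alpha> = real (n * m)"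
  using m by (simp add: am)

lemma rpow_eq: "0 \<le> r \<Longrightarrow> rpow \<alpha> n r = r ^ (n * m)"
  using m by (cases "r = 0") (auto simp: rpow_def exponent powr_realpow simp del: of_nat_mult)

lemma P_eq_power_mode:
  assumes "z \<in> wedge \<alpha>"
  shows "P \<alpha> n z = power_mode n z"
proof -
  obtain r \<theta> where z: "z = polar r \<theta>" "0 \<le> r" "0 \<le> \<theta>" "\<theta> \<le> \<alpha>" using assms by (auto simp: wedge_def)
  have "real n * pi * \<theta> / \<alpha> = (real n * pi / \<alpha>) * \<theta>" by simp
  then have "P \<alpha> n z = rpow \<alpha> n r * cos (real (n * m) * \<theta>)"
    using P_polar[OF angle(1,2) z(2-4), of n] by (simp only: z(1) exponent rpow_def)
  also have "\<dots> = r ^ (n * m) * cos (real (n * m) * \<theta>)" using z by (simp add: rpow_eq)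
  also have "\<dots> = power_mode n z"
    by (simp add: power_mode_def z cplx_polar power_mult_distrib Complex.DeMoivre Re_divide flip: of_real_power del: of_nat_mult)
  finally show ?thesis .
qed

text \<open>The rotations involved are by even multiples of pi / m and disappear after raising to
  the power n m; the reflection is complex conjugation, which does not change the real part.\<close>

lemma power_mode_copy_map: "power_mode n (copy_map \<alpha> k z) = power_mode n z"
proof -
  have 1: "cis (real k * \<alpha>) ^ (n * m) = 1" if ev: "even k" for k
  proof -
    obtain i where "k = 2 * i" using ev by (rule evenE)
    then have e: "real (n * m) * (real k * \<alpha>) = real (n * i) * 2 * pi" using m by (simp add: am)
    have "cos (real (n * i) * 2 * pi) = 1" "sin (real (n * i) * 2 * pi) = 0"
      using cos_2npi[of "n * i"] sin_2npi[of "n * i"] by (simp_all add: mult_ac)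
    then show ?thesis unfolding Complex.DeMoivre e by (simp add: complex_eq_iff)
  qed
  show ?thesis
  proof (cases "even k")
    case True
    then show ?thesis using 1[of k] by (simp add: power_mode_def copy_map_def cplx_rot power_mult_distrib)
  next
    case False
    have "cis ((real k + 1) * \<alpha>) ^ (n * m) = 1" using 1[of "Suc k"] False by (simp add: add.commute)
    then show ?thesis using False
      by (simp add: power_mode_def copy_map_def cplx_rot cplx_mirror power_mult_distrib flip: complex_cnj_power)
  qed
qed

text \<open>The power is entire, so \<open>gauss_mean_value\<close> applies with the whole plane as
  S and there is no error term.\<close>

lemma power_mode_mean_value:
  assumes h: "0 < h"
  shows "(\<integral>z. power_mode n (x + z) \<partial>gauss h) = power_mode n x"
proof -
  interpret prob_space "gauss h" by (rule prob_space_gauss[OF h])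
  have i: "integrable (gauss h) (\<lambda>z. (cplx x + cplx z) ^ (n * m))"
  proof (rule Bochner_Integration.integrable_bound[OF integrable_Fw[OF angle(1) h, of n x]])
    show "AE z in gauss h. norm ((cplx x + cplx z) ^ (n * m)) \<le> norm (Fw \<alpha> n (cplx x + cplx z))"
      by (simp add: norm_Fw_rpow rpow_eq norm_power)
  qed measurable
  have "(\<integral>z. indicator UNIV z *\<^sub>R (\<lambda>w. w ^ (n * m)) (cplx x + cplx z) \<partial>gauss h) = measure (gauss h) UNIV *\<^sub>R (\<lambda>w. w ^ (n * m)) (cplx x)"
  proof (rule gauss_mean_value)
    show "\<exists>\<rho>. norm z < \<rho> \<and> (\<lambda>w. w ^ (n * m)) holomorphic_on ball (cplx x) \<rho>" for z :: "real^2"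
      by (intro exI[of _ "norm z + 1"] conjI holomorphic_intros) simp
  qed (use i h in auto)
  then have "(\<integral>z. (cplx x + cplx z) ^ (n * m) \<partial>gauss h) = cplx x ^ (n * m)"
    using prob_space by simp
  then have "Re (\<integral>z. (cplx x + cplx z) ^ (n * m) \<partial>gauss h) = power_mode n x" by (simp add: power_mode_def)
  then show ?thesis using integral_Re[OF i] by (simp add: power_mode_def)
qed

text \<open>Free planar Brownian motion has exactly the moments that \<open>mode_moment\<close>
  gives for the reflected one: completing the square, then the mean value property at the contracted
  point, then homogeneity.\<close>

lemma power_mode_gauss_moment:
  assumes t: "0 < t" and l: "0 < l"
  shows "(\<integral>z. gauss_density t (z - x) * (power_mode n z * exp (- l * (norm z)\<^sup>2)) \<partial>lborel)
    = contr l t powr (real n * pi / \<alpha> + 1) * (power_mode n x * exp (- (l * contr l t) * (norm x)\<^sup>2))"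
proof -
  define c where "c = 1 / (1 + 2 * l * t)"
  have p: "0 < 1 + 2 * l * t" using t l by (simp add: add_pos_pos)
  then have c: "0 < c" by (simp add: c_def)
  have "(\<integral>z. gauss_density t (z - x) * (power_mode n z * exp (- l * (norm z)\<^sup>2)) \<partial>lborel)
    = (\<integral>z. gauss_density t ((x + z) - x) * (power_mode n (x + z) * exp (- l * (norm (x + z))\<^sup>2)) \<partial>lborel)"
    by (subst lborel_integral_translate[of _ x, symmetric]) auto
  also have "\<dots> = (\<integral>z. exp (- l * (norm (x + z))\<^sup>2) *\<^sub>R power_mode n (x + z) \<partial>gauss t)"
    using t by (subst integral_gauss) (auto simp: mult_ac)
  also have "\<dots> = (c * exp (- l * c * (norm x)\<^sup>2)) *\<^sub>R (\<integral>z. power_mode n (c *\<^sub>R x + z) \<partial>gauss (t * c))"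
    unfolding c_def by (rule gauss_integral_mult_exp[OF _ t p]) measurable
  also have "(\<integral>z. power_mode n (c *\<^sub>R x + z) \<partial>gauss (t * c)) = power_mode n (c *\<^sub>R x)"
    using t c by (intro power_mode_mean_value) simp
  also have "power_mode n (c *\<^sub>R x) = c ^ (n * m) * power_mode n x"
    by (simp add: power_mode_def power_mult_distrib flip: of_real_power)
  finally have "(\<integral>z. gauss_density t (z - x) * (power_mode n z * exp (- l * (norm z)\<^sup>2)) \<partial>lborel)
    = (c ^ (n * m) * c) * (power_mode n x * exp (- (l * c) * (norm x)\<^sup>2))" by simp
  moreover have "c ^ (n * m) * c = c powr (real n * pi / \<alpha> + 1)"
    using c by (simp only: exponent powr_add powr_realpow powr_one less_imp_le)
  ultimately show ?thesis by (simp only: c_def contr_def)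
qed

end

lemma borel_measurable_orthogonal:
  fixes A :: "real^'n \<Rightarrow> real^'n"
  shows "orthogonal_transformation A \<Longrightarrow> A \<in> borel_measurable borel"
  using orthogonal_transformation_linear[of A]
  by (intro borel_measurable_continuous_onI linear_continuous_on) (simp add: linear_conv_bounded_linear)

context wedge_rbm
begin

text \<open>The proposed density is the planar Gaussian about x folded into the wedge by the copies.
  For functions invariant under the copies, integrating against it over the wedge equals integrating
  against the Gaussian over the plane; the damped modes are such functions, so the moments agree
  with those of X_t and \<open>wedge_measure_eqI\<close> concludes.\<close>

theorem law_images:
  assumes m: "1 \<le> m" and am: "\<alpha> = pi / real m" and x: "x \<in> wedge \<alpha>" and t: "0 < t"
  shows "distributed M lborel (X t)
    (\<lambda>y. ennreal (1 / (2 * pi * t) * (\<Sum>k<2 * m. exp (- (norm (x - wedge_copy \<alpha> k y))\<^sup>2 / (2 * t)))) * indicator (wedge \<alpha>) y)"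
proof -
  let ?A = "copy_map \<alpha>" and ?W = "wedge \<alpha>"
  define \<gamma> where "\<gamma> z = gauss_density t (z - x)" for z
  define q where "q y = (\<Sum>k<2 * m. \<gamma> (?A k y) * indicator ?W y)" for y
  have \<gamma>0: "0 \<le> \<gamma> z" for z using t by (simp add: \<gamma>_def gauss_density_nonneg)
  have q0: "0 \<le> q y" for y unfolding q_def by (intro sum_nonneg mult_nonneg_nonneg \<gamma>0) auto
  have [measurable]: "\<gamma> \<in> borel_measurable borel" unfolding \<gamma>_def[abs_def] by measurable
  have Am[measurable]: "?A k \<in> borel_measurable borel" for k by (rule borel_measurable_orthogonal[OF orthogonal_copy_map])
  have Wm[measurable]: "?W \<in> sets borel" using closed_wedge[OF \<alpha>] by (rule borel_closed)
  have AW[measurable]: "?A k ` ?W \<in> sets borel" for k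
    using orthogonal_copy_map[of \<alpha> k]
    by (intro borel_closed closed_injective_linear_image closed_wedge \<alpha> orthogonal_transformation_linear orthogonal_transformation_inj)
  have [measurable]: "q \<in> borel_measurable borel" unfolding q_def[abs_def] by measurable
  have density_eq: "ennreal (1 / (2 * pi * t) * (\<Sum>k<2 * m. exp (- (norm (x - wedge_copy \<alpha> k y))\<^sup>2 / (2 * t)))) * indicator ?W y
    = ennreal (q y)" for y
    by (simp add: q_def \<gamma>_def gauss_density_def wedge_copy_eq norm_minus_commute sum_distrib_left indicator_def)
  \<comment> \<open>Change of variables along one copy, which preserves Lebesgue measure and maps
    the wedge onto the k-th sector.\<close>
  have push: "integrable lborel (\<lambda>y. \<gamma> (?A k y) * g (?A k y) * indicator ?W y)"
      "(\<integral>y. \<gamma> (?A k y) * g (?A k y) * indicator ?W y \<partial>lborel) = (\<integral>z. \<gamma> z * g z * indicator (?A k ` ?W) z \<partial>lborel)"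
    if g[measurable]: "g \<in> borel_measurable borel" and i: "integrable lborel (\<lambda>z. \<gamma> z * g z)" for g k
  proof -
    have e: "\<gamma> (?A k y) * g (?A k y) * indicator ?W y = \<gamma> (?A k y) * g (?A k y) * indicator (?A k ` ?W) (?A k y)" for y
      using orthogonal_transformation_inj[OF orthogonal_copy_map, of \<alpha> k] by (auto simp: indicator_def inj_eq)
    have d: "distr lborel borel (?A k) = lborel" by (rule orthogonal_lborel_distr[OF orthogonal_copy_map])
    have "integrable lborel (\<lambda>z. \<gamma> z * g z * indicator (?A k ` ?W) z)"
      using i by (intro integrable_real_mult_indicator) auto
    then have "integrable (distr lborel borel (?A k)) (\<lambda>z. \<gamma> z * g z * indicator (?A k ` ?W) z)" unfolding d .
    then show "integrable lborel (\<lambda>y. \<gamma> (?A k y) * g (?A k y) * indicator ?W y)"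
      unfolding e by (subst (asm) integrable_distr_eq) auto
    have "(\<integral>z. \<gamma> z * g z * indicator (?A k ` ?W) z \<partial>distr lborel borel (?A k))
      = (\<integral>y. \<gamma> (?A k y) * g (?A k y) * indicator (?A k ` ?W) (?A k y) \<partial>lborel)"
      by (subst integral_distr) auto
    then show "(\<integral>y. \<gamma> (?A k y) * g (?A k y) * indicator ?W y \<partial>lborel) = (\<integral>z. \<gamma> z * g z * indicator (?A k ` ?W) z \<partial>lborel)"
      unfolding d e by simp
  qed
  \<comment> \<open>Summing over the copies and using that they tile the plane almost
    everywhere.\<close>
  have fold: "integrable lborel (\<lambda>y. q y * f y)" "(\<integral>y. q y * f y \<partial>lborel) = (\<integral>z. \<gamma> z * g z \<partial>lborel)"
    if g[measurable]: "g \<in> borel_measurable borel" and i: "integrable lborel (\<lambda>z. \<gamma> z * g z)"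
      and inv: "\<And>k y. y \<in> ?W \<Longrightarrow> g (?A k y) = f y" for f g
  proof -
    have e: "q y * f y = (\<Sum>k<2 * m. \<gamma> (?A k y) * g (?A k y) * indicator ?W y)" for y
      using inv[of y] by (cases "y \<in> ?W") (simp_all add: q_def sum_distrib_right)
    show "integrable lborel (\<lambda>y. q y * f y)" unfolding e by (intro Bochner_Integration.integrable_sum push(1)[OF g i])
    have "(\<integral>y. q y * f y \<partial>lborel) = (\<Sum>k<2 * m. \<integral>y. \<gamma> (?A k y) * g (?A k y) * indicator ?W y \<partial>lborel)"
      unfolding e by (intro Bochner_Integration.integral_sum push(1)[OF g i])
    also have "\<dots> = (\<Sum>k<2 * m. \<integral>z. \<gamma> z * g z * indicator (?A k ` ?W) z \<partial>lborel)"
      by (intro sum.cong refl push(2)[OF g i])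
    also have "\<dots> = (\<integral>z. (\<Sum>k<2 * m. \<gamma> z * g z * indicator (?A k ` ?W) z) \<partial>lborel)"
      using i by (intro Bochner_Integration.integral_sum[symmetric] integrable_real_mult_indicator) auto
    also have "\<dots> = (\<integral>z. \<gamma> z * g z \<partial>lborel)"
    proof (rule integral_cong_AE)
      show "AE z in lborel. (\<Sum>k<2 * m. \<gamma> z * g z * indicator (?A k ` ?W) z) = \<gamma> z * g z"
        using AE_copies_tile[OF m am] by eventually_elim (simp add: sum_distrib_left[symmetric])
    qed measurable
    finally show "(\<integral>y. q y * f y \<partial>lborel) = (\<integral>z. \<gamma> z * g z \<partial>lborel)" .
  qed
  have \<gamma>i: "integrable lborel \<gamma>"
  proof -
    interpret G: prob_space "gauss t" by (rule prob_space_gauss[OF t])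
    have "integrable (gauss t) (\<lambda>_. 1::real)" by simp
    then have "integrable lborel (gauss_density t)"
      unfolding gauss_def using t by (subst (asm) integrable_density) (auto simp: gauss_density_nonneg)
    then have "integrable lborel (\<lambda>z. gauss_density t (- x + 1 *\<^sub>R z))"
      by (subst (asm) lborel_distr_plus[of "- x", symmetric]) (simp add: integrable_distr_eq)
    then show ?thesis by (simp add: \<gamma>_def[abs_def])
  qed
  have \<gamma>b: "integrable lborel (\<lambda>z. \<gamma> z * g z)" if "g \<in> borel_measurable borel" "\<And>z. \<bar>g z\<bar> \<le> B" for g B
  proof (rule Bochner_Integration.integrable_bound[of lborel "\<lambda>z. B * \<gamma> z"])
    show "AE z in lborel. norm (\<gamma> z * g z) \<le> norm (B * \<gamma> z)"
    proof (rule AE_I2)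
      fix z
      have "\<bar>g z\<bar> \<le> \<bar>B\<bar>" using that(2)[of z] by linarith
      then show "norm (\<gamma> z * g z) \<le> norm (B * \<gamma> z)" using \<gamma>0[of z] mult_left_mono[of "\<bar>g z\<bar>" "\<bar>B\<bar>" "\<gamma> z"] by (simp add: abs_mult mult.commute)
    qed
  qed (use that \<gamma>i in auto)
  define R where "R = density lborel (\<lambda>y. ennreal (q y))"
  have [measurable]: "X t \<in> borel_measurable M" using t by (intro measurable_X) simp
  have "distr M borel (X t) = R"
  proof (rule wedge_measure_eqI[OF \<alpha>])
    show "finite_measure (distr M borel (X t))" by (intro finite_measure_distr) measurable
    show "sets (distr M borel (X t)) = sets borel" "sets R = sets borel" by (simp_all add: R_def)
    show "AE z in distr M borel (X t). z \<in> ?W" using t by (intro AE_law_in_wedge) simp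
    show "AE z in R. z \<in> ?W"
    proof -
      have "y \<in> ?W" if "0 < q y" for y using that by (cases "y \<in> ?W") (simp_all add: q_def)
      then show ?thesis unfolding R_def by (subst AE_density) auto
    qed
    have "integrable lborel q" using fold(1)[of "\<lambda>_. 1" "\<lambda>_. 1"] \<gamma>i by simp
    then have "(\<integral>\<^sup>+y. ennreal (q y) \<partial>lborel) < \<infinity>" by (simp add: real_integrable_def less_top)
    then show "finite_measure R" unfolding R_def by (intro finite_measureI) (simp add: emeasure_density)
    fix k :: nat and l :: real assume l: "0 < l"
    define g where "g z = power_mode m k z * exp (- l * (norm z)\<^sup>2)" for z
    obtain B where B: "\<And>r. 0 \<le> r \<Longrightarrow> rpow \<alpha> k r * r ^ 0 * exp (- l * r\<^sup>2) \<le> B"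
      using rpow_exp_bounded[OF \<alpha>(1) l, of k 0] by blast
    have gb: "\<bar>g z\<bar> \<le> B" for z
    proof -
      have "\<bar>power_mode m k z\<bar> \<le> rpow \<alpha> k (norm z)"
        unfolding rpow_eq[OF m am norm_ge_zero] power_mode_def[OF m am]
        using abs_Re_le_cmod[of "cplx z ^ (k * m)"] by (simp add: norm_power)
      then have "\<bar>g z\<bar> \<le> rpow \<alpha> k (norm z) * exp (- l * (norm z)\<^sup>2)"
        unfolding g_def abs_mult by (simp add: mult_right_mono)
      then show ?thesis using B[of "norm z"] by simp
    qed
    have gm: "g \<in> borel_measurable borel" unfolding g_def[abs_def]
      by (intro borel_measurable_times borel_measurable_power_mode[OF m am]) measurable
    have inv: "g (?A j y) = P \<alpha> k y * exp (- l * (norm y)\<^sup>2)" if "y \<in> ?W" for j y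
      using that orthogonal_transformation[of "?A j"] orthogonal_copy_map[of \<alpha> j]
      by (auto simp: g_def power_mode_copy_map[OF m am] P_eq_power_mode[OF m am])
    have "(\<integral>y. P \<alpha> k y * exp (- l * (norm y)\<^sup>2) \<partial>R) = (\<integral>y. q y * (P \<alpha> k y * exp (- l * (norm y)\<^sup>2)) \<partial>lborel)"
      unfolding R_def by (subst integral_density) (auto simp: q0)
    also have "\<dots> = (\<integral>z. \<gamma> z * g z \<partial>lborel)"
      by (rule fold(2)[OF gm \<gamma>b[OF gm gb] inv])
    also have "\<dots> = contr l t powr (real k * pi / \<alpha> + 1) * (P \<alpha> k x * exp (- (l * contr l t) * (norm x)\<^sup>2))"
      unfolding \<gamma>_def g_def P_eq_power_mode[OF m am x] by (rule power_mode_gauss_moment[OF m am t l])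
    finally show "(\<integral>z. P \<alpha> k z * exp (- l * (norm z)\<^sup>2) \<partial>distr M borel (X t)) = (\<integral>z. P \<alpha> k z * exp (- l * (norm z)\<^sup>2) \<partial>R)"
      using law_moment[OF t l, of k] by simp
  qed
  moreover have "distr M lborel (X t) = distr M borel (X t)" by (intro distr_cong) auto
  ultimately show ?thesis unfolding distributed_def density_eq R_def by simp
qed

end

text \<open>Both assertions are instances of \<open>law_images\<close> and
  \<open>law_series\<close>. For the second, the n = 0 term with its coefficient 1/2 is split off
  the series.\<close>

theorem theorem3:
  fixes M :: "'a measure" and F :: "real \<Rightarrow> 'a measure"
    and W X L :: "real \<Rightarrow> 'a \<Rightarrow> real^2" and n :: "real^2 \<Rightarrow> real^2"
  shows "(\<forall>(m::nat) x t. 1 \<le> m \<longrightarrow> x \<in> wedge (pi / m) \<longrightarrow> 0 < t \<longrightarrow>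
      normally_reflected_brownian_motion M F W x (wedge (pi / m)) n X L \<longrightarrow>
      distributed M lborel (X t)
        (\<lambda>y. ennreal (1 / (2 * pi * t) *
               (\<Sum>k<2 * m. exp (- (norm (x - wedge_copy (pi / m) k y))\<^sup>2 / (2 * t)))) *
             indicator (wedge (pi / m)) y)) \<and>
    (\<forall>\<alpha> r\<^sub>0 \<theta>\<^sub>0 t. 0 < \<alpha> \<longrightarrow> \<alpha> < 2 * pi \<longrightarrow> 0 \<le> r\<^sub>0 \<longrightarrow> 0 \<le> \<theta>\<^sub>0 \<longrightarrow> \<theta>\<^sub>0 \<le> \<alpha> \<longrightarrow> 0 < t \<longrightarrow>
      normally_reflected_brownian_motion M F W (polar r\<^sub>0 \<theta>\<^sub>0) (wedge \<alpha>) n X L \<longrightarrow>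
      distr M borel (X t) =
        distr
          (density lborel (\<lambda>(r, \<theta>).
             ennreal (2 * r / (t * \<alpha>) * exp (- (r\<^sup>2 + r\<^sub>0\<^sup>2) / (2 * t)) *
               (1 / 2 * bessel_I 0 (r * r\<^sub>0 / t) +
                (\<Sum>j. bessel_I (Suc j * pi / \<alpha>) (r * r\<^sub>0 / t) *
                     cos (Suc j * pi * \<theta> / \<alpha>) * cos (Suc j * pi * \<theta>\<^sub>0 / \<alpha>)))) *
             indicator ({0..} \<times> {0..\<alpha>}) (r, \<theta>)))
          borel (\<lambda>(r, \<theta>). polar r \<theta>))"
proof (intro conjI allI impI)
  fix m :: nat and x :: "real^2" and t :: real
  assume m: "1 \<le> m" and x: "x \<in> wedge (pi / m)" and t: "0 < t"
    and n: "normally_reflected_brownian_motion M F W x (wedge (pi / m)) n X L"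
  have w: "wedge_rbm M F W x (pi / m) n X L"
    using n angle[OF m refl] by (intro wedge_rbm.intro wedge_rbm_axioms.intro) auto
  show "distributed M lborel (X t)
        (\<lambda>y. ennreal (1 / (2 * pi * t) *
               (\<Sum>k<2 * m. exp (- (norm (x - wedge_copy (pi / m) k y))\<^sup>2 / (2 * t)))) *
             indicator (wedge (pi / m)) y)"
    by (rule wedge_rbm.law_images[OF w m refl x t])
next
  fix \<alpha> r\<^sub>0 \<theta>\<^sub>0 t :: real
  assume a: "0 < \<alpha>" "\<alpha> < 2 * pi" and r0: "0 \<le> r\<^sub>0" and t0: "0 \<le> \<theta>\<^sub>0" "\<theta>\<^sub>0 \<le> \<alpha>" and t: "0 < t"
    and n: "normally_reflected_brownian_motion M F W (polar r\<^sub>0 \<theta>\<^sub>0) (wedge \<alpha>) n X L"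
  have w: "wedge_rbm M F W (polar r\<^sub>0 \<theta>\<^sub>0) \<alpha> n X L"
    using n a by (intro wedge_rbm.intro wedge_rbm_axioms.intro) auto
  \<comment> \<open>Splitting off the head needs summability, which is available for r \<ge>
    0.\<close>
  have series: "(\<Sum>n. series_term \<alpha> t r\<^sub>0 \<theta>\<^sub>0 n r \<theta>) = 1 / 2 * bessel_I 0 (r * r\<^sub>0 / t) +
                (\<Sum>j. bessel_I (Suc j * pi / \<alpha>) (r * r\<^sub>0 / t) *
                     cos (Suc j * pi * \<theta> / \<alpha>) * cos (Suc j * pi * \<theta>\<^sub>0 / \<alpha>))" if "0 \<le> r" for r \<theta>
    using suminf_split_head[OF summable_series_term[OF a(1) t r0 that, of \<theta>\<^sub>0 \<theta>]]
    by (simp add: series_term_def del: of_nat_Suc)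
  have density: "(\<lambda>(r, \<theta>).
             ennreal (2 * r / (t * \<alpha>) * exp (- (r\<^sup>2 + r\<^sub>0\<^sup>2) / (2 * t)) *
               (1 / 2 * bessel_I 0 (r * r\<^sub>0 / t) +
                (\<Sum>j. bessel_I (Suc j * pi / \<alpha>) (r * r\<^sub>0 / t) *
                     cos (Suc j * pi * \<theta> / \<alpha>) * cos (Suc j * pi * \<theta>\<^sub>0 / \<alpha>)))) *
             indicator ({0..} \<times> {0..\<alpha>}) (r, \<theta>))
    = (\<lambda>z. ennreal (series_density \<alpha> t r\<^sub>0 \<theta>\<^sub>0 (fst z) (snd z)) * indicator ({0..} \<times> {0..\<alpha>}) z)"
  proof
    fix z :: "real \<times> real"
    obtain r \<theta> where z: "z = (r, \<theta>)" by (cases z)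
    show "(case z of (r, \<theta>) \<Rightarrow>
             ennreal (2 * r / (t * \<alpha>) * exp (- (r\<^sup>2 + r\<^sub>0\<^sup>2) / (2 * t)) *
               (1 / 2 * bessel_I 0 (r * r\<^sub>0 / t) +
                (\<Sum>j. bessel_I (Suc j * pi / \<alpha>) (r * r\<^sub>0 / t) *
                     cos (Suc j * pi * \<theta> / \<alpha>) * cos (Suc j * pi * \<theta>\<^sub>0 / \<alpha>)))) *
             indicator ({0..} \<times> {0..\<alpha>}) (r, \<theta>))
      = ennreal (series_density \<alpha> t r\<^sub>0 \<theta>\<^sub>0 (fst z) (snd z)) * indicator ({0..} \<times> {0..\<alpha>}) z"
    \<comment> \<open>For r < 0 the indicator makes both sides 0.\<close>
    proof (cases "0 \<le> r")
      case True
      show ?thesis unfolding z prod.case fst_conv snd_conv series_density_def series[OF True] ..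
    qed (simp add: z)
  qed
  show "distr M borel (X t) =
        distr
          (density lborel (\<lambda>(r, \<theta>).
             ennreal (2 * r / (t * \<alpha>) * exp (- (r\<^sup>2 + r\<^sub>0\<^sup>2) / (2 * t)) *
               (1 / 2 * bessel_I 0 (r * r\<^sub>0 / t) +
                (\<Sum>j. bessel_I (Suc j * pi / \<alpha>) (r * r\<^sub>0 / t) *
                     cos (Suc j * pi * \<theta> / \<alpha>) * cos (Suc j * pi * \<theta>\<^sub>0 / \<alpha>)))) *
             indicator ({0..} \<times> {0..\<alpha>}) (r, \<theta>)))
          borel (\<lambda>(r, \<theta>). polar r \<theta>)"
    unfolding density case_prod_beta' by (rule wedge_rbm.law_series[OF w refl r0 t0 t])
qed

end
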